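(* Let $(\Omega^1,d)$ be a first order differential calculus over $A$ such that $\Omega^1$ is finitely generated projective as a right $A$-module. The coproduct $\Delta$ and counit $\epsilon$ given on generators by $$\Delta(a\overline{b})=a\otimes\overline{b},\quad \Delta((x,\omega))=\sum_i(x,\omega_i)\otimes(x_i,\omega),\quad \Delta(x)=x\otimes 1+\sum_i(x,\omega_i)\otimes x_i,$$ $$\epsilon(a\overline{b})=ab,\quad \epsilon((x,\omega))=\mathrm{ev}(x\otimes\omega),\quad \epsilon(x)=0$$ for $a,b\in A$, $x\in\mathfrak{X}^1$, $\omega\in\Omega^1$, and extended to products by $\Delta(m\bullet n)=m_{(1)}\bullet n_{(1)}\otimes m_{(2)}\bullet n_{(2)}$ and $\epsilon(m\bullet n)=\epsilon(m\bullet\epsilon(n))$, are well-defined maps on $B\mathfrak{X}^1$ and provide $B\mathfrak{X}^1$ with a left $A$-bialgebroid structure.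
   Context: Conventions. $\mathbb{K}$ is a field, $A$ a unital associative $\mathbb{K}$-algebra, $\otimes$ means $\otimes_A$. $A^{op}=\{\overline{a}: a\in A\}$ with $\overline{a}\,\overline{b}=\overline{ba}$; $A^e=A\otimes_{\mathbb{K}}A^{op}$ with elements written $a\overline{b}$. $R\star S$ is the free product of algebras, $T_{A^e}(V)$ the tensor algebra of an $A^e$-bimodule $V$, $TV$ the tensor algebra of a vector space $V$. Left $A$-bialgebroids. An $A^e$-ring is a $\mathbb{K}$-algebra $B$ with an algebra map $\eta:A^e\to B$; write $a,\overline{a}$ for the images of $a,\overline{a}$ in $B$. $|B$ denotes $B$ as an $A$-bimodule via $r\cdot b\cdot s=r\overline{s}b$, so $|B\otimes|B=B\otimes_{\mathbb{K}}B/\langle\overline{s}b\otimes b'-b\otimes sb'\rangle$. A left $A$-bialgebroid structure on the $A^e$-ring $B$ consists of $A$-bimodule maps $\Delta:|B\to|B\otimes|B$, $\Delta(b)=b_{(1)}\otimes b_{(2)}$, and $\epsilon:|B\to A$ such that: $\Delta$ is coassociative; $\epsilon(b_{(1)})b_{(2)}=b=\overline{\epsilon(b_{(2)})}b_{(1)}$; $\Delta(br\overline{s})=b_{(1)}r\otimes b_{(2)}\overline{s}$; $\epsilon(br)=\epsilon(b\overline{r})$; $\Delta(bb')=b_{(1)}b'_{(1)}\otimes b_{(2)}b'_{(2)}$; $\Delta(1)=1\otimes1$; $\epsilon(1)=1$; $\epsilon(bb')=\epsilon(b\,\epsilon(b'))=\epsilon(b\,\overline{\epsilon(b')})$ for all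 $b,b'\in B$, $r,s\in A$. A (first order) differential calculus over $A$ is an $A$-bimodule $\Omega^1$ with a $\mathbb{K}$-linear map $d:A\to\Omega^1$ satisfying $d(ab)=(da)b+a\,db$. Duals. $\mathfrak{X}^1=\mathrm{Hom}_A(\Omega^1,A)$ (right module maps), with $(axb)(\omega)=a\,x(b\omega)$, is the left dual bimodule of $\Omega^1$, with $\mathrm{ev}:\mathfrak{X}^1\otimes\Omega^1\to A$, $\mathrm{ev}(x\otimes\omega)=x(\omega)$, and $\mathrm{coev}:A\to\Omega^1\otimes\mathfrak{X}^1$, $\mathrm{coev}(1)=\sum_i\omega_i\otimes x_i$. The algebra $B(\Omega^1)$. Let $\mathfrak{M}=\mathfrak{X}^1\otimes_{\mathbb{K}}\Omega^1$, elements $x\otimes_{\mathbb{K}}\omega$ written $(x,\omega)$, with $A^e$-bimodule structure $a\overline{a'}(x,\omega)b\overline{b'}=(axb,b'\omega a')$. Put $B(\Omega^1)=T_{A^e}(\mathfrak{M})$, with product $\bullet$. The algebra $B\mathfrak{X}^1$. It is the quotient of $B(\Omega^1)\star T\mathfrak{X}^1$ by the ideal generated by the relations $$a\bullet x=ax,\qquad x\bullet a=xa+\mathrm{ev}(x\otimes da),\qquad x\bullet\overline{a}=\overline{a}\bullet x+(x,da)\qquad (x\in\mathfrak{X}^1,\ a\in A),$$ where $ax,xa\in\mathfrak{X}^1$ denote the bimodule actions; it is an $A^e$-ring via $A^e\subset B(\Omega^1)$. *)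

theory Defs
  imports "HOL-Algebra.Module" "HOL-Algebra.QuotRing"
begin

text \<open>
  All structures are records with a carrier. A map between structures is only meaningful on the
  carrier of its domain; wherever equality of maps matters (dual modules, uniqueness), maps are
  required to be \<^const>\<open>extensional\<close>.
\<close>

section \<open>Algebras and bimodules over a field\<close>

locale k_algebra = K?: field K + A?: module K A + A?: ring A
    for K :: "'k ring" (structure) and A :: "('k, 'a) module" (structure) +
  assumes smult_mult_left:
      "\<lbrakk>k \<in> carrier K; a \<in> carrier A; b \<in> carrier A\<rbrakk> \<Longrightarrow>
        (k \<odot>\<^bsub>A\<^esub> a) \<otimes>\<^bsub>A\<^esub> b = k \<odot>\<^bsub>A\<^esub> (a \<otimes>\<^bsub>A\<^esub> b)"
    and smult_mult_right:
      "\<lbrakk>k \<in> carrier K; a \<in> carrier A; b \<in> carrier A\<rbrakk> \<Longrightarrow>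
        a \<otimes>\<^bsub>A\<^esub> (k \<odot>\<^bsub>A\<^esub> b) = k \<odot>\<^bsub>A\<^esub> (a \<otimes>\<^bsub>A\<^esub> b)"

record ('k, 'a, 'm) bimodule = "('k, 'm) module" +
  lact :: "'a \<Rightarrow> 'm \<Rightarrow> 'm" (infixr \<open>\<triangleright>\<index>\<close> 70)
  ract :: "'m \<Rightarrow> 'a \<Rightarrow> 'm" (infixl \<open>\<triangleleft>\<index>\<close> 70)

text \<open>The record of a (bi)module contains the fields \<^const>\<open>mult\<close> and \<^const>\<open>one\<close> only for technical
  reasons; they are not used.\<close>

locale bimodule = k_algebra K A + M?: module K M
    for K :: "'k ring" (structure) and A :: "('k, 'a) module" (structure)
      and M :: "('k, 'a, 'm) bimodule" (structure) +
  assumes lact_closed: "\<lbrakk>a \<in> carrier A; m \<in> carrier M\<rbrakk> \<Longrightarrow> a \<triangleright>\<^bsub>M\<^esub> m \<in> carrier M"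
    and ract_closed: "\<lbrakk>a \<in> carrier A; m \<in> carrier M\<rbrakk> \<Longrightarrow> m \<triangleleft>\<^bsub>M\<^esub> a \<in> carrier M"
    and lact_add: "\<lbrakk>a \<in> carrier A; m \<in> carrier M; n \<in> carrier M\<rbrakk> \<Longrightarrow>
        a \<triangleright>\<^bsub>M\<^esub> (m \<oplus>\<^bsub>M\<^esub> n) = a \<triangleright>\<^bsub>M\<^esub> m \<oplus>\<^bsub>M\<^esub> a \<triangleright>\<^bsub>M\<^esub> n"
    and add_lact: "\<lbrakk>a \<in> carrier A; b \<in> carrier A; m \<in> carrier M\<rbrakk> \<Longrightarrow>
        (a \<oplus>\<^bsub>A\<^esub> b) \<triangleright>\<^bsub>M\<^esub> m = a \<triangleright>\<^bsub>M\<^esub> m \<oplus>\<^bsub>M\<^esub> b \<triangleright>\<^bsub>M\<^esub> m"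
    and add_ract: "\<lbrakk>a \<in> carrier A; m \<in> carrier M; n \<in> carrier M\<rbrakk> \<Longrightarrow>
        (m \<oplus>\<^bsub>M\<^esub> n) \<triangleleft>\<^bsub>M\<^esub> a = m \<triangleleft>\<^bsub>M\<^esub> a \<oplus>\<^bsub>M\<^esub> n \<triangleleft>\<^bsub>M\<^esub> a"
    and ract_add: "\<lbrakk>a \<in> carrier A; b \<in> carrier A; m \<in> carrier M\<rbrakk> \<Longrightarrow>
        m \<triangleleft>\<^bsub>M\<^esub> (a \<oplus>\<^bsub>A\<^esub> b) = m \<triangleleft>\<^bsub>M\<^esub> a \<oplus>\<^bsub>M\<^esub> m \<triangleleft>\<^bsub>M\<^esub> b"
    and lact_smult: "\<lbrakk>k \<in> carrier K; a \<in> carrier A; m \<in> carrier M\<rbrakk> \<Longrightarrow>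
        a \<triangleright>\<^bsub>M\<^esub> (k \<odot>\<^bsub>M\<^esub> m) = k \<odot>\<^bsub>M\<^esub> (a \<triangleright>\<^bsub>M\<^esub> m)"
    and smult_lact: "\<lbrakk>k \<in> carrier K; a \<in> carrier A; m \<in> carrier M\<rbrakk> \<Longrightarrow>
        (k \<odot>\<^bsub>A\<^esub> a) \<triangleright>\<^bsub>M\<^esub> m = k \<odot>\<^bsub>M\<^esub> (a \<triangleright>\<^bsub>M\<^esub> m)"
    and smult_ract: "\<lbrakk>k \<in> carrier K; a \<in> carrier A; m \<in> carrier M\<rbrakk> \<Longrightarrow>
        (k \<odot>\<^bsub>M\<^esub> m) \<triangleleft>\<^bsub>M\<^esub> a = k \<odot>\<^bsub>M\<^esub> (m \<triangleleft>\<^bsub>M\<^esub> a)"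
    and ract_smult: "\<lbrakk>k \<in> carrier K; a \<in> carrier A; m \<in> carrier M\<rbrakk> \<Longrightarrow>
        m \<triangleleft>\<^bsub>M\<^esub> (k \<odot>\<^bsub>A\<^esub> a) = k \<odot>\<^bsub>M\<^esub> (m \<triangleleft>\<^bsub>M\<^esub> a)"
    and one_lact: "m \<in> carrier M \<Longrightarrow> \<one>\<^bsub>A\<^esub> \<triangleright>\<^bsub>M\<^esub> m = m"
    and ract_one: "m \<in> carrier M \<Longrightarrow> m \<triangleleft>\<^bsub>M\<^esub> \<one>\<^bsub>A\<^esub> = m"
    and mult_lact: "\<lbrakk>a \<in> carrier A; b \<in> carrier A; m \<in> carrier M\<rbrakk> \<Longrightarrow>
        (a \<otimes>\<^bsub>A\<^esub> b) \<triangleright>\<^bsub>M\<^esub> m = a \<triangleright>\<^bsub>M\<^esub> (b \<triangleright>\<^bsub>M\<^esub> m)"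
    and ract_mult: "\<lbrakk>a \<in> carrier A; b \<in> carrier A; m \<in> carrier M\<rbrakk> \<Longrightarrow>
        m \<triangleleft>\<^bsub>M\<^esub> (a \<otimes>\<^bsub>A\<^esub> b) = (m \<triangleleft>\<^bsub>M\<^esub> a) \<triangleleft>\<^bsub>M\<^esub> b"
    and lact_ract: "\<lbrakk>a \<in> carrier A; b \<in> carrier A; m \<in> carrier M\<rbrakk> \<Longrightarrow>
        (a \<triangleright>\<^bsub>M\<^esub> m) \<triangleleft>\<^bsub>M\<^esub> b = a \<triangleright>\<^bsub>M\<^esub> (m \<triangleleft>\<^bsub>M\<^esub> b)"

definition linear_maps ::
    "'k ring \<Rightarrow> ('k, 'm, 'p) module_scheme \<Rightarrow> ('k, 'n, 'q) module_scheme \<Rightarrow> ('m \<Rightarrow> 'n) set" where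
  "linear_maps K M N = {f \<in> carrier M \<rightarrow> carrier N.
     (\<forall>x\<in>carrier M. \<forall>y\<in>carrier M. f (x \<oplus>\<^bsub>M\<^esub> y) = f x \<oplus>\<^bsub>N\<^esub> f y) \<and>
     (\<forall>k\<in>carrier K. \<forall>x\<in>carrier M. f (k \<odot>\<^bsub>M\<^esub> x) = k \<odot>\<^bsub>N\<^esub> f x)}"

definition algebra_homs ::
    "'k ring \<Rightarrow> ('k, 'a, 'p) module_scheme \<Rightarrow> ('k, 'b, 'q) module_scheme \<Rightarrow> ('a \<Rightarrow> 'b) set" where
  "algebra_homs K A B = linear_maps K A B \<inter> ring_hom A B"

definition right_module_maps :: "('k, 'a) module \<Rightarrow> ('k, 'a, 'm, 'p) bimodule_scheme \<Rightarrow>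
    ('k, 'a, 'n, 'q) bimodule_scheme \<Rightarrow> ('m \<Rightarrow> 'n) set" where
  "right_module_maps A M N = {f \<in> carrier M \<rightarrow> carrier N.
     (\<forall>x\<in>carrier M. \<forall>y\<in>carrier M. f (x \<oplus>\<^bsub>M\<^esub> y) = f x \<oplus>\<^bsub>N\<^esub> f y) \<and>
     (\<forall>x\<in>carrier M. \<forall>a\<in>carrier A. f (x \<triangleleft>\<^bsub>M\<^esub> a) = f x \<triangleleft>\<^bsub>N\<^esub> a)}"

definition bimodule_maps :: "'k ring \<Rightarrow> ('k, 'a) module \<Rightarrow> ('k, 'a, 'm) bimodule \<Rightarrow>
    ('k, 'a, 'n) bimodule \<Rightarrow> ('m \<Rightarrow> 'n) set" where
  "bimodule_maps K A M N = {f \<in> linear_maps K M N. \<forall>a\<in>carrier A. \<forall>x\<in>carrier M.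
     f (a \<triangleright>\<^bsub>M\<^esub> x) = a \<triangleright>\<^bsub>N\<^esub> f x \<and> f (x \<triangleleft>\<^bsub>M\<^esub> a) = f x \<triangleleft>\<^bsub>N\<^esub> a}"

definition regular_bimodule :: "('k, 'a) module \<Rightarrow> ('k, 'a, 'a) bimodule" where
  "regular_bimodule A = \<lparr>carrier = carrier A, mult = mult A, one = \<one>\<^bsub>A\<^esub>, zero = \<zero>\<^bsub>A\<^esub>,
     add = add A, smult = smult A, lact = mult A, ract = mult A\<rparr>"

text \<open>An element \<open>\<bar>a\<close> of the opposite algebra is represented by \<open>a\<close> itself.\<close>

definition opposite :: "('k, 'a) module \<Rightarrow> ('k, 'a) module" where
  "opposite A = A\<lparr>mult := \<lambda>a b. b \<otimes>\<^bsub>A\<^esub> a\<rparr>"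

definition scalar_algebra :: "'k ring \<Rightarrow> ('k, 'k) module" where
  "scalar_algebra K = \<lparr>carrier = carrier K, mult = mult K, one = \<one>\<^bsub>K\<^esub>, zero = \<zero>\<^bsub>K\<^esub>,
     add = add K, smult = mult K\<rparr>"

text \<open>A vector space as a bimodule over the ground field.\<close>

definition scalar_bimodule :: "('k, 'm, 'p) module_scheme \<Rightarrow> ('k, 'k, 'm) bimodule" where
  "scalar_bimodule M = \<lparr>carrier = carrier M, mult = mult M, one = \<one>\<^bsub>M\<^esub>, zero = \<zero>\<^bsub>M\<^esub>,
     add = add M, smult = smult M, lact = smult M, ract = (\<lambda>m k. k \<odot>\<^bsub>M\<^esub> m)\<rparr>"


section \<open>Quotients, free vector spaces and free algebras\<close>

definition generated_submodule ::
    "'k ring \<Rightarrow> ('k, 'm, 'p) module_scheme \<Rightarrow> 'm set \<Rightarrow> 'm set" where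
  "generated_submodule K M S = \<Inter>{N. submodule N K M \<and> S \<subseteq> N}"

text \<open>For a submodule \<open>I\<close> only the module structure of the result is meaningful; for a two-sided ideal
  \<open>I\<close> of an algebra its ring reduct is \<open>A Quot I\<close>.\<close>

definition quotient :: "('k, 'm, 'p) module_scheme \<Rightarrow> 'm set \<Rightarrow> ('k, 'm set) module" where
  "quotient A I = \<lparr>carrier = a_rcosets\<^bsub>A\<^esub> I, mult = rcoset_mult A I, one = I +>\<^bsub>A\<^esub> \<one>\<^bsub>A\<^esub>, zero = I,
     add = set_add A, smult = (\<lambda>k C. \<Union>c\<in>C. I +>\<^bsub>A\<^esub> (k \<odot>\<^bsub>A\<^esub> c))\<rparr>"

definition basis_vector :: "'k ring \<Rightarrow> 's \<Rightarrow> ('s \<Rightarrow> 'k)" where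
  "basis_vector K s = (\<lambda>t. if t = s then \<one>\<^bsub>K\<^esub> else \<zero>\<^bsub>K\<^esub>)"

definition free_space :: "'k ring \<Rightarrow> 's set \<Rightarrow> ('k, 's \<Rightarrow> 'k) module" where
  "free_space K S = \<lparr>
     carrier = {f. (\<forall>s. f s \<in> carrier K) \<and> finite {s. f s \<noteq> \<zero>\<^bsub>K\<^esub>} \<and> {s. f s \<noteq> \<zero>\<^bsub>K\<^esub>} \<subseteq> S},
     mult = undefined, one = undefined,
     zero = (\<lambda>_. \<zero>\<^bsub>K\<^esub>), add = (\<lambda>f g s. f s \<oplus>\<^bsub>K\<^esub> g s), smult = (\<lambda>k f s. k \<otimes>\<^bsub>K\<^esub> f s)\<rparr>"

text \<open>The free algebra on a set \<open>S\<close> of noncommuting variables has the words in \<open>S\<close> as a basis.\<close>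

definition free_algebra :: "'k ring \<Rightarrow> 's set \<Rightarrow> ('k, 's list \<Rightarrow> 'k) module" where
  "free_algebra K S = (free_space K (lists S))
     \<lparr>mult := (\<lambda>f g w. \<Oplus>\<^bsub>K\<^esub>i\<in>{..length w}. f (take i w) \<otimes>\<^bsub>K\<^esub> g (drop i w)),
      one := basis_vector K []\<rparr>"

text \<open>Relations making a map \<open>j\<close> from a module, resp. an algebra, into the algebra \<open>F\<close> linear, resp. a
  unital algebra map.\<close>

definition linear_relations ::
    "'k ring \<Rightarrow> ('k, 'f) module \<Rightarrow> ('k, 'm, 'p) module_scheme \<Rightarrow> ('m \<Rightarrow> 'f) \<Rightarrow> 'f set" where
  "linear_relations K F M j =
     {j (x \<oplus>\<^bsub>M\<^esub> y) \<ominus>\<^bsub>F\<^esub> (j x \<oplus>\<^bsub>F\<^esub> j y) |x y. x \<in> carrier M \<and> y \<in> carrier M} \<union>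
     {j (k \<odot>\<^bsub>M\<^esub> x) \<ominus>\<^bsub>F\<^esub> k \<odot>\<^bsub>F\<^esub> j x |k x. k \<in> carrier K \<and> x \<in> carrier M}"

definition algebra_relations ::
    "'k ring \<Rightarrow> ('k, 'f) module \<Rightarrow> ('k, 'a) module \<Rightarrow> ('a \<Rightarrow> 'f) \<Rightarrow> 'f set" where
  "algebra_relations K F A j = linear_relations K F A j \<union>
     {j (x \<otimes>\<^bsub>A\<^esub> y) \<ominus>\<^bsub>F\<^esub> j x \<otimes>\<^bsub>F\<^esub> j y |x y. x \<in> carrier A \<and> y \<in> carrier A} \<union>
     {j \<one>\<^bsub>A\<^esub> \<ominus>\<^bsub>F\<^esub> \<one>\<^bsub>F\<^esub>}"


section \<open>Tensor products\<close>

definition bilinear_relations :: "'k ring \<Rightarrow> ('k, 'm, 'p) module_scheme \<Rightarrow>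
    ('k, 'n, 'q) module_scheme \<Rightarrow> ('m \<times> 'n \<Rightarrow> 'k) set" where
  "bilinear_relations K M N = (let F = free_space K (carrier M \<times> carrier N) in
     (\<Union>n\<in>carrier N. linear_relations K F M (\<lambda>m. basis_vector K (m, n))) \<union>
     (\<Union>m\<in>carrier M. linear_relations K F N (\<lambda>n. basis_vector K (m, n))))"

definition tensor_kernel :: "'k ring \<Rightarrow> ('k, 'm, 'p) module_scheme \<Rightarrow>
    ('k, 'n, 'q) module_scheme \<Rightarrow> ('m \<times> 'n \<Rightarrow> 'k) set" where
  "tensor_kernel K M N =
     generated_submodule K (free_space K (carrier M \<times> carrier N)) (bilinear_relations K M N)"

definition tensor :: "'k ring \<Rightarrow> ('k, 'm, 'p) module_scheme \<Rightarrow>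
    ('k, 'n, 'q) module_scheme \<Rightarrow> ('k, ('m \<times> 'n \<Rightarrow> 'k) set) module" where
  "tensor K M N = quotient (free_space K (carrier M \<times> carrier N)) (tensor_kernel K M N)"

definition pure_tensor :: "'k ring \<Rightarrow> ('k, 'm, 'p) module_scheme \<Rightarrow>
    ('k, 'n, 'q) module_scheme \<Rightarrow> 'm \<Rightarrow> 'n \<Rightarrow> ('m \<times> 'n \<Rightarrow> 'k) set" where
  "pure_tensor K M N m n =
     tensor_kernel K M N +>\<^bsub>free_space K (carrier M \<times> carrier N)\<^esub> basis_vector K (m, n)"

text \<open>The linear map on the tensor product induced by a bilinear map \<open>f\<close>.\<close>

definition tensor_lift :: "'k ring \<Rightarrow> ('k, 'm, 'p) module_scheme \<Rightarrow> ('k, 'n, 'q) module_scheme \<Rightarrow>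
    ('k, 'r, 's) module_scheme \<Rightarrow> ('m \<Rightarrow> 'n \<Rightarrow> 'r) \<Rightarrow> ('m \<times> 'n \<Rightarrow> 'k) set \<Rightarrow> 'r" where
  "tensor_lift K M N P f =
     (THE h. h \<in> linear_maps K (tensor K M N) P \<inter> extensional (carrier (tensor K M N)) \<and>
        (\<forall>m\<in>carrier M. \<forall>n\<in>carrier N. h (pure_tensor K M N m n) = f m n))"

text \<open>The tensor product \<open>M \<otimes>\<^sub>A N\<close> of bimodules, as the quotient of \<open>M \<otimes>\<^sub>K N\<close> by the span of
  \<open>ma \<otimes> n - m \<otimes> an\<close>.\<close>

definition balanced_kernel :: "'k ring \<Rightarrow> ('k, 'a) module \<Rightarrow> ('k, 'a, 'm) bimodule \<Rightarrow>
    ('k, 'a, 'n) bimodule \<Rightarrow> ('m \<times> 'n \<Rightarrow> 'k) set set" where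
  "balanced_kernel K A M N = generated_submodule K (tensor K M N)
     {pure_tensor K M N (m \<triangleleft>\<^bsub>M\<^esub> a) n \<ominus>\<^bsub>tensor K M N\<^esub> pure_tensor K M N m (a \<triangleright>\<^bsub>N\<^esub> n) |m a n.
        m \<in> carrier M \<and> a \<in> carrier A \<and> n \<in> carrier N}"

definition balanced_space :: "'k ring \<Rightarrow> ('k, 'a) module \<Rightarrow> ('k, 'a, 'm) bimodule \<Rightarrow>
    ('k, 'a, 'n) bimodule \<Rightarrow> ('k, ('m \<times> 'n \<Rightarrow> 'k) set set) module" where
  "balanced_space K A M N = quotient (tensor K M N) (balanced_kernel K A M N)"

definition pure_tensor_over :: "'k ring \<Rightarrow> ('k, 'a) module \<Rightarrow> ('k, 'a, 'm) bimodule \<Rightarrow>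
    ('k, 'a, 'n) bimodule \<Rightarrow> 'm \<Rightarrow> 'n \<Rightarrow> ('m \<times> 'n \<Rightarrow> 'k) set set" where
  "pure_tensor_over K A M N m n =
     balanced_kernel K A M N +>\<^bsub>tensor K M N\<^esub> pure_tensor K M N m n"

definition tensor_over_lift :: "'k ring \<Rightarrow> ('k, 'a) module \<Rightarrow> ('k, 'a, 'm) bimodule \<Rightarrow>
    ('k, 'a, 'n) bimodule \<Rightarrow> ('k, 'r, 's) module_scheme \<Rightarrow> ('m \<Rightarrow> 'n \<Rightarrow> 'r) \<Rightarrow>
    ('m \<times> 'n \<Rightarrow> 'k) set set \<Rightarrow> 'r" where
  "tensor_over_lift K A M N P f =
     (THE h. h \<in> linear_maps K (balanced_space K A M N) P
          \<inter> extensional (carrier (balanced_space K A M N)) \<and>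
        (\<forall>m\<in>carrier M. \<forall>n\<in>carrier N. h (pure_tensor_over K A M N m n) = f m n))"

definition tensor_over :: "'k ring \<Rightarrow> ('k, 'a) module \<Rightarrow> ('k, 'a, 'm) bimodule \<Rightarrow>
    ('k, 'a, 'n) bimodule \<Rightarrow> ('k, 'a, ('m \<times> 'n \<Rightarrow> 'k) set set) bimodule" where
  "tensor_over K A M N = (let T = balanced_space K A M N in
     \<lparr>carrier = carrier T, mult = mult T, one = \<one>\<^bsub>T\<^esub>, zero = \<zero>\<^bsub>T\<^esub>, add = add T, smult = smult T,
      lact = (\<lambda>a. tensor_over_lift K A M N T (\<lambda>m n. pure_tensor_over K A M N (a \<triangleright>\<^bsub>M\<^esub> m) n)),
      ract = (\<lambda>t a. tensor_over_lift K A M N T (\<lambda>m n. pure_tensor_over K A M N m (n \<triangleleft>\<^bsub>N\<^esub> a)) t)\<rparr>)"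

definition tensor_algebras :: "'k ring \<Rightarrow> ('k, 'a) module \<Rightarrow> ('k, 'b) module \<Rightarrow>
    ('k, ('a \<times> 'b \<Rightarrow> 'k) set) module" where
  "tensor_algebras K A B = (let T = tensor K A B in
     T\<lparr>mult := (\<lambda>u v. tensor_lift K A B T (\<lambda>a b. tensor_lift K A B T
          (\<lambda>a' b'. pure_tensor K A B (a \<otimes>\<^bsub>A\<^esub> a') (b \<otimes>\<^bsub>B\<^esub> b')) v) u),
       one := pure_tensor K A B \<one>\<^bsub>A\<^esub> \<one>\<^bsub>B\<^esub>\<rparr>)"

definition enveloping_algebra ::
    "'k ring \<Rightarrow> ('k, 'a) module \<Rightarrow> ('k, ('a \<times> 'a \<Rightarrow> 'k) set) module" where
  "enveloping_algebra K A = tensor_algebras K A (opposite A)"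

text \<open>The element \<open>a\<bar>b\<close> of \<open>A\<^sup>e\<close>.\<close>

definition env_elem :: "'k ring \<Rightarrow> ('k, 'a) module \<Rightarrow> 'a \<Rightarrow> 'a \<Rightarrow> ('a \<times> 'a \<Rightarrow> 'k) set" where
  "env_elem K A a b = pure_tensor K A (opposite A) a b"


section \<open>Tensor algebras and free products\<close>

text \<open>
  The tensor algebra \<open>T\<^sub>R(V)\<close> of an \<open>R\<close>-bimodule \<open>V\<close> over a \<open>K\<close>-algebra \<open>R\<close>: the algebra generated by
  \<open>R\<close> (as an algebra) and \<open>V\<close> (as a vector space) in which \<open>r \<cdot> v = rv\<close> and \<open>v \<cdot> r = vr\<close>.
  This is the universal \<open>R\<close>-ring with a bimodule map from \<open>V\<close>, i.e. \<open>R \<oplus> V \<oplus> (V \<otimes>\<^sub>R V) \<oplus> \<dots>\<close>.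
  For \<open>R = K\<close> it is the tensor algebra of a vector space.
\<close>

definition ta_free :: "'k ring \<Rightarrow> ('k, 'r) module \<Rightarrow> ('k, 'r, 'v) bimodule \<Rightarrow>
    ('k, ('r + 'v) list \<Rightarrow> 'k) module" where
  "ta_free K R V = free_algebra K (carrier R <+> carrier V)"

definition ta_ideal :: "'k ring \<Rightarrow> ('k, 'r) module \<Rightarrow> ('k, 'r, 'v) bimodule \<Rightarrow>
    (('r + 'v) list \<Rightarrow> 'k) set" where
  "ta_ideal K R V = (let F = ta_free K R V;
       i = (\<lambda>r. basis_vector K [Inl r]); j = (\<lambda>v. basis_vector K [Inr v])
     in genideal F (algebra_relations K F R i \<union> linear_relations K F V j \<union>
       {i r \<otimes>\<^bsub>F\<^esub> j v \<ominus>\<^bsub>F\<^esub> j (r \<triangleright>\<^bsub>V\<^esub> v) |r v. r \<in> carrier R \<and> v \<in> carrier V} \<union>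
       {j v \<otimes>\<^bsub>F\<^esub> i r \<ominus>\<^bsub>F\<^esub> j (v \<triangleleft>\<^bsub>V\<^esub> r) |r v. r \<in> carrier R \<and> v \<in> carrier V}))"

definition tensor_algebra :: "'k ring \<Rightarrow> ('k, 'r) module \<Rightarrow> ('k, 'r, 'v) bimodule \<Rightarrow>
    ('k, (('r + 'v) list \<Rightarrow> 'k) set) module" where
  "tensor_algebra K R V = quotient (ta_free K R V) (ta_ideal K R V)"

definition ta_base :: "'k ring \<Rightarrow> ('k, 'r) module \<Rightarrow> ('k, 'r, 'v) bimodule \<Rightarrow> 'r \<Rightarrow>
    (('r + 'v) list \<Rightarrow> 'k) set" where
  "ta_base K R V r = ta_ideal K R V +>\<^bsub>ta_free K R V\<^esub> basis_vector K [Inl r]"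

definition ta_gen :: "'k ring \<Rightarrow> ('k, 'r) module \<Rightarrow> ('k, 'r, 'v) bimodule \<Rightarrow> 'v \<Rightarrow>
    (('r + 'v) list \<Rightarrow> 'k) set" where
  "ta_gen K R V v = ta_ideal K R V +>\<^bsub>ta_free K R V\<^esub> basis_vector K [Inr v]"

text \<open>The free product (coproduct of unital algebras) \<open>R \<star> S\<close>.\<close>

definition fp_free :: "'k ring \<Rightarrow> ('k, 'r) module \<Rightarrow> ('k, 's) module \<Rightarrow>
    ('k, ('r + 's) list \<Rightarrow> 'k) module" where
  "fp_free K R S = free_algebra K (carrier R <+> carrier S)"

definition fp_ideal :: "'k ring \<Rightarrow> ('k, 'r) module \<Rightarrow> ('k, 's) module \<Rightarrow>
    (('r + 's) list \<Rightarrow> 'k) set" where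
  "fp_ideal K R S = (let F = fp_free K R S in
     genideal F (algebra_relations K F R (\<lambda>r. basis_vector K [Inl r]) \<union>
       algebra_relations K F S (\<lambda>s. basis_vector K [Inr s])))"

definition free_product :: "'k ring \<Rightarrow> ('k, 'r) module \<Rightarrow> ('k, 's) module \<Rightarrow>
    ('k, (('r + 's) list \<Rightarrow> 'k) set) module" where
  "free_product K R S = quotient (fp_free K R S) (fp_ideal K R S)"

definition fp_left :: "'k ring \<Rightarrow> ('k, 'r) module \<Rightarrow> ('k, 's) module \<Rightarrow> 'r \<Rightarrow>
    (('r + 's) list \<Rightarrow> 'k) set" where
  "fp_left K R S r = fp_ideal K R S +>\<^bsub>fp_free K R S\<^esub> basis_vector K [Inl r]"

definition fp_right :: "'k ring \<Rightarrow> ('k, 'r) module \<Rightarrow> ('k, 's) module \<Rightarrow> 's \<Rightarrow>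
    (('r + 's) list \<Rightarrow> 'k) set" where
  "fp_right K R S s = fp_ideal K R S +>\<^bsub>fp_free K R S\<^esub> basis_vector K [Inr s]"


section \<open>Left bialgebroids\<close>

locale Ae_ring = A?: k_algebra K A + B?: k_algebra K B
    for K :: "'k ring" (structure) and A :: "('k, 'a) module" (structure)
      and B :: "('k, 'b) module" (structure) +
  fixes \<eta> :: "('a \<times> 'a \<Rightarrow> 'k) set \<Rightarrow> 'b"
  assumes structure_map: "\<eta> \<in> algebra_homs K (enveloping_algebra K A) B"

definition source :: "'k ring \<Rightarrow> ('k, 'a) module \<Rightarrow> (('a \<times> 'a \<Rightarrow> 'k) set \<Rightarrow> 'b) \<Rightarrow> 'a \<Rightarrow> 'b" where
  "source K A \<eta> a = \<eta> (env_elem K A a \<one>\<^bsub>A\<^esub>)"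

definition target :: "'k ring \<Rightarrow> ('k, 'a) module \<Rightarrow> (('a \<times> 'a \<Rightarrow> 'k) set \<Rightarrow> 'b) \<Rightarrow> 'a \<Rightarrow> 'b" where
  "target K A \<eta> a = \<eta> (env_elem K A \<one>\<^bsub>A\<^esub> a)"

text \<open>The \<open>A\<close>-bimodule \<open>|B\<close>, with \<open>r \<cdot> b \<cdot> s = r\<bar>sb\<close>.\<close>

definition left_bimodule :: "'k ring \<Rightarrow> ('k, 'a) module \<Rightarrow> ('k, 'b) module \<Rightarrow>
    (('a \<times> 'a \<Rightarrow> 'k) set \<Rightarrow> 'b) \<Rightarrow> ('k, 'a, 'b) bimodule" where
  "left_bimodule K A B \<eta> = \<lparr>carrier = carrier B, mult = mult B, one = \<one>\<^bsub>B\<^esub>, zero = \<zero>\<^bsub>B\<^esub>,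
     add = add B, smult = smult B, lact = (\<lambda>r b. source K A \<eta> r \<otimes>\<^bsub>B\<^esub> b),
     ract = (\<lambda>b s. target K A \<eta> s \<otimes>\<^bsub>B\<^esub> b)\<rparr>"

definition bsquare :: "'k ring \<Rightarrow> ('k, 'a) module \<Rightarrow> ('k, 'b) module \<Rightarrow>
    (('a \<times> 'a \<Rightarrow> 'k) set \<Rightarrow> 'b) \<Rightarrow> ('k, 'a, ('b \<times> 'b \<Rightarrow> 'k) set set) bimodule" where
  "bsquare K A B \<eta> = tensor_over K A (left_bimodule K A B \<eta>) (left_bimodule K A B \<eta>)"

definition bpure :: "'k ring \<Rightarrow> ('k, 'a) module \<Rightarrow> ('k, 'b) module \<Rightarrow>
    (('a \<times> 'a \<Rightarrow> 'k) set \<Rightarrow> 'b) \<Rightarrow> 'b \<Rightarrow> 'b \<Rightarrow> ('b \<times> 'b \<Rightarrow> 'k) set set" where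
  "bpure K A B \<eta> = pure_tensor_over K A (left_bimodule K A B \<eta>) (left_bimodule K A B \<eta>)"

definition bsum :: "'k ring \<Rightarrow> ('k, 'a) module \<Rightarrow> ('k, 'b) module \<Rightarrow>
    (('a \<times> 'a \<Rightarrow> 'k) set \<Rightarrow> 'b) \<Rightarrow> nat \<Rightarrow> (nat \<Rightarrow> 'b) \<Rightarrow> (nat \<Rightarrow> 'b) \<Rightarrow>
    ('b \<times> 'b \<Rightarrow> 'k) set set" where
  "bsum K A B \<eta> n p q = (\<Oplus>\<^bsub>bsquare K A B \<eta>\<^esub>i\<in>{..<n}. bpure K A B \<eta> (p i) (q i))"

text \<open>The representation \<open>t = \<Sum>\<^sub>i p\<^sub>i \<otimes> q\<^sub>i\<close> in \<open>|B \<otimes> |B\<close>. An identity in Sweedler notation is required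
  for every representation of the coproducts occurring in it; in particular the independence of
  the representation is part of the axiom.\<close>

definition sweedler :: "'k ring \<Rightarrow> ('k, 'a) module \<Rightarrow> ('k, 'b) module \<Rightarrow>
    (('a \<times> 'a \<Rightarrow> 'k) set \<Rightarrow> 'b) \<Rightarrow> ('b \<times> 'b \<Rightarrow> 'k) set set \<Rightarrow> nat \<Rightarrow> (nat \<Rightarrow> 'b) \<Rightarrow> (nat \<Rightarrow> 'b) \<Rightarrow>
    bool" where
  "sweedler K A B \<eta> t n p q \<longleftrightarrow>
     (\<forall>i<n. p i \<in> carrier B \<and> q i \<in> carrier B) \<and> t = bsum K A B \<eta> n p q"

text \<open>\<open>\<Delta>(bc) = b\<^sub>(\<^sub>1\<^sub>)c\<^sub>(\<^sub>1\<^sub>) \<otimes> b\<^sub>(\<^sub>2\<^sub>)c\<^sub>(\<^sub>2\<^sub>)\<close>.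
  The componentwise product does not descend to all of \<open>|B \<otimes> |B\<close>; that it is well-defined here
  for all representations contains the Takeuchi condition \<open>b\<^sub>(\<^sub>1\<^sub>)\<bar>s \<otimes> b\<^sub>(\<^sub>2\<^sub>) = b\<^sub>(\<^sub>1\<^sub>) \<otimes> b\<^sub>(\<^sub>2\<^sub>)s\<close>.\<close>

definition comult_product_rule :: "'k ring \<Rightarrow> ('k, 'a) module \<Rightarrow> ('k, 'b) module \<Rightarrow>
    (('a \<times> 'a \<Rightarrow> 'k) set \<Rightarrow> 'b) \<Rightarrow> ('b \<Rightarrow> ('b \<times> 'b \<Rightarrow> 'k) set set) \<Rightarrow> bool" where
  "comult_product_rule K A B \<eta> \<Delta> \<longleftrightarrow> (\<forall>b\<in>carrier B. \<forall>c\<in>carrier B. \<forall>n p q n' p' q'.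
     sweedler K A B \<eta> (\<Delta> b) n p q \<and> sweedler K A B \<eta> (\<Delta> c) n' p' q' \<longrightarrow>
     \<Delta> (b \<otimes>\<^bsub>B\<^esub> c) = (\<Oplus>\<^bsub>bsquare K A B \<eta>\<^esub>i\<in>{..<n}. \<Oplus>\<^bsub>bsquare K A B \<eta>\<^esub>j\<in>{..<n'}.
        bpure K A B \<eta> (p i \<otimes>\<^bsub>B\<^esub> p' j) (q i \<otimes>\<^bsub>B\<^esub> q' j)))"

text \<open>In the coassociativity axiom \<open>(|B \<otimes> |B) \<otimes> |B\<close> is identified with \<open>|B \<otimes> (|B \<otimes> |B)\<close>, so that the
  axiom reads \<open>b\<^sub>(\<^sub>1\<^sub>)\<^sub>(\<^sub>1\<^sub>) \<otimes> (b\<^sub>(\<^sub>1\<^sub>)\<^sub>(\<^sub>2\<^sub>) \<otimes> b\<^sub>(\<^sub>2\<^sub>)) = b\<^sub>(\<^sub>1\<^sub>) \<otimes> \<Delta>(b\<^sub>(\<^sub>2\<^sub>))\<close>.\<close>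

locale left_bialgebroid = Ae_ring K A B \<eta>
    for K :: "'k ring" (structure) and A :: "('k, 'a) module" (structure)
      and B :: "('k, 'b) module" (structure) and \<eta> +
  fixes \<Delta> :: "'b \<Rightarrow> ('b \<times> 'b \<Rightarrow> 'k) set set" and \<epsilon> :: "'b \<Rightarrow> 'a"
  assumes comult_bimodule_map:
      "\<Delta> \<in> bimodule_maps K A (left_bimodule K A B \<eta>) (bsquare K A B \<eta>)"
    and counit_bimodule_map:
      "\<epsilon> \<in> bimodule_maps K A (left_bimodule K A B \<eta>) (regular_bimodule A)"
    and coassociative:
      "\<And>b n p q m u v.
        \<lbrakk>b \<in> carrier B; sweedler K A B \<eta> (\<Delta> b) n p q;
         \<And>i. i < n \<Longrightarrow> sweedler K A B \<eta> (\<Delta> (p i)) (m i) (u i) (v i)\<rbrakk> \<Longrightarrow>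
        (\<Oplus>\<^bsub>tensor_over K A (left_bimodule K A B \<eta>) (bsquare K A B \<eta>)\<^esub>i\<in>{..<n}.
          \<Oplus>\<^bsub>tensor_over K A (left_bimodule K A B \<eta>) (bsquare K A B \<eta>)\<^esub>j\<in>{..<m i}.
            pure_tensor_over K A (left_bimodule K A B \<eta>) (bsquare K A B \<eta>)
              (u i j) (bpure K A B \<eta> (v i j) (q i))) =
        (\<Oplus>\<^bsub>tensor_over K A (left_bimodule K A B \<eta>) (bsquare K A B \<eta>)\<^esub>i\<in>{..<n}.
            pure_tensor_over K A (left_bimodule K A B \<eta>) (bsquare K A B \<eta>) (p i) (\<Delta> (q i)))"
    and counit_left:
      "\<And>b n p q. \<lbrakk>b \<in> carrier B; sweedler K A B \<eta> (\<Delta> b) n p q\<rbrakk> \<Longrightarrow>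
        (\<Oplus>\<^bsub>B\<^esub>i\<in>{..<n}. source K A \<eta> (\<epsilon> (p i)) \<otimes>\<^bsub>B\<^esub> q i) = b"
    and counit_right:
      "\<And>b n p q. \<lbrakk>b \<in> carrier B; sweedler K A B \<eta> (\<Delta> b) n p q\<rbrakk> \<Longrightarrow>
        (\<Oplus>\<^bsub>B\<^esub>i\<in>{..<n}. target K A \<eta> (\<epsilon> (q i)) \<otimes>\<^bsub>B\<^esub> p i) = b"
    and comult_right_base:
      "\<And>b r s n p q.
        \<lbrakk>b \<in> carrier B; r \<in> carrier A; s \<in> carrier A; sweedler K A B \<eta> (\<Delta> b) n p q\<rbrakk> \<Longrightarrow>
        \<Delta> (b \<otimes>\<^bsub>B\<^esub> source K A \<eta> r \<otimes>\<^bsub>B\<^esub> target K A \<eta> s) =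
          bsum K A B \<eta> n (\<lambda>i. p i \<otimes>\<^bsub>B\<^esub> source K A \<eta> r) (\<lambda>i. q i \<otimes>\<^bsub>B\<^esub> target K A \<eta> s)"
    and counit_right_base:
      "\<And>b r. \<lbrakk>b \<in> carrier B; r \<in> carrier A\<rbrakk> \<Longrightarrow>
        \<epsilon> (b \<otimes>\<^bsub>B\<^esub> source K A \<eta> r) = \<epsilon> (b \<otimes>\<^bsub>B\<^esub> target K A \<eta> r)"
    and comult_mult: "comult_product_rule K A B \<eta> \<Delta>"
    and comult_one: "\<Delta> \<one>\<^bsub>B\<^esub> = bpure K A B \<eta> \<one>\<^bsub>B\<^esub> \<one>\<^bsub>B\<^esub>"
    and counit_one: "\<epsilon> \<one>\<^bsub>B\<^esub> = \<one>\<^bsub>A\<^esub>"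
    and counit_mult_source:
      "\<And>b c. \<lbrakk>b \<in> carrier B; c \<in> carrier B\<rbrakk> \<Longrightarrow>
        \<epsilon> (b \<otimes>\<^bsub>B\<^esub> c) = \<epsilon> (b \<otimes>\<^bsub>B\<^esub> source K A \<eta> (\<epsilon> c))"
    and counit_mult_target:
      "\<And>b c. \<lbrakk>b \<in> carrier B; c \<in> carrier B\<rbrakk> \<Longrightarrow>
        \<epsilon> (b \<otimes>\<^bsub>B\<^esub> c) = \<epsilon> (b \<otimes>\<^bsub>B\<^esub> target K A \<eta> (\<epsilon> c))"


section \<open>Differential calculi and the algebra of vector fields\<close>

locale differential_calculus = bimodule K A \<Omega>
    for K :: "'k ring" (structure) and A :: "('k, 'a) module" (structure)
      and \<Omega> :: "('k, 'a, 'w) bimodule" (structure) +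
  fixes d :: "'a \<Rightarrow> 'w"
  assumes d_linear: "d \<in> linear_maps K A \<Omega>"
    and leibniz: "\<lbrakk>a \<in> carrier A; b \<in> carrier A\<rbrakk> \<Longrightarrow>
        d (a \<otimes>\<^bsub>A\<^esub> b) = d a \<triangleleft>\<^bsub>\<Omega>\<^esub> b \<oplus>\<^bsub>\<Omega>\<^esub> a \<triangleright>\<^bsub>\<Omega>\<^esub> d b"

definition free_bimodule :: "('k, 'a) module \<Rightarrow> nat \<Rightarrow> ('k, 'a, nat \<Rightarrow> 'a) bimodule" where
  "free_bimodule A n = \<lparr>carrier = {..<n} \<rightarrow>\<^sub>E carrier A, mult = undefined, one = undefined,
     zero = (\<lambda>i\<in>{..<n}. \<zero>\<^bsub>A\<^esub>), add = (\<lambda>f g. \<lambda>i\<in>{..<n}. f i \<oplus>\<^bsub>A\<^esub> g i),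
     smult = (\<lambda>k f. \<lambda>i\<in>{..<n}. k \<odot>\<^bsub>A\<^esub> f i), lact = (\<lambda>a f. \<lambda>i\<in>{..<n}. a \<otimes>\<^bsub>A\<^esub> f i),
     ract = (\<lambda>f a. \<lambda>i\<in>{..<n}. f i \<otimes>\<^bsub>A\<^esub> a)\<rparr>"

text \<open>Finitely generated projective as a right module: a direct summand of some \<open>A\<^sup>n\<close>.\<close>

definition fg_projective_right :: "('k, 'a) module \<Rightarrow> ('k, 'a, 'm) bimodule \<Rightarrow> bool" where
  "fg_projective_right A M \<longleftrightarrow> (\<exists>n.
     \<exists>\<iota>\<in>right_module_maps A M (free_bimodule A n). \<exists>\<pi>\<in>right_module_maps A (free_bimodule A n) M.
       \<forall>m\<in>carrier M. \<pi> (\<iota> m) = m)"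

text \<open>The left dual \<open>Hom\<^sub>A(\<Omega>, A)\<close> (right module maps), with \<open>(axb)(\<omega>) = a x(b\<omega>)\<close>.\<close>

definition left_dual :: "('k, 'a) module \<Rightarrow> ('k, 'a, 'w) bimodule \<Rightarrow> ('k, 'a, 'w \<Rightarrow> 'a) bimodule"
  where
  "left_dual A \<Omega> = \<lparr>
     carrier = right_module_maps A \<Omega> (regular_bimodule A) \<inter> extensional (carrier \<Omega>),
     mult = undefined, one = undefined,
     zero = (\<lambda>\<omega>\<in>carrier \<Omega>. \<zero>\<^bsub>A\<^esub>), add = (\<lambda>x y. \<lambda>\<omega>\<in>carrier \<Omega>. x \<omega> \<oplus>\<^bsub>A\<^esub> y \<omega>),
     smult = (\<lambda>k x. \<lambda>\<omega>\<in>carrier \<Omega>. k \<odot>\<^bsub>A\<^esub> x \<omega>), lact = (\<lambda>a x. \<lambda>\<omega>\<in>carrier \<Omega>. a \<otimes>\<^bsub>A\<^esub> x \<omega>),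
     ract = (\<lambda>x b. \<lambda>\<omega>\<in>carrier \<Omega>. x (b \<triangleright>\<^bsub>\<Omega>\<^esub> \<omega>))\<rparr>"

text \<open>\<open>coev(1) = \<Sum>\<^sub>i \<omega>\<^sub>i \<otimes> x\<^sub>i\<close>: the two triangle identities that characterise \<open>coev\<close> given the
  evaluation \<open>ev(x \<otimes> \<omega>) = x(\<omega>)\<close>.\<close>

definition coev_family :: "('k, 'a, 'w) bimodule \<Rightarrow> ('k, 'a) module \<Rightarrow> nat \<Rightarrow> (nat \<Rightarrow> 'w) \<Rightarrow>
    (nat \<Rightarrow> 'w \<Rightarrow> 'a) \<Rightarrow> bool" where
  "coev_family \<Omega> A n \<omega> x \<longleftrightarrow>
     (\<forall>i<n. \<omega> i \<in> carrier \<Omega> \<and> x i \<in> carrier (left_dual A \<Omega>)) \<and>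
     (\<forall>\<omega>'\<in>carrier \<Omega>. (\<Oplus>\<^bsub>\<Omega>\<^esub>i\<in>{..<n}. \<omega> i \<triangleleft>\<^bsub>\<Omega>\<^esub> x i \<omega>') = \<omega>') \<and>
     (\<forall>x'\<in>carrier (left_dual A \<Omega>).
        (\<Oplus>\<^bsub>left_dual A \<Omega>\<^esub>i\<in>{..<n}. x' (\<omega> i) \<triangleright>\<^bsub>left_dual A \<Omega>\<^esub> x i) = x')"

type_synonym ('k, 'a) env = "('a \<times> 'a \<Rightarrow> 'k) set"
type_synonym ('k, 'a, 'w) endo = "(('w \<Rightarrow> 'a) \<times> 'w \<Rightarrow> 'k) set"
type_synonym ('k, 'a, 'w) BOm = "((('k, 'a) env + ('k, 'a, 'w) endo) list \<Rightarrow> 'k) set"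
type_synonym ('k, 'a, 'w) TX = "(('k + ('w \<Rightarrow> 'a)) list \<Rightarrow> 'k) set"
type_synonym ('k, 'a, 'w) BOm_TX = "((('k, 'a, 'w) BOm + ('k, 'a, 'w) TX) list \<Rightarrow> 'k) set"
type_synonym ('k, 'a, 'w) BXt = "('k, 'a, 'w) BOm_TX set"

text \<open>The \<open>A\<^sup>e\<close>-bimodule \<open>\<MM> = \<XX>\<^sup>1 \<otimes>\<^sub>K \<Omega>\<^sup>1\<close>, with
  \<open>a\<bar>a' (x, \<omega>) = (ax, \<omega>a')\<close> and \<open>(x, \<omega>) b\<bar>b' = (xb, b'\<omega>)\<close>.\<close>

definition endo_bimodule :: "'k ring \<Rightarrow> ('k, 'a) module \<Rightarrow> ('k, 'a, 'w) bimodule \<Rightarrow>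
    ('k, ('k, 'a) env, ('k, 'a, 'w) endo) bimodule" where
  "endo_bimodule K A \<Omega> = (let X = left_dual A \<Omega>; M = tensor K X \<Omega> in
     \<lparr>carrier = carrier M, mult = mult M, one = \<one>\<^bsub>M\<^esub>, zero = \<zero>\<^bsub>M\<^esub>, add = add M, smult = smult M,
      lact = (\<lambda>u t. tensor_lift K A (opposite A) M (\<lambda>a a'. tensor_lift K X \<Omega> M
         (\<lambda>x \<omega>. pure_tensor K X \<Omega> (a \<triangleright>\<^bsub>X\<^esub> x) (\<omega> \<triangleleft>\<^bsub>\<Omega>\<^esub> a')) t) u),
      ract = (\<lambda>t u. tensor_lift K A (opposite A) M (\<lambda>b b'. tensor_lift K X \<Omega> M
         (\<lambda>x \<omega>. pure_tensor K X \<Omega> (x \<triangleleft>\<^bsub>X\<^esub> b) (b' \<triangleright>\<^bsub>\<Omega>\<^esub> \<omega>)) t) u)\<rparr>)"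

definition B_Omega :: "'k ring \<Rightarrow> ('k, 'a) module \<Rightarrow> ('k, 'a, 'w) bimodule \<Rightarrow>
    ('k, ('k, 'a, 'w) BOm) module" where
  "B_Omega K A \<Omega> = tensor_algebra K (enveloping_algebra K A) (endo_bimodule K A \<Omega>)"

definition T_X :: "'k ring \<Rightarrow> ('k, 'a) module \<Rightarrow> ('k, 'a, 'w) bimodule \<Rightarrow>
    ('k, ('k, 'a, 'w) TX) module" where
  "T_X K A \<Omega> = tensor_algebra K (scalar_algebra K) (scalar_bimodule (left_dual A \<Omega>))"

definition B_Omega_T_X :: "'k ring \<Rightarrow> ('k, 'a) module \<Rightarrow> ('k, 'a, 'w) bimodule \<Rightarrow>
    ('k, ('k, 'a, 'w) BOm_TX) module" where
  "B_Omega_T_X K A \<Omega> = free_product K (B_Omega K A \<Omega>) (T_X K A \<Omega>)"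

text \<open>The images of \<open>A\<^sup>e\<close>, \<open>\<MM>\<close> and \<open>\<XX>\<^sup>1\<close> in \<open>B(\<Omega>\<^sup>1) \<star> T\<XX>\<^sup>1\<close>.\<close>

definition fp_env :: "'k ring \<Rightarrow> ('k, 'a) module \<Rightarrow> ('k, 'a, 'w) bimodule \<Rightarrow> ('k, 'a) env \<Rightarrow>
    ('k, 'a, 'w) BOm_TX" where
  "fp_env K A \<Omega> u = fp_left K (B_Omega K A \<Omega>) (T_X K A \<Omega>)
     (ta_base K (enveloping_algebra K A) (endo_bimodule K A \<Omega>) u)"

definition fp_endo :: "'k ring \<Rightarrow> ('k, 'a) module \<Rightarrow> ('k, 'a, 'w) bimodule \<Rightarrow> ('w \<Rightarrow> 'a) \<Rightarrow> 'w \<Rightarrow>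
    ('k, 'a, 'w) BOm_TX" where
  "fp_endo K A \<Omega> x \<omega> = fp_left K (B_Omega K A \<Omega>) (T_X K A \<Omega>)
     (ta_gen K (enveloping_algebra K A) (endo_bimodule K A \<Omega>)
       (pure_tensor K (left_dual A \<Omega>) \<Omega> x \<omega>))"

definition fp_field :: "'k ring \<Rightarrow> ('k, 'a) module \<Rightarrow> ('k, 'a, 'w) bimodule \<Rightarrow> ('w \<Rightarrow> 'a) \<Rightarrow>
    ('k, 'a, 'w) BOm_TX" where
  "fp_field K A \<Omega> x = fp_right K (B_Omega K A \<Omega>) (T_X K A \<Omega>)
     (ta_gen K (scalar_algebra K) (scalar_bimodule (left_dual A \<Omega>)) x)"

definition BX_ideal :: "'k ring \<Rightarrow> ('k, 'a) module \<Rightarrow> ('k, 'a, 'w) bimodule \<Rightarrow> ('a \<Rightarrow> 'w) \<Rightarrow>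
    ('k, 'a, 'w) BOm_TX set" where
  "BX_ideal K A \<Omega> d = (let F = B_Omega_T_X K A \<Omega>; X = left_dual A \<Omega>;
       s = (\<lambda>a. fp_env K A \<Omega> (env_elem K A a \<one>\<^bsub>A\<^esub>)); t = (\<lambda>a. fp_env K A \<Omega> (env_elem K A \<one>\<^bsub>A\<^esub> a));
       j = fp_field K A \<Omega>
     in genideal F (
       {s a \<otimes>\<^bsub>F\<^esub> j x \<ominus>\<^bsub>F\<^esub> j (a \<triangleright>\<^bsub>X\<^esub> x) |a x. a \<in> carrier A \<and> x \<in> carrier X} \<union>
       {j x \<otimes>\<^bsub>F\<^esub> s a \<ominus>\<^bsub>F\<^esub> (j (x \<triangleleft>\<^bsub>X\<^esub> a) \<oplus>\<^bsub>F\<^esub> s (x (d a))) |a x.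
          a \<in> carrier A \<and> x \<in> carrier X} \<union>
       {j x \<otimes>\<^bsub>F\<^esub> t a \<ominus>\<^bsub>F\<^esub> (t a \<otimes>\<^bsub>F\<^esub> j x \<oplus>\<^bsub>F\<^esub> fp_endo K A \<Omega> x (d a)) |a x.
          a \<in> carrier A \<and> x \<in> carrier X}))"

definition BX :: "'k ring \<Rightarrow> ('k, 'a) module \<Rightarrow> ('k, 'a, 'w) bimodule \<Rightarrow> ('a \<Rightarrow> 'w) \<Rightarrow>
    ('k, ('k, 'a, 'w) BXt) module" where
  "BX K A \<Omega> d = quotient (B_Omega_T_X K A \<Omega>) (BX_ideal K A \<Omega> d)"

definition BX_env :: "'k ring \<Rightarrow> ('k, 'a) module \<Rightarrow> ('k, 'a, 'w) bimodule \<Rightarrow> ('a \<Rightarrow> 'w) \<Rightarrow>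
    ('k, 'a) env \<Rightarrow> ('k, 'a, 'w) BXt" where
  "BX_env K A \<Omega> d u = BX_ideal K A \<Omega> d +>\<^bsub>B_Omega_T_X K A \<Omega>\<^esub> fp_env K A \<Omega> u"

definition BX_endo :: "'k ring \<Rightarrow> ('k, 'a) module \<Rightarrow> ('k, 'a, 'w) bimodule \<Rightarrow> ('a \<Rightarrow> 'w) \<Rightarrow>
    ('w \<Rightarrow> 'a) \<Rightarrow> 'w \<Rightarrow> ('k, 'a, 'w) BXt" where
  "BX_endo K A \<Omega> d x \<omega> = BX_ideal K A \<Omega> d +>\<^bsub>B_Omega_T_X K A \<Omega>\<^esub> fp_endo K A \<Omega> x \<omega>"

definition BX_field :: "'k ring \<Rightarrow> ('k, 'a) module \<Rightarrow> ('k, 'a, 'w) bimodule \<Rightarrow> ('a \<Rightarrow> 'w) \<Rightarrow>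
    ('w \<Rightarrow> 'a) \<Rightarrow> ('k, 'a, 'w) BXt" where
  "BX_field K A \<Omega> d x = BX_ideal K A \<Omega> d +>\<^bsub>B_Omega_T_X K A \<Omega>\<^esub> fp_field K A \<Omega> x"

text \<open>The formulas for a coproduct and a counit on \<open>B\<XX>\<^sup>1\<close>: linear maps with the prescribed values
  on generators, extended to products by the stated rules.\<close>

locale BX_coproduct_counit =
  fixes K :: "'k ring" and A :: "('k, 'a) module" and \<Omega> :: "('k, 'a, 'w) bimodule"
    and d :: "'a \<Rightarrow> 'w"
    and \<Delta> :: "('k, 'a, 'w) BXt \<Rightarrow> (('k, 'a, 'w) BXt \<times> ('k, 'a, 'w) BXt \<Rightarrow> 'k) set set"
    and \<epsilon> :: "('k, 'a, 'w) BXt \<Rightarrow> 'a"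
  assumes comult_linear: "\<Delta> \<in> linear_maps K (BX K A \<Omega> d) (bsquare K A (BX K A \<Omega> d) (BX_env K A \<Omega> d))"
    and comult_extensional: "\<Delta> \<in> extensional (carrier (BX K A \<Omega> d))"
    and counit_linear: "\<epsilon> \<in> linear_maps K (BX K A \<Omega> d) A"
    and counit_extensional: "\<epsilon> \<in> extensional (carrier (BX K A \<Omega> d))"
    and comult_env:
      "\<lbrakk>a \<in> carrier A; b \<in> carrier A\<rbrakk> \<Longrightarrow>
        \<Delta> (BX_env K A \<Omega> d (env_elem K A a b)) = bpure K A (BX K A \<Omega> d) (BX_env K A \<Omega> d)
          (source K A (BX_env K A \<Omega> d) a) (target K A (BX_env K A \<Omega> d) b)"
    and comult_endo:
      "\<lbrakk>x \<in> carrier (left_dual A \<Omega>); \<omega> \<in> carrier \<Omega>; coev_family \<Omega> A n \<omega>\<^sub>i x\<^sub>i\<rbrakk> \<Longrightarrow>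
        \<Delta> (BX_endo K A \<Omega> d x \<omega>) = bsum K A (BX K A \<Omega> d) (BX_env K A \<Omega> d) n
          (\<lambda>i. BX_endo K A \<Omega> d x (\<omega>\<^sub>i i)) (\<lambda>i. BX_endo K A \<Omega> d (x\<^sub>i i) \<omega>)"
    and comult_field:
      "\<lbrakk>x \<in> carrier (left_dual A \<Omega>); coev_family \<Omega> A n \<omega>\<^sub>i x\<^sub>i\<rbrakk> \<Longrightarrow>
        \<Delta> (BX_field K A \<Omega> d x) =
          bpure K A (BX K A \<Omega> d) (BX_env K A \<Omega> d) (BX_field K A \<Omega> d x) \<one>\<^bsub>BX K A \<Omega> d\<^esub>
          \<oplus>\<^bsub>bsquare K A (BX K A \<Omega> d) (BX_env K A \<Omega> d)\<^esub>
          bsum K A (BX K A \<Omega> d) (BX_env K A \<Omega> d) n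
            (\<lambda>i. BX_endo K A \<Omega> d x (\<omega>\<^sub>i i)) (\<lambda>i. BX_field K A \<Omega> d (x\<^sub>i i))"
    and counit_env:
      "\<lbrakk>a \<in> carrier A; b \<in> carrier A\<rbrakk> \<Longrightarrow>
        \<epsilon> (BX_env K A \<Omega> d (env_elem K A a b)) = a \<otimes>\<^bsub>A\<^esub> b"
    and counit_endo:
      "\<lbrakk>x \<in> carrier (left_dual A \<Omega>); \<omega> \<in> carrier \<Omega>\<rbrakk> \<Longrightarrow> \<epsilon> (BX_endo K A \<Omega> d x \<omega>) = x \<omega>"
    and counit_field:
      "x \<in> carrier (left_dual A \<Omega>) \<Longrightarrow> \<epsilon> (BX_field K A \<Omega> d x) = \<zero>\<^bsub>A\<^esub>"
    and comult_product: "comult_product_rule K A (BX K A \<Omega> d) (BX_env K A \<Omega> d) \<Delta>"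
    and counit_product:
      "\<lbrakk>m \<in> carrier (BX K A \<Omega> d); n' \<in> carrier (BX K A \<Omega> d)\<rbrakk> \<Longrightarrow>
        \<epsilon> (m \<otimes>\<^bsub>BX K A \<Omega> d\<^esub> n') =
        \<epsilon> (m \<otimes>\<^bsub>BX K A \<Omega> d\<^esub> source K A (BX_env K A \<Omega> d) (\<epsilon> n'))"

end

theory Submission
  imports Defs
begin

text \<open>
  A left module over \<open>B\<XX>\<^sup>1\<close> is the same as an \<open>A\<close>-bimodule \<open>N\<close> together with operators \<open>E x \<omega>\<close> and
  \<open>J x\<close> on \<open>N\<close> that satisfy the defining relations. Such modules form a monoidal category: on
  \<open>M \<otimes>\<^sub>A N\<close> one puts \<open>E x \<omega> = \<Sum>\<^sub>i E x \<omega>\<^sub>i \<otimes> E x\<^sub>i \<omega>\<close> and \<open>J x = J x \<otimes> 1 + \<Sum>\<^sub>i E x \<omega>\<^sub>i \<otimes> J x\<^sub>i\<close>, and the unit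
  is \<open>A\<close> with \<open>E x \<omega> c = x(c\<omega>)\<close> and \<open>J x c = x(dc)\<close>. The module \<open>|B\<close> is free on the generator \<open>1\<close>, so there
  are unique homomorphisms \<open>\<Delta>: |B \<rightarrow> |B \<otimes> |B\<close> and \<open>\<epsilon>: |B \<rightarrow> A\<close> with \<open>\<Delta>(1) = 1 \<otimes> 1\<close> and \<open>\<epsilon>(1) = 1\<close>. Every
  axiom of a bialgebroid says that two homomorphisms out of \<open>|B\<close> agree, which needs to be checked at
  \<open>1\<close> only; for the product rule the homomorphisms are \<open>b \<mapsto> \<Delta>(bc)\<close> and right multiplication of \<open>\<Delta>(b)\<close>
  by the components of \<open>\<Delta>(c)\<close>, which is well defined because tensors are balanced by left multiplications.
\<close>

section \<open>Linear maps\<close>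

text \<open>The obstacle is that \<open>|B \<otimes> |B\<close> is not an algebra: the componentwise
  product of \<open>b \<otimes> b'\<close> and \<open>c \<otimes> c'\<close> respects the balancing
  over \<open>A\<close> in its left argument only. So \<Delta> cannot be read off from a
  presentation as an algebra map unless a Takeuchi product is built first. A module asks only for
  operators on a space, and the particular operators \<open>E\<close> and \<open>J\<close> do
  descend to a tensor product over \<open>A\<close>; this replaces the Takeuchi product. Finite
  projectivity enters as a dual basis, that is, as coev(1). Two facts about it carry the
  computations: it does not depend on the choice, and it is central in the \<open>A\<close>-bimodule
  of tensors. Centrality makes \<open>E\<close> well defined. Neither summand of \<open>J\<close>
  descends alone: moving a scalar a across the tensor sign produces a term \<open>E x (d a)\<close>
  in both of them, and these terms match because \<open>d a\<close> can be expanded in the dual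
  basis. Uniqueness of \<Delta> and \<epsilon> is a separate matter. A competing pair is assumed to
  obey the product rules and to have the right values on generators, not to consist of
  homomorphisms; it is compared by induction along left multiplication by generators.\<close>

lemma linear_mapsI:
  assumes "\<And>x. x \<in> carrier M \<Longrightarrow> f x \<in> carrier N"
    and "\<And>x y. \<lbrakk>x \<in> carrier M; y \<in> carrier M\<rbrakk> \<Longrightarrow> f (x \<oplus>\<^bsub>M\<^esub> y) = f x \<oplus>\<^bsub>N\<^esub> f y"
    and "\<And>k x. \<lbrakk>k \<in> carrier K; x \<in> carrier M\<rbrakk> \<Longrightarrow> f (k \<odot>\<^bsub>M\<^esub> x) = k \<odot>\<^bsub>N\<^esub> f x"
  shows "f \<in> linear_maps K M N"
  using assms by (auto simp: linear_maps_def)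

lemma
  assumes "f \<in> linear_maps K M N"
  shows lin_closed: "x \<in> carrier M \<Longrightarrow> f x \<in> carrier N"
    and lin_add: "\<lbrakk>x \<in> carrier M; y \<in> carrier M\<rbrakk> \<Longrightarrow> f (x \<oplus>\<^bsub>M\<^esub> y) = f x \<oplus>\<^bsub>N\<^esub> f y"
    and lin_smult: "\<lbrakk>k \<in> carrier K; x \<in> carrier M\<rbrakk> \<Longrightarrow> f (k \<odot>\<^bsub>M\<^esub> x) = k \<odot>\<^bsub>N\<^esub> f x"
  using assms by (auto simp: linear_maps_def)

lemma lin_zero:
  assumes "f \<in> linear_maps K M N" "module K M" "module K N"
  shows "f \<zero>\<^bsub>M\<^esub> = \<zero>\<^bsub>N\<^esub>"
proof -
  interpret M: module K M by fact
  interpret N: module K N by fact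
  show ?thesis
    using lin_smult[OF assms(1), of "\<zero>\<^bsub>K\<^esub>" "\<zero>\<^bsub>M\<^esub>"] lin_closed[OF assms(1), of "\<zero>\<^bsub>M\<^esub>"] by simp
qed

lemma (in module) smult_neg_one:
  "x \<in> carrier M \<Longrightarrow> (\<ominus>\<^bsub>R\<^esub> \<one>\<^bsub>R\<^esub>) \<odot>\<^bsub>M\<^esub> x = \<ominus>\<^bsub>M\<^esub> x"
  by (simp add: smult_l_minus)

lemma (in abelian_group) diff_eq_zero_iff:
  assumes "x \<in> carrier G" "y \<in> carrier G"
  shows "x \<ominus> y = \<zero> \<longleftrightarrow> x = y"
proof
  assume "x \<ominus> y = \<zero>"
  then have "(x \<ominus> y) \<oplus> y = y" using assms by simp
  then show "x = y" using assms by (simp add: a_minus_def a_assoc l_neg)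
qed (use assms in \<open>simp add: a_minus_def r_neg\<close>)

lemma lin_minus:
  assumes "f \<in> linear_maps K M N" "module K M" "module K N" "x \<in> carrier M"
  shows "f (\<ominus>\<^bsub>M\<^esub> x) = \<ominus>\<^bsub>N\<^esub> f x"
proof -
  interpret M: module K M by fact
  interpret N: module K N by fact
  show ?thesis
    using lin_smult[OF assms(1), of "\<ominus>\<^bsub>K\<^esub> \<one>\<^bsub>K\<^esub>" x] lin_closed[OF assms(1,4)] assms(4)
    by (simp add: M.smult_neg_one N.smult_neg_one)
qed

lemma lin_diff:
  assumes "f \<in> linear_maps K M N" "module K M" "module K N" "x \<in> carrier M" "y \<in> carrier M"
  shows "f (x \<ominus>\<^bsub>M\<^esub> y) = f x \<ominus>\<^bsub>N\<^esub> f y"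
proof -
  interpret M: module K M by fact
  interpret N: module K N by fact
  show ?thesis using assms by (simp add: a_minus_def lin_add[OF assms(1)] lin_minus)
qed

lemma lin_finsum:
  assumes "f \<in> linear_maps K M N" "module K M" "module K N" "g \<in> S \<rightarrow> carrier M"
  shows "f (finsum M g S) = finsum N (\<lambda>i. f (g i)) S"
proof -
  interpret M: module K M by fact
  interpret N: module K N by fact
  from assms(4) show ?thesis
  proof (induction S rule: infinite_finite_induct)
    case (insert a S)
    then have "finsum M g (insert a S) = g a \<oplus>\<^bsub>M\<^esub> finsum M g S" by (intro M.finsum_insert) auto
    moreover have "finsum N (\<lambda>i. f (g i)) (insert a S) = f (g a) \<oplus>\<^bsub>N\<^esub> finsum N (\<lambda>i. f (g i)) S"
      using insert by (intro N.finsum_insert) (auto intro!: lin_closed[OF assms(1)])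
    moreover have "finsum M g S \<in> carrier M" "g a \<in> carrier M" using insert by auto
    ultimately show ?case using insert by (simp add: lin_add[OF assms(1)])
  qed (auto simp: lin_zero[OF assms(1-3)])
qed

lemma lin_compose:
  assumes "f \<in> linear_maps K M N" "g \<in> linear_maps K N P"
  shows "(\<lambda>x. g (f x)) \<in> linear_maps K M P"
  using assms by (auto simp: linear_maps_def Pi_iff)

lemma lin_id: "(\<lambda>x. x) \<in> linear_maps K M M"
  by (auto simp: linear_maps_def)

lemma lin_cong:
  assumes "module K M" "\<And>x. x \<in> carrier M \<Longrightarrow> g x = f x" "f \<in> linear_maps K M N"
  shows "g \<in> linear_maps K M N"
proof -
  interpret M: module K M by fact
  show ?thesis using assms(2,3) by (auto simp: linear_maps_def)
qed

lemma lin_restrict: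
  assumes "f \<in> linear_maps K M N" "module K M"
  shows "restrict f (carrier M) \<in> linear_maps K M N"
  by (rule lin_cong[OF assms(2) _ assms(1)]) simp

lemma lin_plus:
  assumes f: "f \<in> linear_maps K M N" and g: "g \<in> linear_maps K M N" and N: "module K N"
  shows "(\<lambda>x. f x \<oplus>\<^bsub>N\<^esub> g x) \<in> linear_maps K M N"
proof -
  interpret N: module K N by fact
  note * = lin_closed[OF f] lin_closed[OF g] lin_add[OF f] lin_add[OF g] lin_smult[OF f] lin_smult[OF g]
  show ?thesis by (rule linear_mapsI) (simp_all add: * N.smult_r_distr N.add.m_ac)
qed

lemma lin_scale:
  assumes f: "f \<in> linear_maps K M N" and N: "module K N" and k: "k \<in> carrier K"
  shows "(\<lambda>x. k \<odot>\<^bsub>N\<^esub> f x) \<in> linear_maps K M N"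
proof -
  interpret N: module K N by fact
  note * = lin_closed[OF f] lin_add[OF f] lin_smult[OF f]
  show ?thesis using k
    by (intro linear_mapsI)
      (simp_all add: * N.smult_r_distr N.smult_assoc1[symmetric] N.R.m_comm)
qed

lemma lin_const_zero:
  assumes "module K N"
  shows "(\<lambda>x. \<zero>\<^bsub>N\<^esub>) \<in> linear_maps K M N"
proof -
  interpret N: module K N by fact
  show ?thesis by (rule linear_mapsI) auto
qed

lemma lin_sum:
  assumes f: "\<And>i. i \<in> S \<Longrightarrow> f i \<in> linear_maps K M N" and M: "module K M" and N: "module K N"
  shows "(\<lambda>x. finsum N (\<lambda>i. f i x) S) \<in> linear_maps K M N"
proof -
  interpret N: module K N by fact
  show ?thesis using f
  proof (induction S rule: infinite_finite_induct)
    case (insert a S)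
    have "(\<lambda>x. f a x \<oplus>\<^bsub>N\<^esub> finsum N (\<lambda>i. f i x) S) \<in> linear_maps K M N"
      using insert by (intro lin_plus[OF _ _ N]) auto
    moreover have "finsum N (\<lambda>i. f i x) (insert a S) = f a x \<oplus>\<^bsub>N\<^esub> finsum N (\<lambda>i. f i x) S"
      if "x \<in> carrier M" for x
      using insert that by (intro N.finsum_insert) (auto intro: lin_closed)
    ultimately show ?case by (rule lin_cong[OF M, rotated])
  qed (auto intro: lin_const_zero[OF N])
qed

section \<open>Quotients\<close>

text \<open>Negation is multiplication by -1, so closure under scalars already covers it.\<close>

lemma submoduleI':
  assumes "module K M" "H \<subseteq> carrier M" "\<zero>\<^bsub>M\<^esub> \<in> H"
    and add: "\<And>a b. \<lbrakk>a \<in> H; b \<in> H\<rbrakk> \<Longrightarrow> a \<oplus>\<^bsub>M\<^esub> b \<in> H"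
    and smult: "\<And>k x. \<lbrakk>k \<in> carrier K; x \<in> H\<rbrakk> \<Longrightarrow> k \<odot>\<^bsub>M\<^esub> x \<in> H"
  shows "submodule H K M"
proof -
  interpret M: module K M by fact
  show ?thesis
  proof (rule M.submoduleI)
    fix a assume "a \<in> H"
    then show "\<ominus>\<^bsub>M\<^esub> a \<in> H" using smult[of "\<ominus>\<^bsub>K\<^esub> \<one>\<^bsub>K\<^esub>" a] assms(2) by (auto simp: M.smult_neg_one)
  qed (use assms in auto)
qed

locale quotient_module = M: module K M
  for K :: "'k ring" and M :: "('k, 'm, 'p) module_scheme" and I +
  assumes I_submodule: "submodule I K M"
begin

sublocale I: abelian_subgroup I M
  using I_submodule by (intro abelian_subgroupI3 additive_subgroup.intro)
      (auto simp: submodule_def M.abelian_group_axioms)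

abbreviation "cls \<equiv> a_r_coset M I"

lemma cls_eq_iff:
  assumes "x \<in> carrier M" "y \<in> carrier M"
  shows "cls x = cls y \<longleftrightarrow> x \<ominus>\<^bsub>M\<^esub> y \<in> I"
proof -
  have "cls x = cls y \<longleftrightarrow> x \<in> cls y"
    using I.a_repr_independence'[of x y] I.a_rcos_self[of x] assms by auto
  also have "\<dots> \<longleftrightarrow> x \<ominus>\<^bsub>M\<^esub> y \<in> I"
    using I.a_rcos_module[of y x] assms by (simp add: a_minus_def)
  finally show ?thesis .
qed

text \<open>The scalar multiplication of \<open>quotient\<close> is a union over all representatives
  of a coset. Two representatives differ by an element of \<open>I\<close>, and so do their
  multiples; all members of the union are therefore one and the same coset.\<close>

lemma cls_smult:
  assumes k: "k \<in> carrier K" and x: "x \<in> carrier M"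
  shows "(\<Union>c\<in>cls x. cls (k \<odot>\<^bsub>M\<^esub> c)) = cls (k \<odot>\<^bsub>M\<^esub> x)"
proof -
  have "cls (k \<odot>\<^bsub>M\<^esub> c) = cls (k \<odot>\<^bsub>M\<^esub> x)" if c: "c \<in> cls x" for c
  proof -
    have cM: "c \<in> carrier M" by (rule I.a_elemrcos_carrier[OF x c])
    then have "c \<ominus>\<^bsub>M\<^esub> x \<in> I" using cls_eq_iff[OF _ x, of c] I.a_repr_independence'[OF c x] by simp
    then have "k \<odot>\<^bsub>M\<^esub> (c \<ominus>\<^bsub>M\<^esub> x) \<in> I" using k I_submodule by (simp add: submodule.smult_closed)
    also have "k \<odot>\<^bsub>M\<^esub> (c \<ominus>\<^bsub>M\<^esub> x) = k \<odot>\<^bsub>M\<^esub> c \<ominus>\<^bsub>M\<^esub> k \<odot>\<^bsub>M\<^esub> x"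
      using k x cM by (simp add: a_minus_def M.smult_r_distr M.smult_r_minus)
    finally show ?thesis using k x cM by (simp add: cls_eq_iff)
  qed
  then have "(\<Union>c\<in>cls x. cls (k \<odot>\<^bsub>M\<^esub> c)) = (\<Union>c\<in>cls x. cls (k \<odot>\<^bsub>M\<^esub> x))"
    by (intro SUP_cong) auto
  also have "\<dots> = cls (k \<odot>\<^bsub>M\<^esub> x)"
    using I.a_rcos_self[OF x] by (simp add: UN_constant) blast
  finally show ?thesis .
qed

lemma carrier_quotient: "carrier (quotient M I) = cls ` carrier M"
  by (auto simp: quotient_def A_RCOSETS_def')

lemma zero_quotient: "\<zero>\<^bsub>quotient M I\<^esub> = cls \<zero>\<^bsub>M\<^esub>"
  using I.a_subset by (simp add: quotient_def M.a_coset_add_zero)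

lemma add_quotient: "\<lbrakk>x \<in> carrier M; y \<in> carrier M\<rbrakk> \<Longrightarrow> cls x \<oplus>\<^bsub>quotient M I\<^esub> cls y = cls (x \<oplus>\<^bsub>M\<^esub> y)"
  by (simp add: quotient_def I.a_rcos_sum)

lemma smult_quotient: "\<lbrakk>k \<in> carrier K; x \<in> carrier M\<rbrakk> \<Longrightarrow> k \<odot>\<^bsub>quotient M I\<^esub> cls x = cls (k \<odot>\<^bsub>M\<^esub> x)"
  by (simp add: quotient_def cls_smult)

lemmas quotient_simps = carrier_quotient zero_quotient add_quotient smult_quotient

lemma module_quotient: "module K (quotient M I)"
proof (rule moduleI)
  show "abelian_group (quotient M I)"
  proof (rule abelian_groupI)
    fix C assume "C \<in> carrier (quotient M I)"
    then obtain x where x: "x \<in> carrier M" "C = cls x" by (auto simp: quotient_simps)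
    then show "\<exists>D\<in>carrier (quotient M I). D \<oplus>\<^bsub>quotient M I\<^esub> C = \<zero>\<^bsub>quotient M I\<^esub>"
      by (intro bexI[of _ "cls (\<ominus>\<^bsub>M\<^esub> x)"]) (simp_all add: quotient_simps M.l_neg)
  qed (auto simp: quotient_simps M.add.m_ac)
qed (auto simp: quotient_simps M.smult_l_distr M.smult_r_distr M.smult_assoc1 M.R.is_cring)

lemma cls_linear: "cls \<in> linear_maps K M (quotient M I)"
  by (rule linear_mapsI) (auto simp: quotient_simps)

lemma quotient_lift:
  assumes f: "f \<in> linear_maps K M P" and P: "module K P" and "\<And>x. x \<in> I \<Longrightarrow> f x = \<zero>\<^bsub>P\<^esub>"
  shows "\<exists>h\<in>linear_maps K (quotient M I) P. \<forall>x\<in>carrier M. h (cls x) = f x"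
proof -
  interpret P: module K P by fact
  \<comment> \<open>The chosen representative does not matter: two of them differ by an element of
    \<open>I\<close>, on which \<open>f\<close> vanishes.\<close>
  define h where "h C = f (SOME x. x \<in> carrier M \<and> C = cls x)" for C
  have h: "h (cls x) = f x" if x: "x \<in> carrier M" for x
  proof -
    define y where "y = (SOME y. y \<in> carrier M \<and> cls x = cls y)"
    have y: "y \<in> carrier M \<and> cls x = cls y"
      unfolding y_def by (rule someI[of _ x]) (use x in auto)
    then have "x \<ominus>\<^bsub>M\<^esub> y \<in> I" using x cls_eq_iff by auto
    then have "f x \<ominus>\<^bsub>P\<^esub> f y = \<zero>\<^bsub>P\<^esub>"
      using assms(3) lin_diff[OF f M.module_axioms P, of x y] x y by auto
    then have "f x = f y" using x y lin_closed[OF f] P.diff_eq_zero_iff by simp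
    then show ?thesis by (simp add: h_def y_def)
  qed
  moreover have "h \<in> linear_maps K (quotient M I) P"
    by (rule linear_mapsI)
      (auto simp: quotient_simps h lin_closed[OF f] lin_add[OF f] lin_smult[OF f])
  ultimately show ?thesis by auto
qed

end

lemma generated_submodule:
  assumes "module K M" "S \<subseteq> carrier M"
  shows generated_submodule_submodule: "submodule (generated_submodule K M S) K M"
    and generated_submodule_incl: "S \<subseteq> generated_submodule K M S"
proof -
  interpret M: module K M by fact
  \<comment> \<open>The intersection that defines the generated submodule is over a nonempty family,
    hence lies in the carrier.\<close>
  have c: "carrier M \<in> {N. submodule N K M \<and> S \<subseteq> N}"
    using assms M.carrier_is_submodule by auto
  have z: "\<zero>\<^bsub>M\<^esub> \<in> N" if "submodule N K M" for N
    using that by (metis partial_object.simps(3) monoid.simps(2) submodule.axioms(1) subgroup.one_closed)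
  show "submodule (generated_submodule K M S) K M"
  proof (rule submoduleI'[OF assms(1)])
    show "generated_submodule K M S \<subseteq> carrier M" using c by (auto simp: generated_submodule_def)
  qed (use z M.submoduleE in \<open>auto simp: generated_submodule_def\<close>)
  show "S \<subseteq> generated_submodule K M S" by (auto simp: generated_submodule_def)
qed

text \<open>The kernel of a linear map is a submodule; once it contains \<open>S\<close> it contains
  everything that \<open>S\<close> generates.\<close>

lemma vanish_on_generated:
  assumes M: "module K M" and P: "module K P" and S: "S \<subseteq> carrier M" and f: "f \<in> linear_maps K M P"
    and 0: "\<And>x. x \<in> S \<Longrightarrow> f x = \<zero>\<^bsub>P\<^esub>"
    and x: "x \<in> generated_submodule K M S"
  shows "f x = \<zero>\<^bsub>P\<^esub>"
proof -
  interpret M: module K M by fact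
  interpret P: module K P by fact
  have "submodule {x \<in> carrier M. f x = \<zero>\<^bsub>P\<^esub>} K M"
    by (rule submoduleI'[OF M])
      (auto simp: lin_zero[OF f M P] lin_add[OF f] lin_smult[OF f])
  with x S 0 show ?thesis by (auto simp: generated_submodule_def)
qed

section \<open>Free vector spaces\<close>

lemma
  assumes "cring K"
  shows module_free_space: "module K (free_space K S)"
    and basis_vector_in_free_space: "s \<in> S \<Longrightarrow> basis_vector K s \<in> carrier (free_space K S)"
proof -
  interpret K: cring K by fact
  have fin: "finite {s. f s \<oplus>\<^bsub>K\<^esub> g s \<noteq> \<zero>\<^bsub>K\<^esub>}" "{s. f s \<oplus>\<^bsub>K\<^esub> g s \<noteq> \<zero>\<^bsub>K\<^esub>} \<subseteq> S"
    if "finite {s. f s \<noteq> \<zero>\<^bsub>K\<^esub>}" "finite {s. g s \<noteq> \<zero>\<^bsub>K\<^esub>}"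
      "{s. f s \<noteq> \<zero>\<^bsub>K\<^esub>} \<subseteq> S" "{s. g s \<noteq> \<zero>\<^bsub>K\<^esub>} \<subseteq> S" for f g :: "'b \<Rightarrow> 'a"
  proof -
    have "{s. f s \<oplus>\<^bsub>K\<^esub> g s \<noteq> \<zero>\<^bsub>K\<^esub>} \<subseteq> {s. f s \<noteq> \<zero>\<^bsub>K\<^esub>} \<union> {s. g s \<noteq> \<zero>\<^bsub>K\<^esub>}" by auto
    with that show "finite {s. f s \<oplus>\<^bsub>K\<^esub> g s \<noteq> \<zero>\<^bsub>K\<^esub>}" "{s. f s \<oplus>\<^bsub>K\<^esub> g s \<noteq> \<zero>\<^bsub>K\<^esub>} \<subseteq> S"
      by (auto intro: finite_subset)
  qed
  have fin2: "finite {s. k \<otimes>\<^bsub>K\<^esub> f s \<noteq> \<zero>\<^bsub>K\<^esub>}" "{s. k \<otimes>\<^bsub>K\<^esub> f s \<noteq> \<zero>\<^bsub>K\<^esub>} \<subseteq> S"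
    if "finite {s. f s \<noteq> \<zero>\<^bsub>K\<^esub>}" "{s. f s \<noteq> \<zero>\<^bsub>K\<^esub>} \<subseteq> S" "k \<in> carrier K" for f :: "'b \<Rightarrow> 'a" and k
  proof -
    have "{s. k \<otimes>\<^bsub>K\<^esub> f s \<noteq> \<zero>\<^bsub>K\<^esub>} \<subseteq> {s. f s \<noteq> \<zero>\<^bsub>K\<^esub>}" using that by auto
    with that show "finite {s. k \<otimes>\<^bsub>K\<^esub> f s \<noteq> \<zero>\<^bsub>K\<^esub>}" "{s. k \<otimes>\<^bsub>K\<^esub> f s \<noteq> \<zero>\<^bsub>K\<^esub>} \<subseteq> S"
      by (auto intro: finite_subset)
  qed
  show "module K (free_space K S)"
  proof (rule moduleI)
    show "abelian_group (free_space K S)"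
    proof (rule abelian_groupI)
      fix f assume "f \<in> carrier (free_space K S)"
      then show "\<exists>g\<in>carrier (free_space K S). g \<oplus>\<^bsub>free_space K S\<^esub> f = \<zero>\<^bsub>free_space K S\<^esub>"
        by (intro bexI[of _ "\<lambda>s. \<ominus>\<^bsub>K\<^esub> f s"]) (auto simp: free_space_def K.l_neg K.minus_equality)
    qed (auto simp: free_space_def K.add.m_ac fin)
  qed (auto simp: free_space_def K.cring_axioms K.l_distr K.r_distr K.m_assoc fin2)
  have "{t. basis_vector K s t \<noteq> \<zero>\<^bsub>K\<^esub>} \<subseteq> {s}" by (auto simp: basis_vector_def)
  then show "s \<in> S \<Longrightarrow> basis_vector K s \<in> carrier (free_space K S)"
    using finite_subset by (auto simp: free_space_def) (auto simp: basis_vector_def)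
qed

lemma free_space_mem: "f \<in> carrier (free_space K S) \<Longrightarrow> f s \<in> carrier K"
  by (auto simp: free_space_def)

text \<open>Induction on a finite set containing the support. One step splits off the coordinate at
  \<open>t\<close>, writing f as a function that vanishes there plus \<open>f t\<close> times a
  basis vector.\<close>

lemma free_space_induct [consumes 2, case_names zero basis add smult]:
  assumes K: "cring K" and f: "f \<in> carrier (free_space K S)"
    and zero: "P \<zero>\<^bsub>free_space K S\<^esub>" and basis: "\<And>s. s \<in> S \<Longrightarrow> P (basis_vector K s)"
    and add: "\<And>f g. \<lbrakk>f \<in> carrier (free_space K S); g \<in> carrier (free_space K S); P f; P g\<rbrakk> \<Longrightarrow>
      P (f \<oplus>\<^bsub>free_space K S\<^esub> g)"
    and smult: "\<And>k f. \<lbrakk>k \<in> carrier K; f \<in> carrier (free_space K S); P f\<rbrakk> \<Longrightarrow>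
      P (k \<odot>\<^bsub>free_space K S\<^esub> f)"
  shows "P f"
proof -
  interpret K: cring K by fact
  interpret F: module K "free_space K S" by (rule module_free_space[OF K])
  have "\<forall>f\<in>carrier (free_space K S). {s. f s \<noteq> \<zero>\<^bsub>K\<^esub>} \<subseteq> T \<longrightarrow> P f" if "finite T" for T
    using that
  proof (induction T)
    case empty
    have "f = \<zero>\<^bsub>free_space K S\<^esub>" if "{s. f s \<noteq> \<zero>\<^bsub>K\<^esub>} \<subseteq> {}" for f :: "'b \<Rightarrow> 'a"
      using that by (auto simp: free_space_def)
    then show ?case using zero by blast
  next
    case (insert t T)
    show ?case
    proof (intro ballI impI)
      fix f assume f: "f \<in> carrier (free_space K S)" "{s. f s \<noteq> \<zero>\<^bsub>K\<^esub>} \<subseteq> insert t T"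
      show "P f"
      proof (cases "f t = \<zero>\<^bsub>K\<^esub>")
        case True
        then have "{s. f s \<noteq> \<zero>\<^bsub>K\<^esub>} \<subseteq> T" using f by auto
        then show ?thesis using f insert by blast
      next
        case False
        define g where "g = f(t := \<zero>\<^bsub>K\<^esub>)"
        have tS: "t \<in> S" using False f by (auto simp: free_space_def)
        have "{s. g s \<noteq> \<zero>\<^bsub>K\<^esub>} \<subseteq> {s. f s \<noteq> \<zero>\<^bsub>K\<^esub>}" by (auto simp: g_def)
        then have g: "g \<in> carrier (free_space K S)"
          using f(1) by (auto simp: free_space_def intro: finite_subset) (simp add: g_def)
        have "{s. g s \<noteq> \<zero>\<^bsub>K\<^esub>} \<subseteq> T" using f by (auto simp: g_def)
        then have "P g" using g insert by blast
        have ft: "f s \<in> carrier K" for s using f by (simp add: free_space_mem)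
        have "f = g \<oplus>\<^bsub>free_space K S\<^esub> (f t \<odot>\<^bsub>free_space K S\<^esub> basis_vector K t)"
          using ft by (auto simp: free_space_def g_def basis_vector_def)
        moreover have "basis_vector K t \<in> carrier (free_space K S)"
          using tS by (rule basis_vector_in_free_space[OF K])
        ultimately show ?thesis
          using g \<open>P g\<close> ft[of t] tS by (metis F.smult_closed add basis smult)
      qed
    qed
  qed
  then show ?thesis using f by (auto simp: free_space_def)
qed

lemma free_space_lift:
  assumes K: "cring K" and P: "module K P" and f: "\<And>s. s \<in> S \<Longrightarrow> f s \<in> carrier P"
  shows "\<exists>h\<in>linear_maps K (free_space K S) P. \<forall>s\<in>S. h (basis_vector K s) = f s"
proof -
  interpret K: cring K by fact
  interpret P: module K P by fact
  interpret F: module K "free_space K S" by (rule module_free_space[OF K])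
  define h where "h g = finsum P (\<lambda>s. g s \<odot>\<^bsub>P\<^esub> f s) {s. g s \<noteq> \<zero>\<^bsub>K\<^esub>}" for g
  \<comment> \<open>Enlarging the support to any finite \<open>T\<close> changes nothing. This is
    what allows two functions to be summed over a common index set.\<close>
  have h: "h g = finsum P (\<lambda>s. g s \<odot>\<^bsub>P\<^esub> f s) T"
    if "finite T" "{s. g s \<noteq> \<zero>\<^bsub>K\<^esub>} \<subseteq> T" "T \<subseteq> S" "g \<in> carrier (free_space K S)" for g T
    unfolding h_def using that f
    by (intro P.add.finprod_mono_neutral_cong_left) (auto simp: free_space_mem subset_iff)
  have "h \<in> linear_maps K (free_space K S) P"
  proof (rule linear_mapsI)
    fix g assume "g \<in> carrier (free_space K S)"
    then show "h g \<in> carrier P" unfolding h_def using f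
      by (intro P.finsum_closed) (auto simp: free_space_def subset_iff)
  next
    fix g g' assume g: "g \<in> carrier (free_space K S)" "g' \<in> carrier (free_space K S)"
    define T where "T = {s. g s \<noteq> \<zero>\<^bsub>K\<^esub>} \<union> {s. g' s \<noteq> \<zero>\<^bsub>K\<^esub>}"
    have T: "finite T" "T \<subseteq> S" using g by (auto simp: T_def free_space_def)
    have "h (g \<oplus>\<^bsub>free_space K S\<^esub> g') = finsum P (\<lambda>s. (g s \<oplus>\<^bsub>K\<^esub> g' s) \<odot>\<^bsub>P\<^esub> f s) T"
      using g T F.add.m_closed[OF g] by (subst h[of T]) (auto simp: T_def free_space_def)
    also have "\<dots> = finsum P (\<lambda>s. g s \<odot>\<^bsub>P\<^esub> f s \<oplus>\<^bsub>P\<^esub> g' s \<odot>\<^bsub>P\<^esub> f s) T"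
      using g T f by (intro P.finsum_cong') (auto simp: free_space_mem P.smult_l_distr subset_iff)
    also have "\<dots> = h g \<oplus>\<^bsub>P\<^esub> h g'"
      using g T f by (subst P.finsum_addf) (auto simp: h[of T] T_def free_space_mem subset_iff)
    finally show "h (g \<oplus>\<^bsub>free_space K S\<^esub> g') = h g \<oplus>\<^bsub>P\<^esub> h g'" .
  next
    fix k g assume g: "k \<in> carrier K" "g \<in> carrier (free_space K S)"
    define T where "T = {s. g s \<noteq> \<zero>\<^bsub>K\<^esub>}"
    have T: "finite T" "T \<subseteq> S" using g by (auto simp: T_def free_space_def)
    have "h (k \<odot>\<^bsub>free_space K S\<^esub> g) = finsum P (\<lambda>s. (k \<otimes>\<^bsub>K\<^esub> g s) \<odot>\<^bsub>P\<^esub> f s) T"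
      using g T F.smult_closed[OF g] by (subst h[of T]) (auto simp: T_def free_space_def)
    also have "\<dots> = finsum P (\<lambda>s. k \<odot>\<^bsub>P\<^esub> (g s \<odot>\<^bsub>P\<^esub> f s)) T"
      using g T f by (intro P.finsum_cong') (auto simp: free_space_mem P.smult_assoc1 subset_iff)
    also have "\<dots> = k \<odot>\<^bsub>P\<^esub> h g"
      using g T f by (subst P.finsum_smult_ldistr[symmetric]) (auto simp: h[of T] T_def free_space_mem subset_iff)
    finally show "h (k \<odot>\<^bsub>free_space K S\<^esub> g) = k \<odot>\<^bsub>P\<^esub> h g" .
  qed
  moreover have "h (basis_vector K s) = f s" if s: "s \<in> S" for s
    using s f basis_vector_in_free_space[OF K s]
    by (subst h[of "{s}"]) (auto simp: basis_vector_def)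
  ultimately show ?thesis by blast
qed

lemma basis_vector_free_space_ext:
  assumes K: "cring K" and P: "module K P"
    and f: "f \<in> linear_maps K (free_space K S) P" and g: "g \<in> linear_maps K (free_space K S) P"
    and "\<And>s. s \<in> S \<Longrightarrow> f (basis_vector K s) = g (basis_vector K s)"
    and x: "x \<in> carrier (free_space K S)"
  shows "f x = g x"
  using K x
proof (induction rule: free_space_induct)
  case zero
  then show ?case by (simp add: lin_zero[OF f] lin_zero[OF g] module_free_space K P)
qed (simp_all add: lin_add[OF f] lin_add[OF g] lin_smult[OF f] lin_smult[OF g] assms(5))

section \<open>Tensor products over the ground field\<close>

definition bilinear_maps :: "'k ring \<Rightarrow> ('k, 'm, 'p) module_scheme \<Rightarrow> ('k, 'n, 'q) module_scheme \<Rightarrow>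
    ('k, 'r, 's) module_scheme \<Rightarrow> ('m \<Rightarrow> 'n \<Rightarrow> 'r) set" where
  "bilinear_maps K M N P = {f. (\<forall>n\<in>carrier N. (\<lambda>m. f m n) \<in> linear_maps K M P) \<and>
     (\<forall>m\<in>carrier M. f m \<in> linear_maps K N P)}"

lemma bilinear_mapsI:
  assumes "\<And>n. n \<in> carrier N \<Longrightarrow> (\<lambda>m. f m n) \<in> linear_maps K M P"
    and "\<And>m. m \<in> carrier M \<Longrightarrow> (\<lambda>n. f m n) \<in> linear_maps K N P"
  shows "f \<in> bilinear_maps K M N P"
  using assms by (simp add: bilinear_maps_def)

lemma
  assumes "f \<in> bilinear_maps K M N P"
  shows bilin_left: "n \<in> carrier N \<Longrightarrow> (\<lambda>m. f m n) \<in> linear_maps K M P"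
    and bilin_right: "m \<in> carrier M \<Longrightarrow> f m \<in> linear_maps K N P"
  using assms by (simp_all add: bilinear_maps_def)

lemma bilin_closed: "\<lbrakk>f \<in> bilinear_maps K M N P; m \<in> carrier M; n \<in> carrier N\<rbrakk> \<Longrightarrow> f m n \<in> carrier P"
  by (rule lin_closed[OF bilin_right])

lemma bilin_compose:
  assumes f: "f \<in> bilinear_maps K M N P" and g: "g \<in> linear_maps K M' M" and h: "h \<in> linear_maps K N' N"
  shows "(\<lambda>m n. f (g m) (h n)) \<in> bilinear_maps K M' N' P"
  by (intro bilinear_mapsI lin_compose[OF g bilin_left[OF f]] lin_compose[OF h bilin_right[OF f]]
    lin_closed[OF g] lin_closed[OF h])

lemma bilin_compose_lin:
  assumes f: "f \<in> bilinear_maps K M N P" and g: "g \<in> linear_maps K P P'"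
  shows "(\<lambda>m n. g (f m n)) \<in> bilinear_maps K M N P'"
  by (intro bilinear_mapsI lin_compose[OF _ g] bilin_left[OF f] bilin_right[OF f])

lemma bilin_plus:
  assumes "f \<in> bilinear_maps K M N P" "g \<in> bilinear_maps K M N P" "module K P"
  shows "(\<lambda>m n. f m n \<oplus>\<^bsub>P\<^esub> g m n) \<in> bilinear_maps K M N P"
  using assms by (auto simp: bilinear_maps_def intro: lin_plus)

lemma bilin_sum:
  assumes "\<And>i. i \<in> S \<Longrightarrow> f i \<in> bilinear_maps K M N P" "module K M" "module K N" "module K P"
  shows "(\<lambda>m n. finsum P (\<lambda>i. f i m n) S) \<in> bilinear_maps K M N P"
  using assms by (auto simp: bilinear_maps_def intro!: lin_sum)

lemma linear_relations_closed:
  assumes "module K F" "module K M" "\<And>x. x \<in> carrier M \<Longrightarrow> j x \<in> carrier F"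
  shows "linear_relations K F M j \<subseteq> carrier F"
proof -
  interpret F: module K F by fact
  interpret M: module K M by fact
  show ?thesis using assms(3) by (auto simp: linear_relations_def)
qed

text \<open>Applied to a relation such as
  \<open>j (x \<oplus> y) \<ominus> (j x \<oplus> j y)\<close>, the map \<open>h\<close> yields the
  additivity defect of \<open>f\<close>, which is zero. So a map on free generators survives the
  quotient as soon as its composite with \<open>j\<close> is linear.\<close>

lemma linear_relations_vanish:
  assumes F: "module K F" and M: "module K M" and P: "module K P"
    and j: "\<And>x. x \<in> carrier M \<Longrightarrow> j x \<in> carrier F"
    and h: "h \<in> linear_maps K F P" and hj: "\<And>x. x \<in> carrier M \<Longrightarrow> h (j x) = f x"
    and f: "f \<in> linear_maps K M P"
    and x: "x \<in> linear_relations K F M j"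
  shows "h x = \<zero>\<^bsub>P\<^esub>"
proof -
  interpret F: module K F by fact
  interpret M: module K M by fact
  interpret P: module K P by fact
  show ?thesis using x
    by (auto simp: linear_relations_def lin_diff[OF h F P] j lin_add[OF h] lin_smult[OF h] hj
      lin_add[OF f] lin_smult[OF f] lin_closed[OF f] P.diff_eq_zero_iff)
qed

section \<open>The tensor product over the ground field and its universal property\<close>

context
  fixes K :: "'k ring" and M :: "('k, 'm, 'p) module_scheme" and N :: "('k, 'n, 'q) module_scheme"
  assumes M: "module K M" and N: "module K N"
begin

interpretation M: module K M by (rule M)
interpretation N: module K N by (rule N)

private abbreviation "pair_space \<equiv> free_space K (carrier M \<times> carrier N)"

interpretation F: module K pair_space by (rule module_free_space) (rule M.R.is_cring)

private lemma basis: "\<lbrakk>m \<in> carrier M; n \<in> carrier N\<rbrakk> \<Longrightarrow> basis_vector K (m, n) \<in> carrier pair_space"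
  by (rule basis_vector_in_free_space) (auto intro: M.R.is_cring)

private lemma relations_closed: "bilinear_relations K M N \<subseteq> carrier pair_space"
proof -
  have "linear_relations K pair_space M (\<lambda>m. basis_vector K (m, n)) \<subseteq> carrier pair_space" if "n \<in> carrier N" for n
    by (rule linear_relations_closed) (use that M basis F.module_axioms in auto)
  moreover have "linear_relations K pair_space N (\<lambda>n. basis_vector K (m, n)) \<subseteq> carrier pair_space" if "m \<in> carrier M" for m
    by (rule linear_relations_closed) (use that N basis F.module_axioms in auto)
  ultimately show ?thesis by (auto simp: bilinear_relations_def Let_def)
qed

interpretation Q: quotient_module K pair_space "tensor_kernel K M N"
  unfolding tensor_kernel_def
  by (intro quotient_module.intro quotient_module_axioms.intro F.module_axioms
    generated_submodule_submodule relations_closed)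

private lemma pure_eq: "pure_tensor K M N m n = Q.cls (basis_vector K (m, n))"
  by (simp add: pure_tensor_def)

private lemma tens: "tensor K M N = quotient pair_space (tensor_kernel K M N)"
  by (simp add: tensor_def)

lemma module_tensor: "module K (tensor K M N)"
  unfolding tens by (rule Q.module_quotient)

private lemma clsD: "\<lbrakk>x \<ominus>\<^bsub>pair_space\<^esub> y \<in> bilinear_relations K M N; x \<in> carrier pair_space; y \<in> carrier pair_space\<rbrakk> \<Longrightarrow> Q.cls x = Q.cls y"
  using generated_submodule_incl[OF F.module_axioms relations_closed]
  by (subst Q.cls_eq_iff) (auto simp: tensor_kernel_def)

lemma pure_tensor_bilinear: "pure_tensor K M N \<in> bilinear_maps K M N (tensor K M N)"
proof (rule bilinear_mapsI)
  note simps = pure_eq tens Q.quotient_simps basis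
  fix n assume n: "n \<in> carrier N"
  show "(\<lambda>m. pure_tensor K M N m n) \<in> linear_maps K M (tensor K M N)"
  proof (rule linear_mapsI)
    fix x y assume "x \<in> carrier M" "y \<in> carrier M"
    then show "pure_tensor K M N (x \<oplus>\<^bsub>M\<^esub> y) n = pure_tensor K M N x n \<oplus>\<^bsub>tensor K M N\<^esub> pure_tensor K M N y n"
      using n by (simp add: simps)
        (rule clsD, auto simp: bilinear_relations_def linear_relations_def Let_def basis)
  next
    fix k x assume "k \<in> carrier K" "x \<in> carrier M"
    then show "pure_tensor K M N (k \<odot>\<^bsub>M\<^esub> x) n = k \<odot>\<^bsub>tensor K M N\<^esub> pure_tensor K M N x n"
      using n by (simp add: simps)
        (rule clsD, auto simp: bilinear_relations_def linear_relations_def Let_def basis)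
  qed (simp add: simps n)
next
  note simps = pure_eq tens Q.quotient_simps basis
  fix m assume m: "m \<in> carrier M"
  show "pure_tensor K M N m \<in> linear_maps K N (tensor K M N)"
  proof (rule linear_mapsI)
    fix x y assume "x \<in> carrier N" "y \<in> carrier N"
    then show "pure_tensor K M N m (x \<oplus>\<^bsub>N\<^esub> y) = pure_tensor K M N m x \<oplus>\<^bsub>tensor K M N\<^esub> pure_tensor K M N m y"
      using m by (simp add: simps)
        (rule clsD, auto simp: bilinear_relations_def linear_relations_def Let_def basis)
  next
    fix k x assume "k \<in> carrier K" "x \<in> carrier N"
    then show "pure_tensor K M N m (k \<odot>\<^bsub>N\<^esub> x) = k \<odot>\<^bsub>tensor K M N\<^esub> pure_tensor K M N m x"
      using m by (simp add: simps)
        (rule clsD, auto simp: bilinear_relations_def linear_relations_def Let_def basis)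
  qed (simp add: simps m)
qed

text \<open>The class map from the free space is onto and sends basis vectors to pure tensors, so
  pure tensors span.\<close>

lemma tensor_induct [consumes 1, case_names zero pure add smult]:
  assumes t: "t \<in> carrier (tensor K M N)"
    and zero: "P \<zero>\<^bsub>tensor K M N\<^esub>"
    and pure: "\<And>m n. \<lbrakk>m \<in> carrier M; n \<in> carrier N\<rbrakk> \<Longrightarrow> P (pure_tensor K M N m n)"
    and add: "\<And>s t. \<lbrakk>s \<in> carrier (tensor K M N); t \<in> carrier (tensor K M N); P s; P t\<rbrakk> \<Longrightarrow>
      P (s \<oplus>\<^bsub>tensor K M N\<^esub> t)"
    and smult: "\<And>k t. \<lbrakk>k \<in> carrier K; t \<in> carrier (tensor K M N); P t\<rbrakk> \<Longrightarrow> P (k \<odot>\<^bsub>tensor K M N\<^esub> t)"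
  shows "P t"
proof -
  obtain x where x: "x \<in> carrier pair_space" "t = Q.cls x" using t by (auto simp: tens Q.quotient_simps)
  have "P (Q.cls x)" using M.R.is_cring x(1)
  proof (induction x rule: free_space_induct)
    case zero
    then show ?case using assms(2) by (simp add: tens Q.quotient_simps)
  next
    case (basis s)
    then show ?case using assms(3) by (cases s) (simp add: pure_tensor_def)
  next
    case (add f g)
    then show ?case using assms(4)[of "Q.cls f" "Q.cls g"] by (simp add: tens Q.quotient_simps)
  next
    case (smult k f)
    then show ?case using assms(5)[of k "Q.cls f"] by (simp add: tens Q.quotient_simps)
  qed
  then show ?thesis by (simp add: x)
qed

lemma tensor_ext:
  assumes P: "module K P"
    and f: "f \<in> linear_maps K (tensor K M N) P" and g: "g \<in> linear_maps K (tensor K M N) P"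
    and "\<And>m n. \<lbrakk>m \<in> carrier M; n \<in> carrier N\<rbrakk> \<Longrightarrow> f (pure_tensor K M N m n) = g (pure_tensor K M N m n)"
    and t: "t \<in> carrier (tensor K M N)"
  shows "f t = g t"
  using t
proof (induction rule: tensor_induct)
  case zero
  then show ?case by (simp add: lin_zero[OF f] lin_zero[OF g] module_tensor P)
qed (simp_all add: lin_add[OF f] lin_add[OF g] lin_smult[OF f] lin_smult[OF g] assms(4))

lemma tensor_universal:
  assumes P: "module K P" and f: "f \<in> bilinear_maps K M N P"
  shows "\<exists>h\<in>linear_maps K (tensor K M N) P.
    \<forall>m\<in>carrier M. \<forall>n\<in>carrier N. h (pure_tensor K M N m n) = f m n"
proof -
  obtain g where g: "g \<in> linear_maps K pair_space P"
    and gb: "\<And>s. s \<in> carrier M \<times> carrier N \<Longrightarrow> g (basis_vector K s) = f (fst s) (snd s)"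
    using free_space_lift[OF M.R.is_cring P, of "carrier M \<times> carrier N" "\<lambda>s. f (fst s) (snd s)"]
      bilin_closed[OF f] by auto
  have "g x = \<zero>\<^bsub>P\<^esub>" if "x \<in> bilinear_relations K M N" for x
  proof -
    have "g x = \<zero>\<^bsub>P\<^esub>" if n: "n \<in> carrier N"
      "x \<in> linear_relations K pair_space M (\<lambda>m. basis_vector K (m, n))" for n
      by (rule linear_relations_vanish[OF F.module_axioms M P _ g _ bilin_left[OF f n(1)] n(2)])
        (auto simp: basis n gb)
    moreover have "g x = \<zero>\<^bsub>P\<^esub>" if m: "m \<in> carrier M"
      "x \<in> linear_relations K pair_space N (\<lambda>n. basis_vector K (m, n))" for m
      by (rule linear_relations_vanish[OF F.module_axioms N P _ g _ bilin_right[OF f m(1)] m(2)])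
        (auto simp: basis m gb)
    ultimately show ?thesis using that by (auto simp: bilinear_relations_def Let_def)
  qed
  from vanish_on_generated[OF F.module_axioms P relations_closed g this]
  have g0: "g x = \<zero>\<^bsub>P\<^esub>" if "x \<in> tensor_kernel K M N" for x
    using that unfolding tensor_kernel_def by blast
  obtain h where "h \<in> linear_maps K (tensor K M N) P" "\<And>x. x \<in> carrier pair_space \<Longrightarrow> h (Q.cls x) = g x"
    using Q.quotient_lift[OF g P g0] unfolding tens by auto
  then show ?thesis using gb basis by (intro bexI[of _ h]) (auto simp: pure_eq)
qed

text \<open>Since \<open>tensor_lift\<close> is a definite description, its values are accessible
  only after unique existence. The universal map, restricted to the carrier, exists; spanning by
  pure tensors together with extensionality leaves no other.\<close>

lemma tensor_lift:
  assumes P: "module K P" and f: "f \<in> bilinear_maps K M N P"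
  shows tensor_lift_linear: "tensor_lift K M N P f \<in> linear_maps K (tensor K M N) P"
    and tensor_lift_pure: "\<lbrakk>m \<in> carrier M; n \<in> carrier N\<rbrakk> \<Longrightarrow>
      tensor_lift K M N P f (pure_tensor K M N m n) = f m n"
proof -
  let ?Q = "\<lambda>h. h \<in> linear_maps K (tensor K M N) P \<inter> extensional (carrier (tensor K M N)) \<and>
        (\<forall>m\<in>carrier M. \<forall>n\<in>carrier N. h (pure_tensor K M N m n) = f m n)"
  obtain h where h: "h \<in> linear_maps K (tensor K M N) P"
    "\<And>m n. \<lbrakk>m \<in> carrier M; n \<in> carrier N\<rbrakk> \<Longrightarrow> h (pure_tensor K M N m n) = f m n"
    using tensor_universal[OF P f] by blast
  have "?Q (restrict h (carrier (tensor K M N)))"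
    using lin_restrict[OF h(1) module_tensor] h(2) bilin_closed[OF pure_tensor_bilinear] by simp
  moreover have "g = g'" if "?Q g" "?Q g'" for g g'
    by (rule extensionalityI[of _ "carrier (tensor K M N)"])
      (use that tensor_ext[OF P, of g g'] in auto)
  ultimately have "\<exists>!h. ?Q h" by blast
  from theI'[OF this] have "?Q (tensor_lift K M N P f)" unfolding tensor_lift_def .
  then show "tensor_lift K M N P f \<in> linear_maps K (tensor K M N) P"
    "\<lbrakk>m \<in> carrier M; n \<in> carrier N\<rbrakk> \<Longrightarrow> tensor_lift K M N P f (pure_tensor K M N m n) = f m n"
    by auto
qed

end

section \<open>Bimodules and their balanced tensor products\<close>

text \<open>Many records below, such as \<open>opposite A\<close>, \<open>left_bimodule\<close> and
  \<open>tensor_over\<close>, share their additive structure with another record without being equal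
  to it. This transfers the module axioms between them.\<close>

lemma module_cong:
  assumes "module K M" "carrier M' = carrier M" "add M' = add M" "\<zero>\<^bsub>M'\<^esub> = \<zero>\<^bsub>M\<^esub>" "smult M' = smult M"
  shows "module K M'"
proof -
  interpret M: module K M by fact
  show ?thesis
  proof (rule moduleI)
    show "abelian_group M'"
      by (rule abelian_groupI) (auto simp: assms(2-) M.add.m_ac intro: M.l_neg M.a_inv_closed)
  qed (auto simp: assms(2-) M.smult_l_distr M.smult_r_distr M.smult_assoc1 M.R.is_cring)
qed

lemma linear_maps_cong:
  assumes "carrier M' = carrier M" "add M' = add M" "smult M' = smult M"
    and "carrier N' = carrier N" "add N' = add N" "smult N' = smult N"
  shows "linear_maps K M' N' = linear_maps K M N"
  using assms by (simp add: linear_maps_def)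

lemma finsum_cong_record:
  assumes "carrier M' = carrier M" "add M' = add M" "\<zero>\<^bsub>M'\<^esub> = \<zero>\<^bsub>M\<^esub>"
  shows "finsum M' f S = finsum M f S"
  using assms by (simp add: finsum_def finprod_def)

lemma (in k_algebra) mult_bilinear: "mult A \<in> bilinear_maps K A A A"
  by (intro bilinear_mapsI linear_mapsI)
    (auto simp: A.l_distr A.r_distr smult_mult_left smult_mult_right)

lemma (in bimodule) lact_bilinear: "lact M \<in> bilinear_maps K A M M"
  by (intro bilinear_mapsI linear_mapsI) (auto simp: lact_closed lact_add add_lact lact_smult smult_lact)

lemma (in bimodule) ract_bilinear: "ract M \<in> bilinear_maps K M A M"
  by (intro bilinear_mapsI linear_mapsI) (auto simp: ract_closed ract_add add_ract ract_smult smult_ract)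

lemma bimoduleI:
  assumes "k_algebra K A" "module K M"
    and l: "lact M \<in> bilinear_maps K A M M" and r: "ract M \<in> bilinear_maps K M A M"
    and "\<And>m. m \<in> carrier M \<Longrightarrow> \<one>\<^bsub>A\<^esub> \<triangleright>\<^bsub>M\<^esub> m = m" "\<And>m. m \<in> carrier M \<Longrightarrow> m \<triangleleft>\<^bsub>M\<^esub> \<one>\<^bsub>A\<^esub> = m"
    and "\<And>a b m. \<lbrakk>a \<in> carrier A; b \<in> carrier A; m \<in> carrier M\<rbrakk> \<Longrightarrow>
        (a \<otimes>\<^bsub>A\<^esub> b) \<triangleright>\<^bsub>M\<^esub> m = a \<triangleright>\<^bsub>M\<^esub> (b \<triangleright>\<^bsub>M\<^esub> m)"
    and "\<And>a b m. \<lbrakk>a \<in> carrier A; b \<in> carrier A; m \<in> carrier M\<rbrakk> \<Longrightarrow>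
        m \<triangleleft>\<^bsub>M\<^esub> (a \<otimes>\<^bsub>A\<^esub> b) = (m \<triangleleft>\<^bsub>M\<^esub> a) \<triangleleft>\<^bsub>M\<^esub> b"
    and "\<And>a b m. \<lbrakk>a \<in> carrier A; b \<in> carrier A; m \<in> carrier M\<rbrakk> \<Longrightarrow>
        (a \<triangleright>\<^bsub>M\<^esub> m) \<triangleleft>\<^bsub>M\<^esub> b = a \<triangleright>\<^bsub>M\<^esub> (m \<triangleleft>\<^bsub>M\<^esub> b)"
  shows "bimodule K A M"
proof -
  note ll = bilin_left[OF l] and lr = bilin_right[OF l] and rl = bilin_left[OF r] and rr = bilin_right[OF r]
  show ?thesis
    by (intro bimodule.intro bimodule_axioms.intro assms)
      (assumption | rule bilin_closed[OF l] bilin_closed[OF r]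
        lin_add[OF ll] lin_add[OF lr] lin_add[OF rl] lin_add[OF rr]
        lin_smult[OF ll] lin_smult[OF lr] lin_smult[OF rl] lin_smult[OF rr])+
qed

definition balanced_maps :: "'k ring \<Rightarrow> ('k, 'a) module \<Rightarrow> ('k, 'a, 'm) bimodule \<Rightarrow>
    ('k, 'a, 'n) bimodule \<Rightarrow> ('k, 'r, 's) module_scheme \<Rightarrow> ('m \<Rightarrow> 'n \<Rightarrow> 'r) set" where
  "balanced_maps K A M N P = {f \<in> bilinear_maps K M N P.
     \<forall>m\<in>carrier M. \<forall>a\<in>carrier A. \<forall>n\<in>carrier N. f (m \<triangleleft>\<^bsub>M\<^esub> a) n = f m (a \<triangleright>\<^bsub>N\<^esub> n)}"

lemma balanced_mapsI:
  assumes "f \<in> bilinear_maps K M N P"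
    and "\<And>m a n. \<lbrakk>m \<in> carrier M; a \<in> carrier A; n \<in> carrier N\<rbrakk> \<Longrightarrow> f (m \<triangleleft>\<^bsub>M\<^esub> a) n = f m (a \<triangleright>\<^bsub>N\<^esub> n)"
  shows "f \<in> balanced_maps K A M N P"
  using assms by (simp add: balanced_maps_def)

lemma balanced_bilinear: "f \<in> balanced_maps K A M N P \<Longrightarrow> f \<in> bilinear_maps K M N P"
  by (simp add: balanced_maps_def)

lemma balanced_swap:
  "\<lbrakk>f \<in> balanced_maps K A M N P; m \<in> carrier M; a \<in> carrier A; n \<in> carrier N\<rbrakk> \<Longrightarrow>
    f (m \<triangleleft>\<^bsub>M\<^esub> a) n = f m (a \<triangleright>\<^bsub>N\<^esub> n)"
  by (simp add: balanced_maps_def)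

lemma tensor_over_simps:
  "carrier (tensor_over K A M N) = carrier (balanced_space K A M N)"
  "add (tensor_over K A M N) = add (balanced_space K A M N)"
  "\<zero>\<^bsub>tensor_over K A M N\<^esub> = \<zero>\<^bsub>balanced_space K A M N\<^esub>"
  "smult (tensor_over K A M N) = smult (balanced_space K A M N)"
  by (simp_all add: tensor_over_def Let_def)

section \<open>The tensor product over \<open>A\<close>: universal property and bimodule
  structure\<close>

context
  fixes K :: "'k ring" and A :: "('k, 'a) module" and M :: "('k, 'a, 'm) bimodule"
    and N :: "('k, 'a, 'n) bimodule"
  assumes M: "bimodule K A M" and N: "bimodule K A N"
begin

interpretation M: bimodule K A M by (rule M)
interpretation N: bimodule K A N by (rule N)

private lemma mM: "module K M" and mN: "module K N" by (rule M.M.module_axioms N.M.module_axioms)+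

private abbreviation "T \<equiv> tensor K M N"

interpretation T: module K T by (rule module_tensor[OF mM mN])

private abbreviation "relations \<equiv>
  {pure_tensor K M N (m \<triangleleft>\<^bsub>M\<^esub> a) n \<ominus>\<^bsub>T\<^esub> pure_tensor K M N m (a \<triangleright>\<^bsub>N\<^esub> n) |m a n.
        m \<in> carrier M \<and> a \<in> carrier A \<and> n \<in> carrier N}"

private lemma pure: "\<lbrakk>m \<in> carrier M; n \<in> carrier N\<rbrakk> \<Longrightarrow> pure_tensor K M N m n \<in> carrier T"
  by (rule bilin_closed[OF pure_tensor_bilinear[OF mM mN]])

private lemma relations: "relations \<subseteq> carrier T"
  by (auto intro!: T.minus_closed pure M.ract_closed N.lact_closed)

interpretation Q: quotient_module K T "balanced_kernel K A M N"
  unfolding balanced_kernel_def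
  by (intro quotient_module.intro quotient_module_axioms.intro T.module_axioms
    generated_submodule_submodule relations)

private lemma pure_over: "pure_tensor_over K A M N m n = Q.cls (pure_tensor K M N m n)"
  by (simp add: pure_tensor_over_def)

private lemma space: "balanced_space K A M N = quotient T (balanced_kernel K A M N)"
  by (simp add: balanced_space_def)

lemma module_tensor_over: "module K (tensor_over K A M N)"
  by (rule module_cong[OF Q.module_quotient]) (simp_all add: tensor_over_simps space)

private lemma lin1: "linear_maps K (tensor_over K A M N) P = linear_maps K (quotient T (balanced_kernel K A M N)) P"
  by (rule linear_maps_cong) (simp_all add: tensor_over_simps space)

private lemma lin2: "linear_maps K P (tensor_over K A M N) = linear_maps K P (quotient T (balanced_kernel K A M N))"
  by (rule linear_maps_cong) (simp_all add: tensor_over_simps space)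

lemma pure_tensor_over_balanced: "pure_tensor_over K A M N \<in> balanced_maps K A M N (tensor_over K A M N)"
proof (rule balanced_mapsI)
  have "pure_tensor_over K A M N = (\<lambda>m n. Q.cls (pure_tensor K M N m n))"
    by (intro ext) (simp add: pure_over)
  then show "pure_tensor_over K A M N \<in> bilinear_maps K M N (tensor_over K A M N)"
    using bilin_compose_lin[OF pure_tensor_bilinear[OF mM mN] Q.cls_linear]
    by (simp add: bilinear_maps_def lin2)
  fix m a n assume "m \<in> carrier M" "a \<in> carrier A" "n \<in> carrier N"
  then show "pure_tensor_over K A M N (m \<triangleleft>\<^bsub>M\<^esub> a) n = pure_tensor_over K A M N m (a \<triangleright>\<^bsub>N\<^esub> n)"
    using generated_submodule_incl[OF T.module_axioms relations]
    by (simp add: pure_over, subst Q.cls_eq_iff)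
      (auto simp: balanced_kernel_def intro!: pure M.ract_closed N.lact_closed)
qed

lemma tensor_over_induct [consumes 1, case_names zero pure add smult]:
  assumes t: "t \<in> carrier (tensor_over K A M N)"
    and zero: "P \<zero>\<^bsub>tensor_over K A M N\<^esub>"
    and pure: "\<And>m n. \<lbrakk>m \<in> carrier M; n \<in> carrier N\<rbrakk> \<Longrightarrow> P (pure_tensor_over K A M N m n)"
    and add: "\<And>s t. \<lbrakk>s \<in> carrier (tensor_over K A M N); t \<in> carrier (tensor_over K A M N); P s; P t\<rbrakk> \<Longrightarrow>
      P (s \<oplus>\<^bsub>tensor_over K A M N\<^esub> t)"
    and smult: "\<And>k t. \<lbrakk>k \<in> carrier K; t \<in> carrier (tensor_over K A M N); P t\<rbrakk> \<Longrightarrow>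
      P (k \<odot>\<^bsub>tensor_over K A M N\<^esub> t)"
  shows "P t"
proof -
  note simps = tensor_over_simps space Q.quotient_simps
  obtain x where x: "x \<in> carrier T" "t = Q.cls x" using t by (auto simp: simps)
  have "P (Q.cls x)" using x(1)
  proof (induction x rule: tensor_induct[OF mM mN, consumes 1, case_names zero pure add smult])
    case zero
    then show ?case using assms(2) by (simp add: simps)
  next
    case (pure m n)
    then show ?case using assms(3) by (simp add: pure_over)
  next
    case (add f g)
    then show ?case using assms(4)[of "Q.cls f" "Q.cls g"] by (simp add: simps)
  next
    case (smult k f)
    then show ?case using assms(5)[of k "Q.cls f"] by (simp add: simps)
  qed
  then show ?thesis by (simp add: x)
qed

lemma tensor_over_ext:
  assumes P: "module K P"
    and f: "f \<in> linear_maps K (tensor_over K A M N) P" and g: "g \<in> linear_maps K (tensor_over K A M N) P"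
    and "\<And>m n. \<lbrakk>m \<in> carrier M; n \<in> carrier N\<rbrakk> \<Longrightarrow> f (pure_tensor_over K A M N m n) = g (pure_tensor_over K A M N m n)"
    and t: "t \<in> carrier (tensor_over K A M N)"
  shows "f t = g t"
  using t
proof (induction rule: tensor_over_induct)
  case zero
  then show ?case by (simp add: lin_zero[OF f] lin_zero[OF g] module_tensor_over P)
qed (simp_all add: lin_add[OF f] lin_add[OF g] lin_smult[OF f] lin_smult[OF g] assms(4))

lemma tensor_over_universal:
  assumes P: "module K P" and f: "f \<in> balanced_maps K A M N P"
  shows "\<exists>h\<in>linear_maps K (tensor_over K A M N) P.
    \<forall>m\<in>carrier M. \<forall>n\<in>carrier N. h (pure_tensor_over K A M N m n) = f m n"
proof -
  interpret P: module K P by (rule P)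
  obtain g where g: "g \<in> linear_maps K T P"
    and gp: "\<And>m n. \<lbrakk>m \<in> carrier M; n \<in> carrier N\<rbrakk> \<Longrightarrow> g (pure_tensor K M N m n) = f m n"
    using tensor_universal[OF mM mN P balanced_bilinear[OF f]] by blast
  have "g x = \<zero>\<^bsub>P\<^esub>" if "x \<in> relations" for x
    using that by (auto simp: lin_diff[OF g T.module_axioms P] pure M.ract_closed N.lact_closed gp
        balanced_swap[OF f] P.diff_eq_zero_iff bilin_closed[OF balanced_bilinear[OF f]])
  from vanish_on_generated[OF T.module_axioms P relations g this]
  have g0: "g x = \<zero>\<^bsub>P\<^esub>" if "x \<in> balanced_kernel K A M N" for x
    using that unfolding balanced_kernel_def by blast
  obtain h where "h \<in> linear_maps K (tensor_over K A M N) P" "\<And>x. x \<in> carrier T \<Longrightarrow> h (Q.cls x) = g x"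
    using Q.quotient_lift[OF g P g0] unfolding lin1 by auto
  then show ?thesis using gp pure by (intro bexI[of _ h]) (auto simp: pure_over)
qed

lemma tensor_over_lift:
  assumes P: "module K P" and f: "f \<in> balanced_maps K A M N P"
  shows tensor_over_lift_linear: "tensor_over_lift K A M N P f \<in> linear_maps K (tensor_over K A M N) P"
    and tensor_over_lift_pure: "\<lbrakk>m \<in> carrier M; n \<in> carrier N\<rbrakk> \<Longrightarrow>
      tensor_over_lift K A M N P f (pure_tensor_over K A M N m n) = f m n"
proof -
  let ?S = "balanced_space K A M N"
  let ?Q = "\<lambda>h. h \<in> linear_maps K ?S P \<inter> extensional (carrier ?S) \<and>
        (\<forall>m\<in>carrier M. \<forall>n\<in>carrier N. h (pure_tensor_over K A M N m n) = f m n)"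
  have lin: "linear_maps K ?S P = linear_maps K (tensor_over K A M N) P"
    by (simp add: space lin1)
  have car: "carrier ?S = carrier (tensor_over K A M N)" by (simp add: tensor_over_simps)
  obtain h where h: "h \<in> linear_maps K (tensor_over K A M N) P"
    "\<And>m n. \<lbrakk>m \<in> carrier M; n \<in> carrier N\<rbrakk> \<Longrightarrow> h (pure_tensor_over K A M N m n) = f m n"
    using tensor_over_universal[OF P f] by blast
  have "?Q (restrict h (carrier ?S))"
    using lin_restrict[OF h(1) module_tensor_over] h(2)
      bilin_closed[OF balanced_bilinear[OF pure_tensor_over_balanced]]
    unfolding lin car by simp
  moreover have "g = g'" if "?Q g" "?Q g'" for g g'
    by (rule extensionalityI[of _ "carrier ?S"])
      (use that tensor_over_ext[OF P, of g g'] in \<open>auto simp: lin car\<close>)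
  ultimately have "\<exists>!h. ?Q h" by blast
  from theI'[OF this] have "?Q (tensor_over_lift K A M N P f)" unfolding tensor_over_lift_def .
  then show "tensor_over_lift K A M N P f \<in> linear_maps K (tensor_over K A M N) P"
    "\<lbrakk>m \<in> carrier M; n \<in> carrier N\<rbrakk> \<Longrightarrow> tensor_over_lift K A M N P f (pure_tensor_over K A M N m n) = f m n"
    by (auto simp: lin)
qed

text \<open>The actions of \<open>tensor_over\<close> are lifts into \<open>balanced_space\<close>,
  as the bimodule record cannot occur in its own definition. A lift depends only on the carrier, the
  addition and the scalars of its target, and these agree for both records.\<close>

lemma tensor_over_lift_space:
  "tensor_over_lift K A M N (balanced_space K A M N) f = tensor_over_lift K A M N (tensor_over K A M N) f"
  unfolding tensor_over_lift_def linear_maps_def by (simp add: tensor_over_simps)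

text \<open>Balancing moves scalars that act on the right of the first factor, and these commute
  with its left action.\<close>

private lemma left_balanced:
  assumes a: "a \<in> carrier A"
  shows "(\<lambda>m n. pure_tensor_over K A M N (a \<triangleright>\<^bsub>M\<^esub> m) n) \<in> balanced_maps K A M N (tensor_over K A M N)"
  by (intro balanced_mapsI bilin_compose[OF balanced_bilinear[OF pure_tensor_over_balanced] _ lin_id]
      bilin_right[OF M.lact_bilinear a])
    (simp add: M.lact_ract[symmetric] a balanced_swap[OF pure_tensor_over_balanced] M.lact_closed)

private lemma right_balanced:
  assumes a: "a \<in> carrier A"
  shows "(\<lambda>m n. pure_tensor_over K A M N m (n \<triangleleft>\<^bsub>N\<^esub> a)) \<in> balanced_maps K A M N (tensor_over K A M N)"
  by (intro balanced_mapsI bilin_compose[OF balanced_bilinear[OF pure_tensor_over_balanced] lin_id]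
      bilin_left[OF N.ract_bilinear a])
    (simp add: N.lact_ract a balanced_swap[OF pure_tensor_over_balanced] N.ract_closed)

lemma lact_tensor_over:
  assumes "a \<in> carrier A"
  shows lact_tensor_over_linear: "lact (tensor_over K A M N) a \<in> linear_maps K (tensor_over K A M N) (tensor_over K A M N)"
    and lact_pure_tensor_over: "\<lbrakk>m \<in> carrier M; n \<in> carrier N\<rbrakk> \<Longrightarrow>
      a \<triangleright>\<^bsub>tensor_over K A M N\<^esub> pure_tensor_over K A M N m n = pure_tensor_over K A M N (a \<triangleright>\<^bsub>M\<^esub> m) n"
proof -
  have "lact (tensor_over K A M N) a =
      tensor_over_lift K A M N (tensor_over K A M N) (\<lambda>m n. pure_tensor_over K A M N (a \<triangleright>\<^bsub>M\<^esub> m) n)"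
    by (simp add: tensor_over_lift_space[symmetric]) (simp add: tensor_over_def Let_def)
  with tensor_over_lift[OF module_tensor_over left_balanced[OF assms]]
  show "lact (tensor_over K A M N) a \<in> linear_maps K (tensor_over K A M N) (tensor_over K A M N)"
    "\<lbrakk>m \<in> carrier M; n \<in> carrier N\<rbrakk> \<Longrightarrow>
      a \<triangleright>\<^bsub>tensor_over K A M N\<^esub> pure_tensor_over K A M N m n = pure_tensor_over K A M N (a \<triangleright>\<^bsub>M\<^esub> m) n"
    by simp_all
qed

lemma ract_tensor_over:
  assumes "a \<in> carrier A"
  shows ract_tensor_over_linear: "(\<lambda>t. t \<triangleleft>\<^bsub>tensor_over K A M N\<^esub> a) \<in> linear_maps K (tensor_over K A M N) (tensor_over K A M N)"
    and ract_pure_tensor_over: "\<lbrakk>m \<in> carrier M; n \<in> carrier N\<rbrakk> \<Longrightarrow>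
      pure_tensor_over K A M N m n \<triangleleft>\<^bsub>tensor_over K A M N\<^esub> a = pure_tensor_over K A M N m (n \<triangleleft>\<^bsub>N\<^esub> a)"
proof -
  have "t \<triangleleft>\<^bsub>tensor_over K A M N\<^esub> a =
      tensor_over_lift K A M N (tensor_over K A M N) (\<lambda>m n. pure_tensor_over K A M N m (n \<triangleleft>\<^bsub>N\<^esub> a)) t" for t
    by (simp add: tensor_over_lift_space[symmetric]) (simp add: tensor_over_def Let_def)
  with tensor_over_lift[OF module_tensor_over right_balanced[OF assms]]
  show "(\<lambda>t. t \<triangleleft>\<^bsub>tensor_over K A M N\<^esub> a) \<in> linear_maps K (tensor_over K A M N) (tensor_over K A M N)"
    "\<lbrakk>m \<in> carrier M; n \<in> carrier N\<rbrakk> \<Longrightarrow>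
      pure_tensor_over K A M N m n \<triangleleft>\<^bsub>tensor_over K A M N\<^esub> a = pure_tensor_over K A M N m (n \<triangleleft>\<^bsub>N\<^esub> a)"
    by simp_all
qed

lemma pure_tensor_over_closed:
  "\<lbrakk>m \<in> carrier M; n \<in> carrier N\<rbrakk> \<Longrightarrow> pure_tensor_over K A M N m n \<in> carrier (tensor_over K A M N)"
  by (rule bilin_closed[OF balanced_bilinear[OF pure_tensor_over_balanced]])

text \<open>Every bimodule axiom equates two maps that are linear in the tensor, so a check on pure
  tensors is enough; there the left action concerns the first factor alone and the right action the
  second.\<close>

lemma bimodule_tensor_over: "bimodule K A (tensor_over K A M N)"
proof -
  let ?T = "tensor_over K A M N"
  interpret T: module K ?T by (rule module_tensor_over)
  note pb = balanced_bilinear[OF pure_tensor_over_balanced]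
  note simps = lact_pure_tensor_over ract_pure_tensor_over M.lact_closed N.ract_closed
    lin_closed[OF lact_tensor_over_linear] lin_closed[OF ract_tensor_over_linear]
    lin_add[OF bilin_left[OF pb]] lin_add[OF bilin_right[OF pb]]
    lin_smult[OF bilin_left[OF pb]] lin_smult[OF bilin_right[OF pb]] pure_tensor_over_closed
  note l = lact_tensor_over_linear and r = ract_tensor_over_linear
  note ext = tensor_over_ext[OF T.module_axioms]
  show ?thesis
  proof (rule bimoduleI)
    show "lact ?T \<in> bilinear_maps K A ?T ?T"
    proof (intro bilinear_mapsI linear_mapsI)
      fix t a b assume t: "t \<in> carrier ?T" and [simp]: "a \<in> carrier A" "b \<in> carrier A"
      show "(a \<oplus>\<^bsub>A\<^esub> b) \<triangleright>\<^bsub>?T\<^esub> t = a \<triangleright>\<^bsub>?T\<^esub> t \<oplus>\<^bsub>?T\<^esub> b \<triangleright>\<^bsub>?T\<^esub> t"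
        by (rule ext[OF _ lin_plus[OF l l] _ t]) (simp_all add: l T.module_axioms simps M.add_lact)
    next
      fix t k a assume t: "t \<in> carrier ?T" and [simp]: "a \<in> carrier A" "k \<in> carrier K"
      show "(k \<odot>\<^bsub>A\<^esub> a) \<triangleright>\<^bsub>?T\<^esub> t = k \<odot>\<^bsub>?T\<^esub> (a \<triangleright>\<^bsub>?T\<^esub> t)"
        by (rule ext[OF _ lin_scale[OF l] _ t]) (simp_all add: l T.module_axioms simps M.smult_lact)
    qed (simp_all add: simps lin_add[OF l] lin_smult[OF l])
    show "ract ?T \<in> bilinear_maps K ?T A ?T"
    proof (intro bilinear_mapsI linear_mapsI)
      fix t a b assume t: "t \<in> carrier ?T" and [simp]: "a \<in> carrier A" "b \<in> carrier A"
      show "t \<triangleleft>\<^bsub>?T\<^esub> (a \<oplus>\<^bsub>A\<^esub> b) = t \<triangleleft>\<^bsub>?T\<^esub> a \<oplus>\<^bsub>?T\<^esub> t \<triangleleft>\<^bsub>?T\<^esub> b"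
        by (rule ext[OF _ lin_plus[OF r r] _ t]) (simp_all add: r T.module_axioms simps N.ract_add)
    next
      fix t k a assume t: "t \<in> carrier ?T" and [simp]: "a \<in> carrier A" "k \<in> carrier K"
      show "t \<triangleleft>\<^bsub>?T\<^esub> (k \<odot>\<^bsub>A\<^esub> a) = k \<odot>\<^bsub>?T\<^esub> (t \<triangleleft>\<^bsub>?T\<^esub> a)"
        by (rule ext[OF _ lin_scale[OF r] _ t]) (simp_all add: r T.module_axioms simps N.ract_smult)
    qed (simp_all add: simps lin_add[OF r] lin_smult[OF r])
    fix t assume t: "t \<in> carrier ?T"
    show "\<one>\<^bsub>A\<^esub> \<triangleright>\<^bsub>?T\<^esub> t = t" by (rule ext[OF _ lin_id _ t]) (simp_all add: l simps M.one_lact)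
    show "t \<triangleleft>\<^bsub>?T\<^esub> \<one>\<^bsub>A\<^esub> = t" by (rule ext[OF _ lin_id _ t]) (simp_all add: r simps N.ract_one)
    fix a b assume [simp]: "a \<in> carrier A" "b \<in> carrier A"
    show "(a \<otimes>\<^bsub>A\<^esub> b) \<triangleright>\<^bsub>?T\<^esub> t = a \<triangleright>\<^bsub>?T\<^esub> (b \<triangleright>\<^bsub>?T\<^esub> t)"
      by (rule ext[OF _ lin_compose[OF l l] _ t]) (simp_all add: l simps M.mult_lact)
    show "t \<triangleleft>\<^bsub>?T\<^esub> (a \<otimes>\<^bsub>A\<^esub> b) = (t \<triangleleft>\<^bsub>?T\<^esub> a) \<triangleleft>\<^bsub>?T\<^esub> b"
      by (rule ext[OF _ lin_compose[OF r r] _ t]) (simp_all add: r simps N.ract_mult)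
    show "(a \<triangleright>\<^bsub>?T\<^esub> t) \<triangleleft>\<^bsub>?T\<^esub> b = a \<triangleright>\<^bsub>?T\<^esub> (t \<triangleleft>\<^bsub>?T\<^esub> b)"
      by (rule ext[OF lin_compose[OF l r] lin_compose[OF r l] _ t]) (simp_all add: simps)
  qed (rule M.k_algebra_axioms T.module_axioms)+
qed

end

section \<open>Free algebras, quotient algebras and their representations\<close>

lemma k_algebraI:
  assumes "field K" "module K F" and m: "mult F \<in> bilinear_maps K F F F" and "\<one>\<^bsub>F\<^esub> \<in> carrier F"
    and "\<And>x y z. \<lbrakk>x \<in> carrier F; y \<in> carrier F; z \<in> carrier F\<rbrakk> \<Longrightarrow> (x \<otimes>\<^bsub>F\<^esub> y) \<otimes>\<^bsub>F\<^esub> z = x \<otimes>\<^bsub>F\<^esub> (y \<otimes>\<^bsub>F\<^esub> z)"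
    and "\<And>x. x \<in> carrier F \<Longrightarrow> \<one>\<^bsub>F\<^esub> \<otimes>\<^bsub>F\<^esub> x = x" "\<And>x. x \<in> carrier F \<Longrightarrow> x \<otimes>\<^bsub>F\<^esub> \<one>\<^bsub>F\<^esub> = x"
  shows "k_algebra K F"
proof -
  interpret F: module K F by fact
  note l = bilin_left[OF m] and r = bilin_right[OF m]
  have "ring F"
    by (rule ringI)
      (auto intro!: monoidI F.abelian_group_axioms assms bilin_closed[OF m] lin_add[OF l] lin_add[OF r])
  then show ?thesis
    by (intro k_algebra.intro k_algebra_axioms.intro assms lin_smult[OF l] lin_smult[OF r])
qed

text \<open>Phrased as a bilinear action rather than as an algebra map into endomorphisms: no
  endomorphism algebra has to be built, and equations are required on carriers only.\<close>

definition representation :: "'k ring \<Rightarrow> ('k, 'f) module \<Rightarrow> ('k, 'n, 'q) module_scheme \<Rightarrow>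
    ('f \<Rightarrow> 'n \<Rightarrow> 'n) \<Rightarrow> bool" where
  "representation K F N \<rho> \<longleftrightarrow> \<rho> \<in> bilinear_maps K F N N \<and>
     (\<forall>f\<in>carrier F. \<forall>g\<in>carrier F. \<forall>n\<in>carrier N. \<rho> (f \<otimes>\<^bsub>F\<^esub> g) n = \<rho> f (\<rho> g n)) \<and>
     (\<forall>n\<in>carrier N. \<rho> \<one>\<^bsub>F\<^esub> n = n)"

lemma representationI:
  assumes "\<rho> \<in> bilinear_maps K F N N"
    and "\<And>n f g. \<lbrakk>n \<in> carrier N; f \<in> carrier F; g \<in> carrier F\<rbrakk> \<Longrightarrow> \<rho> (f \<otimes>\<^bsub>F\<^esub> g) n = \<rho> f (\<rho> g n)"
    and "\<And>n. n \<in> carrier N \<Longrightarrow> \<rho> \<one>\<^bsub>F\<^esub> n = n"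
  shows "representation K F N \<rho>"
  using assms by (simp add: representation_def)

lemma representationD:
  assumes "representation K F N \<rho>"
  shows "\<rho> \<in> bilinear_maps K F N N"
    and "\<lbrakk>f \<in> carrier F; g \<in> carrier F; n \<in> carrier N\<rbrakk> \<Longrightarrow> \<rho> (f \<otimes>\<^bsub>F\<^esub> g) n = \<rho> f (\<rho> g n)"
    and "n \<in> carrier N \<Longrightarrow> \<rho> \<one>\<^bsub>F\<^esub> n = n"
  using assms by (simp_all add: representation_def)

definition subalgebra :: "'k ring \<Rightarrow> ('k, 'f) module \<Rightarrow> 'f set \<Rightarrow> bool" where
  "subalgebra K F H \<longleftrightarrow> H \<subseteq> carrier F \<and> \<one>\<^bsub>F\<^esub> \<in> H \<and> (\<forall>x\<in>H. \<forall>y\<in>H. x \<oplus>\<^bsub>F\<^esub> y \<in> H) \<and>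
     (\<forall>x\<in>H. \<forall>y\<in>H. x \<otimes>\<^bsub>F\<^esub> y \<in> H) \<and> (\<forall>k\<in>carrier K. \<forall>x\<in>H. k \<odot>\<^bsub>F\<^esub> x \<in> H)"

lemma subalgebraI:
  assumes "H \<subseteq> carrier F" "\<one>\<^bsub>F\<^esub> \<in> H" "\<And>x y. \<lbrakk>x \<in> H; y \<in> H\<rbrakk> \<Longrightarrow> x \<oplus>\<^bsub>F\<^esub> y \<in> H"
    "\<And>x y. \<lbrakk>x \<in> H; y \<in> H\<rbrakk> \<Longrightarrow> x \<otimes>\<^bsub>F\<^esub> y \<in> H" "\<And>k x. \<lbrakk>k \<in> carrier K; x \<in> H\<rbrakk> \<Longrightarrow> k \<odot>\<^bsub>F\<^esub> x \<in> H"
  shows "subalgebra K F H"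
  using assms by (simp add: subalgebra_def)

lemma subalgebraD:
  assumes "subalgebra K F H"
  shows "H \<subseteq> carrier F" "\<one>\<^bsub>F\<^esub> \<in> H" "\<lbrakk>x \<in> H; y \<in> H\<rbrakk> \<Longrightarrow> x \<oplus>\<^bsub>F\<^esub> y \<in> H"
    "\<lbrakk>x \<in> H; y \<in> H\<rbrakk> \<Longrightarrow> x \<otimes>\<^bsub>F\<^esub> y \<in> H" "\<lbrakk>k \<in> carrier K; x \<in> H\<rbrakk> \<Longrightarrow> k \<odot>\<^bsub>F\<^esub> x \<in> H"
  using assms by (auto simp: subalgebra_def)

definition generated_by :: "'k ring \<Rightarrow> ('k, 'f) module \<Rightarrow> 'f set \<Rightarrow> bool" where
  "generated_by K F G \<longleftrightarrow> (\<forall>H. subalgebra K F H \<longrightarrow> G \<subseteq> H \<longrightarrow> carrier F \<subseteq> H)"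

lemma generated_byI: "(\<And>H. \<lbrakk>subalgebra K F H; G \<subseteq> H\<rbrakk> \<Longrightarrow> carrier F \<subseteq> H) \<Longrightarrow> generated_by K F G"
  by (simp add: generated_by_def)

lemma generated_byD: "\<lbrakk>generated_by K F G; subalgebra K F H; G \<subseteq> H\<rbrakk> \<Longrightarrow> carrier F \<subseteq> H"
  by (simp add: generated_by_def)

section \<open>The free algebra on a set of letters\<close>

context
  fixes K :: "'k ring" and S :: "'s set"
  assumes K: "field K"
begin

interpretation K: field K by (rule K)

private abbreviation "word_algebra \<equiv> free_algebra K S"
private abbreviation "word_space \<equiv> free_space K (lists S)"

private lemma fields: "carrier word_algebra = carrier word_space" "add word_algebra = add word_space" "\<zero>\<^bsub>word_algebra\<^esub> = \<zero>\<^bsub>word_space\<^esub>" "smult word_algebra = smult word_space"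
  by (simp_all add: free_algebra_def)

private lemma cK: "cring K" by (rule K.is_cring)

private lemma linF: "linear_maps K word_algebra P = linear_maps K word_space P"
  by (rule linear_maps_cong) (simp_all add: fields)

private lemma mod: "module K word_algebra"
  by (rule module_cong[OF module_free_space[OF cK] fields])

interpretation F: module K word_algebra by (rule mod)

private lemma basis_closed: "w \<in> lists S \<Longrightarrow> basis_vector K w \<in> carrier word_algebra"
  using basis_vector_in_free_space[OF cK] by (simp add: fields)

private lemmas fext = basis_vector_free_space_ext[OF cK, where S = "lists S", folded linF fields]

private lemma mult_eq: "(f \<otimes>\<^bsub>word_algebra\<^esub> g) w = (\<Oplus>\<^bsub>K\<^esub>i\<in>{..length w}. f (take i w) \<otimes>\<^bsub>K\<^esub> g (drop i w))"
  by (simp add: free_algebra_def)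

private lemma val: "f \<in> carrier word_algebra \<Longrightarrow> f w \<in> carrier K"
  using free_space_mem by (simp add: fields)

text \<open>The product sums over all ways to cut a word \<open>w\<close> in two. Only the cut at
  position \<open>length u\<close> can contribute, and it contributes exactly when
  \<open>w = u @ v\<close>.\<close>

private lemma mult_basis: "basis_vector K u \<otimes>\<^bsub>word_algebra\<^esub> basis_vector K v = basis_vector K (u @ v)"
proof
  fix w
  have *: "basis_vector K u (take i w) \<otimes>\<^bsub>K\<^esub> basis_vector K v (drop i w) =
      (if i = length u then (if w = u @ v then \<one>\<^bsub>K\<^esub> else \<zero>\<^bsub>K\<^esub>) else \<zero>\<^bsub>K\<^esub>)" if "i \<le> length w" for i
  proof (cases "take i w = u \<and> drop i w = v")
    case True
    then have "w = u @ v" "i = length u" using that by auto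
    then show ?thesis by (simp add: basis_vector_def)
  next
    case False
    then have "\<not> (i = length u \<and> w = u @ v)" by auto
    moreover have "basis_vector K u (take i w) \<otimes>\<^bsub>K\<^esub> basis_vector K v (drop i w) = \<zero>\<^bsub>K\<^esub>"
      using False by (auto simp: basis_vector_def)
    ultimately show ?thesis by simp
  qed
  have "(basis_vector K u \<otimes>\<^bsub>word_algebra\<^esub> basis_vector K v) w =
      (\<Oplus>\<^bsub>K\<^esub>i\<in>{..length w}. if i = length u then (if w = u @ v then \<one>\<^bsub>K\<^esub> else \<zero>\<^bsub>K\<^esub>) else \<zero>\<^bsub>K\<^esub>)"
    unfolding mult_eq
    by (intro K.finsum_cong') (simp_all add: *)
  also have "\<dots> = basis_vector K (u @ v) w"
  proof (cases "w = u @ v")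
    case True
    then show ?thesis
      using K.add.finprod_singleton_swap[of "length u" "{..length w}" "\<lambda>_. \<one>\<^bsub>K\<^esub>"]
      by (simp add: basis_vector_def cong: if_cong)
  qed (simp add: basis_vector_def cong: if_cong)
  finally show "(basis_vector K u \<otimes>\<^bsub>word_algebra\<^esub> basis_vector K v) w = basis_vector K (u @ v) w" .
qed

private lemma pointwise:
  "(h \<oplus>\<^bsub>word_algebra\<^esub> h') w = h w \<oplus>\<^bsub>K\<^esub> h' w" "(k \<odot>\<^bsub>word_algebra\<^esub> h) w = k \<otimes>\<^bsub>K\<^esub> h w" "\<zero>\<^bsub>word_algebra\<^esub> w = \<zero>\<^bsub>K\<^esub>"
  by (simp_all add: free_algebra_def free_space_def)

private lemma mult_add:
  assumes "f \<in> carrier word_algebra" "f' \<in> carrier word_algebra" "g \<in> carrier word_algebra"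
  shows "(f \<oplus>\<^bsub>word_algebra\<^esub> f') \<otimes>\<^bsub>word_algebra\<^esub> g = f \<otimes>\<^bsub>word_algebra\<^esub> g \<oplus>\<^bsub>word_algebra\<^esub> f' \<otimes>\<^bsub>word_algebra\<^esub> g"
    and "g \<otimes>\<^bsub>word_algebra\<^esub> (f \<oplus>\<^bsub>word_algebra\<^esub> f') = g \<otimes>\<^bsub>word_algebra\<^esub> f \<oplus>\<^bsub>word_algebra\<^esub> g \<otimes>\<^bsub>word_algebra\<^esub> f'"
  by (rule ext, simp add: assms pointwise mult_eq val K.finsum_addf K.l_distr K.r_distr)+

private lemma mult_smult:
  assumes "k \<in> carrier K" "f \<in> carrier word_algebra" "g \<in> carrier word_algebra"
  shows "(k \<odot>\<^bsub>word_algebra\<^esub> f) \<otimes>\<^bsub>word_algebra\<^esub> g = k \<odot>\<^bsub>word_algebra\<^esub> (f \<otimes>\<^bsub>word_algebra\<^esub> g)"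
    and "g \<otimes>\<^bsub>word_algebra\<^esub> (k \<odot>\<^bsub>word_algebra\<^esub> f) = k \<odot>\<^bsub>word_algebra\<^esub> (g \<otimes>\<^bsub>word_algebra\<^esub> f)"
  by (rule ext, simp add: assms pointwise mult_eq val K.finsum_rdistr K.m_assoc K.m_lcomm)+

private lemma mult_zero:
  assumes "g \<in> carrier word_algebra"
  shows "\<zero>\<^bsub>word_algebra\<^esub> \<otimes>\<^bsub>word_algebra\<^esub> g = \<zero>\<^bsub>word_algebra\<^esub>" and "g \<otimes>\<^bsub>word_algebra\<^esub> \<zero>\<^bsub>word_algebra\<^esub> = \<zero>\<^bsub>word_algebra\<^esub>"
  by (rule ext, simp add: assms pointwise mult_eq val)+

private lemmas mult_laws = mult_add mult_smult mult_zero

text \<open>Finiteness of the support is not visible in the convolution formula. The distributive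
  laws are pointwise identities and hold before closedness is known, so the claim reduces to two
  words, whose product is their concatenation.\<close>

private lemma mult_closed:
  assumes f: "f \<in> carrier word_algebra" and g: "g \<in> carrier word_algebra"
  shows "f \<otimes>\<^bsub>word_algebra\<^esub> g \<in> carrier word_algebra"
proof -
  note induct = free_space_induct[OF cK, where S = "lists S", folded fields, consumes 1, case_names zero basis add smult]
  have 1: "basis_vector K u \<otimes>\<^bsub>word_algebra\<^esub> g \<in> carrier word_algebra" if u: "u \<in> lists S" for u
    using g
  proof (induction g rule: induct)
    case (basis v)
    then show ?case using u by (simp add: mult_basis basis_closed)
  qed (simp_all add: mult_laws basis_closed[OF u])
  show ?thesis using f
    by (induction f rule: induct) (simp_all add: 1 mult_laws g)
qed

private lemma mult_bilin: "mult word_algebra \<in> bilinear_maps K word_algebra word_algebra word_algebra"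
  by (intro bilinear_mapsI linear_mapsI) (simp_all add: mult_closed mult_laws)

private lemma one_eq: "\<one>\<^bsub>word_algebra\<^esub> = basis_vector K []"
  by (simp add: free_algebra_def)

private lemma one_closed: "\<one>\<^bsub>word_algebra\<^esub> \<in> carrier word_algebra"
  unfolding one_eq by (rule basis_closed) (rule lists.Nil)

private lemmas one = one_eq one_closed

text \<open>Both sides of each law are linear in every argument, so associativity is reduced to
  words one argument at a time, where it is associativity of concatenation.\<close>

lemma k_algebra_free_algebra: "k_algebra K word_algebra"
proof (rule k_algebraI[OF K mod mult_bilin one(2)])
  note l = bilin_left[OF mult_bilin] and r = bilin_right[OF mult_bilin]
  show "\<one>\<^bsub>word_algebra\<^esub> \<otimes>\<^bsub>word_algebra\<^esub> f = f" if "f \<in> carrier word_algebra" for f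
    by (rule fext[OF mod r lin_id]) (simp_all add: one_eq mult_basis that basis_closed)
  show "f \<otimes>\<^bsub>word_algebra\<^esub> \<one>\<^bsub>word_algebra\<^esub> = f" if "f \<in> carrier word_algebra" for f
    by (rule fext[OF mod l lin_id]) (simp_all add: one_eq mult_basis that basis_closed)
  fix f g h assume f: "f \<in> carrier word_algebra" and g: "g \<in> carrier word_algebra" and h: "h \<in> carrier word_algebra"
  have 1: "(basis_vector K u \<otimes>\<^bsub>word_algebra\<^esub> basis_vector K v) \<otimes>\<^bsub>word_algebra\<^esub> h = basis_vector K u \<otimes>\<^bsub>word_algebra\<^esub> (basis_vector K v \<otimes>\<^bsub>word_algebra\<^esub> h)"
    if "u \<in> lists S" "v \<in> lists S" for u v
    by (rule fext[OF mod r lin_compose[OF r r] _ h]) (simp_all add: that basis_closed mult_closed mult_basis)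
  have 2: "(basis_vector K u \<otimes>\<^bsub>word_algebra\<^esub> g) \<otimes>\<^bsub>word_algebra\<^esub> h = basis_vector K u \<otimes>\<^bsub>word_algebra\<^esub> (g \<otimes>\<^bsub>word_algebra\<^esub> h)" if "u \<in> lists S" for u
    by (rule fext[OF mod lin_compose[OF r l] lin_compose[OF l r] _ g])
      (simp_all add: that h basis_closed 1)
  show "(f \<otimes>\<^bsub>word_algebra\<^esub> g) \<otimes>\<^bsub>word_algebra\<^esub> h = f \<otimes>\<^bsub>word_algebra\<^esub> (g \<otimes>\<^bsub>word_algebra\<^esub> h)"
    by (rule fext[OF mod lin_compose[OF l l] l _ f]) (simp_all add: g h mult_closed 2)
qed

lemma letter_closed: "s \<in> S \<Longrightarrow> basis_vector K [s] \<in> carrier word_algebra"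
  by (simp add: basis_closed)

text \<open>A word acts by composing the maps of its letters, the last letter acting first;
  concatenation of words then becomes composition.\<close>

lemma free_algebra_lift:
  assumes N: "module K N" and \<phi>: "\<And>s. s \<in> S \<Longrightarrow> \<phi> s \<in> linear_maps K N N"
  shows "\<exists>\<rho>. representation K word_algebra N \<rho> \<and> (\<forall>s\<in>S. \<forall>n\<in>carrier N. \<rho> (basis_vector K [s]) n = \<phi> s n)"
proof -
  have word: "foldr \<phi> w \<in> linear_maps K N N" if "w \<in> lists S" for w
    using that
  proof (induction w)
    case Nil
    show ?case using lin_id by (simp add: id_def)
  next
    case (Cons s w)
    then show ?case using lin_compose[OF Cons.IH \<phi>[of s]] by (simp add: comp_def)
  qed
  \<comment> \<open>The action is built with \<open>n\<close> fixed, as a linear map in the algebra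
    element. Linearity in \<open>n\<close> is recovered afterwards by comparing the maps on
    words.\<close>
  have "\<forall>n\<in>carrier N. \<exists>h. h \<in> linear_maps K word_algebra N \<and> (\<forall>w\<in>lists S. h (basis_vector K w) = foldr \<phi> w n)"
  proof
    fix n assume n: "n \<in> carrier N"
    from free_space_lift[OF cK N, of "lists S" "\<lambda>w. foldr \<phi> w n"]
    show "\<exists>h. h \<in> linear_maps K word_algebra N \<and> (\<forall>w\<in>lists S. h (basis_vector K w) = foldr \<phi> w n)"
      unfolding linF using lin_closed[OF word n] by auto
  qed
  from bchoice[OF this] obtain r where r: "\<And>n. n \<in> carrier N \<Longrightarrow> r n \<in> linear_maps K word_algebra N"
    and rb: "\<And>n w. \<lbrakk>n \<in> carrier N; w \<in> lists S\<rbrakk> \<Longrightarrow> r n (basis_vector K w) = foldr \<phi> w n"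
    by auto
  interpret N: module K N by (rule N)
  interpret alg: k_algebra K word_algebra by (rule k_algebra_free_algebra)
  note w = lin_closed[OF word] lin_add[OF word] lin_smult[OF word]
  define \<rho> where "\<rho> f n = r n f" for f n
  have lin: "\<rho> f \<in> linear_maps K N N" if f: "f \<in> carrier word_algebra" for f
  proof (rule linear_mapsI)
    fix m n assume mn [simp]: "m \<in> carrier N" "n \<in> carrier N"
    show "\<rho> f m \<in> carrier N" using lin_closed[OF r f] by (simp add: \<rho>_def)
    show "\<rho> f (m \<oplus>\<^bsub>N\<^esub> n) = \<rho> f m \<oplus>\<^bsub>N\<^esub> \<rho> f n"
      unfolding \<rho>_def by (rule fext[OF N r lin_plus[OF r r N] _ f]) (simp_all add: rb w)
    fix k assume k [simp]: "k \<in> carrier K"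
    show "\<rho> f (k \<odot>\<^bsub>N\<^esub> n) = k \<odot>\<^bsub>N\<^esub> \<rho> f n"
      unfolding \<rho>_def by (rule fext[OF N r lin_scale[OF r N] _ f]) (simp_all add: rb w)
  qed
  note l = bilin_left[OF mult_bilin] and r' = bilin_right[OF mult_bilin]
  have "representation K word_algebra N \<rho>"
  proof (rule representationI)
    show "\<rho> \<in> bilinear_maps K word_algebra N N"
      using lin r by (auto simp: bilinear_maps_def \<rho>_def[abs_def])
    fix n assume n: "n \<in> carrier N"
    show "\<rho> \<one>\<^bsub>word_algebra\<^esub> n = n" using n by (simp add: \<rho>_def one rb)
    fix f g assume f: "f \<in> carrier word_algebra" and g: "g \<in> carrier word_algebra"
    have rg: "\<rho> g n \<in> carrier N" using lin_closed[OF lin] g n by simp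
    have "\<rho> (basis_vector K u \<otimes>\<^bsub>word_algebra\<^esub> g) n = \<rho> (basis_vector K u) (\<rho> g n)" if u: "u \<in> lists S" for u
    proof -
      have "r n (basis_vector K u \<otimes>\<^bsub>word_algebra\<^esub> g) = foldr \<phi> u (r n g)"
        by (rule fext[OF N lin_compose[OF r' r] lin_compose[OF r word] _ g])
          (simp_all add: u n basis_closed mult_basis rb)
      then show ?thesis using u rg by (simp add: \<rho>_def rb)
    qed
    then show "\<rho> (f \<otimes>\<^bsub>word_algebra\<^esub> g) n = \<rho> f (\<rho> g n)"
      using rg n g unfolding \<rho>_def
      by (intro fext[OF N lin_compose[OF l r] r _ f]) simp_all
  qed
  then show ?thesis using rb[of _ "[_]"] by (intro exI[of _ \<rho>]) (auto simp: \<rho>_def)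
qed

lemma free_algebra_generated: "generated_by K word_algebra ((\<lambda>s. basis_vector K [s]) ` S)"
proof (rule generated_byI)
  fix H assume H: "subalgebra K word_algebra H" "(\<lambda>s. basis_vector K [s]) ` S \<subseteq> H"
  note sub = subalgebraD[OF H(1)]
  have word: "basis_vector K w \<in> H" if "w \<in> lists S" for w
    using that
  proof (induction w)
    case Nil
    show ?case using sub(2) by (simp add: one)
  next
    case (Cons s w)
    then have "basis_vector K [s] \<otimes>\<^bsub>word_algebra\<^esub> basis_vector K w \<in> H" using H(2) by (intro sub) auto
    then show ?case by (simp add: mult_basis)
  qed
  interpret alg: k_algebra K word_algebra by (rule k_algebra_free_algebra)
  have zero: "\<zero>\<^bsub>word_algebra\<^esub> \<in> H" using sub(5)[of "\<zero>\<^bsub>K\<^esub>" "\<one>\<^bsub>word_algebra\<^esub>"] sub(2) by simp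
  show "carrier word_algebra \<subseteq> H"
  proof
    fix f assume "f \<in> carrier word_algebra"
    then show "f \<in> H"
      by (induction f rule: free_space_induct[OF cK, where S = "lists S", folded fields, consumes 1, case_names zero basis add smult])
        (auto simp: zero word sub)
  qed
qed

end

section \<open>Quotients by two-sided ideals and the representations they inherit\<close>

locale quotient_algebra = F: k_algebra K F + I: ideal I F
  for K :: "'k ring" and F :: "('k, 'f) module" and I
begin

text \<open>Ideals of rings know nothing about \<open>K\<close>, but in a unital algebra k x = (k 1)
  x.\<close>

lemma ideal_smult:
  assumes "k \<in> carrier K" "x \<in> I"
  shows "k \<odot>\<^bsub>F\<^esub> x \<in> I"
proof -
  have "(k \<odot>\<^bsub>F\<^esub> \<one>\<^bsub>F\<^esub>) \<otimes>\<^bsub>F\<^esub> x \<in> I" using assms by (intro I.I_l_closed) auto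
  then show ?thesis using assms I.Icarr F.smult_mult_left by simp
qed

sublocale quotient_module K F I
  by (intro quotient_module.intro quotient_module_axioms.intro submoduleI' F.A.module_axioms)
    (simp_all add: ideal_smult subsetI)

lemma mult_quotient: "\<lbrakk>x \<in> carrier F; y \<in> carrier F\<rbrakk> \<Longrightarrow> cls x \<otimes>\<^bsub>quotient F I\<^esub> cls y = cls (x \<otimes>\<^bsub>F\<^esub> y)"
  by (simp add: quotient_def I.rcoset_mult_add)

lemma one_quotient: "\<one>\<^bsub>quotient F I\<^esub> = cls \<one>\<^bsub>F\<^esub>"
  by (simp add: quotient_def)

lemmas alg_simps = quotient_simps mult_quotient one_quotient

lemma k_algebra_quotient: "k_algebra K (quotient F I)"
  by (rule k_algebraI[OF F.K.field_axioms module_quotient])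
    (auto intro!: bilinear_mapsI linear_mapsI
      simp: alg_simps F.A.l_distr F.A.r_distr F.smult_mult_left F.smult_mult_right F.A.m_assoc)

lemma quotient_generated:
  assumes "generated_by K F G" "G \<subseteq> carrier F"
  shows "generated_by K (quotient F I) (cls ` G)"
proof (rule generated_byI)
  fix H assume H: "subalgebra K (quotient F I) H" "cls ` G \<subseteq> H"
  have "subalgebra K F {x \<in> carrier F. cls x \<in> H}"
    by (rule subalgebraI) (use subalgebraD(2-5)[OF H(1)] in \<open>auto simp: add_quotient[symmetric]
        smult_quotient[symmetric] mult_quotient[symmetric] one_quotient[symmetric]\<close>)
  then have "carrier F \<subseteq> {x \<in> carrier F. cls x \<in> H}"
    by (rule generated_byD[OF assms(1)]) (use H assms in auto)
  then show "carrier (quotient F I) \<subseteq> H" by (auto simp: alg_simps)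
qed

text \<open>For fixed \<open>n\<close>, acting on \<open>n\<close> factors through the quotient. The
  factorisations, chosen separately for each \<open>n\<close>, fit together into an action because
  they are determined on classes.\<close>

lemma representation_quotient:
  assumes N: "module K N" and \<rho>: "representation K F N \<rho>"
    and 0: "\<And>f n. \<lbrakk>f \<in> I; n \<in> carrier N\<rbrakk> \<Longrightarrow> \<rho> f n = \<zero>\<^bsub>N\<^esub>"
  shows "\<exists>\<rho>'. representation K (quotient F I) N \<rho>' \<and>
    (\<forall>f\<in>carrier F. \<forall>n\<in>carrier N. \<rho>' (cls f) n = \<rho> f n)"
proof -
  note b = representationD[OF \<rho>]
  have "\<forall>n\<in>carrier N. \<exists>h. h \<in> linear_maps K (quotient F I) N \<and> (\<forall>f\<in>carrier F. h (cls f) = \<rho> f n)"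
  proof
    fix n assume n: "n \<in> carrier N"
    from quotient_lift[OF bilin_left[OF b(1) n] N 0[OF _ n]]
    show "\<exists>h. h \<in> linear_maps K (quotient F I) N \<and> (\<forall>f\<in>carrier F. h (cls f) = \<rho> f n)"
      by auto
  qed
  from bchoice[OF this] obtain r where r: "\<And>n. n \<in> carrier N \<Longrightarrow> r n \<in> linear_maps K (quotient F I) N"
    and rb: "\<And>n f. \<lbrakk>n \<in> carrier N; f \<in> carrier F\<rbrakk> \<Longrightarrow> r n (cls f) = \<rho> f n"
    by auto
  interpret N: module K N by (rule N)
  have "representation K (quotient F I) N (\<lambda>C n. r n C)"
    by (rule representationI)
      (use b(2,3) r in \<open>auto intro!: bilinear_mapsI linear_mapsI simp: alg_simps rb bilin_closed[OF b(1)]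
        lin_add[OF bilin_right[OF b(1)]] lin_add[OF bilin_left[OF b(1)]]
        lin_smult[OF bilin_right[OF b(1)]] lin_smult[OF bilin_left[OF b(1)]]\<close>)
  then show ?thesis using rb by blast
qed

end

text \<open>The annihilator of a module is a two-sided ideal. So a representation passes to a
  presented algebra once the listed relations act as zero.\<close>

lemma representation_kernel_ideal:
  assumes F: "k_algebra K F" and N: "module K N" and \<rho>: "representation K F N \<rho>"
    and R: "R \<subseteq> carrier F" and 0: "\<And>f n. \<lbrakk>f \<in> R; n \<in> carrier N\<rbrakk> \<Longrightarrow> \<rho> f n = \<zero>\<^bsub>N\<^esub>"
    and f: "f \<in> genideal F R" and n: "n \<in> carrier N"
  shows "\<rho> f n = \<zero>\<^bsub>N\<^esub>"
proof -
  interpret F: k_algebra K F by (rule F)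
  interpret N: module K N by (rule N)
  note b = representationD[OF \<rho>]
  note l = bilin_left[OF b(1)] and r = bilin_right[OF b(1)]
  let ?I = "{f \<in> carrier F. \<forall>n\<in>carrier N. \<rho> f n = \<zero>\<^bsub>N\<^esub>}"
  have "submodule ?I K F"
    by (rule submoduleI'[OF F.A.module_axioms])
      (auto simp: lin_zero[OF l] lin_add[OF l] lin_smult[OF l] F.A.module_axioms N)
  then have "ideal ?I F"
    by (intro idealI F.A.ring_axioms)
      (auto simp: submodule_def b bilin_closed[OF b(1)] lin_zero[OF r] N)
  then have "genideal F R \<subseteq> ?I" using R 0 by (intro F.A.genideal_minimal) auto
  then show ?thesis using f n by blast
qed

section \<open>Representations of tensor algebras and free products\<close>

lemma (in quotient_algebra) cls_linear_relations:
  assumes "module K M" and j: "\<And>x. x \<in> carrier M \<Longrightarrow> j x \<in> carrier F"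
    and I: "linear_relations K F M j \<subseteq> I"
  shows "(\<lambda>x. cls (j x)) \<in> linear_maps K M (quotient F I)"
proof -
  interpret M: module K M by fact
  show ?thesis
  proof (rule linear_mapsI)
    fix x y assume xy: "x \<in> carrier M" "y \<in> carrier M"
    then have "j (x \<oplus>\<^bsub>M\<^esub> y) \<ominus>\<^bsub>F\<^esub> (j x \<oplus>\<^bsub>F\<^esub> j y) \<in> I"
      using I unfolding linear_relations_def by blast
    then show "cls (j (x \<oplus>\<^bsub>M\<^esub> y)) = cls (j x) \<oplus>\<^bsub>quotient F I\<^esub> cls (j y)"
      using j xy by (simp add: add_quotient cls_eq_iff)
  next
    fix k x assume kx: "k \<in> carrier K" "x \<in> carrier M"
    then have "j (k \<odot>\<^bsub>M\<^esub> x) \<ominus>\<^bsub>F\<^esub> k \<odot>\<^bsub>F\<^esub> j x \<in> I"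
      using I unfolding linear_relations_def by blast
    then show "cls (j (k \<odot>\<^bsub>M\<^esub> x)) = k \<odot>\<^bsub>quotient F I\<^esub> cls (j x)"
      using j kx by (simp add: smult_quotient cls_eq_iff)
  qed (use j in \<open>simp add: carrier_quotient\<close>)
qed

text \<open>This is all that \<^const>\<open>algebra_relations\<close> needs, so associativity of \<open>A\<^sup>e\<close> never has to be
  proved.\<close>

locale weak_algebra = module K R for K :: "'k ring" and R :: "('k, 'r) module" +
  assumes weak_one_closed: "\<one>\<^bsub>R\<^esub> \<in> carrier R"
    and weak_mult_closed: "\<lbrakk>x \<in> carrier R; y \<in> carrier R\<rbrakk> \<Longrightarrow> x \<otimes>\<^bsub>R\<^esub> y \<in> carrier R"

lemma (in k_algebra) weak_algebra: "weak_algebra K A"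
  by (intro weak_algebra.intro weak_algebra_axioms.intro A.module_axioms) auto

lemma algebra_relations_closed:
  assumes "k_algebra K F" "weak_algebra K R" and j: "\<And>x. x \<in> carrier R \<Longrightarrow> j x \<in> carrier F"
  shows "algebra_relations K F R j \<subseteq> carrier F"
proof -
  interpret F: k_algebra K F by fact
  interpret R: weak_algebra K R by fact
  show ?thesis
    using linear_relations_closed[OF F.A.module_axioms R.module_axioms j]
    by (auto simp: algebra_relations_def j R.weak_one_closed R.weak_mult_closed)
qed

text \<open>If the letters \<open>j x\<close> act through \<sigma>, the relations turn into
  linearity, multiplicativity and unitality of \<sigma>.\<close>

lemma algebra_relations_vanish:
  assumes "k_algebra K F" "weak_algebra K R" and N: "module K N"
    and j: "\<And>x. x \<in> carrier R \<Longrightarrow> j x \<in> carrier F"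
    and \<rho>: "representation K F N \<rho>" and \<sigma>: "representation K R N \<sigma>"
    and \<rho>\<sigma>: "\<And>x n. \<lbrakk>x \<in> carrier R; n \<in> carrier N\<rbrakk> \<Longrightarrow> \<rho> (j x) n = \<sigma> x n"
    and x: "x \<in> algebra_relations K F R j" and n: "n \<in> carrier N"
  shows "\<rho> x n = \<zero>\<^bsub>N\<^esub>"
proof -
  interpret F: k_algebra K F by fact
  interpret R: weak_algebra K R by fact
  interpret N: module K N by fact
  note F = F.A.module_axioms
  note l = bilin_left[OF representationD(1)[OF \<rho>] n] and c = bilin_closed[OF representationD(1)[OF \<sigma>]]
  have "\<rho> x n = \<zero>\<^bsub>N\<^esub>" if "x \<in> linear_relations K F R j"
    by (rule linear_relations_vanish[OF F R.module_axioms N j l \<rho>\<sigma>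
          bilin_left[OF representationD(1)[OF \<sigma>] n] that]) (simp_all add: n)
  then show ?thesis using x n
    by (auto simp: algebra_relations_def lin_diff[OF l F N] j R.weak_one_closed R.weak_mult_closed
        representationD[OF \<rho>] representationD[OF \<sigma>] \<rho>\<sigma> N.diff_eq_zero_iff c)
qed

lemma (in quotient_algebra) cls_algebra_relations:
  assumes "weak_algebra K R" and j: "\<And>x. x \<in> carrier R \<Longrightarrow> j x \<in> carrier F"
    and I: "algebra_relations K F R j \<subseteq> I"
  shows "(\<lambda>x. cls (j x)) \<in> algebra_homs K R (quotient F I)"
proof -
  interpret R: weak_algebra K R by fact
  have "(\<lambda>x. cls (j x)) \<in> linear_maps K R (quotient F I)"
    by (rule cls_linear_relations[OF R.module_axioms]) (use j I in \<open>auto simp: algebra_relations_def\<close>)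
  moreover from this have "(\<lambda>x. cls (j x)) \<in> ring_hom R (quotient F I)"
  proof (intro ring_hom_memI)
    fix x y assume xy: "x \<in> carrier R" "y \<in> carrier R"
    then have "j (x \<otimes>\<^bsub>R\<^esub> y) \<ominus>\<^bsub>F\<^esub> j x \<otimes>\<^bsub>F\<^esub> j y \<in> I"
      using I unfolding algebra_relations_def by blast
    then show "cls (j (x \<otimes>\<^bsub>R\<^esub> y)) = cls (j x) \<otimes>\<^bsub>quotient F I\<^esub> cls (j y)"
      using j xy R.weak_mult_closed by (simp add: mult_quotient cls_eq_iff)
  next
    show "cls (j \<one>\<^bsub>R\<^esub>) = \<one>\<^bsub>quotient F I\<^esub>"
      using I j R.weak_one_closed by (simp add: one_quotient cls_eq_iff algebra_relations_def)
  qed (auto simp: linear_maps_def)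
  ultimately show ?thesis by (simp add: algebra_homs_def)
qed

lemma generated_by_mono: "\<lbrakk>generated_by K F G; G \<subseteq> G'\<rbrakk> \<Longrightarrow> generated_by K F G'"
  by (auto simp: generated_by_def)

lemma algebra_homs_linear: "f \<in> algebra_homs K A B \<Longrightarrow> f \<in> linear_maps K A B"
  by (simp add: algebra_homs_def)

lemma algebra_homs_mult: "\<lbrakk>f \<in> algebra_homs K A B; x \<in> carrier A; y \<in> carrier A\<rbrakk> \<Longrightarrow> f (x \<otimes>\<^bsub>A\<^esub> y) = f x \<otimes>\<^bsub>B\<^esub> f y"
  by (simp add: algebra_homs_def ring_hom_mult)

lemma algebra_homs_one: "f \<in> algebra_homs K A B \<Longrightarrow> f \<one>\<^bsub>A\<^esub> = \<one>\<^bsub>B\<^esub>"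
  by (simp add: algebra_homs_def ring_hom_one)

text \<open>The preimage of a subalgebra under an algebra map is a subalgebra.\<close>

lemma generated_by_hom:
  assumes A: "generated_by K A G" "k_algebra K A" and f: "f \<in> algebra_homs K A B"
    and H: "subalgebra K B H" and G: "G \<subseteq> carrier A" "f ` G \<subseteq> H"
  shows "f ` carrier A \<subseteq> H"
proof -
  interpret A: k_algebra K A by fact
  have "subalgebra K A {x \<in> carrier A. f x \<in> H}"
    by (rule subalgebraI)
      (auto simp: algebra_homs_one[OF f] algebra_homs_mult[OF f] lin_add[OF algebra_homs_linear[OF f]]
        lin_smult[OF algebra_homs_linear[OF f]] subalgebraD[OF H])
  then have "carrier A \<subseteq> {x \<in> carrier A. f x \<in> H}"
    by (rule generated_byD[OF A(1)]) (use G in auto)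
  then show ?thesis by auto
qed

section \<open>The tensor algebra of a bimodule and its modules\<close>

context
  fixes K :: "'k ring" and R :: "('k, 'r) module" and V :: "('k, 'r, 'v) bimodule"
  assumes K: "field K" and R: "weak_algebra K R" and V: "module K V"
    and l: "\<And>r v. \<lbrakk>r \<in> carrier R; v \<in> carrier V\<rbrakk> \<Longrightarrow> r \<triangleright>\<^bsub>V\<^esub> v \<in> carrier V"
    and r: "\<And>r v. \<lbrakk>r \<in> carrier R; v \<in> carrier V\<rbrakk> \<Longrightarrow> v \<triangleleft>\<^bsub>V\<^esub> r \<in> carrier V"
begin

interpretation R: weak_algebra K R by (rule R)
interpretation V: module K V by (rule V)

private abbreviation "S \<equiv> carrier R <+> carrier V"
private abbreviation "F \<equiv> ta_free K R V"
private abbreviation "i r \<equiv> basis_vector K [Inl r]"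
private abbreviation "j v \<equiv> basis_vector K [Inr v]"

interpretation F: k_algebra K F
  unfolding ta_free_def by (rule k_algebra_free_algebra[OF K])

private lemma letters: "r \<in> carrier R \<Longrightarrow> i r \<in> carrier F" "v \<in> carrier V \<Longrightarrow> j v \<in> carrier F"
  by (auto simp: ta_free_def intro!: letter_closed[OF K])

private definition "rel = algebra_relations K F R i \<union> linear_relations K F V j \<union>
       {i r \<otimes>\<^bsub>F\<^esub> j v \<ominus>\<^bsub>F\<^esub> j (r \<triangleright>\<^bsub>V\<^esub> v) |r v. r \<in> carrier R \<and> v \<in> carrier V} \<union>
       {j v \<otimes>\<^bsub>F\<^esub> i r \<ominus>\<^bsub>F\<^esub> j (v \<triangleleft>\<^bsub>V\<^esub> r) |r v. r \<in> carrier R \<and> v \<in> carrier V}"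

private lemma ideal_eq: "ta_ideal K R V = genideal F rel"
  by (simp add: ta_ideal_def rel_def Let_def)

private lemma rel_closed: "rel \<subseteq> carrier F"
  using algebra_relations_closed[OF F.k_algebra_axioms R, where j = i, OF letters(1)]
    linear_relations_closed[OF F.A.module_axioms V, where j = j, OF letters(2)]
  by (auto simp: rel_def letters l r)

private lemma rel_ideal: "rel \<subseteq> ta_ideal K R V"
  unfolding ideal_eq by (rule F.A.genideal_self[OF rel_closed])

interpretation Q: quotient_algebra K F "ta_ideal K R V"
  unfolding ideal_eq
  by (intro quotient_algebra.intro F.k_algebra_axioms F.A.genideal_ideal rel_closed)

private lemma Q: "tensor_algebra K R V = quotient F (ta_ideal K R V)"
  "ta_base K R V = (\<lambda>r. Q.cls (i r))" "ta_gen K R V = (\<lambda>v. Q.cls (j v))"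
  by (auto simp: tensor_algebra_def ta_base_def ta_gen_def)

lemma k_algebra_tensor_algebra: "k_algebra K (tensor_algebra K R V)"
  unfolding Q by (rule Q.k_algebra_quotient)

lemma ta_base_hom: "ta_base K R V \<in> algebra_homs K R (tensor_algebra K R V)"
  unfolding Q by (rule Q.cls_algebra_relations[OF R letters(1)]) (use rel_ideal in \<open>auto simp: rel_def\<close>)

lemma ta_gen_linear: "ta_gen K R V \<in> linear_maps K V (tensor_algebra K R V)"
  unfolding Q by (rule Q.cls_linear_relations[OF V letters(2)]) (use rel_ideal in \<open>auto simp: rel_def\<close>)

lemma ta_base_gen:
  assumes "r \<in> carrier R" "v \<in> carrier V"
  shows "ta_base K R V r \<otimes>\<^bsub>tensor_algebra K R V\<^esub> ta_gen K R V v = ta_gen K R V (r \<triangleright>\<^bsub>V\<^esub> v)"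
    and "ta_gen K R V v \<otimes>\<^bsub>tensor_algebra K R V\<^esub> ta_base K R V r = ta_gen K R V (v \<triangleleft>\<^bsub>V\<^esub> r)"
proof -
  have "i r \<otimes>\<^bsub>F\<^esub> j v \<ominus>\<^bsub>F\<^esub> j (r \<triangleright>\<^bsub>V\<^esub> v) \<in> rel" "j v \<otimes>\<^bsub>F\<^esub> i r \<ominus>\<^bsub>F\<^esub> j (v \<triangleleft>\<^bsub>V\<^esub> r) \<in> rel"
    using assms unfolding rel_def by blast+
  with rel_ideal assms
  show "ta_base K R V r \<otimes>\<^bsub>tensor_algebra K R V\<^esub> ta_gen K R V v = ta_gen K R V (r \<triangleright>\<^bsub>V\<^esub> v)"
    "ta_gen K R V v \<otimes>\<^bsub>tensor_algebra K R V\<^esub> ta_base K R V r = ta_gen K R V (v \<triangleleft>\<^bsub>V\<^esub> r)"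
    unfolding Q by (auto simp: Q.mult_quotient letters Q.cls_eq_iff l r)
qed

lemma tensor_algebra_generated:
  "generated_by K (tensor_algebra K R V) (ta_base K R V ` carrier R \<union> ta_gen K R V ` carrier V)"
proof -
  have "generated_by K F ((\<lambda>s. basis_vector K [s]) ` S)"
    unfolding ta_free_def by (rule free_algebra_generated[OF K])
  then have "generated_by K (quotient F (ta_ideal K R V)) (Q.cls ` ((\<lambda>s. basis_vector K [s]) ` S))"
    by (rule Q.quotient_generated) (use letters in auto)
  then show ?thesis unfolding Q by (rule generated_by_mono) auto
qed

text \<open>A module over the tensor algebra amounts to an \<open>R\<close>-module with a bilinear
  action of \<open>V\<close> by operators. The hypotheses \<open>lm\<close> and \<open>rm\<close>
  say that the two families of mixed relations act as zero.\<close>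

lemma tensor_algebra_representation:
  assumes N: "module K N" and \<sigma>: "representation K R N \<sigma>" and m: "m \<in> bilinear_maps K V N N"
    and lm: "\<And>r v n. \<lbrakk>r \<in> carrier R; v \<in> carrier V; n \<in> carrier N\<rbrakk> \<Longrightarrow> \<sigma> r (m v n) = m (r \<triangleright>\<^bsub>V\<^esub> v) n"
    and rm: "\<And>r v n. \<lbrakk>r \<in> carrier R; v \<in> carrier V; n \<in> carrier N\<rbrakk> \<Longrightarrow> m v (\<sigma> r n) = m (v \<triangleleft>\<^bsub>V\<^esub> r) n"
  shows "\<exists>\<rho>. representation K (tensor_algebra K R V) N \<rho> \<and>
    (\<forall>r\<in>carrier R. \<forall>n\<in>carrier N. \<rho> (ta_base K R V r) n = \<sigma> r n) \<and>
    (\<forall>v\<in>carrier V. \<forall>n\<in>carrier N. \<rho> (ta_gen K R V v) n = m v n)"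
proof -
  interpret N: module K N by (rule N)
  note sb = representationD(1)[OF \<sigma>]
  have c: "case_sum \<sigma> m s \<in> linear_maps K N N" if "s \<in> S" for s
    using that bilin_right[OF sb] bilin_right[OF m] by auto
  have "\<exists>\<rho>. representation K F N \<rho> \<and>
      (\<forall>s\<in>S. \<forall>n\<in>carrier N. \<rho> (basis_vector K [s]) n = case_sum \<sigma> m s n)"
    unfolding ta_free_def by (rule free_algebra_lift[OF K N c])
  then obtain \<rho> where \<rho>: "representation K F N \<rho>"
    and \<rho>S: "\<forall>s\<in>S. \<forall>n\<in>carrier N. \<rho> (basis_vector K [s]) n = case_sum \<sigma> m s n"
    by (elim exE conjE) (rule that)
  have \<rho>i: "\<rho> (i r) n = \<sigma> r n" if "r \<in> carrier R" "n \<in> carrier N" for r n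
    using \<rho>S[THEN bspec, OF InlI[OF that(1)], THEN bspec, OF that(2)] by simp
  have \<rho>j: "\<rho> (j v) n = m v n" if "v \<in> carrier V" "n \<in> carrier N" for v n
    using \<rho>S[THEN bspec, OF InrI[OF that(1)], THEN bspec, OF that(2)] by simp
  note F = F.A.module_axioms
  have "\<rho> f n = \<zero>\<^bsub>N\<^esub>" if f: "f \<in> rel" and n: "n \<in> carrier N" for f n
  proof -
    note ll = bilin_left[OF representationD(1)[OF \<rho>] n]
    have "\<rho> f n = \<zero>\<^bsub>N\<^esub>" if "f \<in> algebra_relations K F R i"
      by (rule algebra_relations_vanish[OF F.k_algebra_axioms R N letters(1) \<rho> \<sigma> \<rho>i that n])
    moreover have "\<rho> f n = \<zero>\<^bsub>N\<^esub>" if "f \<in> linear_relations K F V j"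
      by (rule linear_relations_vanish[OF F V N letters(2) ll \<rho>j bilin_left[OF m n] that]) (simp_all add: n)
    ultimately show ?thesis using f n
      by (auto simp: rel_def lin_diff[OF ll F N] letters l r representationD[OF \<rho>] \<rho>i \<rho>j lm rm
          N.diff_eq_zero_iff bilin_closed[OF m] bilin_closed[OF sb])
  qed
  from representation_kernel_ideal[OF F.k_algebra_axioms N \<rho> rel_closed this]
  have "\<rho> f n = \<zero>\<^bsub>N\<^esub>" if "f \<in> ta_ideal K R V" "n \<in> carrier N" for f n
    using that unfolding ideal_eq by blast
  from Q.representation_quotient[OF N \<rho> this]
  obtain \<rho>' where "representation K (tensor_algebra K R V) N \<rho>'"
    "\<And>f n. \<lbrakk>f \<in> carrier F; n \<in> carrier N\<rbrakk> \<Longrightarrow> \<rho>' (Q.cls f) n = \<rho> f n"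
    unfolding Q by blast
  then show ?thesis
    by (intro exI[of _ \<rho>']) (simp add: Q(2,3) letters \<rho>i \<rho>j)
qed

end

section \<open>The free product of two algebras and its modules\<close>

context
  fixes K :: "'k ring" and R :: "('k, 'r) module" and S :: "('k, 's) module"
  assumes R: "k_algebra K R" and S: "k_algebra K S"
begin

interpretation R: k_algebra K R by (rule R)
interpretation S: k_algebra K S by (rule S)

private lemma fp_K: "field K" by (rule R.K.field_axioms)

private abbreviation "L \<equiv> carrier R <+> carrier S"
private abbreviation "FP \<equiv> fp_free K R S"
private abbreviation "li r \<equiv> basis_vector K [Inl r]"
private abbreviation "lj v \<equiv> basis_vector K [Inr v]"

interpretation F: k_algebra K FP
  unfolding fp_free_def by (rule k_algebra_free_algebra[OF fp_K])

private lemma fp_letters: "r \<in> carrier R \<Longrightarrow> li r \<in> carrier FP" "v \<in> carrier S \<Longrightarrow> lj v \<in> carrier FP"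
  by (auto simp: fp_free_def intro!: letter_closed[OF fp_K])

private definition "fp_rel = algebra_relations K FP R li \<union> algebra_relations K FP S lj"

private lemma fp_ideal_eq: "fp_ideal K R S = genideal FP fp_rel"
  by (simp add: fp_ideal_def fp_rel_def Let_def)

private lemma fp_rel_closed: "fp_rel \<subseteq> carrier FP"
  using algebra_relations_closed[OF F.k_algebra_axioms R.weak_algebra, where j = li, OF fp_letters(1)]
    algebra_relations_closed[OF F.k_algebra_axioms S.weak_algebra, where j = lj, OF fp_letters(2)]
  by (auto simp: fp_rel_def)

private lemma fp_rel_ideal: "fp_rel \<subseteq> fp_ideal K R S"
  unfolding fp_ideal_eq by (rule F.A.genideal_self[OF fp_rel_closed])

interpretation Q: quotient_algebra K FP "fp_ideal K R S"
  unfolding fp_ideal_eq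
  by (intro quotient_algebra.intro F.k_algebra_axioms F.A.genideal_ideal fp_rel_closed)

private lemma fp_Q: "free_product K R S = quotient FP (fp_ideal K R S)"
  "fp_left K R S = (\<lambda>r. Q.cls (li r))" "fp_right K R S = (\<lambda>v. Q.cls (lj v))"
  by (auto simp: free_product_def fp_left_def fp_right_def)

lemma k_algebra_free_product: "k_algebra K (free_product K R S)"
  unfolding fp_Q by (rule Q.k_algebra_quotient)

lemma fp_left_hom: "fp_left K R S \<in> algebra_homs K R (free_product K R S)"
  unfolding fp_Q by (rule Q.cls_algebra_relations[OF R.weak_algebra fp_letters(1)]) (use fp_rel_ideal in \<open>auto simp: fp_rel_def\<close>)

lemma fp_right_hom: "fp_right K R S \<in> algebra_homs K S (free_product K R S)"
  unfolding fp_Q by (rule Q.cls_algebra_relations[OF S.weak_algebra fp_letters(2)]) (use fp_rel_ideal in \<open>auto simp: fp_rel_def\<close>)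

lemma free_product_generated:
  "generated_by K (free_product K R S) (fp_left K R S ` carrier R \<union> fp_right K R S ` carrier S)"
proof -
  have "generated_by K FP ((\<lambda>s. basis_vector K [s]) ` L)"
    unfolding fp_free_def by (rule free_algebra_generated[OF fp_K])
  then have "generated_by K (quotient FP (fp_ideal K R S)) (Q.cls ` ((\<lambda>s. basis_vector K [s]) ` L))"
    by (rule Q.quotient_generated) (use fp_letters in auto)
  then show ?thesis unfolding fp_Q by (rule generated_by_mono) auto
qed

text \<open>The free product relates letters only within one factor, so any two actions on the same
  space combine.\<close>

lemma free_product_representation:
  assumes N: "module K N" and \<sigma>: "representation K R N \<sigma>" and \<tau>: "representation K S N \<tau>"
  shows "\<exists>\<rho>. representation K (free_product K R S) N \<rho> \<and>
    (\<forall>r\<in>carrier R. \<forall>n\<in>carrier N. \<rho> (fp_left K R S r) n = \<sigma> r n) \<and>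
    (\<forall>s\<in>carrier S. \<forall>n\<in>carrier N. \<rho> (fp_right K R S s) n = \<tau> s n)"
proof -
  note sb = representationD(1)[OF \<sigma>] and tb = representationD(1)[OF \<tau>]
  have c: "case_sum \<sigma> \<tau> s \<in> linear_maps K N N" if "s \<in> L" for s
    using that bilin_right[OF sb] bilin_right[OF tb] by auto
  have "\<exists>\<rho>. representation K FP N \<rho> \<and>
      (\<forall>s\<in>L. \<forall>n\<in>carrier N. \<rho> (basis_vector K [s]) n = case_sum \<sigma> \<tau> s n)"
    unfolding fp_free_def by (rule free_algebra_lift[OF fp_K N c])
  then obtain \<rho> where \<rho>: "representation K FP N \<rho>"
    and \<rho>L: "\<forall>s\<in>L. \<forall>n\<in>carrier N. \<rho> (basis_vector K [s]) n = case_sum \<sigma> \<tau> s n"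
    by (elim exE conjE) (rule that)
  have \<rho>i: "\<rho> (li r) n = \<sigma> r n" if "r \<in> carrier R" "n \<in> carrier N" for r n
    using \<rho>L[THEN bspec, OF InlI[OF that(1)], THEN bspec, OF that(2)] by simp
  have \<rho>j: "\<rho> (lj v) n = \<tau> v n" if "v \<in> carrier S" "n \<in> carrier N" for v n
    using \<rho>L[THEN bspec, OF InrI[OF that(1)], THEN bspec, OF that(2)] by simp
  have "\<rho> f n = \<zero>\<^bsub>N\<^esub>" if f: "f \<in> fp_rel" and n: "n \<in> carrier N" for f n
    using f algebra_relations_vanish[where j = li, OF F.k_algebra_axioms R.weak_algebra N fp_letters(1) \<rho> \<sigma> \<rho>i _ n]
      algebra_relations_vanish[where j = lj, OF F.k_algebra_axioms S.weak_algebra N fp_letters(2) \<rho> \<tau> \<rho>j _ n]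
    unfolding fp_rel_def by blast
  from representation_kernel_ideal[OF F.k_algebra_axioms N \<rho> fp_rel_closed this]
  have "\<rho> f n = \<zero>\<^bsub>N\<^esub>" if "f \<in> fp_ideal K R S" "n \<in> carrier N" for f n
    using that unfolding fp_ideal_eq by blast
  from Q.representation_quotient[OF N \<rho> this]
  obtain \<rho>' where "representation K (free_product K R S) N \<rho>'"
    "\<And>f n. \<lbrakk>f \<in> carrier FP; n \<in> carrier N\<rbrakk> \<Longrightarrow> \<rho>' (Q.cls f) n = \<rho> f n"
    unfolding fp_Q by blast
  then show ?thesis
    by (intro exI[of _ \<rho>']) (simp add: fp_Q(2,3) fp_letters \<rho>i \<rho>j)
qed

end

section \<open>The enveloping algebra and the dual bimodule\<close>

text \<open>A lift depends bilinearly on parameters if its values on pure tensors do. Each law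
  equates maps that are linear in \<open>t\<close>, and those are compared on pure tensors. This is
  what makes a second lift, in the parameters, possible.\<close>

lemma tensor_lift_family:
  assumes M: "module K M" and N: "module K N" and P: "module K P"
    and f: "\<And>a b. \<lbrakk>a \<in> carrier A; b \<in> carrier B\<rbrakk> \<Longrightarrow> f a b \<in> bilinear_maps K M N P"
    and f': "\<And>m n. \<lbrakk>m \<in> carrier M; n \<in> carrier N\<rbrakk> \<Longrightarrow> (\<lambda>a b. f a b m n) \<in> bilinear_maps K A B P"
    and A: "module K A" and B: "module K B" and t: "t \<in> carrier (tensor K M N)"
  shows "(\<lambda>a b. tensor_lift K M N P (f a b) t) \<in> bilinear_maps K A B P"
proof -
  interpret A: module K A by (rule A)
  interpret B: module K B by (rule B)
  note lin = tensor_lift_linear[OF M N P f] and pure = tensor_lift_pure[OF M N P f]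
  note ext = tensor_ext[OF M N P]
  note l = bilin_left[OF f'] and r = bilin_right[OF f']
  show ?thesis
  proof (intro bilinear_mapsI linear_mapsI)
    fix a a' b assume [simp]: "a \<in> carrier A" "a' \<in> carrier A" "b \<in> carrier B"
    show "tensor_lift K M N P (f (a \<oplus>\<^bsub>A\<^esub> a') b) t =
        tensor_lift K M N P (f a b) t \<oplus>\<^bsub>P\<^esub> tensor_lift K M N P (f a' b) t"
      by (rule ext[OF _ lin_plus[OF lin lin] _ t]) (simp_all add: lin P pure lin_add[OF l])
  next
    fix k a b assume [simp]: "k \<in> carrier K" "a \<in> carrier A" "b \<in> carrier B"
    show "tensor_lift K M N P (f (k \<odot>\<^bsub>A\<^esub> a) b) t = k \<odot>\<^bsub>P\<^esub> tensor_lift K M N P (f a b) t"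
      by (rule ext[OF _ lin_scale[OF lin] _ t]) (simp_all add: lin P pure lin_smult[OF l])
  next
    fix a b b' assume [simp]: "a \<in> carrier A" "b \<in> carrier B" "b' \<in> carrier B"
    show "tensor_lift K M N P (f a (b \<oplus>\<^bsub>B\<^esub> b')) t =
        tensor_lift K M N P (f a b) t \<oplus>\<^bsub>P\<^esub> tensor_lift K M N P (f a b') t"
      by (rule ext[OF _ lin_plus[OF lin lin] _ t]) (simp_all add: lin P pure lin_add[OF r])
  next
    fix k a b assume [simp]: "k \<in> carrier K" "a \<in> carrier A" "b \<in> carrier B"
    show "tensor_lift K M N P (f a (k \<odot>\<^bsub>B\<^esub> b)) t = k \<odot>\<^bsub>P\<^esub> tensor_lift K M N P (f a b) t"
      by (rule ext[OF _ lin_scale[OF lin] _ t]) (simp_all add: lin P pure lin_smult[OF r])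
  qed (simp_all add: lin_closed[OF lin] t)
qed

text \<open>All products and actions on \<open>A\<^sup>e\<close> and \<open>\<MM>\<close> are such iterated lifts.\<close>

definition double_lift :: "'k ring \<Rightarrow> ('k, 'a, 'p) module_scheme \<Rightarrow> ('k, 'b, 'q) module_scheme \<Rightarrow>
    ('k, 'm, 'r) module_scheme \<Rightarrow> ('k, 'n, 's) module_scheme \<Rightarrow> ('k, 't, 'u) module_scheme \<Rightarrow>
    ('a \<Rightarrow> 'b \<Rightarrow> 'm \<Rightarrow> 'n \<Rightarrow> 't) \<Rightarrow> ('a \<times> 'b \<Rightarrow> 'k) set \<Rightarrow> ('m \<times> 'n \<Rightarrow> 'k) set \<Rightarrow> 't" where
  "double_lift K A B M N P f u t =
     tensor_lift K A B P (\<lambda>a b. tensor_lift K M N P (\<lambda>m n. f a b m n) t) u"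

text \<open>Linearity in the outer tensor is built in. Linearity in the inner one is tested on pure
  outer tensors, where only the inner lift remains.\<close>

lemma double_lift:
  assumes A: "module K A" and B: "module K B" and M: "module K M" and N: "module K N" and P: "module K P"
    and f: "\<And>a b. \<lbrakk>a \<in> carrier A; b \<in> carrier B\<rbrakk> \<Longrightarrow> f a b \<in> bilinear_maps K M N P"
    and f': "\<And>m n. \<lbrakk>m \<in> carrier M; n \<in> carrier N\<rbrakk> \<Longrightarrow> (\<lambda>a b. f a b m n) \<in> bilinear_maps K A B P"
  shows double_lift_bilinear:
      "double_lift K A B M N P f \<in> bilinear_maps K (tensor K A B) (tensor K M N) P"
    and double_lift_pure: "\<lbrakk>a \<in> carrier A; b \<in> carrier B; m \<in> carrier M; n \<in> carrier N\<rbrakk> \<Longrightarrow>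
      double_lift K A B M N P f (pure_tensor K A B a b) (pure_tensor K M N m n) = f a b m n"
proof -
  note fam = tensor_lift_family[OF M N P f f' A B]
  note lin = tensor_lift_linear[OF M N P f] and pure = tensor_lift_pure[OF M N P f]
  note lin' = tensor_lift_linear[OF A B P fam] and pure' = tensor_lift_pure[OF A B P fam]
  note ext = tensor_ext[OF A B P]
  interpret T: module K "tensor K M N" by (rule module_tensor[OF M N])
  note [simp] = bilin_closed[OF pure_tensor_bilinear[OF M N]]
  show "double_lift K A B M N P f \<in> bilinear_maps K (tensor K A B) (tensor K M N) P"
    unfolding double_lift_def
  proof (intro bilinear_mapsI)
    fix t assume "t \<in> carrier (tensor K M N)"
    then show "(\<lambda>u. tensor_lift K A B P (\<lambda>a b. tensor_lift K M N P (\<lambda>m n. f a b m n) t) u)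
        \<in> linear_maps K (tensor K A B) P" using lin' by simp
  next
    fix u assume u: "u \<in> carrier (tensor K A B)"
    show "(\<lambda>t. tensor_lift K A B P (\<lambda>a b. tensor_lift K M N P (\<lambda>m n. f a b m n) t) u)
        \<in> linear_maps K (tensor K M N) P"
    proof (rule linear_mapsI)
      fix s t assume [simp]: "s \<in> carrier (tensor K M N)" "t \<in> carrier (tensor K M N)"
      show "tensor_lift K A B P (\<lambda>a b. tensor_lift K M N P (\<lambda>m n. f a b m n) s) u \<in> carrier P"
        using lin_closed[OF lin' u] by simp
      show "tensor_lift K A B P (\<lambda>a b. tensor_lift K M N P (\<lambda>m n. f a b m n) (s \<oplus>\<^bsub>tensor K M N\<^esub> t)) u =
        tensor_lift K A B P (\<lambda>a b. tensor_lift K M N P (\<lambda>m n. f a b m n) s) u \<oplus>\<^bsub>P\<^esub>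
        tensor_lift K A B P (\<lambda>a b. tensor_lift K M N P (\<lambda>m n. f a b m n) t) u"
        by (rule ext[OF lin' lin_plus[OF lin' lin'] _ u]) (simp_all add: P pure' lin_add[OF lin])
      fix k assume [simp]: "k \<in> carrier K"
      show "tensor_lift K A B P (\<lambda>a b. tensor_lift K M N P (\<lambda>m n. f a b m n) (k \<odot>\<^bsub>tensor K M N\<^esub> s)) u =
        k \<odot>\<^bsub>P\<^esub> tensor_lift K A B P (\<lambda>a b. tensor_lift K M N P (\<lambda>m n. f a b m n) s) u"
        by (rule ext[OF lin' lin_scale[OF lin'] _ u]) (simp_all add: P pure' lin_smult[OF lin])
    qed
  qed
  show "\<lbrakk>a \<in> carrier A; b \<in> carrier B; m \<in> carrier M; n \<in> carrier N\<rbrakk> \<Longrightarrow>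
      double_lift K A B M N P f (pure_tensor K A B a b) (pure_tensor K M N m n) = f a b m n"
    by (simp add: double_lift_def pure' pure)
qed

lemma k_algebra_opposite:
  assumes "k_algebra K A"
  shows "k_algebra K (opposite A)"
proof -
  interpret A: k_algebra K A by fact
  show ?thesis
  proof (rule k_algebraI[OF A.K.field_axioms])
    show "module K (opposite A)"
      by (rule module_cong[OF A.A.module_axioms]) (simp_all add: opposite_def)
    have "linear_maps K (opposite A) (opposite A) = linear_maps K A A"
      by (rule linear_maps_cong) (simp_all add: opposite_def)
    then show "mult (opposite A) \<in> bilinear_maps K (opposite A) (opposite A) (opposite A)"
      using bilin_left[OF A.mult_bilinear] bilin_right[OF A.mult_bilinear]
      by (intro bilinear_mapsI) (simp_all add: opposite_def)
  qed (simp_all add: opposite_def A.A.m_assoc)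
qed

lemma opposite_simps [simp]:
  "carrier (opposite A) = carrier A" "a \<otimes>\<^bsub>opposite A\<^esub> b = b \<otimes>\<^bsub>A\<^esub> a" "\<one>\<^bsub>opposite A\<^esub> = \<one>\<^bsub>A\<^esub>"
  "add (opposite A) = add A" "smult (opposite A) = smult A" "\<zero>\<^bsub>opposite A\<^esub> = \<zero>\<^bsub>A\<^esub>"
  by (simp_all add: opposite_def)

lemma linear_maps_opposite: "linear_maps K (opposite A) M = linear_maps K A M"
  by (rule linear_maps_cong) simp_all

lemma bilinear_maps_opposite: "bilinear_maps K A (opposite A) M = bilinear_maps K A A M"
  by (simp add: bilinear_maps_def linear_maps_opposite)

lemma tensor_algebras_simps [simp]:
  "carrier (tensor_algebras K A B) = carrier (tensor K A B)"
  "add (tensor_algebras K A B) = add (tensor K A B)" "smult (tensor_algebras K A B) = smult (tensor K A B)"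
  "\<zero>\<^bsub>tensor_algebras K A B\<^esub> = \<zero>\<^bsub>tensor K A B\<^esub>" "\<one>\<^bsub>tensor_algebras K A B\<^esub> = pure_tensor K A B \<one>\<^bsub>A\<^esub> \<one>\<^bsub>B\<^esub>"
  "mult (tensor_algebras K A B) = double_lift K A B A B (tensor K A B)
    (\<lambda>a b a' b'. pure_tensor K A B (a \<otimes>\<^bsub>A\<^esub> a') (b \<otimes>\<^bsub>B\<^esub> b'))"
  by (auto simp: tensor_algebras_def Let_def double_lift_def[abs_def] fun_eq_iff)

section \<open>The product on a tensor product of algebras\<close>

context
  fixes K :: "'k ring" and A :: "('k, 'a) module" and B :: "('k, 'b) module"
  assumes A: "k_algebra K A" and B: "k_algebra K B"
begin

interpretation A: k_algebra K A by (rule A)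
interpretation B: k_algebra K B by (rule B)

private lemma mA: "module K A" and mB: "module K B" by (rule A.A.module_axioms B.A.module_axioms)+

private lemma mult1:
  "\<lbrakk>a \<in> carrier A; b \<in> carrier B\<rbrakk> \<Longrightarrow>
    (\<lambda>a' b'. pure_tensor K A B (a \<otimes>\<^bsub>A\<^esub> a') (b \<otimes>\<^bsub>B\<^esub> b')) \<in> bilinear_maps K A B (tensor K A B)"
  by (intro bilin_compose[OF pure_tensor_bilinear[OF mA mB]] bilin_right[OF A.mult_bilinear]
    bilin_right[OF B.mult_bilinear])

private lemma mult2:
  "\<lbrakk>a' \<in> carrier A; b' \<in> carrier B\<rbrakk> \<Longrightarrow>
    (\<lambda>a b. pure_tensor K A B (a \<otimes>\<^bsub>A\<^esub> a') (b \<otimes>\<^bsub>B\<^esub> b')) \<in> bilinear_maps K A B (tensor K A B)"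
  by (intro bilin_compose[OF pure_tensor_bilinear[OF mA mB]] bilin_left[OF A.mult_bilinear]
    bilin_left[OF B.mult_bilinear])

lemma tensor_algebras_mult_bilinear:
  "mult (tensor_algebras K A B) \<in> bilinear_maps K (tensor K A B) (tensor K A B) (tensor K A B)"
  unfolding tensor_algebras_simps
  by (rule double_lift_bilinear[OF mA mB mA mB module_tensor[OF mA mB] mult1 mult2])

lemma tensor_algebras_mult_pure:
  "\<lbrakk>a \<in> carrier A; b \<in> carrier B; a' \<in> carrier A; b' \<in> carrier B\<rbrakk> \<Longrightarrow>
    pure_tensor K A B a b \<otimes>\<^bsub>tensor_algebras K A B\<^esub> pure_tensor K A B a' b' =
    pure_tensor K A B (a \<otimes>\<^bsub>A\<^esub> a') (b \<otimes>\<^bsub>B\<^esub> b')"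
  unfolding tensor_algebras_simps
  by (rule double_lift_pure[OF mA mB mA mB module_tensor[OF mA mB] mult1 mult2])

lemma weak_algebra_tensor_algebras: "weak_algebra K (tensor_algebras K A B)"
proof (intro weak_algebra.intro weak_algebra_axioms.intro)
  show "module K (tensor_algebras K A B)"
    by (rule module_cong[OF module_tensor[OF mA mB]]) simp_all
  show "\<one>\<^bsub>tensor_algebras K A B\<^esub> \<in> carrier (tensor_algebras K A B)"
    using bilin_closed[OF pure_tensor_bilinear[OF mA mB]] by simp
  show "\<And>x y. \<lbrakk>x \<in> carrier (tensor_algebras K A B); y \<in> carrier (tensor_algebras K A B)\<rbrakk> \<Longrightarrow>
      x \<otimes>\<^bsub>tensor_algebras K A B\<^esub> y \<in> carrier (tensor_algebras K A B)"
    using bilin_closed[OF tensor_algebras_mult_bilinear] by (simp del: tensor_algebras_simps(6))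
qed

end

section \<open>The enveloping algebra and its elements \<open>a\<bar>b\<close>\<close>

context k_algebra
begin

lemmas k_algebra_opposite_self = k_algebra_opposite[OF k_algebra_axioms]

lemma module_opposite: "module K (opposite A)"
  by (rule module_cong[OF A.module_axioms]) simp_all

lemma weak_algebra_env: "weak_algebra K (enveloping_algebra K A)"
  unfolding enveloping_algebra_def by (rule weak_algebra_tensor_algebras[OF k_algebra_axioms k_algebra_opposite_self])

lemma carrier_env: "carrier (enveloping_algebra K A) = carrier (tensor K A (opposite A))"
  by (simp add: enveloping_algebra_def)

lemma linear_maps_env: "linear_maps K (enveloping_algebra K A) M = linear_maps K (tensor K A (opposite A)) M"
  by (rule linear_maps_cong) (simp_all add: enveloping_algebra_def)

lemma env_elem_closed: "\<lbrakk>a \<in> carrier A; b \<in> carrier A\<rbrakk> \<Longrightarrow> env_elem K A a b \<in> carrier (enveloping_algebra K A)"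
  unfolding env_elem_def carrier_env
  using bilin_closed[OF pure_tensor_bilinear[OF A.module_axioms module_opposite]] by simp

lemma env_elem_bilinear: "env_elem K A \<in> bilinear_maps K A A (enveloping_algebra K A)"
proof -
  have eq: "linear_maps K A (enveloping_algebra K A) = linear_maps K A (tensor K A (opposite A))"
    by (rule linear_maps_cong) (simp_all add: enveloping_algebra_def)
  have "pure_tensor K A (opposite A) \<in> bilinear_maps K A A (tensor K A (opposite A))"
    using pure_tensor_bilinear[OF A.module_axioms module_opposite] by (simp add: bilinear_maps_opposite)
  then show ?thesis unfolding bilinear_maps_def eq env_elem_def[abs_def] by simp
qed

lemma env_elem_mult:
  "\<lbrakk>a \<in> carrier A; b \<in> carrier A; a' \<in> carrier A; b' \<in> carrier A\<rbrakk> \<Longrightarrow>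
    env_elem K A a b \<otimes>\<^bsub>enveloping_algebra K A\<^esub> env_elem K A a' b' = env_elem K A (a \<otimes>\<^bsub>A\<^esub> a') (b' \<otimes>\<^bsub>A\<^esub> b)"
  unfolding env_elem_def enveloping_algebra_def
  using tensor_algebras_mult_pure[OF k_algebra_axioms k_algebra_opposite_self, of a b a' b'] by simp

lemma env_one: "\<one>\<^bsub>enveloping_algebra K A\<^esub> = env_elem K A \<one>\<^bsub>A\<^esub> \<one>\<^bsub>A\<^esub>"
  by (simp add: enveloping_algebra_def env_elem_def)

lemma env_ext:
  assumes "module K P" "f \<in> linear_maps K (enveloping_algebra K A) P" "g \<in> linear_maps K (enveloping_algebra K A) P"
    and "\<And>a b. \<lbrakk>a \<in> carrier A; b \<in> carrier A\<rbrakk> \<Longrightarrow> f (env_elem K A a b) = g (env_elem K A a b)"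
    and "u \<in> carrier (enveloping_algebra K A)"
  shows "f u = g u"
  using tensor_ext[OF A.module_axioms module_opposite assms(1), of f g u] assms(2-)
  by (simp add: linear_maps_env carrier_env env_elem_def)

end

text \<open>A bimodule is a left module over the enveloping algebra, with \<open>a\<bar>b\<close>
  acting as m to (a m) b. The reversed product in the second factor is what makes the right action
  multiplicative.\<close>

lemma (in bimodule) env_representation:
  "\<exists>\<sigma>. representation K (enveloping_algebra K A) M \<sigma> \<and>
    (\<forall>a\<in>carrier A. \<forall>b\<in>carrier A. \<forall>m\<in>carrier M. \<sigma> (env_elem K A a b) m = (a \<triangleright>\<^bsub>M\<^esub> m) \<triangleleft>\<^bsub>M\<^esub> b)"
proof -
  let ?T = "tensor K A (opposite A)"
  note modules = A.module_axioms module_opposite M.module_axioms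
  note l = lact_bilinear and r = ract_bilinear
  define f where "f m a b = (a \<triangleright>\<^bsub>M\<^esub> m) \<triangleleft>\<^bsub>M\<^esub> b" for m a b
  have f: "f m \<in> bilinear_maps K A (opposite A) M" if m: "m \<in> carrier M" for m
    unfolding bilinear_maps_opposite f_def
    by (intro bilinear_mapsI lin_compose[OF bilin_left[OF l] bilin_left[OF r]] bilin_right[OF r]
      bilin_closed[OF l] m)
  have fm: "(\<lambda>m. f m a b) \<in> linear_maps K M M" if "a \<in> carrier A" "b \<in> carrier A" for a b
    unfolding f_def by (intro lin_compose[OF bilin_right[OF l] bilin_left[OF r]] that)
  define \<sigma> where "\<sigma> u m = tensor_lift K A (opposite A) M (f m) u" for u m
  note lin = tensor_lift_linear[OF modules f] and pure = tensor_lift_pure[OF modules f]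
  note ext = env_ext[OF M.module_axioms]
  have pure': "\<sigma> (env_elem K A a b) m = f m a b" if "a \<in> carrier A" "b \<in> carrier A" "m \<in> carrier M" for a b m
    using that by (simp add: \<sigma>_def env_elem_def pure)
  have lin1: "(\<lambda>u. \<sigma> u m) \<in> linear_maps K (enveloping_algebra K A) M" if "m \<in> carrier M" for m
    using that by (simp add: linear_maps_env \<sigma>_def lin)
  have lin2: "\<sigma> u \<in> linear_maps K M M" if u: "u \<in> carrier (enveloping_algebra K A)" for u
  proof (rule linear_mapsI)
    fix m n assume [simp]: "m \<in> carrier M" "n \<in> carrier M"
    show "\<sigma> u m \<in> carrier M" by (rule lin_closed[OF lin1 u]) simp
    show "\<sigma> u (m \<oplus>\<^bsub>M\<^esub> n) = \<sigma> u m \<oplus>\<^bsub>M\<^esub> \<sigma> u n"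
      by (rule ext[OF lin1 lin_plus[OF lin1 lin1] _ u]) (simp_all add: M.module_axioms pure' lin_add[OF fm])
    fix k assume [simp]: "k \<in> carrier K"
    show "\<sigma> u (k \<odot>\<^bsub>M\<^esub> m) = k \<odot>\<^bsub>M\<^esub> \<sigma> u m"
      by (rule ext[OF lin1 lin_scale[OF lin1] _ u]) (simp_all add: M.module_axioms pure' lin_smult[OF fm])
  qed
  interpret e: weak_algebra K "enveloping_algebra K A" by (rule weak_algebra_env)
  have mb: "mult (enveloping_algebra K A) \<in>
      bilinear_maps K (enveloping_algebra K A) (enveloping_algebra K A) (enveloping_algebra K A)"
    using tensor_algebras_mult_bilinear[OF k_algebra_axioms k_algebra_opposite_self]
    by (simp add: bilinear_maps_def linear_maps_def enveloping_algebra_def del: tensor_algebras_simps(6))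
  have "representation K (enveloping_algebra K A) M \<sigma>"
  proof (rule representationI)
    show "\<sigma> \<in> bilinear_maps K (enveloping_algebra K A) M M"
      by (intro bilinear_mapsI lin1 lin2)
    fix m assume m [simp]: "m \<in> carrier M"
    show "\<sigma> \<one>\<^bsub>enveloping_algebra K A\<^esub> m = m"
      by (simp add: env_one pure' f_def one_lact ract_one)
    fix u v assume u: "u \<in> carrier (enveloping_algebra K A)" and v: "v \<in> carrier (enveloping_algebra K A)"
    \<comment> \<open>The product of the enveloping algebra is given explicitly on elements
      \<open>env_elem K A a b\<close> only, so multiplicativity is extended one factor at a time,
      first in \<open>v\<close> and then in \<open>u\<close>.\<close>
    have 1: "\<sigma> (env_elem K A a b \<otimes>\<^bsub>enveloping_algebra K A\<^esub> v) m = \<sigma> (env_elem K A a b) (\<sigma> v m)"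
      if [simp]: "a \<in> carrier A" "b \<in> carrier A" for a b
      by (rule ext[OF lin_compose[OF bilin_right[OF mb] lin1] lin_compose[OF lin1 lin2] _ v])
        (simp_all add: env_elem_closed env_elem_mult pure' f_def lact_closed ract_closed mult_lact ract_mult lact_ract)
    show "\<sigma> (u \<otimes>\<^bsub>enveloping_algebra K A\<^esub> v) m = \<sigma> u (\<sigma> v m)"
      by (rule ext[OF lin_compose[OF bilin_left[OF mb] lin1] lin1 _ u])
        (simp_all add: v 1 lin_closed[OF lin2])
  qed
  then show ?thesis using pure' by (intro exI[of _ \<sigma>]) (simp add: f_def)
qed

section \<open>The dual bimodule and dual bases\<close>

context bimodule
begin

lemma smult_one_ract: "\<lbrakk>k \<in> carrier K; m \<in> carrier M\<rbrakk> \<Longrightarrow> m \<triangleleft>\<^bsub>M\<^esub> (k \<odot>\<^bsub>A\<^esub> \<one>\<^bsub>A\<^esub>) = k \<odot>\<^bsub>M\<^esub> m"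
  by (simp add: ract_smult ract_one)

abbreviation "X \<equiv> left_dual A M"

lemma left_dual_simps:
  "\<zero>\<^bsub>X\<^esub> = (\<lambda>\<omega>\<in>carrier M. \<zero>\<^bsub>A\<^esub>)" "x \<oplus>\<^bsub>X\<^esub> y = (\<lambda>\<omega>\<in>carrier M. x \<omega> \<oplus>\<^bsub>A\<^esub> y \<omega>)"
  "k \<odot>\<^bsub>X\<^esub> x = (\<lambda>\<omega>\<in>carrier M. k \<odot>\<^bsub>A\<^esub> x \<omega>)" "a \<triangleright>\<^bsub>X\<^esub> x = (\<lambda>\<omega>\<in>carrier M. a \<otimes>\<^bsub>A\<^esub> x \<omega>)"
  "x \<triangleleft>\<^bsub>X\<^esub> b = (\<lambda>\<omega>\<in>carrier M. x (b \<triangleright>\<^bsub>M\<^esub> \<omega>))"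
  by (simp_all add: left_dual_def)

lemma left_dual_iff:
  "x \<in> carrier X \<longleftrightarrow> x \<in> extensional (carrier M) \<and> (\<forall>\<omega>\<in>carrier M. x \<omega> \<in> carrier A) \<and>
     (\<forall>\<omega>\<in>carrier M. \<forall>\<omega>'\<in>carrier M. x (\<omega> \<oplus>\<^bsub>M\<^esub> \<omega>') = x \<omega> \<oplus>\<^bsub>A\<^esub> x \<omega>') \<and>
     (\<forall>\<omega>\<in>carrier M. \<forall>a\<in>carrier A. x (\<omega> \<triangleleft>\<^bsub>M\<^esub> a) = x \<omega> \<otimes>\<^bsub>A\<^esub> a)"
  by (auto simp: left_dual_def right_module_maps_def regular_bimodule_def)

lemma
  assumes "x \<in> carrier X"
  shows dual_ext: "x \<in> extensional (carrier M)"
    and dual_closed: "\<omega> \<in> carrier M \<Longrightarrow> x \<omega> \<in> carrier A"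
    and dual_add: "\<lbrakk>\<omega> \<in> carrier M; \<omega>' \<in> carrier M\<rbrakk> \<Longrightarrow> x (\<omega> \<oplus>\<^bsub>M\<^esub> \<omega>') = x \<omega> \<oplus>\<^bsub>A\<^esub> x \<omega>'"
    and dual_ract: "\<lbrakk>\<omega> \<in> carrier M; a \<in> carrier A\<rbrakk> \<Longrightarrow> x (\<omega> \<triangleleft>\<^bsub>M\<^esub> a) = x \<omega> \<otimes>\<^bsub>A\<^esub> a"
  using assms by (simp_all add: left_dual_iff)

text \<open>Right \<open>A\<close>-linearity includes \<open>K\<close>-linearity, because a scalar k
  acts as the algebra element k 1.\<close>

lemma dual_smult: "\<lbrakk>x \<in> carrier X; k \<in> carrier K; \<omega> \<in> carrier M\<rbrakk> \<Longrightarrow> x (k \<odot>\<^bsub>M\<^esub> \<omega>) = k \<odot>\<^bsub>A\<^esub> x \<omega>"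
  using dual_ract[of x \<omega> "k \<odot>\<^bsub>A\<^esub> \<one>\<^bsub>A\<^esub>"] dual_closed[of x \<omega>] by (simp add: smult_one_ract smult_mult_right)

lemma dual_linear: "x \<in> carrier X \<Longrightarrow> x \<in> linear_maps K M A"
  by (rule linear_mapsI) (simp_all add: dual_closed dual_add dual_smult)

lemma dual_eqI:
  "\<lbrakk>x \<in> carrier X; y \<in> carrier X; \<And>\<omega>. \<omega> \<in> carrier M \<Longrightarrow> x \<omega> = y \<omega>\<rbrakk> \<Longrightarrow> x = y"
  by (rule extensionalityI[OF dual_ext dual_ext]) auto

lemma dual_pointwise:
  assumes "\<omega> \<in> carrier M"
  shows "(x \<oplus>\<^bsub>X\<^esub> y) \<omega> = x \<omega> \<oplus>\<^bsub>A\<^esub> y \<omega>" "(k \<odot>\<^bsub>X\<^esub> x) \<omega> = k \<odot>\<^bsub>A\<^esub> x \<omega>" "\<zero>\<^bsub>X\<^esub> \<omega> = \<zero>\<^bsub>A\<^esub>"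
    "(a \<triangleright>\<^bsub>X\<^esub> x) \<omega> = a \<otimes>\<^bsub>A\<^esub> x \<omega>" "(x \<triangleleft>\<^bsub>X\<^esub> a) \<omega> = x (a \<triangleright>\<^bsub>M\<^esub> \<omega>)"
  using assms by (simp_all add: left_dual_simps)

lemma left_dual_closed:
  "\<zero>\<^bsub>X\<^esub> \<in> carrier X"
  "\<lbrakk>x \<in> carrier X; y \<in> carrier X\<rbrakk> \<Longrightarrow> x \<oplus>\<^bsub>X\<^esub> y \<in> carrier X"
  "\<lbrakk>k \<in> carrier K; x \<in> carrier X\<rbrakk> \<Longrightarrow> k \<odot>\<^bsub>X\<^esub> x \<in> carrier X"
  "\<lbrakk>a \<in> carrier A; x \<in> carrier X\<rbrakk> \<Longrightarrow> a \<triangleright>\<^bsub>X\<^esub> x \<in> carrier X"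
  "\<lbrakk>a \<in> carrier A; x \<in> carrier X\<rbrakk> \<Longrightarrow> x \<triangleleft>\<^bsub>X\<^esub> a \<in> carrier X"
  by (auto simp: left_dual_iff left_dual_simps ract_closed lact_closed A.M.add.m_ac A.l_distr A.r_distr
    smult_mult_left A.smult_r_distr A.m_assoc lact_add lact_ract[symmetric])

lemma module_left_dual: "module K X"
proof (rule moduleI)
  show "abelian_group X"
  proof (rule abelian_groupI)
    fix x assume x: "x \<in> carrier X"
    \<comment> \<open>Subtraction in \<open>X\<close> presupposes that it is a group, so the inverse
      of \<open>x\<close> is written as (-1) x, whose closedness is known.\<close>
    show "\<exists>y\<in>carrier X. y \<oplus>\<^bsub>X\<^esub> x = \<zero>\<^bsub>X\<^esub>"
    proof (rule bexI[of _ "(\<ominus>\<^bsub>K\<^esub> \<one>\<^bsub>K\<^esub>) \<odot>\<^bsub>X\<^esub> x"])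
      show "(\<ominus>\<^bsub>K\<^esub> \<one>\<^bsub>K\<^esub>) \<odot>\<^bsub>X\<^esub> x \<oplus>\<^bsub>X\<^esub> x = \<zero>\<^bsub>X\<^esub>"
        by (rule dual_eqI)
          (simp_all add: x left_dual_closed dual_pointwise A.smult_neg_one dual_closed[OF x] A.M.l_neg)
    qed (simp add: x left_dual_closed)
  qed (auto intro!: dual_eqI simp: left_dual_closed dual_pointwise dual_closed A.M.add.m_ac)
qed (auto intro!: dual_eqI simp: left_dual_closed dual_pointwise dual_closed A.smult_l_distr
  A.smult_r_distr A.smult_assoc1 K.is_cring)

lemma bimodule_left_dual: "bimodule K A X"
  by (rule bimoduleI[OF k_algebra_axioms module_left_dual])
    (auto intro!: dual_eqI bilinear_mapsI linear_mapsI simp: left_dual_closed dual_pointwise dual_closed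
      A.l_distr A.r_distr smult_mult_left smult_mult_right A.m_assoc add_lact smult_lact dual_add
      dual_smult lact_closed mult_lact one_lact)

lemma eval_linear: "\<omega> \<in> carrier M \<Longrightarrow> (\<lambda>x. x \<omega>) \<in> linear_maps K X A"
  by (rule linear_mapsI) (simp_all add: dual_closed dual_pointwise)

lemma eval_bilinear: "(\<lambda>x \<omega>. x \<omega>) \<in> bilinear_maps K X M A"
  by (intro bilinear_mapsI eval_linear dual_linear)

text \<open>One triangle identity implies the other: evaluate the second sum at a form, move the
  values of \<open>x i\<close> inside \<open>y\<close> by right linearity, and apply the first
  identity under \<open>y\<close>.\<close>

lemma coev_familyI:
  assumes m: "\<And>i. i < n \<Longrightarrow> \<omega> i \<in> carrier M" and x: "\<And>i. i < n \<Longrightarrow> x i \<in> carrier X"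
    and s: "\<And>\<omega>'. \<omega>' \<in> carrier M \<Longrightarrow> (\<Oplus>\<^bsub>M\<^esub>i\<in>{..<n}. \<omega> i \<triangleleft>\<^bsub>M\<^esub> x i \<omega>') = \<omega>'"
  shows "coev_family M A n \<omega> x"
proof -
  interpret X: bimodule K A X by (rule bimodule_left_dual)
  have "(\<Oplus>\<^bsub>X\<^esub>i\<in>{..<n}. y (\<omega> i) \<triangleright>\<^bsub>X\<^esub> x i) = y" if y: "y \<in> carrier X" for y
  proof (rule dual_eqI)
    have c: "(\<lambda>i. y (\<omega> i) \<triangleright>\<^bsub>X\<^esub> x i) \<in> {..<n} \<rightarrow> carrier X"
      using m x y by (auto intro!: X.lact_closed dual_closed)
    then show "(\<Oplus>\<^bsub>X\<^esub>i\<in>{..<n}. y (\<omega> i) \<triangleright>\<^bsub>X\<^esub> x i) \<in> carrier X" by (rule X.M.finsum_closed)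
    fix \<omega>' assume w: "\<omega>' \<in> carrier M"
    have "(\<Oplus>\<^bsub>X\<^esub>i\<in>{..<n}. y (\<omega> i) \<triangleright>\<^bsub>X\<^esub> x i) \<omega>' = (\<Oplus>\<^bsub>A\<^esub>i\<in>{..<n}. (y (\<omega> i) \<triangleright>\<^bsub>X\<^esub> x i) \<omega>')"
      by (rule lin_finsum[OF eval_linear[OF w] module_left_dual A.module_axioms c])
    also have "\<dots> = (\<Oplus>\<^bsub>A\<^esub>i\<in>{..<n}. y (\<omega> i \<triangleleft>\<^bsub>M\<^esub> x i \<omega>'))"
      using m x y w by (intro A.M.finsum_cong') (auto simp: dual_pointwise dual_ract dual_closed ract_closed)
    also have "\<dots> = y (\<Oplus>\<^bsub>M\<^esub>i\<in>{..<n}. \<omega> i \<triangleleft>\<^bsub>M\<^esub> x i \<omega>')"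
      using m x w by (intro lin_finsum[OF dual_linear[OF y] M.module_axioms A.module_axioms, symmetric])
        (auto simp: ract_closed dual_closed)
    finally show "(\<Oplus>\<^bsub>X\<^esub>i\<in>{..<n}. y (\<omega> i) \<triangleright>\<^bsub>X\<^esub> x i) \<omega>' = y \<omega>'" using s[OF w] by simp
  qed (rule y)
  then show ?thesis using m x s by (simp add: coev_family_def)
qed

text \<open>The dual basis lemma. The forms are the images under \<pi> of the standard basis of the
  free module, the functionals are the coordinates of \<iota>; expanding \<iota> m in the standard
  basis and applying \<pi> returns m.\<close>

lemma coev_family_exists:
  assumes "fg_projective_right A M"
  shows "\<exists>n \<omega> x. coev_family M A n \<omega> x"
proof -
  obtain n \<iota> \<pi> where \<iota>: "\<iota> \<in> right_module_maps A M (free_bimodule A n)"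
    and \<pi>: "\<pi> \<in> right_module_maps A (free_bimodule A n) M"
    and \<pi>\<iota>: "\<And>m. m \<in> carrier M \<Longrightarrow> \<pi> (\<iota> m) = m"
    using assms by (auto simp: fg_projective_right_def)
  let ?F = "free_bimodule A n"
  define e where "e i = (\<lambda>j\<in>{..<n}. if j = i then \<one>\<^bsub>A\<^esub> else \<zero>\<^bsub>A\<^esub>)" for i
  define x where "x i = (\<lambda>m\<in>carrier M. \<iota> m i)" for i
  have eF: "e i \<in> carrier ?F" for i by (auto simp: e_def free_bimodule_def)
  have \<iota>c: "m \<in> carrier M \<Longrightarrow> \<iota> m \<in> carrier ?F" for m using \<iota> by (auto simp: right_module_maps_def)
  have \<iota>i: "\<lbrakk>m \<in> carrier M; i < n\<rbrakk> \<Longrightarrow> \<iota> m i \<in> carrier A" for m i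
    using \<iota>c[of m] by (auto simp: free_bimodule_def)
  have \<pi>c: "f \<in> carrier ?F \<Longrightarrow> \<pi> f \<in> carrier M" for f using \<pi> by (auto simp: right_module_maps_def)
  have \<pi>a: "\<lbrakk>f \<in> carrier ?F; g \<in> carrier ?F\<rbrakk> \<Longrightarrow> \<pi> (f \<oplus>\<^bsub>?F\<^esub> g) = \<pi> f \<oplus>\<^bsub>M\<^esub> \<pi> g" for f g
    using \<pi> by (auto simp: right_module_maps_def)
  have \<pi>r: "\<lbrakk>f \<in> carrier ?F; a \<in> carrier A\<rbrakk> \<Longrightarrow> \<pi> (f \<triangleleft>\<^bsub>?F\<^esub> a) = \<pi> f \<triangleleft>\<^bsub>M\<^esub> a" for f a
    using \<pi> by (auto simp: right_module_maps_def)
  have \<pi>z: "\<pi> \<zero>\<^bsub>?F\<^esub> = \<zero>\<^bsub>M\<^esub>"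
  proof -
    have z: "\<zero>\<^bsub>?F\<^esub> \<in> carrier ?F" "\<zero>\<^bsub>?F\<^esub> \<oplus>\<^bsub>?F\<^esub> \<zero>\<^bsub>?F\<^esub> = \<zero>\<^bsub>?F\<^esub>" by (auto simp: free_bimodule_def)
    then show ?thesis using \<pi>a[OF z(1,1)] \<pi>c[OF z(1)] by simp
  qed
  have "x i \<in> carrier X" if i: "i < n" for i
  proof -
    have "\<iota> (m \<oplus>\<^bsub>M\<^esub> m') i = \<iota> m i \<oplus>\<^bsub>A\<^esub> \<iota> m' i" if "m \<in> carrier M" "m' \<in> carrier M" for m m'
      using \<iota> that i by (simp add: right_module_maps_def free_bimodule_def)
    moreover have "\<iota> (m \<triangleleft>\<^bsub>M\<^esub> a) i = \<iota> m i \<otimes>\<^bsub>A\<^esub> a" if "m \<in> carrier M" "a \<in> carrier A" for m a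
      using \<iota> that i by (simp add: right_module_maps_def free_bimodule_def)
    ultimately show ?thesis using i by (simp add: left_dual_iff x_def \<iota>i ract_closed)
  qed
  moreover have "(\<Oplus>\<^bsub>M\<^esub>i\<in>{..<n}. \<pi> (e i) \<triangleleft>\<^bsub>M\<^esub> x i m) = m" if m: "m \<in> carrier M" for m
  proof -
    \<comment> \<open>\<open>v k\<close> keeps the first \<open>k\<close> coordinates of \<iota> m.
      These truncations build the sum one term at a time inside \<open>M\<close>, so that finite
      sums in \<open>free_bimodule\<close> never have to be formed.\<close>
    define v where "v k = (\<lambda>j\<in>{..<n}. if j < k then \<iota> m j else \<zero>\<^bsub>A\<^esub>)" for k
    have v: "v k \<in> carrier ?F" for k using \<iota>i[OF m] by (auto simp: v_def free_bimodule_def)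
    have c: "\<pi> (e i) \<triangleleft>\<^bsub>M\<^esub> x i m \<in> carrier M" if "i < n" for i
      using that m by (auto intro!: ract_closed \<pi>c eF simp: x_def \<iota>i)
    have "k \<le> n \<Longrightarrow> \<pi> (v k) = (\<Oplus>\<^bsub>M\<^esub>i\<in>{..<k}. \<pi> (e i) \<triangleleft>\<^bsub>M\<^esub> x i m)" for k
    proof (induction k)
      case 0
      have "v 0 = \<zero>\<^bsub>?F\<^esub>" by (auto simp: v_def free_bimodule_def)
      then show ?case by (simp add: \<pi>z)
    next
      case (Suc k)
      then have k: "k < n" by simp
      have "v (Suc k) = e k \<triangleleft>\<^bsub>?F\<^esub> \<iota> m k \<oplus>\<^bsub>?F\<^esub> v k"
        using \<iota>i[OF m] k by (auto simp: v_def e_def free_bimodule_def less_Suc_eq)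
      moreover have "e k \<triangleleft>\<^bsub>?F\<^esub> \<iota> m k \<in> carrier ?F" using \<iota>i[OF m] k by (auto simp: e_def free_bimodule_def)
      ultimately have "\<pi> (v (Suc k)) = \<pi> (e k) \<triangleleft>\<^bsub>M\<^esub> x k m \<oplus>\<^bsub>M\<^esub> \<pi> (v k)"
        using \<iota>i[OF m k] m by (simp add: \<pi>a v \<pi>r eF x_def)
      also have "\<dots> = (\<Oplus>\<^bsub>M\<^esub>i\<in>{..<Suc k}. \<pi> (e i) \<triangleleft>\<^bsub>M\<^esub> x i m)"
        using Suc c unfolding lessThan_Suc by (subst M.finsum_insert) auto
      finally show ?case .
    qed
    from this[of n] have "\<pi> (v n) = (\<Oplus>\<^bsub>M\<^esub>i\<in>{..<n}. \<pi> (e i) \<triangleleft>\<^bsub>M\<^esub> x i m)" by simp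
    moreover have "v n = \<iota> m"
      using \<iota>c[OF m] by (auto simp: v_def free_bimodule_def PiE_iff extensional_def restrict_def fun_eq_iff)
    ultimately show ?thesis using \<pi>\<iota>[OF m] by simp
  qed
  ultimately show ?thesis using coev_familyI[of n "\<lambda>i. \<pi> (e i)" x] \<pi>c eF by blast
qed

end

section \<open>Modules over the algebra of vector fields\<close>

text \<open>A left module over \<open>B\<XX>\<^sup>1\<close> is an \<open>A\<close>-bimodule (the action of \<open>A\<^sup>e\<close>) with operators \<open>E x \<omega>\<close> and
  \<open>J x\<close> for the generators \<open>(x, \<omega>)\<close> and \<open>x\<close>.\<close>

locale vf_module = N: bimodule K A N
    for K :: "'k ring" and A :: "('k, 'a) module" and N :: "('k, 'a, 'n) bimodule" +
  fixes \<Omega> :: "('k, 'a, 'w) bimodule" and d :: "'a \<Rightarrow> 'w"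
    and E :: "('w \<Rightarrow> 'a) \<Rightarrow> 'w \<Rightarrow> 'n \<Rightarrow> 'n" and J :: "('w \<Rightarrow> 'a) \<Rightarrow> 'n \<Rightarrow> 'n"
  assumes E_linear: "\<lbrakk>x \<in> carrier (left_dual A \<Omega>); \<omega> \<in> carrier \<Omega>\<rbrakk> \<Longrightarrow> E x \<omega> \<in> linear_maps K N N"
    and E_bilinear: "n \<in> carrier N \<Longrightarrow> (\<lambda>x \<omega>. E x \<omega> n) \<in> bilinear_maps K (left_dual A \<Omega>) \<Omega> N"
    and J_bilinear: "J \<in> bilinear_maps K (left_dual A \<Omega>) N N"
    and E_lact: "\<lbrakk>a \<in> carrier A; x \<in> carrier (left_dual A \<Omega>); \<omega> \<in> carrier \<Omega>; n \<in> carrier N\<rbrakk> \<Longrightarrow>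
      E (a \<triangleright>\<^bsub>left_dual A \<Omega>\<^esub> x) \<omega> n = a \<triangleright>\<^bsub>N\<^esub> E x \<omega> n"
    and E_ract: "\<lbrakk>a \<in> carrier A; x \<in> carrier (left_dual A \<Omega>); \<omega> \<in> carrier \<Omega>; n \<in> carrier N\<rbrakk> \<Longrightarrow>
      E x (\<omega> \<triangleleft>\<^bsub>\<Omega>\<^esub> a) n = E x \<omega> n \<triangleleft>\<^bsub>N\<^esub> a"
    and E_lact_right: "\<lbrakk>a \<in> carrier A; x \<in> carrier (left_dual A \<Omega>); \<omega> \<in> carrier \<Omega>; n \<in> carrier N\<rbrakk> \<Longrightarrow>
      E x \<omega> (a \<triangleright>\<^bsub>N\<^esub> n) = E (x \<triangleleft>\<^bsub>left_dual A \<Omega>\<^esub> a) \<omega> n"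
    and E_ract_right: "\<lbrakk>a \<in> carrier A; x \<in> carrier (left_dual A \<Omega>); \<omega> \<in> carrier \<Omega>; n \<in> carrier N\<rbrakk> \<Longrightarrow>
      E x \<omega> (n \<triangleleft>\<^bsub>N\<^esub> a) = E x (a \<triangleright>\<^bsub>\<Omega>\<^esub> \<omega>) n"
    and J_lact: "\<lbrakk>a \<in> carrier A; x \<in> carrier (left_dual A \<Omega>); n \<in> carrier N\<rbrakk> \<Longrightarrow>
      J (a \<triangleright>\<^bsub>left_dual A \<Omega>\<^esub> x) n = a \<triangleright>\<^bsub>N\<^esub> J x n"
    and J_lact_right: "\<lbrakk>a \<in> carrier A; x \<in> carrier (left_dual A \<Omega>); n \<in> carrier N\<rbrakk> \<Longrightarrow>
      J x (a \<triangleright>\<^bsub>N\<^esub> n) = J (x \<triangleleft>\<^bsub>left_dual A \<Omega>\<^esub> a) n \<oplus>\<^bsub>N\<^esub> x (d a) \<triangleright>\<^bsub>N\<^esub> n"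
    and J_ract_right: "\<lbrakk>a \<in> carrier A; x \<in> carrier (left_dual A \<Omega>); n \<in> carrier N\<rbrakk> \<Longrightarrow>
      J x (n \<triangleleft>\<^bsub>N\<^esub> a) = J x n \<triangleleft>\<^bsub>N\<^esub> a \<oplus>\<^bsub>N\<^esub> E x (d a) n"
begin

lemma E_closed: "\<lbrakk>x \<in> carrier (left_dual A \<Omega>); \<omega> \<in> carrier \<Omega>; n \<in> carrier N\<rbrakk> \<Longrightarrow> E x \<omega> n \<in> carrier N"
  by (rule lin_closed[OF E_linear])

lemma J_closed: "\<lbrakk>x \<in> carrier (left_dual A \<Omega>); n \<in> carrier N\<rbrakk> \<Longrightarrow> J x n \<in> carrier N"
  by (rule bilin_closed[OF J_bilinear])

end

section \<open>The bimodule of pairs (x, \<omega>) over the enveloping algebra\<close>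

context differential_calculus
begin

lemma d_closed: "a \<in> carrier A \<Longrightarrow> d a \<in> carrier \<Omega>"
  by (rule lin_closed[OF d_linear])

interpretation X: bimodule K A X by (rule bimodule_left_dual)

abbreviation "Env \<equiv> enveloping_algebra K A"
abbreviation "EM \<equiv> endo_bimodule K A \<Omega>"

lemma ground_modules: "module K A" "module K (opposite A)" "module K X" "module K \<Omega>" "module K (tensor K X \<Omega>)"
  by (rule A.module_axioms module_opposite module_left_dual M.module_axioms module_tensor[OF module_left_dual M.module_axioms])+

lemma endo_simps [simp]:
  "carrier EM = carrier (tensor K X \<Omega>)" "add EM = add (tensor K X \<Omega>)"
  "\<zero>\<^bsub>EM\<^esub> = \<zero>\<^bsub>tensor K X \<Omega>\<^esub>" "smult EM = smult (tensor K X \<Omega>)"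
  by (simp_all add: endo_bimodule_def Let_def)

lemma module_endo: "module K EM"
  by (rule module_cong[OF ground_modules(5)]) simp_all

lemma dual_tensor_bilinear: "pure_tensor K X \<Omega> \<in> bilinear_maps K X \<Omega> (tensor K X \<Omega>)"
  by (rule pure_tensor_bilinear[OF ground_modules(3,4)])

lemma lact_family:
  "\<lbrakk>a \<in> carrier A; a' \<in> carrier A\<rbrakk> \<Longrightarrow>
    (\<lambda>x \<omega>. pure_tensor K X \<Omega> (a \<triangleright>\<^bsub>X\<^esub> x) (\<omega> \<triangleleft>\<^bsub>\<Omega>\<^esub> a')) \<in> bilinear_maps K X \<Omega> (tensor K X \<Omega>)"
  "\<lbrakk>x \<in> carrier X; \<omega> \<in> carrier \<Omega>\<rbrakk> \<Longrightarrow>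
    (\<lambda>a a'. pure_tensor K X \<Omega> (a \<triangleright>\<^bsub>X\<^esub> x) (\<omega> \<triangleleft>\<^bsub>\<Omega>\<^esub> a')) \<in> bilinear_maps K A (opposite A) (tensor K X \<Omega>)"
  unfolding bilinear_maps_opposite
  by (intro bilin_compose[OF dual_tensor_bilinear] bilin_right[OF X.lact_bilinear] bilin_left[OF ract_bilinear]
    bilin_left[OF X.lact_bilinear] bilin_right[OF ract_bilinear]; assumption)+

lemma ract_family:
  "\<lbrakk>a \<in> carrier A; a' \<in> carrier A\<rbrakk> \<Longrightarrow>
    (\<lambda>x \<omega>. pure_tensor K X \<Omega> (x \<triangleleft>\<^bsub>X\<^esub> a) (a' \<triangleright>\<^bsub>\<Omega>\<^esub> \<omega>)) \<in> bilinear_maps K X \<Omega> (tensor K X \<Omega>)"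
  "\<lbrakk>x \<in> carrier X; \<omega> \<in> carrier \<Omega>\<rbrakk> \<Longrightarrow>
    (\<lambda>a a'. pure_tensor K X \<Omega> (x \<triangleleft>\<^bsub>X\<^esub> a) (a' \<triangleright>\<^bsub>\<Omega>\<^esub> \<omega>)) \<in> bilinear_maps K A (opposite A) (tensor K X \<Omega>)"
  unfolding bilinear_maps_opposite
  by (intro bilin_compose[OF dual_tensor_bilinear] bilin_left[OF X.ract_bilinear] bilin_right[OF lact_bilinear]
    bilin_right[OF X.ract_bilinear] bilin_left[OF lact_bilinear]; assumption)+

lemma lact_endo: "lact EM = double_lift K A (opposite A) X \<Omega> (tensor K X \<Omega>)
    (\<lambda>a a' x \<omega>. pure_tensor K X \<Omega> (a \<triangleright>\<^bsub>X\<^esub> x) (\<omega> \<triangleleft>\<^bsub>\<Omega>\<^esub> a'))"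
  by (auto simp: endo_bimodule_def Let_def double_lift_def[abs_def] fun_eq_iff)

lemma ract_endo: "t \<triangleleft>\<^bsub>EM\<^esub> u = double_lift K A (opposite A) X \<Omega> (tensor K X \<Omega>)
    (\<lambda>a a' x \<omega>. pure_tensor K X \<Omega> (x \<triangleleft>\<^bsub>X\<^esub> a) (a' \<triangleright>\<^bsub>\<Omega>\<^esub> \<omega>)) u t"
  by (auto simp: endo_bimodule_def Let_def double_lift_def fun_eq_iff)

lemma lact_endo_bilinear:
  "lact EM \<in> bilinear_maps K (tensor K A (opposite A)) (tensor K X \<Omega>) (tensor K X \<Omega>)"
  unfolding lact_endo by (rule double_lift_bilinear[OF ground_modules]) (simp_all add: lact_family)

lemma lact_endo_pure:
  "\<lbrakk>a \<in> carrier A; a' \<in> carrier A; x \<in> carrier X; \<omega> \<in> carrier \<Omega>\<rbrakk> \<Longrightarrow>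
    env_elem K A a a' \<triangleright>\<^bsub>EM\<^esub> pure_tensor K X \<Omega> x \<omega> = pure_tensor K X \<Omega> (a \<triangleright>\<^bsub>X\<^esub> x) (\<omega> \<triangleleft>\<^bsub>\<Omega>\<^esub> a')"
  unfolding lact_endo env_elem_def by (subst double_lift_pure[OF ground_modules]) (simp_all add: lact_family)

lemma ract_endo_bilinear:
  "(\<lambda>u t. t \<triangleleft>\<^bsub>EM\<^esub> u) \<in> bilinear_maps K (tensor K A (opposite A)) (tensor K X \<Omega>) (tensor K X \<Omega>)"
  unfolding ract_endo by (rule double_lift_bilinear[OF ground_modules]) (simp_all add: ract_family)

lemma ract_endo_pure:
  "\<lbrakk>a \<in> carrier A; a' \<in> carrier A; x \<in> carrier X; \<omega> \<in> carrier \<Omega>\<rbrakk> \<Longrightarrow>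
    pure_tensor K X \<Omega> x \<omega> \<triangleleft>\<^bsub>EM\<^esub> env_elem K A a a' = pure_tensor K X \<Omega> (x \<triangleleft>\<^bsub>X\<^esub> a) (a' \<triangleright>\<^bsub>\<Omega>\<^esub> \<omega>)"
  unfolding ract_endo env_elem_def by (subst double_lift_pure[OF ground_modules]) (simp_all add: ract_family)

end

lemma subalgebra_zero:
  assumes "k_algebra K F" "subalgebra K F H"
  shows "\<zero>\<^bsub>F\<^esub> \<in> H"
proof -
  interpret F: k_algebra K F by fact
  show ?thesis using subalgebraD(5)[OF assms(2), of "\<zero>\<^bsub>K\<^esub>" "\<one>\<^bsub>F\<^esub>"] subalgebraD(2)[OF assms(2)] by simp
qed

text \<open>A subalgebra is in particular a subspace, and pure tensors span.\<close>

lemma tensor_into_subalgebra: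
  assumes F: "k_algebra K F" and H: "subalgebra K F H" and M: "module K M" and N: "module K N"
    and f: "f \<in> linear_maps K (tensor K M N) F"
    and "\<And>m n. \<lbrakk>m \<in> carrier M; n \<in> carrier N\<rbrakk> \<Longrightarrow> f (pure_tensor K M N m n) \<in> H"
    and t: "t \<in> carrier (tensor K M N)"
  shows "f t \<in> H"
proof -
  interpret F: k_algebra K F by (rule F)
  show ?thesis using t
    by (induction t rule: tensor_induct[OF M N, consumes 1, case_names zero pure add smult])
      (simp_all add: assms(6) lin_zero[OF f] module_tensor M N F.A.module_axioms lin_add[OF f] lin_smult[OF f]
        subalgebraD[OF H] subalgebra_zero[OF F H])
qed

lemma algebra_homs_compose:
  assumes f: "f \<in> algebra_homs K A B" and g: "g \<in> algebra_homs K B C"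
  shows "(\<lambda>x. g (f x)) \<in> algebra_homs K A C"
  using lin_compose[OF algebra_homs_linear[OF f] algebra_homs_linear[OF g]] f g
  by (auto simp: algebra_homs_def ring_hom_def Pi_iff)

section \<open>The free product of \<open>B_Omega\<close> and \<open>T_X\<close>: generators and
  modules\<close>

context differential_calculus
begin

interpretation X: bimodule K A X by (rule bimodule_left_dual)
interpretation T: module K "tensor K X \<Omega>" by (rule ground_modules(5))

lemma lact_endo_closed: "\<lbrakk>u \<in> carrier Env; t \<in> carrier EM\<rbrakk> \<Longrightarrow> u \<triangleright>\<^bsub>EM\<^esub> t \<in> carrier EM"
  using bilin_closed[OF lact_endo_bilinear] by (simp add: carrier_env)

lemma ract_endo_closed: "\<lbrakk>u \<in> carrier Env; t \<in> carrier EM\<rbrakk> \<Longrightarrow> t \<triangleleft>\<^bsub>EM\<^esub> u \<in> carrier EM"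
  using bilin_closed[OF ract_endo_bilinear] by (simp add: carrier_env)

lemmas B_Omega_data = K.field_axioms weak_algebra_env module_endo lact_endo_closed ract_endo_closed

lemma k_algebra_B_Omega: "k_algebra K (B_Omega K A \<Omega>)"
  unfolding B_Omega_def by (rule k_algebra_tensor_algebra[OF B_Omega_data])

lemma weak_algebra_scalar: "weak_algebra K (scalar_algebra K)"
proof (intro weak_algebra.intro weak_algebra_axioms.intro)
  show "module K (scalar_algebra K)"
    by (rule moduleI)
      (auto intro!: abelian_groupI bexI[of _ "\<ominus>\<^bsub>K\<^esub> _"] simp: scalar_algebra_def K.is_cring K.l_distr K.r_distr K.m_assoc
        K.add.m_ac K.l_neg K.r_neg)
qed (simp_all add: scalar_algebra_def)

lemma linear_maps_scalar: "linear_maps K (scalar_bimodule X) N = linear_maps K X N"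
  by (rule linear_maps_cong) (simp_all add: scalar_bimodule_def)

lemma module_scalar: "module K (scalar_bimodule X)"
  by (rule module_cong[OF module_left_dual]) (simp_all add: scalar_bimodule_def)

lemma scalar_act_closed:
  "\<lbrakk>k \<in> carrier (scalar_algebra K); x \<in> carrier (scalar_bimodule X)\<rbrakk> \<Longrightarrow>
    k \<triangleright>\<^bsub>scalar_bimodule X\<^esub> x \<in> carrier (scalar_bimodule X)"
  "\<lbrakk>k \<in> carrier (scalar_algebra K); x \<in> carrier (scalar_bimodule X)\<rbrakk> \<Longrightarrow>
    x \<triangleleft>\<^bsub>scalar_bimodule X\<^esub> k \<in> carrier (scalar_bimodule X)"
  by (simp_all add: scalar_bimodule_def scalar_algebra_def)

lemmas T_X_data = K.field_axioms weak_algebra_scalar module_scalar scalar_act_closed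

lemma k_algebra_T_X: "k_algebra K (T_X K A \<Omega>)"
  unfolding T_X_def by (rule k_algebra_tensor_algebra[OF T_X_data])

abbreviation "FP \<equiv> B_Omega_T_X K A \<Omega>"

lemma k_algebra_FP: "k_algebra K FP"
  unfolding B_Omega_T_X_def by (rule k_algebra_free_product[OF k_algebra_B_Omega k_algebra_T_X])

interpretation FP: k_algebra K FP by (rule k_algebra_FP)

lemmas fp_left_hom' = fp_left_hom[OF k_algebra_B_Omega k_algebra_T_X, folded B_Omega_T_X_def]
lemmas fp_right_hom' = fp_right_hom[OF k_algebra_B_Omega k_algebra_T_X, folded B_Omega_T_X_def]

lemma fp_env_hom: "fp_env K A \<Omega> \<in> algebra_homs K Env FP"
  using algebra_homs_compose[OF ta_base_hom[OF B_Omega_data, folded B_Omega_def] fp_left_hom']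
  by (simp add: fp_env_def[abs_def])

lemma fp_endo_linear:
  "(\<lambda>t. fp_left K (B_Omega K A \<Omega>) (T_X K A \<Omega>) (ta_gen K Env EM t)) \<in> linear_maps K (tensor K X \<Omega>) FP"
proof -
  have "linear_maps K EM FP = linear_maps K (tensor K X \<Omega>) FP" by (rule linear_maps_cong) simp_all
  then show ?thesis
    using lin_compose[OF ta_gen_linear[OF B_Omega_data, folded B_Omega_def] algebra_homs_linear[OF fp_left_hom']]
    by simp
qed

lemma fp_endo_bilinear: "fp_endo K A \<Omega> \<in> bilinear_maps K X \<Omega> FP"
  using bilin_compose_lin[OF dual_tensor_bilinear fp_endo_linear] by (simp add: fp_endo_def[abs_def])

lemma fp_field_linear: "fp_field K A \<Omega> \<in> linear_maps K X FP"
  using lin_compose[OF ta_gen_linear[OF T_X_data, folded T_X_def] algebra_homs_linear[OF fp_right_hom']]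
  by (simp add: fp_field_def[abs_def] linear_maps_scalar)

lemma fp_env_endo:
  assumes "a \<in> carrier A" "b \<in> carrier A" "x \<in> carrier X" "\<omega> \<in> carrier \<Omega>"
  shows "fp_env K A \<Omega> (env_elem K A a b) \<otimes>\<^bsub>FP\<^esub> fp_endo K A \<Omega> x \<omega> =
      fp_endo K A \<Omega> (a \<triangleright>\<^bsub>X\<^esub> x) (\<omega> \<triangleleft>\<^bsub>\<Omega>\<^esub> b)"
    and "fp_endo K A \<Omega> x \<omega> \<otimes>\<^bsub>FP\<^esub> fp_env K A \<Omega> (env_elem K A a b) =
      fp_endo K A \<Omega> (x \<triangleleft>\<^bsub>X\<^esub> a) (b \<triangleright>\<^bsub>\<Omega>\<^esub> \<omega>)"
proof -
  note c = env_elem_closed[OF assms(1,2)] bilin_closed[OF dual_tensor_bilinear assms(3,4)]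
  have "ta_base K Env EM (env_elem K A a b) \<in> carrier (B_Omega K A \<Omega>)"
    "ta_gen K Env EM (pure_tensor K X \<Omega> x \<omega>) \<in> carrier (B_Omega K A \<Omega>)"
    using lin_closed[OF algebra_homs_linear[OF ta_base_hom[OF B_Omega_data]]]
      lin_closed[OF ta_gen_linear[OF B_Omega_data]] c by (simp_all add: B_Omega_def)
  moreover note ta_base_gen[OF B_Omega_data, of "env_elem K A a b" "pure_tensor K X \<Omega> x \<omega>", folded B_Omega_def]
  ultimately show "fp_env K A \<Omega> (env_elem K A a b) \<otimes>\<^bsub>FP\<^esub> fp_endo K A \<Omega> x \<omega> =
      fp_endo K A \<Omega> (a \<triangleright>\<^bsub>X\<^esub> x) (\<omega> \<triangleleft>\<^bsub>\<Omega>\<^esub> b)"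
    "fp_endo K A \<Omega> x \<omega> \<otimes>\<^bsub>FP\<^esub> fp_env K A \<Omega> (env_elem K A a b) =
      fp_endo K A \<Omega> (x \<triangleleft>\<^bsub>X\<^esub> a) (b \<triangleright>\<^bsub>\<Omega>\<^esub> \<omega>)"
    using assms c by (simp_all add: fp_env_def fp_endo_def algebra_homs_mult[OF fp_left_hom', symmetric]
        lact_endo_pure ract_endo_pure)
qed

text \<open>The two factors generate the free product. Within \<open>B_Omega\<close>, both the base
  algebra and the bimodule are spanned by pure tensors, which is why elements
  \<open>env_elem K A a b\<close> and \<open>fp_endo K A \<Omega> x \<omega>\<close>
  suffice.\<close>

lemma FP_generated:
  "generated_by K FP ({fp_env K A \<Omega> (env_elem K A a b) |a b. a \<in> carrier A \<and> b \<in> carrier A} \<union>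
     {fp_endo K A \<Omega> x \<omega> |x \<omega>. x \<in> carrier X \<and> \<omega> \<in> carrier \<Omega>} \<union> fp_field K A \<Omega> ` carrier X)"
    (is "generated_by K FP ?G")
proof (rule generated_byI)
  fix H assume H: "subalgebra K FP H" and G: "?G \<subseteq> H"
  let ?B = "B_Omega K A \<Omega>" and ?T = "T_X K A \<Omega>"
  have env: "fp_env K A \<Omega> u \<in> H" if u: "u \<in> carrier Env" for u
    by (rule tensor_into_subalgebra[OF k_algebra_FP H ground_modules(1,2)])
      (use u algebra_homs_linear[OF fp_env_hom] G in \<open>auto simp: linear_maps_env carrier_env env_elem_def\<close>)
  have endo: "fp_left K ?B ?T (ta_gen K Env EM t) \<in> H" if "t \<in> carrier EM" for t
    by (rule tensor_into_subalgebra[OF k_algebra_FP H ground_modules(3,4) fp_endo_linear])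
      (use that G in \<open>auto simp: fp_endo_def\<close>)
  have left: "fp_left K ?B ?T ` carrier ?B \<subseteq> H"
  proof (rule generated_by_hom[OF tensor_algebra_generated[OF B_Omega_data, folded B_Omega_def]
      k_algebra_B_Omega fp_left_hom' H])
    show "ta_base K Env EM ` carrier Env \<union> ta_gen K Env EM ` carrier EM \<subseteq> carrier ?B"
      using lin_closed[OF algebra_homs_linear[OF ta_base_hom[OF B_Omega_data]]]
        lin_closed[OF ta_gen_linear[OF B_Omega_data]] unfolding B_Omega_def by blast
    show "fp_left K ?B ?T ` (ta_base K Env EM ` carrier Env \<union> ta_gen K Env EM ` carrier EM) \<subseteq> H"
      using env endo unfolding fp_env_def by blast
  qed
  let ?S = "scalar_algebra K" and ?V = "scalar_bimodule X"
  have right: "fp_right K ?B ?T ` carrier ?T \<subseteq> H"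
  proof (rule generated_by_hom[OF tensor_algebra_generated[OF T_X_data, folded T_X_def]
      k_algebra_T_X fp_right_hom' H])
    interpret S: weak_algebra K ?S by (rule weak_algebra_scalar)
    note hom = algebra_homs_compose[OF ta_base_hom[OF T_X_data, folded T_X_def] fp_right_hom']
    show "ta_base K ?S ?V ` carrier ?S \<union> ta_gen K ?S ?V ` carrier ?V \<subseteq> carrier ?T"
      using lin_closed[OF algebra_homs_linear[OF ta_base_hom[OF T_X_data]]]
        lin_closed[OF ta_gen_linear[OF T_X_data]] unfolding T_X_def by blast
    \<comment> \<open>The letters of \<open>T_X\<close> that come from the ground field are
      multiples of the unit and so lie in every subalgebra.\<close>
    have "fp_right K ?B ?T (ta_base K ?S ?V k) \<in> H" if k: "k \<in> carrier ?S" for k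
    proof -
      have kK: "k \<in> carrier K" using k by (simp add: scalar_algebra_def)
      have "k = k \<odot>\<^bsub>?S\<^esub> \<one>\<^bsub>?S\<^esub>" using kK by (simp add: scalar_algebra_def)
      then have "fp_right K ?B ?T (ta_base K ?S ?V k) = k \<odot>\<^bsub>FP\<^esub> \<one>\<^bsub>FP\<^esub>"
        using lin_smult[OF algebra_homs_linear[OF hom] kK S.weak_one_closed] algebra_homs_one[OF hom] by simp
      then show ?thesis using kK subalgebraD[OF H] by simp
    qed
    moreover have "fp_right K ?B ?T (ta_gen K ?S ?V x) \<in> H" if "x \<in> carrier ?V" for x
      using that G by (auto simp: fp_field_def scalar_bimodule_def)
    ultimately show "fp_right K ?B ?T ` (ta_base K ?S ?V ` carrier ?S \<union> ta_gen K ?S ?V ` carrier ?V) \<subseteq> H"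
      by blast
  qed
  show "carrier FP \<subseteq> H"
    using generated_byD[OF free_product_generated[OF k_algebra_B_Omega k_algebra_T_X, folded B_Omega_T_X_def] H]
      left right by blast
qed

text \<open>The action is assembled from its pieces: the enveloping algebra acts by the bimodule
  structure, pairs act by \<open>E\<close> extended from pure tensors, and \<open>T_X\<close> acts
  by scalars and \<open>J\<close>. The relations coupling \<open>J\<close> with the base algebra
  enter only in \<open>BX_free_module\<close>, on passing to the quotient.\<close>

lemma FP_representation:
  assumes "vf_module K A N \<Omega> d E J"
  shows "\<exists>\<rho>. representation K FP N \<rho> \<and>
    (\<forall>a\<in>carrier A. \<forall>b\<in>carrier A. \<forall>n\<in>carrier N. \<rho> (fp_env K A \<Omega> (env_elem K A a b)) n = (a \<triangleright>\<^bsub>N\<^esub> n) \<triangleleft>\<^bsub>N\<^esub> b) \<and>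
    (\<forall>x\<in>carrier X. \<forall>\<omega>\<in>carrier \<Omega>. \<forall>n\<in>carrier N. \<rho> (fp_endo K A \<Omega> x \<omega>) n = E x \<omega> n) \<and>
    (\<forall>x\<in>carrier X. \<forall>n\<in>carrier N. \<rho> (fp_field K A \<Omega> x) n = J x n)"
proof -
  interpret N: vf_module K A N \<Omega> d E J by fact
  note mN = N.N.M.module_axioms
  let ?T = "tensor K X \<Omega>"
  obtain \<sigma> where \<sigma>: "representation K Env N \<sigma>"
    and \<sigma>e: "\<And>a b n. \<lbrakk>a \<in> carrier A; b \<in> carrier A; n \<in> carrier N\<rbrakk> \<Longrightarrow> \<sigma> (env_elem K A a b) n = (a \<triangleright>\<^bsub>N\<^esub> n) \<triangleleft>\<^bsub>N\<^esub> b"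
    using N.N.env_representation by auto
  note sb = representationD(1)[OF \<sigma>]
  define m where "m t n = tensor_lift K X \<Omega> N (\<lambda>x \<omega>. E x \<omega> n) t" for t n
  have lin1: "(\<lambda>t. m t n) \<in> linear_maps K ?T N" if "n \<in> carrier N" for n
    unfolding m_def by (rule tensor_lift_linear[OF ground_modules(3,4) mN N.E_bilinear[OF that]])
  have pure: "m (pure_tensor K X \<Omega> x \<omega>) n = E x \<omega> n" if "x \<in> carrier X" "\<omega> \<in> carrier \<Omega>" "n \<in> carrier N" for x \<omega> n
    unfolding m_def by (rule tensor_lift_pure[OF ground_modules(3,4) mN N.E_bilinear]) (simp_all add: that)
  note ext = tensor_ext[OF ground_modules(3,4) mN]
  have lin2: "m t \<in> linear_maps K N N" if t: "t \<in> carrier ?T" for t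
  proof (rule linear_mapsI)
    fix n n' assume [simp]: "n \<in> carrier N" "n' \<in> carrier N"
    show "m t n \<in> carrier N" by (rule lin_closed[OF lin1 t]) simp
    show "m t (n \<oplus>\<^bsub>N\<^esub> n') = m t n \<oplus>\<^bsub>N\<^esub> m t n'"
      by (rule ext[OF lin1 lin_plus[OF lin1 lin1] _ t]) (simp_all add: mN pure lin_add[OF N.E_linear])
    fix k assume [simp]: "k \<in> carrier K"
    show "m t (k \<odot>\<^bsub>N\<^esub> n) = k \<odot>\<^bsub>N\<^esub> m t n"
      by (rule ext[OF lin1 lin_scale[OF lin1] _ t]) (simp_all add: mN pure lin_smult[OF N.E_linear])
  qed
  have linEM: "linear_maps K EM N = linear_maps K ?T N" by (rule linear_maps_cong) simp_all
  have mb: "m \<in> bilinear_maps K EM N N"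
    by (rule bilinear_mapsI) (simp_all add: linEM lin1 lin2)
  \<comment> \<open>Again one argument at a time: \<open>t\<close> first, starting from pure tensors
    and with u an element \<open>env_elem K A a b\<close>, and then \<open>u\<close>.\<close>
  have l: "\<sigma> u (m t n) = m (u \<triangleright>\<^bsub>EM\<^esub> t) n" if u: "u \<in> carrier Env" and t: "t \<in> carrier ?T" and n [simp]: "n \<in> carrier N" for u t n
  proof -
    have 1: "\<sigma> (env_elem K A a b) (m t n) = m (env_elem K A a b \<triangleright>\<^bsub>EM\<^esub> t) n"
      if [simp]: "a \<in> carrier A" "b \<in> carrier A" for a b
      by (rule ext[OF lin_compose[OF lin1 bilin_right[OF sb]] lin_compose[OF bilin_right[OF lact_endo_bilinear] lin1] _ t])
        (simp_all add: env_elem_closed[unfolded carrier_env] carrier_env pure lact_endo_pure \<sigma>e N.E_closed X.lact_closed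
          ract_closed N.E_lact N.E_ract)
    have lb: "(\<lambda>u. u \<triangleright>\<^bsub>EM\<^esub> t) \<in> linear_maps K Env ?T"
      using bilin_left[OF lact_endo_bilinear t] by (simp add: linear_maps_env)
    show ?thesis
      by (rule env_ext[OF mN bilin_left[OF sb] lin_compose[OF lb lin1] _ u])
        (simp_all add: 1 lin_closed[OF lin2 n, OF t])
  qed
  have r: "m t (\<sigma> u n) = m (t \<triangleleft>\<^bsub>EM\<^esub> u) n" if u: "u \<in> carrier Env" and t: "t \<in> carrier ?T" and n [simp]: "n \<in> carrier N" for u t n
  proof -
    have 1: "m t (\<sigma> (env_elem K A a b) n) = m (t \<triangleleft>\<^bsub>EM\<^esub> env_elem K A a b) n"
      if [simp]: "a \<in> carrier A" "b \<in> carrier A" for a b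
      by (rule ext[OF lin1 lin_compose[OF bilin_right[OF ract_endo_bilinear] lin1] _ t])
        (simp_all add: env_elem_closed[unfolded carrier_env] pure ract_endo_pure \<sigma>e N.E_closed X.ract_closed
          lact_closed N.E_lact_right N.E_ract_right N.N.lact_closed N.N.ract_closed)
    have rb: "(\<lambda>u. t \<triangleleft>\<^bsub>EM\<^esub> u) \<in> linear_maps K Env ?T"
      using bilin_left[OF ract_endo_bilinear t] by (simp add: linear_maps_env)
    show ?thesis
      by (rule env_ext[OF mN lin_compose[OF bilin_left[OF sb] lin2] lin_compose[OF rb lin1] _ u])
        (simp_all add: 1 t)
  qed
  obtain \<rho>1 where \<rho>1: "representation K (B_Omega K A \<Omega>) N \<rho>1"
    and \<rho>1e: "\<And>u n. \<lbrakk>u \<in> carrier Env; n \<in> carrier N\<rbrakk> \<Longrightarrow> \<rho>1 (ta_base K Env EM u) n = \<sigma> u n"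
    and \<rho>1m: "\<And>t n. \<lbrakk>t \<in> carrier EM; n \<in> carrier N\<rbrakk> \<Longrightarrow> \<rho>1 (ta_gen K Env EM t) n = m t n"
    using tensor_algebra_representation[OF B_Omega_data mN \<sigma> mb, folded B_Omega_def] l r by auto
  let ?S = "scalar_algebra K" and ?V = "scalar_bimodule X"
  have \<tau>: "representation K ?S N (smult N)"
    by (intro representationI bilinear_mapsI linear_mapsI)
      (auto simp: scalar_algebra_def N.N.M.smult_l_distr N.N.M.smult_r_distr N.N.M.smult_assoc1[symmetric] K.m_comm)
  have Jb: "J \<in> bilinear_maps K ?V N N"
    using N.J_bilinear by (simp add: bilinear_maps_def linear_maps_scalar) (simp add: scalar_bimodule_def)
  have sJ: "\<And>k x n. \<lbrakk>k \<in> carrier ?S; x \<in> carrier ?V; n \<in> carrier N\<rbrakk> \<Longrightarrow> k \<odot>\<^bsub>N\<^esub> J x n = J (k \<triangleright>\<^bsub>?V\<^esub> x) n"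
    "\<And>k x n. \<lbrakk>k \<in> carrier ?S; x \<in> carrier ?V; n \<in> carrier N\<rbrakk> \<Longrightarrow> J x (k \<odot>\<^bsub>N\<^esub> n) = J (x \<triangleleft>\<^bsub>?V\<^esub> k) n"
    by (simp_all add: scalar_algebra_def scalar_bimodule_def lin_smult[OF bilin_left[OF N.J_bilinear]]
        lin_smult[OF bilin_right[OF N.J_bilinear]])
  obtain \<rho>2 where \<rho>2: "representation K (T_X K A \<Omega>) N \<rho>2"
    and \<rho>2x: "\<And>x n. \<lbrakk>x \<in> carrier ?V; n \<in> carrier N\<rbrakk> \<Longrightarrow> \<rho>2 (ta_gen K ?S ?V x) n = J x n"
    using tensor_algebra_representation[where m = J and \<sigma> = "smult N", OF T_X_data mN \<tau> Jb sJ, folded T_X_def] by auto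
  obtain \<rho> where \<rho>: "representation K FP N \<rho>"
    and \<rho>l: "\<And>b n. \<lbrakk>b \<in> carrier (B_Omega K A \<Omega>); n \<in> carrier N\<rbrakk> \<Longrightarrow>
      \<rho> (fp_left K (B_Omega K A \<Omega>) (T_X K A \<Omega>) b) n = \<rho>1 b n"
    and \<rho>r: "\<And>b n. \<lbrakk>b \<in> carrier (T_X K A \<Omega>); n \<in> carrier N\<rbrakk> \<Longrightarrow>
      \<rho> (fp_right K (B_Omega K A \<Omega>) (T_X K A \<Omega>) b) n = \<rho>2 b n"
    using free_product_representation[OF k_algebra_B_Omega k_algebra_T_X mN \<rho>1 \<rho>2, folded B_Omega_T_X_def]
    by auto
  show ?thesis
  proof (intro exI[of _ \<rho>] conjI ballI)
    fix a b n assume ab: "a \<in> carrier A" "b \<in> carrier A" and n: "n \<in> carrier N"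
    have "ta_base K Env EM (env_elem K A a b) \<in> carrier (B_Omega K A \<Omega>)"
      using lin_closed[OF algebra_homs_linear[OF ta_base_hom[OF B_Omega_data]]] env_elem_closed[OF ab]
      by (simp add: B_Omega_def)
    then show "\<rho> (fp_env K A \<Omega> (env_elem K A a b)) n = (a \<triangleright>\<^bsub>N\<^esub> n) \<triangleleft>\<^bsub>N\<^esub> b"
      using ab n by (simp add: fp_env_def \<rho>l \<rho>1e \<sigma>e env_elem_closed)
  next
    fix x \<omega> n assume x: "x \<in> carrier X" "\<omega> \<in> carrier \<Omega>" and n: "n \<in> carrier N"
    have "pure_tensor K X \<Omega> x \<omega> \<in> carrier EM" using bilin_closed[OF dual_tensor_bilinear x] by simp
    moreover from this have "ta_gen K Env EM (pure_tensor K X \<Omega> x \<omega>) \<in> carrier (B_Omega K A \<Omega>)"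
      using lin_closed[OF ta_gen_linear[OF B_Omega_data]] by (simp add: B_Omega_def)
    ultimately show "\<rho> (fp_endo K A \<Omega> x \<omega>) n = E x \<omega> n"
      using x n by (simp add: fp_endo_def \<rho>l \<rho>1m pure)
  next
    fix x n assume x: "x \<in> carrier X" and n: "n \<in> carrier N"
    have "x \<in> carrier ?V" using x by (simp add: scalar_bimodule_def)
    moreover from this have "ta_gen K ?S ?V x \<in> carrier (T_X K A \<Omega>)"
      using lin_closed[OF ta_gen_linear[OF T_X_data]] by (simp add: T_X_def)
    ultimately show "\<rho> (fp_field K A \<Omega> x) n = J x n"
      using n by (simp add: fp_field_def \<rho>r \<rho>2x)
  qed (rule \<rho>)
qed

end

lemma (in quotient_algebra) cls_hom: "cls \<in> algebra_homs K F (quotient F I)"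
  using cls_linear by (simp add: algebra_homs_def ring_hom_def alg_simps)

text \<open>These are the homomorphisms of left modules over \<open>BX K A \<Omega> d\<close>,
  expressed through the actions of its generators.\<close>

definition vf_hom :: "'k ring \<Rightarrow> ('k, 'a) module \<Rightarrow> ('k, 'a, 'w) bimodule \<Rightarrow>
    ('k, 'a, 'm) bimodule \<Rightarrow> (('w \<Rightarrow> 'a) \<Rightarrow> 'w \<Rightarrow> 'm \<Rightarrow> 'm) \<Rightarrow> (('w \<Rightarrow> 'a) \<Rightarrow> 'm \<Rightarrow> 'm) \<Rightarrow>
    ('k, 'a, 'n) bimodule \<Rightarrow> (('w \<Rightarrow> 'a) \<Rightarrow> 'w \<Rightarrow> 'n \<Rightarrow> 'n) \<Rightarrow> (('w \<Rightarrow> 'a) \<Rightarrow> 'n \<Rightarrow> 'n) \<Rightarrow> ('m \<Rightarrow> 'n) \<Rightarrow> bool"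
  where "vf_hom K A \<Omega> M E J N E' J' f \<longleftrightarrow> f \<in> bimodule_maps K A M N \<and>
    (\<forall>x\<in>carrier (left_dual A \<Omega>). \<forall>m\<in>carrier M.
      (\<forall>\<omega>\<in>carrier \<Omega>. f (E x \<omega> m) = E' x \<omega> (f m)) \<and> f (J x m) = J' x (f m))"

lemma vf_homI:
  assumes "f \<in> linear_maps K M N"
    and "\<And>a m. \<lbrakk>a \<in> carrier A; m \<in> carrier M\<rbrakk> \<Longrightarrow> f (a \<triangleright>\<^bsub>M\<^esub> m) = a \<triangleright>\<^bsub>N\<^esub> f m"
    and "\<And>a m. \<lbrakk>a \<in> carrier A; m \<in> carrier M\<rbrakk> \<Longrightarrow> f (m \<triangleleft>\<^bsub>M\<^esub> a) = f m \<triangleleft>\<^bsub>N\<^esub> a"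
    and "\<And>x \<omega> m. \<lbrakk>x \<in> carrier (left_dual A \<Omega>); \<omega> \<in> carrier \<Omega>; m \<in> carrier M\<rbrakk> \<Longrightarrow> f (E x \<omega> m) = E' x \<omega> (f m)"
    and "\<And>x m. \<lbrakk>x \<in> carrier (left_dual A \<Omega>); m \<in> carrier M\<rbrakk> \<Longrightarrow> f (J x m) = J' x (f m)"
  shows "vf_hom K A \<Omega> M E J N E' J' f"
  using assms by (simp add: vf_hom_def bimodule_maps_def)

lemma
  assumes "vf_hom K A \<Omega> M E J N E' J' f"
  shows vf_hom_linear: "f \<in> linear_maps K M N"
    and vf_hom_lact: "\<lbrakk>a \<in> carrier A; m \<in> carrier M\<rbrakk> \<Longrightarrow> f (a \<triangleright>\<^bsub>M\<^esub> m) = a \<triangleright>\<^bsub>N\<^esub> f m"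
    and vf_hom_ract: "\<lbrakk>a \<in> carrier A; m \<in> carrier M\<rbrakk> \<Longrightarrow> f (m \<triangleleft>\<^bsub>M\<^esub> a) = f m \<triangleleft>\<^bsub>N\<^esub> a"
    and vf_hom_E: "\<lbrakk>x \<in> carrier (left_dual A \<Omega>); \<omega> \<in> carrier \<Omega>; m \<in> carrier M\<rbrakk> \<Longrightarrow> f (E x \<omega> m) = E' x \<omega> (f m)"
    and vf_hom_J: "\<lbrakk>x \<in> carrier (left_dual A \<Omega>); m \<in> carrier M\<rbrakk> \<Longrightarrow> f (J x m) = J' x (f m)"
    and vf_hom_closed: "m \<in> carrier M \<Longrightarrow> f m \<in> carrier N"
  using assms by (auto simp: vf_hom_def bimodule_maps_def linear_maps_def)

section \<open>The algebra \<open>BX\<close>, its relations, and \<open>|B\<close> as a free module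
  on one generator\<close>

context differential_calculus
begin

interpretation X: bimodule K A X by (rule bimodule_left_dual)
interpretation FP: k_algebra K FP by (rule k_algebra_FP)

lemma fp_closed:
  "\<lbrakk>a \<in> carrier A; b \<in> carrier A\<rbrakk> \<Longrightarrow> fp_env K A \<Omega> (env_elem K A a b) \<in> carrier FP"
  "\<lbrakk>x \<in> carrier X; \<omega> \<in> carrier \<Omega>\<rbrakk> \<Longrightarrow> fp_endo K A \<Omega> x \<omega> \<in> carrier FP"
  "x \<in> carrier X \<Longrightarrow> fp_field K A \<Omega> x \<in> carrier FP"
  by (rule lin_closed[OF algebra_homs_linear[OF fp_env_hom] env_elem_closed] bilin_closed[OF fp_endo_bilinear]
    lin_closed[OF fp_field_linear]; assumption)+

definition BX_rel where "BX_rel =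
  {fp_env K A \<Omega> (env_elem K A a \<one>\<^bsub>A\<^esub>) \<otimes>\<^bsub>FP\<^esub> fp_field K A \<Omega> x \<ominus>\<^bsub>FP\<^esub> fp_field K A \<Omega> (a \<triangleright>\<^bsub>X\<^esub> x) |a x.
     a \<in> carrier A \<and> x \<in> carrier X} \<union>
  {fp_field K A \<Omega> x \<otimes>\<^bsub>FP\<^esub> fp_env K A \<Omega> (env_elem K A a \<one>\<^bsub>A\<^esub>) \<ominus>\<^bsub>FP\<^esub>
     (fp_field K A \<Omega> (x \<triangleleft>\<^bsub>X\<^esub> a) \<oplus>\<^bsub>FP\<^esub> fp_env K A \<Omega> (env_elem K A (x (d a)) \<one>\<^bsub>A\<^esub>)) |a x.
     a \<in> carrier A \<and> x \<in> carrier X} \<union>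
  {fp_field K A \<Omega> x \<otimes>\<^bsub>FP\<^esub> fp_env K A \<Omega> (env_elem K A \<one>\<^bsub>A\<^esub> a) \<ominus>\<^bsub>FP\<^esub>
     (fp_env K A \<Omega> (env_elem K A \<one>\<^bsub>A\<^esub> a) \<otimes>\<^bsub>FP\<^esub> fp_field K A \<Omega> x \<oplus>\<^bsub>FP\<^esub> fp_endo K A \<Omega> x (d a)) |a x.
     a \<in> carrier A \<and> x \<in> carrier X}"

lemma BX_ideal_eq: "BX_ideal K A \<Omega> d = genideal FP BX_rel"
  by (simp add: BX_ideal_def BX_rel_def Let_def)

lemma BX_rel_closed: "BX_rel \<subseteq> carrier FP"
  by (auto simp: BX_rel_def fp_closed X.lact_closed X.ract_closed dual_closed d_closed)

lemma BX_rel_ideal: "BX_rel \<subseteq> BX_ideal K A \<Omega> d"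
  unfolding BX_ideal_eq by (rule FP.A.genideal_self[OF BX_rel_closed])

interpretation Q: quotient_algebra K FP "BX_ideal K A \<Omega> d"
  unfolding BX_ideal_eq
  by (intro quotient_algebra.intro FP.k_algebra_axioms FP.A.genideal_ideal BX_rel_closed)

lemma BX_eqs: "BX K A \<Omega> d = quotient FP (BX_ideal K A \<Omega> d)"
  "BX_env K A \<Omega> d u = Q.cls (fp_env K A \<Omega> u)" "BX_endo K A \<Omega> d x \<omega> = Q.cls (fp_endo K A \<Omega> x \<omega>)"
  "BX_field K A \<Omega> d x = Q.cls (fp_field K A \<Omega> x)"
  by (simp_all add: BX_def BX_env_def BX_endo_def BX_field_def)

abbreviation "BXA \<equiv> BX K A \<Omega> d"
abbreviation "\<eta> \<equiv> BX_env K A \<Omega> d"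
abbreviation "eB \<equiv> BX_endo K A \<Omega> d"
abbreviation "jB \<equiv> BX_field K A \<Omega> d"
abbreviation "sB \<equiv> source K A \<eta>"
abbreviation "tB \<equiv> target K A \<eta>"
abbreviation "LB \<equiv> left_bimodule K A BXA \<eta>"

lemma k_algebra_BX: "k_algebra K BXA"
  unfolding BX_eqs by (rule Q.k_algebra_quotient)

interpretation B: k_algebra K BXA by (rule k_algebra_BX)

lemma BX_env_hom: "\<eta> \<in> algebra_homs K Env BXA"
  using algebra_homs_compose[OF fp_env_hom Q.cls_hom] by (simp add: BX_eqs(1) BX_eqs(2)[abs_def])

lemma BX_endo_bilinear: "eB \<in> bilinear_maps K X \<Omega> BXA"
  using bilin_compose_lin[OF fp_endo_bilinear Q.cls_linear] by (simp add: BX_eqs(1) BX_eqs(3)[abs_def])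

lemma BX_field_linear: "jB \<in> linear_maps K X BXA"
  using lin_compose[OF fp_field_linear Q.cls_linear] by (simp add: BX_eqs(1) BX_eqs(4)[abs_def])

lemma BX_source_linear: "sB \<in> linear_maps K A BXA"
  using lin_compose[OF bilin_left[OF env_elem_bilinear] algebra_homs_linear[OF BX_env_hom]]
  by (simp add: source_def[abs_def])

lemma BX_target_linear: "tB \<in> linear_maps K A BXA"
  using lin_compose[OF bilin_right[OF env_elem_bilinear] algebra_homs_linear[OF BX_env_hom]]
  by (simp add: target_def[abs_def])

lemma BX_env_mult:
  "\<lbrakk>a \<in> carrier A; b \<in> carrier A; a' \<in> carrier A; b' \<in> carrier A\<rbrakk> \<Longrightarrow>
    \<eta> (env_elem K A a b) \<otimes>\<^bsub>BXA\<^esub> \<eta> (env_elem K A a' b') = \<eta> (env_elem K A (a \<otimes>\<^bsub>A\<^esub> a') (b' \<otimes>\<^bsub>A\<^esub> b))"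
  by (simp add: algebra_homs_mult[OF BX_env_hom, symmetric] env_elem_closed env_elem_mult)

lemma BX_closed:
  "a \<in> carrier A \<Longrightarrow> sB a \<in> carrier BXA" "a \<in> carrier A \<Longrightarrow> tB a \<in> carrier BXA"
  "\<lbrakk>x \<in> carrier X; \<omega> \<in> carrier \<Omega>\<rbrakk> \<Longrightarrow> eB x \<omega> \<in> carrier BXA" "x \<in> carrier X \<Longrightarrow> jB x \<in> carrier BXA"
  by (rule lin_closed[OF BX_source_linear] lin_closed[OF BX_target_linear] bilin_closed[OF BX_endo_bilinear]
    lin_closed[OF BX_field_linear]; assumption)+

lemma BX_source_target:
  "\<lbrakk>a \<in> carrier A; b \<in> carrier A\<rbrakk> \<Longrightarrow> sB a \<otimes>\<^bsub>BXA\<^esub> sB b = sB (a \<otimes>\<^bsub>A\<^esub> b)"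
  "\<lbrakk>a \<in> carrier A; b \<in> carrier A\<rbrakk> \<Longrightarrow> tB a \<otimes>\<^bsub>BXA\<^esub> tB b = tB (b \<otimes>\<^bsub>A\<^esub> a)"
  "\<lbrakk>a \<in> carrier A; b \<in> carrier A\<rbrakk> \<Longrightarrow> sB a \<otimes>\<^bsub>BXA\<^esub> tB b = \<eta> (env_elem K A a b)"
  "\<lbrakk>a \<in> carrier A; b \<in> carrier A\<rbrakk> \<Longrightarrow> tB b \<otimes>\<^bsub>BXA\<^esub> sB a = \<eta> (env_elem K A a b)"
  "sB \<one>\<^bsub>A\<^esub> = \<one>\<^bsub>BXA\<^esub>" "tB \<one>\<^bsub>A\<^esub> = \<one>\<^bsub>BXA\<^esub>"
  by (simp_all add: source_def target_def BX_env_mult algebra_homs_one[OF BX_env_hom, symmetric] env_one)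

text \<open>The action of the enveloping algebra on pairs splits into four: \<open>sB\<close>
  touches the field x and \<open>tB\<close> the form \<omega>, each from both sides.\<close>

lemma BX_endo_relations:
  assumes "a \<in> carrier A" "x \<in> carrier X" "\<omega> \<in> carrier \<Omega>"
  shows "sB a \<otimes>\<^bsub>BXA\<^esub> eB x \<omega> = eB (a \<triangleright>\<^bsub>X\<^esub> x) \<omega>" "tB a \<otimes>\<^bsub>BXA\<^esub> eB x \<omega> = eB x (\<omega> \<triangleleft>\<^bsub>\<Omega>\<^esub> a)"
    "eB x \<omega> \<otimes>\<^bsub>BXA\<^esub> sB a = eB (x \<triangleleft>\<^bsub>X\<^esub> a) \<omega>" "eB x \<omega> \<otimes>\<^bsub>BXA\<^esub> tB a = eB x (a \<triangleright>\<^bsub>\<Omega>\<^esub> \<omega>)"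
  using assms by (simp_all add: source_def target_def BX_eqs Q.mult_quotient fp_closed fp_env_endo
      ract_one one_lact X.ract_one X.one_lact)

lemma BX_field_relations:
  assumes a: "a \<in> carrier A" and x: "x \<in> carrier X"
  shows "sB a \<otimes>\<^bsub>BXA\<^esub> jB x = jB (a \<triangleright>\<^bsub>X\<^esub> x)"
    "jB x \<otimes>\<^bsub>BXA\<^esub> sB a = jB (x \<triangleleft>\<^bsub>X\<^esub> a) \<oplus>\<^bsub>BXA\<^esub> sB (x (d a))"
    "jB x \<otimes>\<^bsub>BXA\<^esub> tB a = tB a \<otimes>\<^bsub>BXA\<^esub> jB x \<oplus>\<^bsub>BXA\<^esub> eB x (d a)"
proof -
  note simps = source_def target_def BX_eqs Q.mult_quotient Q.add_quotient fp_closed a x d_closed dual_closed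
    X.lact_closed X.ract_closed Q.cls_eq_iff
  have "fp_env K A \<Omega> (env_elem K A a \<one>\<^bsub>A\<^esub>) \<otimes>\<^bsub>FP\<^esub> fp_field K A \<Omega> x \<ominus>\<^bsub>FP\<^esub> fp_field K A \<Omega> (a \<triangleright>\<^bsub>X\<^esub> x) \<in> BX_rel"
    unfolding BX_rel_def using a x by blast
  then show "sB a \<otimes>\<^bsub>BXA\<^esub> jB x = jB (a \<triangleright>\<^bsub>X\<^esub> x)"
    using BX_rel_ideal by (simp add: simps subsetD)
  have "fp_field K A \<Omega> x \<otimes>\<^bsub>FP\<^esub> fp_env K A \<Omega> (env_elem K A a \<one>\<^bsub>A\<^esub>) \<ominus>\<^bsub>FP\<^esub>
     (fp_field K A \<Omega> (x \<triangleleft>\<^bsub>X\<^esub> a) \<oplus>\<^bsub>FP\<^esub> fp_env K A \<Omega> (env_elem K A (x (d a)) \<one>\<^bsub>A\<^esub>)) \<in> BX_rel"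
    unfolding BX_rel_def using a x by blast
  then show "jB x \<otimes>\<^bsub>BXA\<^esub> sB a = jB (x \<triangleleft>\<^bsub>X\<^esub> a) \<oplus>\<^bsub>BXA\<^esub> sB (x (d a))"
    using BX_rel_ideal by (simp add: simps subsetD)
  have "fp_field K A \<Omega> x \<otimes>\<^bsub>FP\<^esub> fp_env K A \<Omega> (env_elem K A \<one>\<^bsub>A\<^esub> a) \<ominus>\<^bsub>FP\<^esub>
     (fp_env K A \<Omega> (env_elem K A \<one>\<^bsub>A\<^esub> a) \<otimes>\<^bsub>FP\<^esub> fp_field K A \<Omega> x \<oplus>\<^bsub>FP\<^esub> fp_endo K A \<Omega> x (d a)) \<in> BX_rel"
    unfolding BX_rel_def using a x by blast
  then show "jB x \<otimes>\<^bsub>BXA\<^esub> tB a = tB a \<otimes>\<^bsub>BXA\<^esub> jB x \<oplus>\<^bsub>BXA\<^esub> eB x (d a)"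
    using BX_rel_ideal by (simp add: simps subsetD)
qed

lemma BX_generated:
  "generated_by K BXA ({\<eta> (env_elem K A a b) |a b. a \<in> carrier A \<and> b \<in> carrier A} \<union>
     {eB x \<omega> |x \<omega>. x \<in> carrier X \<and> \<omega> \<in> carrier \<Omega>} \<union> jB ` carrier X)"
  unfolding BX_eqs
  by (rule generated_by_mono[OF Q.quotient_generated[OF FP_generated]]) (auto simp: fp_closed)

lemma left_bimodule_simps:
  "carrier LB = carrier BXA" "add LB = add BXA" "\<zero>\<^bsub>LB\<^esub> = \<zero>\<^bsub>BXA\<^esub>" "smult LB = smult BXA"
  "r \<triangleright>\<^bsub>LB\<^esub> b = sB r \<otimes>\<^bsub>BXA\<^esub> b" "b \<triangleleft>\<^bsub>LB\<^esub> r = tB r \<otimes>\<^bsub>BXA\<^esub> b"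
  by (simp_all add: left_bimodule_def)

lemma linear_maps_LB: "linear_maps K LB N = linear_maps K BXA N" "linear_maps K N LB = linear_maps K N BXA"
  by (rule linear_maps_cong; simp add: left_bimodule_simps)+

lemma bimodule_LB: "bimodule K A LB"
proof (rule bimoduleI[OF k_algebra_axioms])
  show "module K LB" by (rule module_cong[OF B.A.module_axioms]) (simp_all add: left_bimodule_simps)
  have "(\<lambda>r b. sB r \<otimes>\<^bsub>BXA\<^esub> b) \<in> bilinear_maps K A BXA BXA" "(\<lambda>b r. tB r \<otimes>\<^bsub>BXA\<^esub> b) \<in> bilinear_maps K BXA A BXA"
    using bilin_compose[OF B.mult_bilinear BX_source_linear lin_id]
      bilin_compose[OF B.mult_bilinear BX_target_linear lin_id] by (auto simp: bilinear_maps_def)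
  then show "lact LB \<in> bilinear_maps K A LB LB" "ract LB \<in> bilinear_maps K LB A LB"
    by (auto simp: bilinear_maps_def linear_maps_LB) (simp_all add: left_bimodule_def)
  fix a b m assume "a \<in> carrier A" "b \<in> carrier A" "m \<in> carrier LB"
  then show "(a \<otimes>\<^bsub>A\<^esub> b) \<triangleright>\<^bsub>LB\<^esub> m = a \<triangleright>\<^bsub>LB\<^esub> (b \<triangleright>\<^bsub>LB\<^esub> m)"
    "m \<triangleleft>\<^bsub>LB\<^esub> (a \<otimes>\<^bsub>A\<^esub> b) = (m \<triangleleft>\<^bsub>LB\<^esub> a) \<triangleleft>\<^bsub>LB\<^esub> b" "(a \<triangleright>\<^bsub>LB\<^esub> m) \<triangleleft>\<^bsub>LB\<^esub> b = a \<triangleright>\<^bsub>LB\<^esub> (m \<triangleleft>\<^bsub>LB\<^esub> b)"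
    by (simp_all add: left_bimodule_simps B.A.m_assoc[symmetric] BX_closed BX_source_target)
qed (simp_all add: left_bimodule_simps BX_source_target)

abbreviation "EB x \<omega> b \<equiv> eB x \<omega> \<otimes>\<^bsub>BXA\<^esub> b"
abbreviation "JB x b \<equiv> jB x \<otimes>\<^bsub>BXA\<^esub> b"

text \<open>The module axioms are the defining relations of \<open>BX\<close> multiplied by n on the
  right.\<close>

lemma vf_module_LB: "vf_module K A LB \<Omega> d EB JB"
proof (intro vf_module.intro vf_module_axioms.intro)
  show "bimodule K A LB" by (rule bimodule_LB)
  fix x assume x: "x \<in> carrier X"
  show "\<And>\<omega>. \<omega> \<in> carrier \<Omega> \<Longrightarrow> EB x \<omega> \<in> linear_maps K LB LB"
    unfolding linear_maps_LB by (intro bilin_right[OF B.mult_bilinear] BX_closed x)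
  fix a n assume a: "a \<in> carrier A" and n: "n \<in> carrier LB"
  note n' = n[unfolded left_bimodule_simps]
  note simps = left_bimodule_simps B.A.m_assoc[symmetric] BX_closed BX_source_target BX_endo_relations BX_field_relations a x n'
    B.A.l_distr d_closed dual_closed X.lact_closed X.ract_closed lact_closed ract_closed
  show "\<And>\<omega>. \<omega> \<in> carrier \<Omega> \<Longrightarrow> EB (a \<triangleright>\<^bsub>X\<^esub> x) \<omega> n = a \<triangleright>\<^bsub>LB\<^esub> EB x \<omega> n"
    "\<And>\<omega>. \<omega> \<in> carrier \<Omega> \<Longrightarrow> EB x (\<omega> \<triangleleft>\<^bsub>\<Omega>\<^esub> a) n = EB x \<omega> n \<triangleleft>\<^bsub>LB\<^esub> a"
    "\<And>\<omega>. \<omega> \<in> carrier \<Omega> \<Longrightarrow> EB x \<omega> (a \<triangleright>\<^bsub>LB\<^esub> n) = EB (x \<triangleleft>\<^bsub>X\<^esub> a) \<omega> n"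
    "\<And>\<omega>. \<omega> \<in> carrier \<Omega> \<Longrightarrow> EB x \<omega> (n \<triangleleft>\<^bsub>LB\<^esub> a) = EB x (a \<triangleright>\<^bsub>\<Omega>\<^esub> \<omega>) n"
    "JB (a \<triangleright>\<^bsub>X\<^esub> x) n = a \<triangleright>\<^bsub>LB\<^esub> JB x n"
    "JB x (a \<triangleright>\<^bsub>LB\<^esub> n) = JB (x \<triangleleft>\<^bsub>X\<^esub> a) n \<oplus>\<^bsub>LB\<^esub> x (d a) \<triangleright>\<^bsub>LB\<^esub> n"
    "JB x (n \<triangleleft>\<^bsub>LB\<^esub> a) = JB x n \<triangleleft>\<^bsub>LB\<^esub> a \<oplus>\<^bsub>LB\<^esub> EB x (d a) n"
    by (simp_all add: simps)
next
  fix n assume "n \<in> carrier LB"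
  then have "(\<lambda>b. b \<otimes>\<^bsub>BXA\<^esub> n) \<in> linear_maps K BXA LB"
    by (simp add: bilin_left[OF B.mult_bilinear] linear_maps_LB left_bimodule_simps)
  from bilin_compose_lin[OF BX_endo_bilinear this]
  show "(\<lambda>x \<omega>. EB x \<omega> n) \<in> bilinear_maps K X \<Omega> LB" .
next
  show "JB \<in> bilinear_maps K X LB LB"
    using bilin_compose[OF B.mult_bilinear BX_field_linear lin_id]
    by (simp add: bilinear_maps_def linear_maps_LB left_bimodule_simps)
qed

text \<open>The map sends b to b n. For this the action of the free product on \<open>N\<close> has
  to descend to the quotient, and the three families of relations act as zero by
  \<open>J_lact\<close>, \<open>J_lact_right\<close> and \<open>J_ract_right\<close>
  respectively.\<close>

theorem BX_free_module:
  assumes N: "vf_module K A N \<Omega> d E J" and n: "n \<in> carrier N"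
  shows "\<exists>f. vf_hom K A \<Omega> LB EB JB N E J f \<and> f \<one>\<^bsub>BXA\<^esub> = n"
proof -
  interpret N: vf_module K A N \<Omega> d E J by (rule N)
  note mN = N.N.M.module_axioms
  obtain r where r: "representation K FP N r"
    and env: "\<And>a b n. \<lbrakk>a \<in> carrier A; b \<in> carrier A; n \<in> carrier N\<rbrakk> \<Longrightarrow>
      r (fp_env K A \<Omega> (env_elem K A a b)) n = (a \<triangleright>\<^bsub>N\<^esub> n) \<triangleleft>\<^bsub>N\<^esub> b"
    and endo: "\<And>x \<omega> n. \<lbrakk>x \<in> carrier X; \<omega> \<in> carrier \<Omega>; n \<in> carrier N\<rbrakk> \<Longrightarrow> r (fp_endo K A \<Omega> x \<omega>) n = E x \<omega> n"
    and field: "\<And>x n. \<lbrakk>x \<in> carrier X; n \<in> carrier N\<rbrakk> \<Longrightarrow> r (fp_field K A \<Omega> x) n = J x n"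
    using FP_representation[OF N] by auto
  have r0: "r f n = \<zero>\<^bsub>N\<^esub>" if "f \<in> BX_rel" and n: "n \<in> carrier N" for f n
  proof -
    note l = bilin_left[OF representationD(1)[OF r] n]
    show ?thesis using that
      by (auto simp: BX_rel_def lin_diff[OF l FP.A.module_axioms mN] lin_add[OF l] fp_closed X.lact_closed X.ract_closed
        dual_closed d_closed representationD[OF r] env endo field N.J_closed N.E_closed N.N.lact_closed N.N.ract_closed
        N.J_lact N.J_lact_right N.J_ract_right N.N.M.diff_eq_zero_iff N.N.ract_one N.N.one_lact)
  qed
  from representation_kernel_ideal[OF FP.k_algebra_axioms mN r BX_rel_closed this]
  have "r f n = \<zero>\<^bsub>N\<^esub>" if "f \<in> BX_ideal K A \<Omega> d" "n \<in> carrier N" for f n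
    using that unfolding BX_ideal_eq by blast
  from Q.representation_quotient[OF mN r this]
  obtain \<rho> where \<rho>: "representation K BXA N \<rho>"
    and \<rho>r: "\<And>f n. \<lbrakk>f \<in> carrier FP; n \<in> carrier N\<rbrakk> \<Longrightarrow> \<rho> (Q.cls f) n = r f n"
    unfolding BX_eqs(1) by blast
  note c = bilin_closed[OF representationD(1)[OF \<rho>] _ n]
  have "vf_hom K A \<Omega> LB EB JB N E J (\<lambda>b. \<rho> b n)"
  proof (rule vf_homI)
    show "(\<lambda>b. \<rho> b n) \<in> linear_maps K LB N"
      unfolding linear_maps_LB by (rule bilin_left[OF representationD(1)[OF \<rho>] n])
  qed (simp_all add: left_bimodule_simps n BX_closed representationD(2)[OF \<rho>],
      simp_all add: source_def target_def BX_eqs(2-4) \<rho>r fp_closed c env endo field N.N.ract_one N.N.one_lact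
        N.N.lact_closed N.N.ract_closed)
  moreover have "\<rho> \<one>\<^bsub>BXA\<^esub> n = n" using n by (rule representationD(3)[OF \<rho>])
  ultimately show ?thesis by blast
qed

text \<open>The elements c with c H inside H form a subalgebra. It contains the generators, hence
  everything, and applying all c to the unit fills the algebra. Thus only left multiplication by
  single generators has to be examined.\<close>

lemma BX_left_induct:
  assumes sub: "H \<subseteq> carrier BXA" and one: "\<one>\<^bsub>BXA\<^esub> \<in> H"
    and add: "\<And>b c. \<lbrakk>b \<in> H; c \<in> H\<rbrakk> \<Longrightarrow> b \<oplus>\<^bsub>BXA\<^esub> c \<in> H"
    and smult: "\<And>k b. \<lbrakk>k \<in> carrier K; b \<in> H\<rbrakk> \<Longrightarrow> k \<odot>\<^bsub>BXA\<^esub> b \<in> H"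
    and env: "\<And>u v b. \<lbrakk>u \<in> carrier A; v \<in> carrier A; b \<in> H\<rbrakk> \<Longrightarrow> \<eta> (env_elem K A u v) \<otimes>\<^bsub>BXA\<^esub> b \<in> H"
    and endo: "\<And>x \<omega> b. \<lbrakk>x \<in> carrier X; \<omega> \<in> carrier \<Omega>; b \<in> H\<rbrakk> \<Longrightarrow> eB x \<omega> \<otimes>\<^bsub>BXA\<^esub> b \<in> H"
    and field: "\<And>x b. \<lbrakk>x \<in> carrier X; b \<in> H\<rbrakk> \<Longrightarrow> jB x \<otimes>\<^bsub>BXA\<^esub> b \<in> H"
  shows "carrier BXA \<subseteq> H"
proof -
  have "subalgebra K BXA {c \<in> carrier BXA. \<forall>b\<in>H. c \<otimes>\<^bsub>BXA\<^esub> b \<in> H}"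
    using sub add smult
    by (intro subalgebraI) (auto simp: B.A.l_distr B.smult_mult_left B.A.m_assoc subset_iff)
  then have "carrier BXA \<subseteq> {c \<in> carrier BXA. \<forall>b\<in>H. c \<otimes>\<^bsub>BXA\<^esub> b \<in> H}"
    by (rule generated_byD[OF BX_generated])
      (auto simp: env endo field BX_closed lin_closed[OF algebra_homs_linear[OF BX_env_hom]] env_elem_closed)
  then have "c \<otimes>\<^bsub>BXA\<^esub> \<one>\<^bsub>BXA\<^esub> \<in> H" if "c \<in> carrier BXA" for c using one that by blast
  then show ?thesis by auto
qed

text \<open>The set where two homomorphisms agree contains the unit and is stable under left
  multiplication by generators.\<close>

theorem BX_free_module_unique:
  assumes N: "vf_module K A N \<Omega> d E J"
    and f: "vf_hom K A \<Omega> LB EB JB N E J f" and g: "vf_hom K A \<Omega> LB EB JB N E J g"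
    and one: "f \<one>\<^bsub>BXA\<^esub> = g \<one>\<^bsub>BXA\<^esub>" and b: "b \<in> carrier BXA"
  shows "f b = g b"
proof -
  let ?H = "{b \<in> carrier BXA. f b = g b}"
  note lf = vf_hom_linear[OF f, unfolded linear_maps_LB] and lg = vf_hom_linear[OF g, unfolded linear_maps_LB]
  have "carrier BXA \<subseteq> ?H"
  proof (rule BX_left_induct)
    fix u v b assume "u \<in> carrier A" "v \<in> carrier A" "b \<in> ?H"
    then show "\<eta> (env_elem K A u v) \<otimes>\<^bsub>BXA\<^esub> b \<in> ?H"
      using vf_hom_lact[OF f, of u "tB v \<otimes>\<^bsub>BXA\<^esub> b"] vf_hom_ract[OF f, of v b]
        vf_hom_lact[OF g, of u "tB v \<otimes>\<^bsub>BXA\<^esub> b"] vf_hom_ract[OF g, of v b]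
      by (simp add: left_bimodule_simps BX_source_target(3)[symmetric] BX_closed B.A.m_assoc)
  qed (use one vf_hom_E[OF f] vf_hom_E[OF g] vf_hom_J[OF f] vf_hom_J[OF g] in
      \<open>auto simp: left_bimodule_simps BX_closed lin_add[OF lf] lin_add[OF lg] lin_smult[OF lf] lin_smult[OF lg]\<close>)
  then show ?thesis using b by auto
qed

end

section \<open>Tensor products of modules\<close>

lemma (in abelian_monoid) finsum_swap:
  assumes "finite I" "finite L" "\<And>i j. \<lbrakk>i \<in> I; j \<in> L\<rbrakk> \<Longrightarrow> f i j \<in> carrier G"
  shows "(\<Oplus>i\<in>I. \<Oplus>j\<in>L. f i j) = (\<Oplus>j\<in>L. \<Oplus>i\<in>I. f i j)"
  using assms(1,3)
proof (induction I)
  case (insert a I)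
  have "(\<Oplus>i\<in>insert a I. \<Oplus>j\<in>L. f i j) = (\<Oplus>j\<in>L. f a j) \<oplus> (\<Oplus>i\<in>I. \<Oplus>j\<in>L. f i j)"
    using insert by (intro finsum_insert) (auto intro!: finsum_closed)
  also have "\<dots> = (\<Oplus>j\<in>L. f a j) \<oplus> (\<Oplus>j\<in>L. \<Oplus>i\<in>I. f i j)" using insert by simp
  also have "\<dots> = (\<Oplus>j\<in>L. f a j \<oplus> (\<Oplus>i\<in>I. f i j))"
    using insert by (intro finsum_addf[symmetric]) (auto intro!: finsum_closed)
  also have "\<dots> = (\<Oplus>j\<in>L. \<Oplus>i\<in>insert a I. f i j)"
    using insert by (intro finsum_cong') (auto intro!: finsum_closed)
  finally show ?case .
qed simp

text \<open>The analogue of \<open>tensor_lift_family\<close> over \<open>A\<close>: bilinear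
  dependence on parameters is inherited from pure tensors.\<close>

lemma tensor_over_family:
  assumes M: "bimodule K A M" and N: "bimodule K A N" and P: "module K P" and C: "module K C" and D: "module K D"
    and g: "\<And>c d. \<lbrakk>c \<in> carrier C; d \<in> carrier D\<rbrakk> \<Longrightarrow> g c d \<in> linear_maps K (tensor_over K A M N) P"
    and b: "\<And>p q. \<lbrakk>p \<in> carrier M; q \<in> carrier N\<rbrakk> \<Longrightarrow>
      (\<lambda>c d. g c d (pure_tensor_over K A M N p q)) \<in> bilinear_maps K C D P"
    and t: "t \<in> carrier (tensor_over K A M N)"
  shows "(\<lambda>c d. g c d t) \<in> bilinear_maps K C D P"
proof -
  interpret C: module K C by (rule C)
  interpret D: module K D by (rule D)
  note ext = tensor_over_ext[OF M N P]
  note l = bilin_left[OF b] and r = bilin_right[OF b]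
  show ?thesis
  proof (intro bilinear_mapsI linear_mapsI)
    fix c c' d assume [simp]: "c \<in> carrier C" "c' \<in> carrier C" "d \<in> carrier D"
    show "g (c \<oplus>\<^bsub>C\<^esub> c') d t = g c d t \<oplus>\<^bsub>P\<^esub> g c' d t"
      by (rule ext[OF g lin_plus[OF g g] _ t]) (simp_all add: P lin_add[OF l])
  next
    fix k c d assume [simp]: "k \<in> carrier K" "c \<in> carrier C" "d \<in> carrier D"
    show "g (k \<odot>\<^bsub>C\<^esub> c) d t = k \<odot>\<^bsub>P\<^esub> g c d t"
      by (rule ext[OF g lin_scale[OF g] _ t]) (simp_all add: P lin_smult[OF l])
  next
    fix c d d' assume [simp]: "c \<in> carrier C" "d \<in> carrier D" "d' \<in> carrier D"
    show "g c (d \<oplus>\<^bsub>D\<^esub> d') t = g c d t \<oplus>\<^bsub>P\<^esub> g c d' t"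
      by (rule ext[OF g lin_plus[OF g g] _ t]) (simp_all add: P lin_add[OF r])
  next
    fix k c d assume [simp]: "k \<in> carrier K" "c \<in> carrier C" "d \<in> carrier D"
    show "g c (k \<odot>\<^bsub>D\<^esub> d) t = k \<odot>\<^bsub>P\<^esub> g c d t"
      by (rule ext[OF g lin_scale[OF g] _ t]) (simp_all add: P lin_smult[OF r])
  qed (simp_all add: lin_closed[OF g t])
qed

text \<open>A calculus together with one fixed dual basis \<theta>, \<xi>. The operators below are
  written in terms of it; \<open>coev_independent\<close> removes the dependence where it
  matters.\<close>

locale framed_calculus = differential_calculus K A \<Omega> d
    for K :: "'k ring" and A :: "('k, 'a) module" and \<Omega> :: "('k, 'a, 'w) bimodule" and d :: "'a \<Rightarrow> 'w" +
  fixes r :: nat and \<theta> :: "nat \<Rightarrow> 'w" and \<xi> :: "nat \<Rightarrow> 'w \<Rightarrow> 'a"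
  assumes coev: "coev_family \<Omega> A r \<theta> \<xi>"
begin

lemma \<theta>_closed: "i < r \<Longrightarrow> \<theta> i \<in> carrier \<Omega>" and \<xi>_closed: "i < r \<Longrightarrow> \<xi> i \<in> carrier X"
  using coev by (simp_all add: coev_family_def)

lemma \<theta>_expand: "\<omega> \<in> carrier \<Omega> \<Longrightarrow> (\<Oplus>\<^bsub>\<Omega>\<^esub>i\<in>{..<r}. \<theta> i \<triangleleft>\<^bsub>\<Omega>\<^esub> \<xi> i \<omega>) = \<omega>"
  using coev by (simp add: coev_family_def)

lemma \<xi>_expand: "x \<in> carrier X \<Longrightarrow> (\<Oplus>\<^bsub>X\<^esub>i\<in>{..<r}. x (\<theta> i) \<triangleright>\<^bsub>X\<^esub> \<xi> i) = x"
  using coev by (simp add: coev_family_def)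

interpretation X: bimodule K A X by (rule bimodule_left_dual)

lemma lin_\<theta>_expand:
  assumes P: "module K P" and g: "g \<in> linear_maps K \<Omega> P" and \<omega>: "\<omega> \<in> carrier \<Omega>"
  shows "(\<Oplus>\<^bsub>P\<^esub>i\<in>{..<r}. g (\<theta> i \<triangleleft>\<^bsub>\<Omega>\<^esub> \<xi> i \<omega>)) = g \<omega>"
  using lin_finsum[OF g M.module_axioms P, of "\<lambda>i. \<theta> i \<triangleleft>\<^bsub>\<Omega>\<^esub> \<xi> i \<omega>" "{..<r}"] \<theta>_expand[OF \<omega>]
  by (simp add: Pi_def ract_closed \<theta>_closed \<xi>_closed dual_closed \<omega>)

lemma lin_\<xi>_expand:
  assumes P: "module K P" and g: "g \<in> linear_maps K X P" and x: "x \<in> carrier X"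
  shows "(\<Oplus>\<^bsub>P\<^esub>i\<in>{..<r}. g (x (\<theta> i) \<triangleright>\<^bsub>X\<^esub> \<xi> i)) = g x"
  using lin_finsum[OF g X.M.module_axioms P, of "\<lambda>i. x (\<theta> i) \<triangleright>\<^bsub>X\<^esub> \<xi> i" "{..<r}"] \<xi>_expand[OF x]
  by (simp add: Pi_def X.lact_closed \<theta>_closed \<xi>_closed dual_closed x)

text \<open>Expand each \<open>u j\<close> in the dual basis as the sum of the
  \<open>\<theta> i\<close> times \<open>\<xi> i (u j)\<close>, carry these coefficients over to
  \<open>y j\<close> by balancing, and exchange the two sums. Any tensor is thereby normalised to
  have the \<open>\<theta> i\<close> as first factors.\<close>

lemma balanced_sum:
  fixes m :: nat
  assumes P: "module K P" and h: "h \<in> balanced_maps K A \<Omega> X P"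
    and u: "\<And>j. j < m \<Longrightarrow> u j \<in> carrier \<Omega>" and y: "\<And>j. j < m \<Longrightarrow> y j \<in> carrier X"
  shows "(\<Oplus>\<^bsub>P\<^esub>j\<in>{..<m}. h (u j) (y j)) =
    (\<Oplus>\<^bsub>P\<^esub>i\<in>{..<r}. h (\<theta> i) (\<Oplus>\<^bsub>X\<^esub>j\<in>{..<m}. \<xi> i (u j) \<triangleright>\<^bsub>X\<^esub> y j))"
proof -
  interpret P: module K P by (rule P)
  note b = balanced_bilinear[OF h]
  note [simp] = \<theta>_closed \<xi>_closed u y dual_closed X.lact_closed ract_closed bilin_closed[OF b]
  have "(\<Oplus>\<^bsub>P\<^esub>j\<in>{..<m}. h (u j) (y j)) = (\<Oplus>\<^bsub>P\<^esub>j\<in>{..<m}. \<Oplus>\<^bsub>P\<^esub>i\<in>{..<r}. h (\<theta> i) (\<xi> i (u j) \<triangleright>\<^bsub>X\<^esub> y j))"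
  proof (rule P.M.finsum_cong')
    fix j assume "j \<in> {..<m}"
    then have j [simp]: "j < m" by simp
    have "(\<Oplus>\<^bsub>P\<^esub>i\<in>{..<r}. h (\<theta> i) (\<xi> i (u j) \<triangleright>\<^bsub>X\<^esub> y j)) = (\<Oplus>\<^bsub>P\<^esub>i\<in>{..<r}. h (\<theta> i \<triangleleft>\<^bsub>\<Omega>\<^esub> \<xi> i (u j)) (y j))"
      by (rule P.M.finsum_cong') (auto simp: balanced_swap[OF h])
    then show "h (u j) (y j) = (\<Oplus>\<^bsub>P\<^esub>i\<in>{..<r}. h (\<theta> i) (\<xi> i (u j) \<triangleright>\<^bsub>X\<^esub> y j))"
      using lin_\<theta>_expand[OF P bilin_left[OF b y[OF j]] u[OF j]] by simp
  qed (auto intro!: P.M.finsum_closed)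
  also have "\<dots> = (\<Oplus>\<^bsub>P\<^esub>i\<in>{..<r}. \<Oplus>\<^bsub>P\<^esub>j\<in>{..<m}. h (\<theta> i) (\<xi> i (u j) \<triangleright>\<^bsub>X\<^esub> y j))"
    by (rule P.M.finsum_swap) auto
  also have "\<dots> = (\<Oplus>\<^bsub>P\<^esub>i\<in>{..<r}. h (\<theta> i) (\<Oplus>\<^bsub>X\<^esub>j\<in>{..<m}. \<xi> i (u j) \<triangleright>\<^bsub>X\<^esub> y j))"
  proof (rule P.M.finsum_cong')
    fix i assume "i \<in> {..<r}"
    then have [simp]: "i < r" by simp
    show "(\<Oplus>\<^bsub>P\<^esub>j\<in>{..<m}. h (\<theta> i) (\<xi> i (u j) \<triangleright>\<^bsub>X\<^esub> y j)) = h (\<theta> i) (\<Oplus>\<^bsub>X\<^esub>j\<in>{..<m}. \<xi> i (u j) \<triangleright>\<^bsub>X\<^esub> y j)"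
      by (rule lin_finsum[OF bilin_right[OF b] X.M.module_axioms P, symmetric]) auto
  qed (auto intro!: X.M.finsum_closed)
  finally show ?thesis .
qed

text \<open>After normalisation by \<open>balanced_sum\<close> the second factor at
  \<open>\<theta> i\<close> is the expansion of \<open>\<xi> i\<close> in the other dual basis,
  which is \<open>\<xi> i\<close> itself.\<close>

lemma coev_independent:
  assumes P: "module K P" and h: "h \<in> balanced_maps K A \<Omega> X P" and c: "coev_family \<Omega> A m u y"
  shows "(\<Oplus>\<^bsub>P\<^esub>j\<in>{..<m}. h (u j) (y j)) = (\<Oplus>\<^bsub>P\<^esub>i\<in>{..<r}. h (\<theta> i) (\<xi> i))"
proof -
  interpret P: module K P by (rule P)
  have "(\<Oplus>\<^bsub>P\<^esub>j\<in>{..<m}. h (u j) (y j)) =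
      (\<Oplus>\<^bsub>P\<^esub>i\<in>{..<r}. h (\<theta> i) (\<Oplus>\<^bsub>X\<^esub>j\<in>{..<m}. \<xi> i (u j) \<triangleright>\<^bsub>X\<^esub> y j))"
    using c by (intro balanced_sum[OF P h]) (auto simp: coev_family_def)
  also have "\<dots> = (\<Oplus>\<^bsub>P\<^esub>i\<in>{..<r}. h (\<theta> i) (\<xi> i))"
    using c by (intro P.M.finsum_cong')
      (auto simp: coev_family_def \<theta>_closed \<xi>_closed bilin_closed[OF balanced_bilinear[OF h]])
  finally show ?thesis .
qed

text \<open>Centrality of coev(1), seen through a balanced map. Normalising the left side yields as
  second factors the expansions of \<open>\<xi> i\<close> composed with multiplication by a, which
  is the right action of a on \<open>\<xi> i\<close>.\<close>

lemma coev_central: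
  assumes P: "module K P" and h: "h \<in> balanced_maps K A \<Omega> X P" and a: "a \<in> carrier A"
  shows "(\<Oplus>\<^bsub>P\<^esub>i\<in>{..<r}. h (a \<triangleright>\<^bsub>\<Omega>\<^esub> \<theta> i) (\<xi> i)) = (\<Oplus>\<^bsub>P\<^esub>i\<in>{..<r}. h (\<theta> i) (\<xi> i \<triangleleft>\<^bsub>X\<^esub> a))"
proof -
  interpret P: module K P by (rule P)
  have "(\<Oplus>\<^bsub>P\<^esub>i\<in>{..<r}. h (a \<triangleright>\<^bsub>\<Omega>\<^esub> \<theta> i) (\<xi> i)) =
      (\<Oplus>\<^bsub>P\<^esub>i\<in>{..<r}. h (\<theta> i) (\<Oplus>\<^bsub>X\<^esub>j\<in>{..<r}. \<xi> i (a \<triangleright>\<^bsub>\<Omega>\<^esub> \<theta> j) \<triangleright>\<^bsub>X\<^esub> \<xi> j))"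
    by (intro balanced_sum[OF P h]) (auto simp: \<theta>_closed \<xi>_closed lact_closed a)
  also have "\<dots> = (\<Oplus>\<^bsub>P\<^esub>i\<in>{..<r}. h (\<theta> i) (\<xi> i \<triangleleft>\<^bsub>X\<^esub> a))"
  proof (rule P.M.finsum_cong')
    fix i assume "i \<in> {..<r}"
    then have i [simp]: "i < r" by simp
    have "(\<Oplus>\<^bsub>X\<^esub>j\<in>{..<r}. \<xi> i (a \<triangleright>\<^bsub>\<Omega>\<^esub> \<theta> j) \<triangleright>\<^bsub>X\<^esub> \<xi> j) = (\<Oplus>\<^bsub>X\<^esub>j\<in>{..<r}. (\<xi> i \<triangleleft>\<^bsub>X\<^esub> a) (\<theta> j) \<triangleright>\<^bsub>X\<^esub> \<xi> j)"
      by (rule X.M.finsum_cong') (auto simp: dual_pointwise \<theta>_closed \<xi>_closed X.lact_closed dual_closed lact_closed a)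
    then show "h (\<theta> i) (\<Oplus>\<^bsub>X\<^esub>j\<in>{..<r}. \<xi> i (a \<triangleright>\<^bsub>\<Omega>\<^esub> \<theta> j) \<triangleright>\<^bsub>X\<^esub> \<xi> j) = h (\<theta> i) (\<xi> i \<triangleleft>\<^bsub>X\<^esub> a)"
      using \<xi>_expand[of "\<xi> i \<triangleleft>\<^bsub>X\<^esub> a"] by (simp add: X.ract_closed \<xi>_closed a)
  qed (auto simp: \<theta>_closed \<xi>_closed X.ract_closed a bilin_closed[OF balanced_bilinear[OF h]])
  finally show ?thesis .
qed

definition tensor_E where
  "tensor_E V W E E' x \<omega> = tensor_over_lift K A V W (tensor_over K A V W)
     (\<lambda>p q. \<Oplus>\<^bsub>tensor_over K A V W\<^esub>i\<in>{..<r}. pure_tensor_over K A V W (E x (\<theta> i) p) (E' (\<xi> i) \<omega> q))"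

definition tensor_J where
  "tensor_J V W E J J' x = tensor_over_lift K A V W (tensor_over K A V W)
     (\<lambda>p q. pure_tensor_over K A V W (J x p) q \<oplus>\<^bsub>tensor_over K A V W\<^esub>
       (\<Oplus>\<^bsub>tensor_over K A V W\<^esub>i\<in>{..<r}. pure_tensor_over K A V W (E x (\<theta> i) p) (J' (\<xi> i) q)))"

end

section \<open>The tensor product of two modules over the algebra of vector fields\<close>

locale vf_pair = framed_calculus K A \<Omega> d r \<theta> \<xi> + V: vf_module K A V \<Omega> d E J + W: vf_module K A W \<Omega> d E' J'
    for K :: "'k ring" and A :: "('k, 'a) module" and \<Omega> :: "('k, 'a, 'w) bimodule" and d :: "'a \<Rightarrow> 'w"
      and r \<theta> \<xi> and V :: "('k, 'a, 'v) bimodule" and E J and W :: "('k, 'a, 'u) bimodule" and E' J'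
begin

abbreviation "T \<equiv> tensor_over K A V W"
abbreviation pto (infixl \<open>\<otimes>\<^sub>T\<close> 70) where "p \<otimes>\<^sub>T q \<equiv> pure_tensor_over K A V W p q"
abbreviation "TE \<equiv> tensor_E V W E E'"
abbreviation "TJ \<equiv> tensor_J V W E J J'"

interpretation X: bimodule K A X by (rule bimodule_left_dual)

lemma bim: "bimodule K A V" "bimodule K A W"
  by (rule V.N.bimodule_axioms W.N.bimodule_axioms)+

sublocale T: bimodule K A T by (rule bimodule_tensor_over[OF bim])

lemmas mT = T.M.module_axioms
lemmas pto_balanced = pure_tensor_over_balanced[OF bim]
lemmas pto_bilinear = balanced_bilinear[OF pto_balanced]
lemmas pto_closed = pure_tensor_over_closed[OF bim]
lemmas pto_act = lact_pure_tensor_over[OF bim] ract_pure_tensor_over[OF bim]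
lemmas pto_ext = tensor_over_ext[OF bim]

lemma pto_add:
  "\<lbrakk>p \<in> carrier V; p' \<in> carrier V; q \<in> carrier W\<rbrakk> \<Longrightarrow> (p \<oplus>\<^bsub>V\<^esub> p') \<otimes>\<^sub>T q = p \<otimes>\<^sub>T q \<oplus>\<^bsub>T\<^esub> p' \<otimes>\<^sub>T q"
  "\<lbrakk>p \<in> carrier V; q \<in> carrier W; q' \<in> carrier W\<rbrakk> \<Longrightarrow> p \<otimes>\<^sub>T (q \<oplus>\<^bsub>W\<^esub> q') = p \<otimes>\<^sub>T q \<oplus>\<^bsub>T\<^esub> p \<otimes>\<^sub>T q'"
  by (simp_all add: lin_add[OF bilin_left[OF pto_bilinear]] lin_add[OF bilin_right[OF pto_bilinear]])

lemmas closures = \<theta>_closed \<xi>_closed pto_closed V.E_closed W.E_closed V.J_closed W.J_closed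
  V.N.lact_closed V.N.ract_closed W.N.lact_closed W.N.ract_closed X.lact_closed X.ract_closed
  lact_closed ract_closed dual_closed d_closed

lemma frame_sum_cong:
  assumes "\<And>i. i < r \<Longrightarrow> f i = g i" "\<And>i. i < r \<Longrightarrow> g i \<in> carrier T"
  shows "(\<Oplus>\<^bsub>T\<^esub>i\<in>{..<r}. f i) = (\<Oplus>\<^bsub>T\<^esub>i\<in>{..<r}. g i)"
  using assms by (intro T.M.finsum_cong') auto

text \<open>For fixed tensor factors, the summand of \<open>tensor_E\<close> is balanced as a
  function of the dual pair, so that the lemmas on coev apply to its sum. \<open>E_ract\<close>
  brings the scalar out of the first factor and \<open>E_lact\<close> takes it into the
  second.\<close>

lemma EE_balanced:
  "\<lbrakk>x \<in> carrier X; \<omega> \<in> carrier \<Omega>; p \<in> carrier V; q \<in> carrier W\<rbrakk> \<Longrightarrow>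
    (\<lambda>\<theta> \<xi>. E x \<theta> p \<otimes>\<^sub>T E' \<xi> \<omega> q) \<in> balanced_maps K A \<Omega> X T"
  by (intro balanced_mapsI bilin_compose[OF pto_bilinear] bilin_right[OF V.E_bilinear] bilin_left[OF W.E_bilinear])
    (simp_all add: V.E_ract W.E_lact balanced_swap[OF pto_balanced] closures)

lemma EJ_balanced:
  "\<lbrakk>x \<in> carrier X; p \<in> carrier V; q \<in> carrier W\<rbrakk> \<Longrightarrow>
    (\<lambda>\<theta> \<xi>. E x \<theta> p \<otimes>\<^sub>T J' \<xi> q) \<in> balanced_maps K A \<Omega> X T"
  by (intro balanced_mapsI bilin_compose[OF pto_bilinear] bilin_right[OF V.E_bilinear] bilin_left[OF W.J_bilinear])
    (simp_all add: V.E_ract W.J_lact balanced_swap[OF pto_balanced] closures)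

text \<open>A scalar a on the right of p can be moved to the left of \<open>\<theta> i\<close>, then
  by \<open>coev_central\<close> to the right of \<open>\<xi> i\<close>, and from there to the left
  of q.\<close>

lemma TE_aux:
  assumes x: "x \<in> carrier X" and \<omega>: "\<omega> \<in> carrier \<Omega>"
  shows "(\<lambda>p q. \<Oplus>\<^bsub>T\<^esub>i\<in>{..<r}. E x (\<theta> i) p \<otimes>\<^sub>T E' (\<xi> i) \<omega> q) \<in> balanced_maps K A V W T"
proof (rule balanced_mapsI)
  show "(\<lambda>p q. \<Oplus>\<^bsub>T\<^esub>i\<in>{..<r}. E x (\<theta> i) p \<otimes>\<^sub>T E' (\<xi> i) \<omega> q) \<in> bilinear_maps K V W T"
    by (intro bilin_sum bilin_compose[OF pto_bilinear] V.E_linear W.E_linear x \<omega> mT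
      V.N.M.module_axioms W.N.M.module_axioms) (simp_all add: closures)
  fix p a q assume pq: "p \<in> carrier V" "q \<in> carrier W" and a: "a \<in> carrier A"
  note [simp] = x \<omega> pq a
  have "(\<Oplus>\<^bsub>T\<^esub>i\<in>{..<r}. E x (\<theta> i) (p \<triangleleft>\<^bsub>V\<^esub> a) \<otimes>\<^sub>T E' (\<xi> i) \<omega> q) =
      (\<Oplus>\<^bsub>T\<^esub>i\<in>{..<r}. E x (a \<triangleright>\<^bsub>\<Omega>\<^esub> \<theta> i) p \<otimes>\<^sub>T E' (\<xi> i) \<omega> q)"
    by (rule frame_sum_cong) (simp_all add: V.E_ract_right closures)
  also have "\<dots> = (\<Oplus>\<^bsub>T\<^esub>i\<in>{..<r}. E x (\<theta> i) p \<otimes>\<^sub>T E' (\<xi> i \<triangleleft>\<^bsub>X\<^esub> a) \<omega> q)"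
    by (rule coev_central[OF mT EE_balanced a]) simp_all
  also have "\<dots> = (\<Oplus>\<^bsub>T\<^esub>i\<in>{..<r}. E x (\<theta> i) p \<otimes>\<^sub>T E' (\<xi> i) \<omega> (a \<triangleright>\<^bsub>W\<^esub> q))"
    by (rule frame_sum_cong) (simp_all add: W.E_lact_right closures)
  finally show "(\<Oplus>\<^bsub>T\<^esub>i\<in>{..<r}. E x (\<theta> i) (p \<triangleleft>\<^bsub>V\<^esub> a) \<otimes>\<^sub>T E' (\<xi> i) \<omega> q) =
      (\<Oplus>\<^bsub>T\<^esub>i\<in>{..<r}. E x (\<theta> i) p \<otimes>\<^sub>T E' (\<xi> i) \<omega> (a \<triangleright>\<^bsub>W\<^esub> q))" .
qed

lemma
  assumes "x \<in> carrier X" "\<omega> \<in> carrier \<Omega>"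
  shows TE_linear: "TE x \<omega> \<in> linear_maps K T T"
    and TE_pure: "\<lbrakk>p \<in> carrier V; q \<in> carrier W\<rbrakk> \<Longrightarrow>
      TE x \<omega> (p \<otimes>\<^sub>T q) = (\<Oplus>\<^bsub>T\<^esub>i\<in>{..<r}. E x (\<theta> i) p \<otimes>\<^sub>T E' (\<xi> i) \<omega> q)"
  using tensor_over_lift[OF bim mT TE_aux[OF assms]] by (simp_all add: tensor_E_def)

text \<open>Neither summand is balanced alone. Moving a out of the first one leaves
  \<open>E x (d a) p \<otimes> q\<close> by \<open>J_ract_right\<close>; in the second one
  \<open>J_lact_right\<close> leaves the terms with coefficient \<open>\<xi> i (d a)\<close>, and
  these add up to the same tensor. The second summand in the formula for \<open>J\<close> is there
  to supply this correction.\<close>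

lemma TJ_aux:
  assumes x: "x \<in> carrier X"
  shows "(\<lambda>p q. J x p \<otimes>\<^sub>T q \<oplus>\<^bsub>T\<^esub> (\<Oplus>\<^bsub>T\<^esub>i\<in>{..<r}. E x (\<theta> i) p \<otimes>\<^sub>T J' (\<xi> i) q)) \<in> balanced_maps K A V W T"
proof (rule balanced_mapsI)
  show "(\<lambda>p q. J x p \<otimes>\<^sub>T q \<oplus>\<^bsub>T\<^esub> (\<Oplus>\<^bsub>T\<^esub>i\<in>{..<r}. E x (\<theta> i) p \<otimes>\<^sub>T J' (\<xi> i) q)) \<in> bilinear_maps K V W T"
    by (intro bilin_plus bilin_sum bilin_compose[OF pto_bilinear] V.E_linear bilin_right[OF V.J_bilinear]
      bilin_right[OF W.J_bilinear] lin_id x mT V.N.M.module_axioms W.N.M.module_axioms) (simp_all add: closures)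
  fix p a q assume pq: "p \<in> carrier V" "q \<in> carrier W" and a: "a \<in> carrier A"
  note [simp] = x pq a
  have "(\<Oplus>\<^bsub>T\<^esub>i\<in>{..<r}. E x (\<theta> i) (p \<triangleleft>\<^bsub>V\<^esub> a) \<otimes>\<^sub>T J' (\<xi> i) q) =
      (\<Oplus>\<^bsub>T\<^esub>i\<in>{..<r}. E x (a \<triangleright>\<^bsub>\<Omega>\<^esub> \<theta> i) p \<otimes>\<^sub>T J' (\<xi> i) q)"
    by (rule frame_sum_cong) (simp_all add: V.E_ract_right closures)
  also have "\<dots> = (\<Oplus>\<^bsub>T\<^esub>i\<in>{..<r}. E x (\<theta> i) p \<otimes>\<^sub>T J' (\<xi> i \<triangleleft>\<^bsub>X\<^esub> a) q)"
    by (rule coev_central[OF mT EJ_balanced a]) simp_all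
  finally have 1: "(\<Oplus>\<^bsub>T\<^esub>i\<in>{..<r}. E x (\<theta> i) (p \<triangleleft>\<^bsub>V\<^esub> a) \<otimes>\<^sub>T J' (\<xi> i) q) =
      (\<Oplus>\<^bsub>T\<^esub>i\<in>{..<r}. E x (\<theta> i) p \<otimes>\<^sub>T J' (\<xi> i \<triangleleft>\<^bsub>X\<^esub> a) q)" .
  \<comment> \<open>The coefficients \<open>\<xi> i (d a)\<close> cross the tensor sign onto
    \<open>\<theta> i\<close>, and the sum is the expansion of \<open>d a\<close> in the dual
    basis.\<close>
  have "(\<Oplus>\<^bsub>T\<^esub>i\<in>{..<r}. E x (\<theta> i) p \<otimes>\<^sub>T (\<xi> i (d a) \<triangleright>\<^bsub>W\<^esub> q)) = (\<Oplus>\<^bsub>T\<^esub>i\<in>{..<r}. E x (\<theta> i \<triangleleft>\<^bsub>\<Omega>\<^esub> \<xi> i (d a)) p \<otimes>\<^sub>T q)"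
    by (rule frame_sum_cong) (simp_all add: V.E_ract balanced_swap[OF pto_balanced] closures)
  also have "\<dots> = E x (d a) p \<otimes>\<^sub>T q"
    by (rule lin_\<theta>_expand[OF mT lin_compose[OF bilin_right[OF V.E_bilinear] bilin_left[OF pto_bilinear]]])
      (simp_all add: closures)
  finally have 2: "(\<Oplus>\<^bsub>T\<^esub>i\<in>{..<r}. E x (\<theta> i) p \<otimes>\<^sub>T (\<xi> i (d a) \<triangleright>\<^bsub>W\<^esub> q)) = E x (d a) p \<otimes>\<^sub>T q" .
  have "(\<Oplus>\<^bsub>T\<^esub>i\<in>{..<r}. E x (\<theta> i) p \<otimes>\<^sub>T J' (\<xi> i) (a \<triangleright>\<^bsub>W\<^esub> q)) =
      (\<Oplus>\<^bsub>T\<^esub>i\<in>{..<r}. E x (\<theta> i) p \<otimes>\<^sub>T J' (\<xi> i \<triangleleft>\<^bsub>X\<^esub> a) q \<oplus>\<^bsub>T\<^esub> E x (\<theta> i) p \<otimes>\<^sub>T (\<xi> i (d a) \<triangleright>\<^bsub>W\<^esub> q))"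
    by (rule frame_sum_cong) (simp_all add: W.J_lact_right pto_add closures)
  also have "\<dots> = (\<Oplus>\<^bsub>T\<^esub>i\<in>{..<r}. E x (\<theta> i) p \<otimes>\<^sub>T J' (\<xi> i \<triangleleft>\<^bsub>X\<^esub> a) q) \<oplus>\<^bsub>T\<^esub> E x (d a) p \<otimes>\<^sub>T q"
    unfolding 2[symmetric] by (rule T.M.finsum_addf) (auto simp: closures)
  finally have 3: "(\<Oplus>\<^bsub>T\<^esub>i\<in>{..<r}. E x (\<theta> i) p \<otimes>\<^sub>T J' (\<xi> i) (a \<triangleright>\<^bsub>W\<^esub> q)) =
      (\<Oplus>\<^bsub>T\<^esub>i\<in>{..<r}. E x (\<theta> i) p \<otimes>\<^sub>T J' (\<xi> i \<triangleleft>\<^bsub>X\<^esub> a) q) \<oplus>\<^bsub>T\<^esub> E x (d a) p \<otimes>\<^sub>T q" .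
  have c: "(\<Oplus>\<^bsub>T\<^esub>i\<in>{..<r}. E x (\<theta> i) p \<otimes>\<^sub>T J' (\<xi> i \<triangleleft>\<^bsub>X\<^esub> a) q) \<in> carrier T"
    by (rule T.M.finsum_closed) (auto simp: closures)
  show "J x (p \<triangleleft>\<^bsub>V\<^esub> a) \<otimes>\<^sub>T q \<oplus>\<^bsub>T\<^esub> (\<Oplus>\<^bsub>T\<^esub>i\<in>{..<r}. E x (\<theta> i) (p \<triangleleft>\<^bsub>V\<^esub> a) \<otimes>\<^sub>T J' (\<xi> i) q) =
      J x p \<otimes>\<^sub>T (a \<triangleright>\<^bsub>W\<^esub> q) \<oplus>\<^bsub>T\<^esub> (\<Oplus>\<^bsub>T\<^esub>i\<in>{..<r}. E x (\<theta> i) p \<otimes>\<^sub>T J' (\<xi> i) (a \<triangleright>\<^bsub>W\<^esub> q))"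
    unfolding 1 3 by (simp add: V.J_ract_right pto_add closures balanced_swap[OF pto_balanced, symmetric] c T.M.add.m_ac)
qed

lemma
  assumes "x \<in> carrier X"
  shows TJ_linear: "TJ x \<in> linear_maps K T T"
    and TJ_pure: "\<lbrakk>p \<in> carrier V; q \<in> carrier W\<rbrakk> \<Longrightarrow>
      TJ x (p \<otimes>\<^sub>T q) = J x p \<otimes>\<^sub>T q \<oplus>\<^bsub>T\<^esub> (\<Oplus>\<^bsub>T\<^esub>i\<in>{..<r}. E x (\<theta> i) p \<otimes>\<^sub>T J' (\<xi> i) q)"
  using tensor_over_lift[OF bim mT TJ_aux[OF assms]] by (simp_all add: tensor_J_def)

lemma EE_sum_closed: "\<lbrakk>x \<in> carrier X; \<omega> \<in> carrier \<Omega>; p \<in> carrier V; q \<in> carrier W\<rbrakk> \<Longrightarrow>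
    (\<Oplus>\<^bsub>T\<^esub>i\<in>{..<r}. E x (\<theta> i) p \<otimes>\<^sub>T E' (\<xi> i) \<omega> q) \<in> carrier T"
  by (rule T.M.finsum_closed) (auto simp: closures)

lemma EJ_sum_closed: "\<lbrakk>x \<in> carrier X; p \<in> carrier V; q \<in> carrier W\<rbrakk> \<Longrightarrow>
    (\<Oplus>\<^bsub>T\<^esub>i\<in>{..<r}. E x (\<theta> i) p \<otimes>\<^sub>T J' (\<xi> i) q) \<in> carrier T"
  by (rule T.M.finsum_closed) (auto simp: closures)

text \<open>All axioms are linear in the tensor and are checked on pure tensors. Left scalars and x
  concern only the first factor of each term, right scalars and \<omega> only the last, so each
  axiom comes from the same axiom of one factor; the derivation terms of \<open>J\<close> need a
  closer look.\<close>

lemma vf_module_tensor: "vf_module K A T \<Omega> d TE TJ"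
proof (intro vf_module.intro vf_module_axioms.intro)
  note la = lact_tensor_over_linear[OF bim] and ra = ract_tensor_over_linear[OF bim]
  show "bimodule K A T" by (rule T.bimodule_axioms)
  show "TE x \<omega> \<in> linear_maps K T T" if "x \<in> carrier X" "\<omega> \<in> carrier \<Omega>" for x \<omega>
    using that by (rule TE_linear)
  show "(\<lambda>x \<omega>. TE x \<omega> t) \<in> bilinear_maps K X \<Omega> T" if t: "t \<in> carrier T" for t
  proof (rule tensor_over_family[OF bim mT ground_modules(3,4) TE_linear _ t])
    fix p q assume pq: "p \<in> carrier V" "q \<in> carrier W"
    have "(\<lambda>x \<omega>. \<Oplus>\<^bsub>T\<^esub>i\<in>{..<r}. E x (\<theta> i) p \<otimes>\<^sub>T E' (\<xi> i) \<omega> q) \<in> bilinear_maps K X \<Omega> T"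
      by (intro bilin_sum bilin_compose[OF pto_bilinear] bilin_left[OF V.E_bilinear] bilin_right[OF W.E_bilinear]
        mT ground_modules(3,4)) (simp_all add: closures pq)
    then show "(\<lambda>x \<omega>. TE x \<omega> (p \<otimes>\<^sub>T q)) \<in> bilinear_maps K X \<Omega> T"
      unfolding bilinear_maps_def
      by (auto simp: TE_pure pq intro!: lin_cong[OF ground_modules(3) TE_pure] lin_cong[OF ground_modules(4) TE_pure])
  qed
  show "TJ \<in> bilinear_maps K X T T"
  proof (rule bilinear_mapsI)
    fix t assume t: "t \<in> carrier T"
    note ext = pto_ext[OF mT]
    have l: "(\<lambda>x. J x p \<otimes>\<^sub>T q \<oplus>\<^bsub>T\<^esub> (\<Oplus>\<^bsub>T\<^esub>i\<in>{..<r}. E x (\<theta> i) p \<otimes>\<^sub>T J' (\<xi> i) q)) \<in> linear_maps K X T"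
      if pq: "p \<in> carrier V" "q \<in> carrier W" for p q
      by (intro lin_plus lin_sum mT ground_modules(3) lin_compose[OF _ bilin_left[OF pto_bilinear]]
        bilin_left[OF V.J_bilinear] bilin_left[OF V.E_bilinear]) (simp_all add: closures pq)
    show "(\<lambda>x. TJ x t) \<in> linear_maps K X T"
    proof (rule linear_mapsI)
      fix x y assume [simp]: "x \<in> carrier X" "y \<in> carrier X"
      show "TJ x t \<in> carrier T" by (rule lin_closed[OF TJ_linear t]) simp
      show "TJ (x \<oplus>\<^bsub>X\<^esub> y) t = TJ x t \<oplus>\<^bsub>T\<^esub> TJ y t"
        by (rule ext[OF TJ_linear lin_plus[OF TJ_linear TJ_linear] _ t])
          (simp_all add: mT TJ_pure lin_add[OF l])
      fix k assume [simp]: "k \<in> carrier K"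
      show "TJ (k \<odot>\<^bsub>X\<^esub> x) t = k \<odot>\<^bsub>T\<^esub> TJ x t"
        by (rule ext[OF TJ_linear lin_scale[OF TJ_linear] _ t]) (simp_all add: mT TJ_pure lin_smult[OF l])
    qed
  qed (rule TJ_linear)
  fix a x t assume a [simp]: "a \<in> carrier A" and x [simp]: "x \<in> carrier X" and t: "t \<in> carrier T"
  note ext = pto_ext[OF mT _ _ _ t]
  note sum_lact = lin_finsum[OF la[OF a] mT mT] and sum_ract = lin_finsum[OF ra[OF a] mT mT]
  show "TE (a \<triangleright>\<^bsub>X\<^esub> x) \<omega> t = a \<triangleright>\<^bsub>T\<^esub> TE x \<omega> t" if [simp]: "\<omega> \<in> carrier \<Omega>" for \<omega>
  proof (rule ext[OF TE_linear lin_compose[OF TE_linear la]])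
    fix p q assume [simp]: "p \<in> carrier V" "q \<in> carrier W"
    show "TE (a \<triangleright>\<^bsub>X\<^esub> x) \<omega> (p \<otimes>\<^sub>T q) = a \<triangleright>\<^bsub>T\<^esub> TE x \<omega> (p \<otimes>\<^sub>T q)"
      by (simp add: TE_pure closures, subst sum_lact, simp add: Pi_def closures,
        rule frame_sum_cong) (simp_all add: V.E_lact closures pto_act)
  qed (simp_all add: closures)
  show "TE x (\<omega> \<triangleleft>\<^bsub>\<Omega>\<^esub> a) t = TE x \<omega> t \<triangleleft>\<^bsub>T\<^esub> a" if [simp]: "\<omega> \<in> carrier \<Omega>" for \<omega>
  proof (rule ext[OF TE_linear lin_compose[OF TE_linear ra]])
    fix p q assume [simp]: "p \<in> carrier V" "q \<in> carrier W"
    show "TE x (\<omega> \<triangleleft>\<^bsub>\<Omega>\<^esub> a) (p \<otimes>\<^sub>T q) = TE x \<omega> (p \<otimes>\<^sub>T q) \<triangleleft>\<^bsub>T\<^esub> a"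
      by (simp add: TE_pure closures, subst sum_ract, simp add: Pi_def closures,
        rule frame_sum_cong) (simp_all add: W.E_ract closures pto_act)
  qed (simp_all add: closures)
  show "TE x \<omega> (a \<triangleright>\<^bsub>T\<^esub> t) = TE (x \<triangleleft>\<^bsub>X\<^esub> a) \<omega> t" if [simp]: "\<omega> \<in> carrier \<Omega>" for \<omega>
  proof (rule ext[OF lin_compose[OF la TE_linear] TE_linear])
    fix p q assume [simp]: "p \<in> carrier V" "q \<in> carrier W"
    show "TE x \<omega> (a \<triangleright>\<^bsub>T\<^esub> (p \<otimes>\<^sub>T q)) = TE (x \<triangleleft>\<^bsub>X\<^esub> a) \<omega> (p \<otimes>\<^sub>T q)"
      by (simp add: TE_pure closures pto_act, rule frame_sum_cong) (simp_all add: V.E_lact_right closures)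
  qed (simp_all add: closures)
  show "TE x \<omega> (t \<triangleleft>\<^bsub>T\<^esub> a) = TE x (a \<triangleright>\<^bsub>\<Omega>\<^esub> \<omega>) t" if [simp]: "\<omega> \<in> carrier \<Omega>" for \<omega>
  proof (rule ext[OF lin_compose[OF ra TE_linear] TE_linear])
    fix p q assume [simp]: "p \<in> carrier V" "q \<in> carrier W"
    show "TE x \<omega> ((p \<otimes>\<^sub>T q) \<triangleleft>\<^bsub>T\<^esub> a) = TE x (a \<triangleright>\<^bsub>\<Omega>\<^esub> \<omega>) (p \<otimes>\<^sub>T q)"
      by (simp add: TE_pure closures pto_act, rule frame_sum_cong) (simp_all add: W.E_ract_right closures)
  qed (simp_all add: closures)
  show "TJ (a \<triangleright>\<^bsub>X\<^esub> x) t = a \<triangleright>\<^bsub>T\<^esub> TJ x t"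
  proof (rule ext[OF TJ_linear lin_compose[OF TJ_linear la]])
    fix p q assume [simp]: "p \<in> carrier V" "q \<in> carrier W"
    have "(\<Oplus>\<^bsub>T\<^esub>i\<in>{..<r}. E (a \<triangleright>\<^bsub>X\<^esub> x) (\<theta> i) p \<otimes>\<^sub>T J' (\<xi> i) q) =
        a \<triangleright>\<^bsub>T\<^esub> (\<Oplus>\<^bsub>T\<^esub>i\<in>{..<r}. E x (\<theta> i) p \<otimes>\<^sub>T J' (\<xi> i) q)"
      by (subst sum_lact, simp add: Pi_def closures, rule frame_sum_cong) (simp_all add: V.E_lact closures pto_act)
    then show "TJ (a \<triangleright>\<^bsub>X\<^esub> x) (p \<otimes>\<^sub>T q) = a \<triangleright>\<^bsub>T\<^esub> TJ x (p \<otimes>\<^sub>T q)"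
      by (simp add: TJ_pure closures lin_add[OF la] EJ_sum_closed V.J_lact pto_act)
  qed (simp_all add: closures)
  \<comment> \<open>The left action meets \<open>J\<close> only in the summand
    \<open>J x p \<otimes> q\<close>, and the term with \<open>x (d a)\<close> comes from
    there.\<close>
  show "TJ x (a \<triangleright>\<^bsub>T\<^esub> t) = TJ (x \<triangleleft>\<^bsub>X\<^esub> a) t \<oplus>\<^bsub>T\<^esub> x (d a) \<triangleright>\<^bsub>T\<^esub> t"
  proof (rule ext[OF lin_compose[OF la TJ_linear] lin_plus[OF TJ_linear la mT]])
    fix p q assume [simp]: "p \<in> carrier V" "q \<in> carrier W"
    have "(\<Oplus>\<^bsub>T\<^esub>i\<in>{..<r}. E x (\<theta> i) (a \<triangleright>\<^bsub>V\<^esub> p) \<otimes>\<^sub>T J' (\<xi> i) q) =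
        (\<Oplus>\<^bsub>T\<^esub>i\<in>{..<r}. E (x \<triangleleft>\<^bsub>X\<^esub> a) (\<theta> i) p \<otimes>\<^sub>T J' (\<xi> i) q)"
      by (rule frame_sum_cong) (simp_all add: V.E_lact_right closures)
    then show "TJ x (a \<triangleright>\<^bsub>T\<^esub> (p \<otimes>\<^sub>T q)) = TJ (x \<triangleleft>\<^bsub>X\<^esub> a) (p \<otimes>\<^sub>T q) \<oplus>\<^bsub>T\<^esub> x (d a) \<triangleright>\<^bsub>T\<^esub> (p \<otimes>\<^sub>T q)"
      by (simp add: TJ_pure closures V.J_lact_right pto_act pto_add EJ_sum_closed T.M.add.m_ac)
  qed (simp_all add: closures)
  \<comment> \<open>The right action meets the \<open>J'\<close> in each term of the sum; the
    resulting terms \<open>E' (\<xi> i) (d a)\<close> together form \<open>TE x (d a)\<close>, the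
    term that the axiom asks for.\<close>
  show "TJ x (t \<triangleleft>\<^bsub>T\<^esub> a) = TJ x t \<triangleleft>\<^bsub>T\<^esub> a \<oplus>\<^bsub>T\<^esub> TE x (d a) t"
  proof (rule ext[OF lin_compose[OF ra TJ_linear] lin_plus[OF lin_compose[OF TJ_linear ra] TE_linear mT]])
    fix p q assume [simp]: "p \<in> carrier V" "q \<in> carrier W"
    have "(\<Oplus>\<^bsub>T\<^esub>i\<in>{..<r}. E x (\<theta> i) p \<otimes>\<^sub>T J' (\<xi> i) (q \<triangleleft>\<^bsub>W\<^esub> a)) =
        (\<Oplus>\<^bsub>T\<^esub>i\<in>{..<r}. (E x (\<theta> i) p \<otimes>\<^sub>T J' (\<xi> i) q) \<triangleleft>\<^bsub>T\<^esub> a \<oplus>\<^bsub>T\<^esub> E x (\<theta> i) p \<otimes>\<^sub>T E' (\<xi> i) (d a) q)"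
      by (rule frame_sum_cong) (simp_all add: W.J_ract_right pto_act pto_add closures)
    also have "\<dots> = (\<Oplus>\<^bsub>T\<^esub>i\<in>{..<r}. (E x (\<theta> i) p \<otimes>\<^sub>T J' (\<xi> i) q) \<triangleleft>\<^bsub>T\<^esub> a) \<oplus>\<^bsub>T\<^esub> TE x (d a) (p \<otimes>\<^sub>T q)"
      by (simp add: TE_pure closures, rule T.M.finsum_addf) (auto simp: closures T.ract_closed)
    also have "(\<Oplus>\<^bsub>T\<^esub>i\<in>{..<r}. (E x (\<theta> i) p \<otimes>\<^sub>T J' (\<xi> i) q) \<triangleleft>\<^bsub>T\<^esub> a) =
        (\<Oplus>\<^bsub>T\<^esub>i\<in>{..<r}. E x (\<theta> i) p \<otimes>\<^sub>T J' (\<xi> i) q) \<triangleleft>\<^bsub>T\<^esub> a"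
      by (rule sum_ract[symmetric]) (auto simp: closures)
    finally show "TJ x ((p \<otimes>\<^sub>T q) \<triangleleft>\<^bsub>T\<^esub> a) = TJ x (p \<otimes>\<^sub>T q) \<triangleleft>\<^bsub>T\<^esub> a \<oplus>\<^bsub>T\<^esub> TE x (d a) (p \<otimes>\<^sub>T q)"
      by (simp add: TJ_pure closures pto_act lin_add[OF ra] EJ_sum_closed T.ract_closed lin_closed[OF TE_linear] T.M.add.m_assoc)
  qed (simp_all add: closures)
qed

end

section \<open>Homomorphisms\<close>

lemma vf_hom_compose:
  assumes f: "vf_hom K A \<Omega> U EU JU V E J f" and g: "vf_hom K A \<Omega> V E J W E' J' g"
  shows "vf_hom K A \<Omega> U EU JU W E' J' (\<lambda>u. g (f u))"
  by (rule vf_homI)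
    (simp_all add: lin_compose[OF vf_hom_linear[OF f] vf_hom_linear[OF g]] vf_hom_closed[OF f]
      vf_hom_lact[OF f] vf_hom_lact[OF g] vf_hom_ract[OF f] vf_hom_ract[OF g]
      vf_hom_E[OF f] vf_hom_E[OF g] vf_hom_J[OF f] vf_hom_J[OF g])

lemma vf_hom_id: "vf_hom K A \<Omega> V E J V E J (\<lambda>v. v)"
  by (rule vf_homI) (simp_all add: lin_id)

text \<open>The coproduct and the counit have to be extensional. Cutting off outside the carrier is
  harmless since no operator leaves it.\<close>

lemma vf_hom_restrict:
  assumes V: "vf_module K A V \<Omega> d E J" and f: "vf_hom K A \<Omega> V E J W E' J' f"
  shows "vf_hom K A \<Omega> V E J W E' J' (restrict f (carrier V))"
proof -
  interpret V: vf_module K A V \<Omega> d E J by (rule V)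
  show ?thesis
    by (rule vf_homI)
      (simp_all add: lin_restrict[OF vf_hom_linear[OF f] V.N.M.module_axioms] V.N.lact_closed V.N.ract_closed
        V.E_closed V.J_closed vf_hom_lact[OF f] vf_hom_ract[OF f] vf_hom_E[OF f] vf_hom_J[OF f])
qed

text \<open>For the product rule: right multiplication by a sum of pure tensors is a sum of
  homomorphisms, one for each term.\<close>

lemma vf_hom_sum:
  assumes V: "vf_module K A V \<Omega> d E J" and W: "vf_module K A W \<Omega> d E' J'"
    and f: "\<And>i. i \<in> S \<Longrightarrow> vf_hom K A \<Omega> V E J W E' J' (f i)"
  shows "vf_hom K A \<Omega> V E J W E' J' (\<lambda>v. \<Oplus>\<^bsub>W\<^esub>i\<in>S. f i v)"
proof -
  interpret V: vf_module K A V \<Omega> d E J by (rule V)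
  interpret W: vf_module K A W \<Omega> d E' J' by (rule W)
  note mV = V.N.M.module_axioms and mW = W.N.M.module_axioms
  note c = vf_hom_closed[OF f]
  \<comment> \<open>Here g stands for any operator on \<open>V\<close> and h for the corresponding
    linear operator on \<open>W\<close>; the four intertwining properties are instances.\<close>
  have push: "(\<Oplus>\<^bsub>W\<^esub>i\<in>S. f i (g v)) = h (\<Oplus>\<^bsub>W\<^esub>i\<in>S. f i v)"
    if h: "h \<in> linear_maps K W W" and v: "v \<in> carrier V" and "\<And>i. i \<in> S \<Longrightarrow> f i (g v) = h (f i v)" for g h v
  proof -
    have "(\<Oplus>\<^bsub>W\<^esub>i\<in>S. f i (g v)) = (\<Oplus>\<^bsub>W\<^esub>i\<in>S. h (f i v))"
      using that c by (intro W.N.M.finsum_cong') (auto intro!: lin_closed[OF h])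
    then show ?thesis using lin_finsum[OF h mW mW, of "\<lambda>i. f i v" S] c v by (simp add: Pi_def)
  qed
  show ?thesis
  proof (rule vf_homI)
    show "(\<lambda>v. \<Oplus>\<^bsub>W\<^esub>i\<in>S. f i v) \<in> linear_maps K V W"
      by (intro lin_sum vf_hom_linear[OF f] mV mW)
  next
    fix a v assume a: "a \<in> carrier A" and v: "v \<in> carrier V"
    show "(\<Oplus>\<^bsub>W\<^esub>i\<in>S. f i (a \<triangleright>\<^bsub>V\<^esub> v)) = a \<triangleright>\<^bsub>W\<^esub> (\<Oplus>\<^bsub>W\<^esub>i\<in>S. f i v)"
      by (rule push[OF bilin_right[OF W.N.lact_bilinear a] v]) (rule vf_hom_lact[OF f a v])
    show "(\<Oplus>\<^bsub>W\<^esub>i\<in>S. f i (v \<triangleleft>\<^bsub>V\<^esub> a)) = (\<Oplus>\<^bsub>W\<^esub>i\<in>S. f i v) \<triangleleft>\<^bsub>W\<^esub> a"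
      by (rule push[OF bilin_left[OF W.N.ract_bilinear a] v]) (rule vf_hom_ract[OF f a v])
  next
    fix x \<omega> v assume x: "x \<in> carrier (left_dual A \<Omega>)" "\<omega> \<in> carrier \<Omega>" and v: "v \<in> carrier V"
    show "(\<Oplus>\<^bsub>W\<^esub>i\<in>S. f i (E x \<omega> v)) = E' x \<omega> (\<Oplus>\<^bsub>W\<^esub>i\<in>S. f i v)"
      by (rule push[OF W.E_linear[OF x] v]) (rule vf_hom_E[OF f x v])
  next
    fix x v assume x: "x \<in> carrier (left_dual A \<Omega>)" and v: "v \<in> carrier V"
    show "(\<Oplus>\<^bsub>W\<^esub>i\<in>S. f i (J x v)) = J' x (\<Oplus>\<^bsub>W\<^esub>i\<in>S. f i v)"
      by (rule push[OF bilin_right[OF W.J_bilinear x] v]) (rule vf_hom_J[OF f x v])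
  qed
qed

lemma regular_bimodule_simps [simp]:
  "carrier (regular_bimodule A) = carrier A" "add (regular_bimodule A) = add A"
  "\<zero>\<^bsub>regular_bimodule A\<^esub> = \<zero>\<^bsub>A\<^esub>" "smult (regular_bimodule A) = smult A"
  "lact (regular_bimodule A) = mult A" "ract (regular_bimodule A) = mult A"
  by (simp_all add: regular_bimodule_def)

lemma linear_maps_regular:
  "linear_maps K (regular_bimodule A) N = linear_maps K A N" "linear_maps K N (regular_bimodule A) = linear_maps K N A"
  by (rule linear_maps_cong; simp)+

lemma (in k_algebra) bimodule_regular: "bimodule K A (regular_bimodule A)"
proof (rule bimoduleI[OF k_algebra_axioms])
  show "module K (regular_bimodule A)" by (rule module_cong[OF A.module_axioms]) simp_all
  show "lact (regular_bimodule A) \<in> bilinear_maps K A (regular_bimodule A) (regular_bimodule A)"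
    "ract (regular_bimodule A) \<in> bilinear_maps K (regular_bimodule A) A (regular_bimodule A)"
    using mult_bilinear by (simp_all add: bilinear_maps_def linear_maps_regular)
qed (simp_all add: A.m_assoc)

section \<open>The algebra \<open>A\<close> as the unit module\<close>

context differential_calculus
begin

abbreviation "EA x \<omega> c \<equiv> x (c \<triangleright>\<^bsub>\<Omega>\<^esub> \<omega>)"
abbreviation "JA x c \<equiv> x (d c)"

text \<open>The two axioms on \<open>J\<close> and products are the Leibniz rule evaluated under x:
  applied to d(a c) it gives x((d a) c) + x(a (d c)). Read as a acting from the left this is
  \<open>J_lact_right\<close>, read as c acting from the right it is
  \<open>J_ract_right\<close>.\<close>

lemma vf_module_regular: "vf_module K A (regular_bimodule A) \<Omega> d EA JA"
proof -
  interpret X: bimodule K A X by (rule bimodule_left_dual)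
  show ?thesis
  proof (intro vf_module.intro vf_module_axioms.intro bimodule_regular)
    show "\<And>x \<omega>. \<lbrakk>x \<in> carrier X; \<omega> \<in> carrier \<Omega>\<rbrakk> \<Longrightarrow> EA x \<omega> \<in> linear_maps K (regular_bimodule A) (regular_bimodule A)"
      unfolding linear_maps_regular by (intro lin_compose[OF bilin_left[OF lact_bilinear] dual_linear])
    show "\<And>n. n \<in> carrier (regular_bimodule A) \<Longrightarrow>
        (\<lambda>x \<omega>. EA x \<omega> n) \<in> bilinear_maps K X \<Omega> (regular_bimodule A)"
      using bilin_compose[OF eval_bilinear lin_id bilin_right[OF lact_bilinear]]
      by (simp add: bilinear_maps_def linear_maps_regular)
    show "JA \<in> bilinear_maps K X (regular_bimodule A) (regular_bimodule A)"
      using bilin_compose[OF eval_bilinear lin_id d_linear] by (simp add: bilinear_maps_def linear_maps_regular)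
  qed (simp_all add: dual_pointwise lact_closed ract_closed d_closed dual_closed mult_lact lact_ract[symmetric]
      dual_ract leibniz dual_add A.M.add.m_ac)
qed

end

section \<open>Homomorphisms out of a tensor product and the unit constraints\<close>

context vf_pair
begin

interpretation X: bimodule K A X by (rule bimodule_left_dual)

text \<open>The hypotheses \<open>fE\<close> and \<open>fJ\<close> are the formulas for
  \<open>TE\<close> and \<open>TJ\<close> on pure tensors, pushed through f. Both sides of every
  intertwining identity being linear, nothing more has to be tested.\<close>

lemma vf_hom_of_balanced:
  assumes N: "vf_module K A N \<Omega> d EN JN" and f: "f \<in> balanced_maps K A V W N"
    and fl: "\<And>a p q. \<lbrakk>a \<in> carrier A; p \<in> carrier V; q \<in> carrier W\<rbrakk> \<Longrightarrow> f (a \<triangleright>\<^bsub>V\<^esub> p) q = a \<triangleright>\<^bsub>N\<^esub> f p q"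
    and fr: "\<And>a p q. \<lbrakk>a \<in> carrier A; p \<in> carrier V; q \<in> carrier W\<rbrakk> \<Longrightarrow> f p (q \<triangleleft>\<^bsub>W\<^esub> a) = f p q \<triangleleft>\<^bsub>N\<^esub> a"
    and fE: "\<And>x \<omega> p q. \<lbrakk>x \<in> carrier X; \<omega> \<in> carrier \<Omega>; p \<in> carrier V; q \<in> carrier W\<rbrakk> \<Longrightarrow>
      (\<Oplus>\<^bsub>N\<^esub>i\<in>{..<r}. f (E x (\<theta> i) p) (E' (\<xi> i) \<omega> q)) = EN x \<omega> (f p q)"
    and fJ: "\<And>x p q. \<lbrakk>x \<in> carrier X; p \<in> carrier V; q \<in> carrier W\<rbrakk> \<Longrightarrow>
      f (J x p) q \<oplus>\<^bsub>N\<^esub> (\<Oplus>\<^bsub>N\<^esub>i\<in>{..<r}. f (E x (\<theta> i) p) (J' (\<xi> i) q)) = JN x (f p q)"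
  shows "\<exists>h. vf_hom K A \<Omega> T TE TJ N EN JN h \<and> (\<forall>p\<in>carrier V. \<forall>q\<in>carrier W. h (p \<otimes>\<^sub>T q) = f p q)"
proof -
  interpret N: vf_module K A N \<Omega> d EN JN by (rule N)
  note mN = N.N.M.module_axioms
  obtain h where h: "h \<in> linear_maps K T N"
    and hp: "\<And>p q. \<lbrakk>p \<in> carrier V; q \<in> carrier W\<rbrakk> \<Longrightarrow> h (p \<otimes>\<^sub>T q) = f p q"
    using tensor_over_universal[OF bim mN f] by blast
  note ext = pto_ext[OF mN]
  have sum: "h (\<Oplus>\<^bsub>T\<^esub>i\<in>{..<r}. p i \<otimes>\<^sub>T q i) = (\<Oplus>\<^bsub>N\<^esub>i\<in>{..<r}. f (p i) (q i))"
    if "\<And>i. i < r \<Longrightarrow> p i \<in> carrier V" "\<And>i. i < r \<Longrightarrow> q i \<in> carrier W" for p q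
  proof -
    have "h (\<Oplus>\<^bsub>T\<^esub>i\<in>{..<r}. p i \<otimes>\<^sub>T q i) = (\<Oplus>\<^bsub>N\<^esub>i\<in>{..<r}. h (p i \<otimes>\<^sub>T q i))"
      using that by (intro lin_finsum[OF h mT mN]) (auto simp: closures)
    also have "\<dots> = (\<Oplus>\<^bsub>N\<^esub>i\<in>{..<r}. f (p i) (q i))"
      using that by (intro N.N.M.finsum_cong') (auto simp: hp bilin_closed[OF balanced_bilinear[OF f]])
    finally show ?thesis .
  qed
  have "vf_hom K A \<Omega> T TE TJ N EN JN h"
  proof (rule vf_homI)
    fix a t assume a: "a \<in> carrier A" and t: "t \<in> carrier T"
    show "h (a \<triangleright>\<^bsub>T\<^esub> t) = a \<triangleright>\<^bsub>N\<^esub> h t"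
      by (rule ext[OF lin_compose[OF bilin_right[OF T.lact_bilinear a] h]
            lin_compose[OF h bilin_right[OF N.N.lact_bilinear a]] _ t]) (simp_all add: pto_act hp closures fl a)
    show "h (t \<triangleleft>\<^bsub>T\<^esub> a) = h t \<triangleleft>\<^bsub>N\<^esub> a"
      by (rule ext[OF lin_compose[OF bilin_left[OF T.ract_bilinear a] h]
            lin_compose[OF h bilin_left[OF N.N.ract_bilinear a]] _ t]) (simp_all add: pto_act hp closures fr a)
  next
    fix x \<omega> t assume x: "x \<in> carrier X" and \<omega>: "\<omega> \<in> carrier \<Omega>" and t: "t \<in> carrier T"
    show "h (TE x \<omega> t) = EN x \<omega> (h t)"
      by (rule ext[OF lin_compose[OF TE_linear[OF x \<omega>] h] lin_compose[OF h N.E_linear[OF x \<omega>]] _ t])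
        (simp_all add: TE_pure x \<omega> sum closures hp fE)
  next
    fix x t assume x: "x \<in> carrier X" and t: "t \<in> carrier T"
    show "h (TJ x t) = JN x (h t)"
      by (rule ext[OF lin_compose[OF TJ_linear[OF x] h] lin_compose[OF h bilin_right[OF N.J_bilinear x]] _ t])
        (simp_all add: TJ_pure x sum closures hp fJ lin_add[OF h] EJ_sum_closed)
  qed (rule h)
  then show ?thesis using hp by blast
qed

text \<open>This is f tensored with the identity, followed by the identification of
  \<open>A \<otimes> W\<close> with \<open>W\<close>. As f carries \<open>E x (\<theta> i) p\<close>
  to the value at \<open>\<theta> i\<close> of x acted on by f p, the dual basis contracts by
  \<open>lin_\<xi>_expand\<close>. For \<open>J\<close> the remaining term x(d(f p)) is supplied by
  \<open>J_lact_right\<close>.\<close>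

lemma vf_hom_left_unit:
  assumes f: "vf_hom K A \<Omega> V E J (regular_bimodule A) EA JA f"
  shows "\<exists>h. vf_hom K A \<Omega> T TE TJ W E' J' h \<and> (\<forall>p\<in>carrier V. \<forall>q\<in>carrier W. h (p \<otimes>\<^sub>T q) = f p \<triangleright>\<^bsub>W\<^esub> q)"
proof (rule vf_hom_of_balanced)
  note fc [simp] = vf_hom_closed[OF f, simplified]
  note mW = W.N.M.module_axioms
  note lb = vf_hom_linear[OF f, unfolded linear_maps_regular]
  show "vf_module K A W \<Omega> d E' J'" by (rule W.vf_module_axioms)
  show "(\<lambda>p q. f p \<triangleright>\<^bsub>W\<^esub> q) \<in> balanced_maps K A V W W"
    by (intro balanced_mapsI bilin_compose[OF W.N.lact_bilinear lb lin_id])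
      (simp add: vf_hom_ract[OF f] W.N.mult_lact)
  fix x p q assume [simp]: "x \<in> carrier X" "p \<in> carrier V" "q \<in> carrier W"
  show "(\<Oplus>\<^bsub>W\<^esub>i\<in>{..<r}. f (E x (\<theta> i) p) \<triangleright>\<^bsub>W\<^esub> E' (\<xi> i) \<omega> q) = E' x \<omega> (f p \<triangleright>\<^bsub>W\<^esub> q)"
    if \<omega> [simp]: "\<omega> \<in> carrier \<Omega>" for \<omega>
  proof -
    have "(\<Oplus>\<^bsub>W\<^esub>i\<in>{..<r}. f (E x (\<theta> i) p) \<triangleright>\<^bsub>W\<^esub> E' (\<xi> i) \<omega> q) =
        (\<Oplus>\<^bsub>W\<^esub>i\<in>{..<r}. E' ((x \<triangleleft>\<^bsub>X\<^esub> f p) (\<theta> i) \<triangleright>\<^bsub>X\<^esub> \<xi> i) \<omega> q)"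
      by (rule W.N.M.finsum_cong') (auto simp: vf_hom_E[OF f] closures dual_pointwise W.E_lact)
    also have "\<dots> = E' (x \<triangleleft>\<^bsub>X\<^esub> f p) \<omega> q"
      by (rule lin_\<xi>_expand[OF mW bilin_left[OF W.E_bilinear]]) (simp_all add: closures)
    finally show ?thesis by (simp add: W.E_lact_right)
  qed
  have "(\<Oplus>\<^bsub>W\<^esub>i\<in>{..<r}. f (E x (\<theta> i) p) \<triangleright>\<^bsub>W\<^esub> J' (\<xi> i) q) =
      (\<Oplus>\<^bsub>W\<^esub>i\<in>{..<r}. J' ((x \<triangleleft>\<^bsub>X\<^esub> f p) (\<theta> i) \<triangleright>\<^bsub>X\<^esub> \<xi> i) q)"
    by (rule W.N.M.finsum_cong') (auto simp: vf_hom_E[OF f] closures dual_pointwise W.J_lact)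
  also have "\<dots> = J' (x \<triangleleft>\<^bsub>X\<^esub> f p) q"
    by (rule lin_\<xi>_expand[OF mW bilin_left[OF W.J_bilinear]]) (simp_all add: closures)
  finally show "f (J x p) \<triangleright>\<^bsub>W\<^esub> q \<oplus>\<^bsub>W\<^esub> (\<Oplus>\<^bsub>W\<^esub>i\<in>{..<r}. f (E x (\<theta> i) p) \<triangleright>\<^bsub>W\<^esub> J' (\<xi> i) q) = J' x (f p \<triangleright>\<^bsub>W\<^esub> q)"
    by (simp add: W.J_lact_right vf_hom_J[OF f] closures W.N.M.add.m_comm)
qed (simp_all add: vf_hom_lact[OF f] vf_hom_closed[OF f, simplified] W.N.mult_lact W.N.lact_ract)

text \<open>The mirror image, contracting with \<open>lin_\<theta>_expand\<close>. For
  \<open>J\<close> the contraction yields \<open>E x (d (g q)) p\<close>, exactly the correction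
  term in \<open>J_ract_right\<close>.\<close>

lemma vf_hom_right_unit:
  assumes g: "vf_hom K A \<Omega> W E' J' (regular_bimodule A) EA JA g"
  shows "\<exists>h. vf_hom K A \<Omega> T TE TJ V E J h \<and> (\<forall>p\<in>carrier V. \<forall>q\<in>carrier W. h (p \<otimes>\<^sub>T q) = p \<triangleleft>\<^bsub>V\<^esub> g q)"
proof (rule vf_hom_of_balanced)
  note gc [simp] = vf_hom_closed[OF g, simplified]
  note mV = V.N.M.module_axioms
  note lb = vf_hom_linear[OF g, unfolded linear_maps_regular]
  show "vf_module K A V \<Omega> d E J" by (rule V.vf_module_axioms)
  show "(\<lambda>p q. p \<triangleleft>\<^bsub>V\<^esub> g q) \<in> balanced_maps K A V W V"
    by (intro balanced_mapsI bilin_compose[OF V.N.ract_bilinear lin_id lb])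
      (simp add: vf_hom_lact[OF g] V.N.ract_mult)
  fix x p q assume [simp]: "x \<in> carrier X" "p \<in> carrier V" "q \<in> carrier W"
  show "(\<Oplus>\<^bsub>V\<^esub>i\<in>{..<r}. E x (\<theta> i) p \<triangleleft>\<^bsub>V\<^esub> g (E' (\<xi> i) \<omega> q)) = E x \<omega> (p \<triangleleft>\<^bsub>V\<^esub> g q)"
    if \<omega> [simp]: "\<omega> \<in> carrier \<Omega>" for \<omega>
  proof -
    have "(\<Oplus>\<^bsub>V\<^esub>i\<in>{..<r}. E x (\<theta> i) p \<triangleleft>\<^bsub>V\<^esub> g (E' (\<xi> i) \<omega> q)) =
        (\<Oplus>\<^bsub>V\<^esub>i\<in>{..<r}. E x (\<theta> i \<triangleleft>\<^bsub>\<Omega>\<^esub> \<xi> i (g q \<triangleright>\<^bsub>\<Omega>\<^esub> \<omega>)) p)"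
      by (rule V.N.M.finsum_cong') (auto simp: vf_hom_E[OF g] closures V.E_ract)
    also have "\<dots> = E x (g q \<triangleright>\<^bsub>\<Omega>\<^esub> \<omega>) p"
      by (rule lin_\<theta>_expand[OF mV bilin_right[OF V.E_bilinear]]) (simp_all add: closures)
    finally show ?thesis by (simp add: V.E_ract_right)
  qed
  have "(\<Oplus>\<^bsub>V\<^esub>i\<in>{..<r}. E x (\<theta> i) p \<triangleleft>\<^bsub>V\<^esub> g (J' (\<xi> i) q)) =
      (\<Oplus>\<^bsub>V\<^esub>i\<in>{..<r}. E x (\<theta> i \<triangleleft>\<^bsub>\<Omega>\<^esub> \<xi> i (d (g q))) p)"
    by (rule V.N.M.finsum_cong') (auto simp: vf_hom_J[OF g] closures V.E_ract)
  also have "\<dots> = E x (d (g q)) p"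
    by (rule lin_\<theta>_expand[OF mV bilin_right[OF V.E_bilinear]]) (simp_all add: closures)
  finally show "J x p \<triangleleft>\<^bsub>V\<^esub> g q \<oplus>\<^bsub>V\<^esub> (\<Oplus>\<^bsub>V\<^esub>i\<in>{..<r}. E x (\<theta> i) p \<triangleleft>\<^bsub>V\<^esub> g (J' (\<xi> i) q)) = J x (p \<triangleleft>\<^bsub>V\<^esub> g q)"
    by (simp add: V.J_ract_right)
qed (simp_all add: vf_hom_ract[OF g] vf_hom_closed[OF g, simplified] V.N.ract_mult V.N.lact_ract)

end

section \<open>Functoriality and associativity of the tensor product\<close>

context framed_calculus
begin

interpretation X: bimodule K A X by (rule bimodule_left_dual)

lemma vf_pairI: "\<lbrakk>vf_module K A V \<Omega> d E J; vf_module K A W \<Omega> d E' J'\<rbrakk> \<Longrightarrow> vf_pair K A \<Omega> d r \<theta> \<xi> V E J W E' J'"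
  by (intro vf_pair.intro framed_calculus_axioms)

text \<open>The operators on a tensor product are made from those of the factors by one formula, and
  f and g intertwine its ingredients term by term.\<close>

lemma vf_hom_tensor:
  assumes V: "vf_module K A V \<Omega> d E J" and W: "vf_module K A W \<Omega> d E' J'"
    and V': "vf_module K A V' \<Omega> d F L" and W': "vf_module K A W' \<Omega> d F' L'"
    and f: "vf_hom K A \<Omega> V E J V' F L f" and g: "vf_hom K A \<Omega> W E' J' W' F' L' g"
  shows "\<exists>h. vf_hom K A \<Omega> (tensor_over K A V W) (tensor_E V W E E') (tensor_J V W E J J')
      (tensor_over K A V' W') (tensor_E V' W' F F') (tensor_J V' W' F L L') h \<and>
    (\<forall>p\<in>carrier V. \<forall>q\<in>carrier W. h (pure_tensor_over K A V W p q) = pure_tensor_over K A V' W' (f p) (g q))"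
proof -
  interpret P: vf_pair K A \<Omega> d r \<theta> \<xi> V E J W E' J' by (rule vf_pairI[OF V W])
  interpret Q: vf_pair K A \<Omega> d r \<theta> \<xi> V' F L W' F' L' by (rule vf_pairI[OF V' W'])
  note [simp] = vf_hom_closed[OF f] vf_hom_closed[OF g]
  show ?thesis
  proof (rule P.vf_hom_of_balanced)
    show "vf_module K A Q.T \<Omega> d Q.TE Q.TJ" by (rule Q.vf_module_tensor)
    show "(\<lambda>p q. pure_tensor_over K A V' W' (f p) (g q)) \<in> balanced_maps K A V W Q.T"
      by (intro balanced_mapsI bilin_compose[OF Q.pto_bilinear vf_hom_linear[OF f] vf_hom_linear[OF g]])
        (simp add: vf_hom_ract[OF f] vf_hom_lact[OF g] balanced_swap[OF Q.pto_balanced])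
    fix x p q assume [simp]: "x \<in> carrier X" "p \<in> carrier V" "q \<in> carrier W"
    show "(\<Oplus>\<^bsub>Q.T\<^esub>i\<in>{..<r}. pure_tensor_over K A V' W' (f (E x (\<theta> i) p)) (g (E' (\<xi> i) \<omega> q))) =
        Q.TE x \<omega> (pure_tensor_over K A V' W' (f p) (g q))" if [simp]: "\<omega> \<in> carrier \<Omega>" for \<omega>
      by (simp add: Q.TE_pure, rule Q.frame_sum_cong)
        (simp_all add: vf_hom_E[OF f] vf_hom_E[OF g] P.closures Q.closures)
    have "(\<Oplus>\<^bsub>Q.T\<^esub>i\<in>{..<r}. pure_tensor_over K A V' W' (f (E x (\<theta> i) p)) (g (J' (\<xi> i) q))) =
        (\<Oplus>\<^bsub>Q.T\<^esub>i\<in>{..<r}. pure_tensor_over K A V' W' (F x (\<theta> i) (f p)) (L' (\<xi> i) (g q)))"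
      by (rule Q.frame_sum_cong) (simp_all add: vf_hom_E[OF f] vf_hom_J[OF g] P.closures Q.closures)
    then show "pure_tensor_over K A V' W' (f (J x p)) (g q) \<oplus>\<^bsub>Q.T\<^esub>
        (\<Oplus>\<^bsub>Q.T\<^esub>i\<in>{..<r}. pure_tensor_over K A V' W' (f (E x (\<theta> i) p)) (g (J' (\<xi> i) q))) =
        Q.TJ x (pure_tensor_over K A V' W' (f p) (g q))"
      by (simp add: Q.TJ_pure vf_hom_J[OF f])
  qed (simp_all add: Q.pto_act vf_hom_lact[OF f] vf_hom_ract[OF g])
qed

text \<open>Associativity of the tensor product of modules, on which coassociativity rests. The
  iterated operators on the two bracketings are the same double sums over dual bases, summed in
  different orders.\<close>

lemma vf_hom_associator:
  assumes V: "vf_module K A V \<Omega> d E J" and W: "vf_module K A W \<Omega> d E' J'" and U: "vf_module K A U \<Omega> d F L"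
  shows "\<exists>h. vf_hom K A \<Omega>
      (tensor_over K A (tensor_over K A V W) U)
      (tensor_E (tensor_over K A V W) U (tensor_E V W E E') F)
      (tensor_J (tensor_over K A V W) U (tensor_E V W E E') (tensor_J V W E J J') L)
      (tensor_over K A V (tensor_over K A W U))
      (tensor_E V (tensor_over K A W U) E (tensor_E W U E' F))
      (tensor_J V (tensor_over K A W U) E J (tensor_J W U E' J' L)) h \<and>
    (\<forall>p\<in>carrier V. \<forall>q\<in>carrier W. \<forall>u\<in>carrier U.
      h (pure_tensor_over K A (tensor_over K A V W) U (pure_tensor_over K A V W p q) u) =
      pure_tensor_over K A V (tensor_over K A W U) p (pure_tensor_over K A W U q u))"
proof -
  interpret VW: vf_pair K A \<Omega> d r \<theta> \<xi> V E J W E' J' by (rule vf_pairI[OF V W])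
  interpret WU: vf_pair K A \<Omega> d r \<theta> \<xi> W E' J' U F L by (rule vf_pairI[OF W U])
  interpret LU: vf_pair K A \<Omega> d r \<theta> \<xi> VW.T VW.TE VW.TJ U F L by (rule vf_pairI[OF VW.vf_module_tensor U])
  interpret VR: vf_pair K A \<Omega> d r \<theta> \<xi> V E J WU.T WU.TE WU.TJ by (rule vf_pairI[OF V WU.vf_module_tensor])
  let ?vw = "pure_tensor_over K A V W" and ?wu = "pure_tensor_over K A W U"
    and ?lu = "pure_tensor_over K A VW.T U" and ?vr = "pure_tensor_over K A V WU.T"
  note mR = VR.mT
  have b: "(\<lambda>p q. ?vr p (?wu q u)) \<in> balanced_maps K A V W VR.T" if u: "u \<in> carrier U" for u
    by (intro balanced_mapsI bilin_compose[OF VR.pto_bilinear lin_id bilin_left[OF WU.pto_bilinear u]])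
      (simp add: balanced_swap[OF VR.pto_balanced] WU.pto_act WU.pto_closed u)
  \<comment> \<open>The factor u is held fixed for a first lift in p and q. The resulting family is
    balanced in the pair t, u, which permits the second lift.\<close>
  define \<alpha> where "\<alpha> u = tensor_over_lift K A V W VR.T (\<lambda>p q. ?vr p (?wu q u))" for u
  have lin: "\<alpha> u \<in> linear_maps K VW.T VR.T" if "u \<in> carrier U" for u
    unfolding \<alpha>_def by (rule tensor_over_lift_linear[OF VW.bim mR b[OF that]])
  have pure: "\<alpha> u (?vw p q) = ?vr p (?wu q u)" if "u \<in> carrier U" "p \<in> carrier V" "q \<in> carrier W" for u p q
    unfolding \<alpha>_def by (rule tensor_over_lift_pure[OF VW.bim mR b[OF that(1)] that(2,3)])
  note ext = VW.pto_ext[OF mR]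
  note cl = VW.closures WU.closures LU.closures VR.closures
  have lin': "(\<lambda>u. \<alpha> u t) \<in> linear_maps K U VR.T" if t: "t \<in> carrier VW.T" for t
  proof (rule linear_mapsI)
    fix u v assume [simp]: "u \<in> carrier U" "v \<in> carrier U"
    show "\<alpha> u t \<in> carrier VR.T" by (rule lin_closed[OF lin t]) simp
    show "\<alpha> (u \<oplus>\<^bsub>U\<^esub> v) t = \<alpha> u t \<oplus>\<^bsub>VR.T\<^esub> \<alpha> v t"
      by (rule ext[OF lin lin_plus[OF lin lin] _ t]) (simp_all add: mR pure WU.pto_add VR.pto_add cl)
    fix k assume [simp]: "k \<in> carrier K"
    show "\<alpha> (k \<odot>\<^bsub>U\<^esub> u) t = k \<odot>\<^bsub>VR.T\<^esub> \<alpha> u t"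
      by (rule ext[OF lin lin_scale[OF lin] _ t])
        (simp_all add: mR pure lin_smult[OF bilin_right[OF WU.pto_bilinear]] lin_smult[OF bilin_right[OF VR.pto_bilinear]] cl)
  qed
  \<comment> \<open>Both sides sum \<open>E x (\<theta> k) p\<close>,
    \<open>E' (\<xi> k) (\<theta> i) q\<close> and \<open>v i\<close> over i and k, the left side
    grouped by i and the right side by k. It is applied with
    \<open>v i = F (\<xi> i) \<omega> u\<close> for \<open>E\<close> and with
    \<open>v i = L (\<xi> i) u\<close> for \<open>J\<close>.\<close>
  have double: "(\<Oplus>\<^bsub>VR.T\<^esub>i\<in>{..<r}. \<alpha> (v i) (VW.TE x (\<theta> i) (?vw p q))) =
      (\<Oplus>\<^bsub>VR.T\<^esub>k\<in>{..<r}. ?vr (E x (\<theta> k) p) (\<Oplus>\<^bsub>WU.T\<^esub>i\<in>{..<r}. ?wu (E' (\<xi> k) (\<theta> i) q) (v i)))"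
    if v: "\<And>i. i < r \<Longrightarrow> v i \<in> carrier U" and x: "x \<in> carrier X" and p: "p \<in> carrier V" and q: "q \<in> carrier W" for v x p q
  proof -
    note [simp] = v x p q cl
    have "(\<Oplus>\<^bsub>VR.T\<^esub>i\<in>{..<r}. \<alpha> (v i) (VW.TE x (\<theta> i) (?vw p q))) =
        (\<Oplus>\<^bsub>VR.T\<^esub>i\<in>{..<r}. \<Oplus>\<^bsub>VR.T\<^esub>k\<in>{..<r}. ?vr (E x (\<theta> k) p) (?wu (E' (\<xi> k) (\<theta> i) q) (v i)))"
    proof (rule VR.frame_sum_cong)
      fix i assume i [simp]: "i < r"
      show "\<alpha> (v i) (VW.TE x (\<theta> i) (?vw p q)) =
          (\<Oplus>\<^bsub>VR.T\<^esub>k\<in>{..<r}. ?vr (E x (\<theta> k) p) (?wu (E' (\<xi> k) (\<theta> i) q) (v i)))"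
        by (simp add: VW.TE_pure, subst lin_finsum[OF lin[OF v[OF i]] VW.mT mR], simp add: Pi_def,
            rule VR.frame_sum_cong) (simp_all add: pure)
      show "(\<Oplus>\<^bsub>VR.T\<^esub>k\<in>{..<r}. ?vr (E x (\<theta> k) p) (?wu (E' (\<xi> k) (\<theta> i) q) (v i))) \<in> carrier VR.T"
        by (rule VR.T.M.finsum_closed) auto
    qed
    also have "\<dots> = (\<Oplus>\<^bsub>VR.T\<^esub>k\<in>{..<r}. \<Oplus>\<^bsub>VR.T\<^esub>i\<in>{..<r}. ?vr (E x (\<theta> k) p) (?wu (E' (\<xi> k) (\<theta> i) q) (v i)))"
      by (rule VR.T.M.finsum_swap) auto
    also have "\<dots> = (\<Oplus>\<^bsub>VR.T\<^esub>k\<in>{..<r}. ?vr (E x (\<theta> k) p) (\<Oplus>\<^bsub>WU.T\<^esub>i\<in>{..<r}. ?wu (E' (\<xi> k) (\<theta> i) q) (v i)))"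
    proof (rule VR.frame_sum_cong)
      fix k assume k [simp]: "k < r"
      have c: "(\<Oplus>\<^bsub>WU.T\<^esub>i\<in>{..<r}. ?wu (E' (\<xi> k) (\<theta> i) q) (v i)) \<in> carrier WU.T"
        by (rule WU.T.M.finsum_closed) auto
      show "(\<Oplus>\<^bsub>VR.T\<^esub>i\<in>{..<r}. ?vr (E x (\<theta> k) p) (?wu (E' (\<xi> k) (\<theta> i) q) (v i))) =
          ?vr (E x (\<theta> k) p) (\<Oplus>\<^bsub>WU.T\<^esub>i\<in>{..<r}. ?wu (E' (\<xi> k) (\<theta> i) q) (v i))"
        by (rule lin_finsum[OF bilin_right[OF VR.pto_bilinear] WU.mT mR, symmetric]) auto
      show "?vr (E x (\<theta> k) p) (\<Oplus>\<^bsub>WU.T\<^esub>i\<in>{..<r}. ?wu (E' (\<xi> k) (\<theta> i) q) (v i)) \<in> carrier VR.T"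
        using c by simp
    qed
    finally show ?thesis .
  qed
  have "\<exists>h. vf_hom K A \<Omega> LU.T LU.TE LU.TJ VR.T VR.TE VR.TJ h \<and>
      (\<forall>t\<in>carrier VW.T. \<forall>u\<in>carrier U. h (?lu t u) = \<alpha> u t)"
  proof (rule LU.vf_hom_of_balanced)
    show "vf_module K A VR.T \<Omega> d VR.TE VR.TJ" by (rule VR.vf_module_tensor)
    note la = bilin_right[OF VW.T.lact_bilinear] and ra = bilin_left[OF VW.T.ract_bilinear]
    note la' = bilin_right[OF VR.T.lact_bilinear] and ra' = bilin_left[OF VR.T.ract_bilinear]
    show "(\<lambda>t u. \<alpha> u t) \<in> balanced_maps K A VW.T U VR.T"
    proof (intro balanced_mapsI bilinear_mapsI)
      fix t a u assume t: "t \<in> carrier VW.T" and [simp]: "a \<in> carrier A" "u \<in> carrier U"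
      show "\<alpha> u (t \<triangleleft>\<^bsub>VW.T\<^esub> a) = \<alpha> (a \<triangleright>\<^bsub>U\<^esub> u) t"
        by (rule ext[OF lin_compose[OF ra lin] lin _ t])
          (simp_all add: cl VW.pto_act pure balanced_swap[OF WU.pto_balanced])
    qed (simp_all add: lin lin')
    fix t u assume t: "t \<in> carrier VW.T" and u [simp]: "u \<in> carrier U"
    show "\<alpha> u (a \<triangleright>\<^bsub>VW.T\<^esub> t) = a \<triangleright>\<^bsub>VR.T\<^esub> \<alpha> u t" if [simp]: "a \<in> carrier A" for a
      by (rule ext[OF lin_compose[OF la lin] lin_compose[OF lin la'] _ t])
        (simp_all add: cl VW.pto_act VR.pto_act pure)
    show "\<alpha> (u \<triangleleft>\<^bsub>U\<^esub> a) t = \<alpha> u t \<triangleleft>\<^bsub>VR.T\<^esub> a" if [simp]: "a \<in> carrier A" for a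
      by (rule ext[OF lin lin_compose[OF lin ra'] _ t])
        (simp_all add: cl WU.pto_act VR.pto_act pure)
    fix x assume x [simp]: "x \<in> carrier X"
    show "(\<Oplus>\<^bsub>VR.T\<^esub>i\<in>{..<r}. \<alpha> (F (\<xi> i) \<omega> u) (VW.TE x (\<theta> i) t)) = VR.TE x \<omega> (\<alpha> u t)"
      if \<omega> [simp]: "\<omega> \<in> carrier \<Omega>" for \<omega>
    proof (rule ext[OF lin_sum lin_compose[OF lin VR.TE_linear] _ t])
      show "(\<lambda>t. \<alpha> (F (\<xi> i) \<omega> u) (VW.TE x (\<theta> i) t)) \<in> linear_maps K VW.T VR.T" if "i \<in> {..<r}" for i
        using that by (intro lin_compose[OF VW.TE_linear lin]) (simp_all add: cl)
      fix p q assume [simp]: "p \<in> carrier V" "q \<in> carrier W"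
      show "(\<Oplus>\<^bsub>VR.T\<^esub>i\<in>{..<r}. \<alpha> (F (\<xi> i) \<omega> u) (VW.TE x (\<theta> i) (?vw p q))) = VR.TE x \<omega> (\<alpha> u (?vw p q))"
        by (subst double) (simp_all add: cl pure VR.TE_pure, rule VR.frame_sum_cong,
          simp_all add: WU.TE_pure cl WU.EE_sum_closed)
    qed (simp_all add: VW.mT mR cl)
    \<comment> \<open>On a pure tensor both sides consist of three parts: \<open>J\<close> on p,
      then \<open>J'\<close> on q after \<open>E\<close> on p, then \<open>L\<close> on u after
      \<open>E\<close> on both. Facts 1 and 2 bring the left side into this form, 3 and 4 the right
      side.\<close>
    show "\<alpha> u (VW.TJ x t) \<oplus>\<^bsub>VR.T\<^esub> (\<Oplus>\<^bsub>VR.T\<^esub>i\<in>{..<r}. \<alpha> (L (\<xi> i) u) (VW.TE x (\<theta> i) t)) = VR.TJ x (\<alpha> u t)"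
    proof (rule ext[OF lin_plus[OF lin_compose[OF VW.TJ_linear lin] lin_sum mR] lin_compose[OF lin VR.TJ_linear] _ t])
      show "(\<lambda>t. \<alpha> (L (\<xi> i) u) (VW.TE x (\<theta> i) t)) \<in> linear_maps K VW.T VR.T" if "i \<in> {..<r}" for i
        using that by (intro lin_compose[OF VW.TE_linear lin]) (simp_all add: cl)
      fix p q assume pq [simp]: "p \<in> carrier V" "q \<in> carrier W"
      have 1: "\<alpha> u (\<Oplus>\<^bsub>VW.T\<^esub>k\<in>{..<r}. ?vw (E x (\<theta> k) p) (J' (\<xi> k) q)) =
          (\<Oplus>\<^bsub>VR.T\<^esub>k\<in>{..<r}. ?vr (E x (\<theta> k) p) (?wu (J' (\<xi> k) q) u))"
        by (subst lin_finsum[OF lin[OF u] VW.mT mR], simp add: Pi_def cl, rule VR.frame_sum_cong)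
          (simp_all add: pure cl)
      have 2: "(\<Oplus>\<^bsub>VR.T\<^esub>i\<in>{..<r}. \<alpha> (L (\<xi> i) u) (VW.TE x (\<theta> i) (?vw p q))) =
          (\<Oplus>\<^bsub>VR.T\<^esub>k\<in>{..<r}. ?vr (E x (\<theta> k) p) (\<Oplus>\<^bsub>WU.T\<^esub>i\<in>{..<r}. ?wu (E' (\<xi> k) (\<theta> i) q) (L (\<xi> i) u)))"
        by (rule double) (simp_all add: cl)
      have 3: "(\<Oplus>\<^bsub>VR.T\<^esub>k\<in>{..<r}. ?vr (E x (\<theta> k) p) (WU.TJ (\<xi> k) (?wu q u))) =
          (\<Oplus>\<^bsub>VR.T\<^esub>k\<in>{..<r}. ?vr (E x (\<theta> k) p) (?wu (J' (\<xi> k) q) u) \<oplus>\<^bsub>VR.T\<^esub>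
            ?vr (E x (\<theta> k) p) (\<Oplus>\<^bsub>WU.T\<^esub>i\<in>{..<r}. ?wu (E' (\<xi> k) (\<theta> i) q) (L (\<xi> i) u)))"
        by (rule VR.frame_sum_cong) (simp_all add: WU.TJ_pure VR.pto_add cl WU.EJ_sum_closed)
      have 4: "\<dots> = (\<Oplus>\<^bsub>VR.T\<^esub>k\<in>{..<r}. ?vr (E x (\<theta> k) p) (?wu (J' (\<xi> k) q) u)) \<oplus>\<^bsub>VR.T\<^esub>
          (\<Oplus>\<^bsub>VR.T\<^esub>k\<in>{..<r}. ?vr (E x (\<theta> k) p) (\<Oplus>\<^bsub>WU.T\<^esub>i\<in>{..<r}. ?wu (E' (\<xi> k) (\<theta> i) q) (L (\<xi> i) u)))"
        by (rule VR.T.M.finsum_addf) (auto simp: cl WU.EJ_sum_closed)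
      have c: "(\<Oplus>\<^bsub>VR.T\<^esub>k\<in>{..<r}. ?vr (E x (\<theta> k) p) (?wu (J' (\<xi> k) q) u)) \<in> carrier VR.T"
        "(\<Oplus>\<^bsub>VR.T\<^esub>k\<in>{..<r}. ?vr (E x (\<theta> k) p) (\<Oplus>\<^bsub>WU.T\<^esub>i\<in>{..<r}. ?wu (E' (\<xi> k) (\<theta> i) q) (L (\<xi> i) u))) \<in> carrier VR.T"
        by (rule VR.T.M.finsum_closed; auto simp: cl WU.EJ_sum_closed)+
      show "\<alpha> u (VW.TJ x (?vw p q)) \<oplus>\<^bsub>VR.T\<^esub> (\<Oplus>\<^bsub>VR.T\<^esub>i\<in>{..<r}. \<alpha> (L (\<xi> i) u) (VW.TE x (\<theta> i) (?vw p q))) =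
          VR.TJ x (\<alpha> u (?vw p q))"
        unfolding 2 using c
        by (simp add: VW.TJ_pure VR.TJ_pure pure lin_add[OF lin] cl VW.EJ_sum_closed 1 3 4 VR.T.M.add.m_assoc)
    qed (simp_all add: VW.mT mR cl)
  qed
  then show ?thesis by (auto simp: pure cl)
qed

end

section \<open>The bialgebroid structure\<close>

context framed_calculus
begin

interpretation X: bimodule K A X by (rule bimodule_left_dual)
interpretation B: k_algebra K BXA by (rule k_algebra_BX)
sublocale LB: vf_module K A LB \<Omega> d EB JB by (rule vf_module_LB)
sublocale BB: vf_pair K A \<Omega> d r \<theta> \<xi> LB EB JB LB EB JB by (rule vf_pairI[OF vf_module_LB vf_module_LB])

abbreviation "Q \<equiv> bsquare K A BXA \<eta>"
abbreviation "bp \<equiv> bpure K A BXA \<eta>"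

lemma bsquare_eq: "Q = BB.T" and bpure_eq: "bp = pure_tensor_over K A LB LB"
  by (simp_all add: bsquare_def bpure_def)

lemma carrier_LB: "carrier LB = carrier BXA"
  by (simp add: left_bimodule_simps)

lemma BX_env_closed: "\<lbrakk>a \<in> carrier A; b \<in> carrier A\<rbrakk> \<Longrightarrow> \<eta> (env_elem K A a b) \<in> carrier BXA"
  by (rule lin_closed[OF algebra_homs_linear[OF BX_env_hom] env_elem_closed])

abbreviation "LB_hom W E' J' f \<equiv> vf_hom K A \<Omega> LB EB JB W E' J' f"

text \<open>Left and right multiplications commute by associativity. By freeness every endomorphism
  of \<open>|B\<close> is of this kind.\<close>

lemma right_mult_hom: "c \<in> carrier BXA \<Longrightarrow> LB_hom LB EB JB (\<lambda>b. b \<otimes>\<^bsub>BXA\<^esub> c)"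
  by (rule vf_homI)
    (simp_all add: linear_maps_LB bilin_left[OF B.mult_bilinear] left_bimodule_simps B.A.m_assoc BX_closed)

lemma env_as_action: "\<lbrakk>a \<in> carrier A; b \<in> carrier A\<rbrakk> \<Longrightarrow> \<eta> (env_elem K A a b) = a \<triangleright>\<^bsub>LB\<^esub> (\<one>\<^bsub>BXA\<^esub> \<triangleleft>\<^bsub>LB\<^esub> b)"
  by (simp add: left_bimodule_simps BX_closed BX_source_target)

text \<open>This discharges the quantification over all representations in the Sweedler axioms: an
  expression that is a linear map applied to the tensor has the same value on each of them.\<close>

lemma lin_bsum:
  assumes h: "h \<in> linear_maps K BB.T P" and P: "module K P" and s: "sweedler K A BXA \<eta> t n p q"
  shows "h t = (\<Oplus>\<^bsub>P\<^esub>i\<in>{..<n}. h (bp (p i) (q i)))"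
proof -
  have "t = (\<Oplus>\<^bsub>BB.T\<^esub>i\<in>{..<n}. bp (p i) (q i))" using s by (simp add: sweedler_def bsum_def bsquare_eq)
  moreover have "(\<lambda>i. bp (p i) (q i)) \<in> {..<n} \<rightarrow> carrier BB.T"
    using s by (auto simp: sweedler_def bpure_eq carrier_LB intro!: BB.pto_closed)
  ultimately show ?thesis using lin_finsum[OF h BB.mT P] by simp
qed

text \<open>The product rule speaks about representations and would say nothing about a coproduct
  that has none. Since pure tensors span, and scalars can be absorbed into the first factor, there
  always is one.\<close>

lemma sweedler_exists:
  assumes "t \<in> carrier BB.T"
  shows "\<exists>n p q. sweedler K A BXA \<eta> t n p q"
  using assms
proof (induction rule: tensor_over_induct[OF BB.bim, consumes 1, case_names zero pure add smult])
  case zero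
  have "sweedler K A BXA \<eta> \<zero>\<^bsub>BB.T\<^esub> 0 undefined undefined" by (simp add: sweedler_def bsum_def bsquare_eq)
  then show ?case by blast
next
  case (pure b c)
  then have "sweedler K A BXA \<eta> (pure_tensor_over K A LB LB b c) (Suc 0) (\<lambda>_. b) (\<lambda>_. c)"
    by (simp add: sweedler_def bsum_def bsquare_eq bpure_eq carrier_LB lessThan_Suc BB.pto_closed)
  then show ?case by blast
next
  case (add s t)
  then obtain n p q n' p' q' where s: "sweedler K A BXA \<eta> s n p q" and t: "sweedler K A BXA \<eta> t n' p' q'" by blast
  \<comment> \<open>The concatenation of the two families, the second one shifted by
    \<open>n\<close>.\<close>
  define P where "P i = (if i < n then p i else p' (i - n))" for i
  define R where "R i = (if i < n then q i else q' (i - n))" for i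
  have c: "\<And>i. i < n + n' \<Longrightarrow> P i \<in> carrier BXA \<and> R i \<in> carrier BXA"
    using s t by (auto simp: P_def R_def sweedler_def)
  have "i \<in> (\<lambda>i. i + n) ` {..<n'}" if "i < n + n'" "\<not> i < n" for i
    using that by (intro image_eqI[of _ _ "i - n"]) auto
  then have "{..<n + n'} = {..<n} \<union> (\<lambda>i. i + n) ` {..<n'}" by force
  then have "bsum K A BXA \<eta> (n + n') P R =
      (\<Oplus>\<^bsub>BB.T\<^esub>i\<in>{..<n} \<union> (\<lambda>i. i + n) ` {..<n'}. pure_tensor_over K A LB LB (P i) (R i))"
    by (simp add: bsum_def bsquare_eq bpure_eq)
  also have "\<dots> = (\<Oplus>\<^bsub>BB.T\<^esub>i\<in>{..<n}. pure_tensor_over K A LB LB (P i) (R i)) \<oplus>\<^bsub>BB.T\<^esub>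
      (\<Oplus>\<^bsub>BB.T\<^esub>i\<in>(\<lambda>i. i + n) ` {..<n'}. pure_tensor_over K A LB LB (P i) (R i))"
    using c by (intro BB.T.M.finsum_Un_disjoint) (auto intro!: BB.pto_closed simp: carrier_LB)
  also have "(\<Oplus>\<^bsub>BB.T\<^esub>i\<in>(\<lambda>i. i + n) ` {..<n'}. pure_tensor_over K A LB LB (P i) (R i)) =
      (\<Oplus>\<^bsub>BB.T\<^esub>i\<in>{..<n'}. pure_tensor_over K A LB LB (P (i + n)) (R (i + n)))"
    using c by (intro BB.T.M.finsum_reindex) (auto intro!: BB.pto_closed simp: carrier_LB)
  also have "\<dots> = t" using t by (simp add: P_def R_def sweedler_def bsum_def bsquare_eq bpure_eq)
  also have "(\<Oplus>\<^bsub>BB.T\<^esub>i\<in>{..<n}. pure_tensor_over K A LB LB (P i) (R i)) =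
      (\<Oplus>\<^bsub>BB.T\<^esub>i\<in>{..<n}. pure_tensor_over K A LB LB (p i) (q i))"
    using s by (intro BB.T.M.finsum_cong') (auto simp: P_def R_def sweedler_def carrier_LB intro!: BB.pto_closed)
  also have "\<dots> = s" using s by (simp add: sweedler_def bsum_def bsquare_eq bpure_eq)
  finally have "sweedler K A BXA \<eta> (s \<oplus>\<^bsub>BB.T\<^esub> t) (n + n') P R" using c by (simp add: sweedler_def)
  then show ?case by blast
next
  case (smult k t)
  then obtain n p q where s: "sweedler K A BXA \<eta> t n p q" by blast
  have l: "(\<lambda>t. k \<odot>\<^bsub>BB.T\<^esub> t) \<in> linear_maps K BB.T BB.T"
    using lin_scale[OF lin_id BB.mT] smult by simp
  have "k \<odot>\<^bsub>BB.T\<^esub> t = bsum K A BXA \<eta> n (\<lambda>i. k \<odot>\<^bsub>BXA\<^esub> p i) q"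
    unfolding lin_bsum[OF l BB.mT s] bsum_def bsquare_eq bpure_eq using s smult
    by (intro BB.T.M.finsum_cong')
      (auto simp: sweedler_def lin_smult[OF bilin_left[OF BB.pto_bilinear], unfolded left_bimodule_simps]
        left_bimodule_simps intro!: BB.pto_closed)
  then have "sweedler K A BXA \<eta> (k \<odot>\<^bsub>BB.T\<^esub> t) n (\<lambda>i. k \<odot>\<^bsub>BXA\<^esub> p i) q"
    using s smult by (simp add: sweedler_def)
  then show ?case by blast
qed

section \<open>The bialgebroid axioms for homomorphisms \<Delta> and \<epsilon> normalised at
  1\<close>

context
  fixes \<Delta> \<epsilon>
  assumes \<Delta>: "LB_hom BB.T BB.TE BB.TJ \<Delta>" and \<Delta>1: "\<Delta> \<one>\<^bsub>BXA\<^esub> = bp \<one>\<^bsub>BXA\<^esub> \<one>\<^bsub>BXA\<^esub>"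
    and \<epsilon>: "LB_hom (regular_bimodule A) EA JA \<epsilon>" and \<epsilon>1: "\<epsilon> \<one>\<^bsub>BXA\<^esub> = \<one>\<^bsub>A\<^esub>"
begin

lemma counit_closed: "b \<in> carrier BXA \<Longrightarrow> \<epsilon> b \<in> carrier A"
  using vf_hom_closed[OF \<epsilon>] by (simp add: carrier_LB)

text \<open>The element arises from 1 by the two actions of \<open>A\<close>, so its coproduct
  arises from \<Delta>(1). On the tensor product the left action works on the first factor and the
  right action on the second, which separates a from b.\<close>

lemma comult_env_value:
  assumes "a \<in> carrier A" "b \<in> carrier A"
  shows "\<Delta> (\<eta> (env_elem K A a b)) = bp (sB a) (tB b)"
proof -
  have one: "\<one>\<^bsub>BXA\<^esub> \<in> carrier LB" by (simp add: carrier_LB)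
  have "\<Delta> (\<eta> (env_elem K A a b)) = bp (a \<triangleright>\<^bsub>LB\<^esub> \<one>\<^bsub>BXA\<^esub>) (\<one>\<^bsub>BXA\<^esub> \<triangleleft>\<^bsub>LB\<^esub> b)"
    unfolding env_as_action[OF assms] using assms one
    by (simp add: vf_hom_lact[OF \<Delta>] vf_hom_ract[OF \<Delta>] LB.N.ract_closed \<Delta>1 bpure_eq BB.pto_act)
  then show ?thesis using assms by (simp add: left_bimodule_simps BX_closed)
qed

lemma counit_env_value:
  assumes "a \<in> carrier A" "b \<in> carrier A"
  shows "\<epsilon> (\<eta> (env_elem K A a b)) = a \<otimes>\<^bsub>A\<^esub> b"
proof -
  have one: "\<one>\<^bsub>BXA\<^esub> \<in> carrier LB" by (simp add: carrier_LB)
  show ?thesis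
    unfolding env_as_action[OF assms] using assms one
    by (simp add: vf_hom_lact[OF \<epsilon>] vf_hom_ract[OF \<epsilon>] LB.N.ract_closed \<epsilon>1)
qed

lemma source_target_values:
  "a \<in> carrier A \<Longrightarrow> \<epsilon> (sB a) = a" "a \<in> carrier A \<Longrightarrow> \<epsilon> (tB a) = a"
  by (simp_all add: source_def target_def counit_env_value)

lemma comult_mult_rule: "comult_product_rule K A BXA \<eta> \<Delta>"
  unfolding comult_product_rule_def
proof (intro ballI allI impI, elim conjE)
  fix b c n p q n' p' q'
  assume b: "b \<in> carrier BXA" and c: "c \<in> carrier BXA" and s: "sweedler K A BXA \<eta> (\<Delta> b) n p q"
    and s': "sweedler K A BXA \<eta> (\<Delta> c) n' p' q'"
  have cl: "i < n \<Longrightarrow> p i \<in> carrier BXA" "i < n \<Longrightarrow> q i \<in> carrier BXA"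
    "j < n' \<Longrightarrow> p' j \<in> carrier BXA" "j < n' \<Longrightarrow> q' j \<in> carrier BXA" for i j
    using s s' by (auto simp: sweedler_def)
  \<comment> \<open>\<open>h j\<close> is right multiplication by the pure tensor
    \<open>p' j \<otimes> q' j\<close>, obtained by tensoring two right multiplications. A
    representation of \<Delta>(c) is used term by term, since as a map on all tensors right
    multiplication may depend on the representation.\<close>
  have "\<forall>j\<in>{..<n'}. \<exists>h. vf_hom K A \<Omega> BB.T BB.TE BB.TJ BB.T BB.TE BB.TJ h \<and>
      (\<forall>u\<in>carrier LB. \<forall>v\<in>carrier LB. h (pure_tensor_over K A LB LB u v) =
        pure_tensor_over K A LB LB (u \<otimes>\<^bsub>BXA\<^esub> p' j) (v \<otimes>\<^bsub>BXA\<^esub> q' j))"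
    using vf_hom_tensor[OF vf_module_LB vf_module_LB vf_module_LB vf_module_LB right_mult_hom right_mult_hom] cl
    by simp
  from bchoice[OF this] obtain h where H: "\<forall>j\<in>{..<n'}. vf_hom K A \<Omega> BB.T BB.TE BB.TJ BB.T BB.TE BB.TJ (h j) \<and>
      (\<forall>u\<in>carrier LB. \<forall>v\<in>carrier LB. h j (pure_tensor_over K A LB LB u v) =
        pure_tensor_over K A LB LB (u \<otimes>\<^bsub>BXA\<^esub> p' j) (v \<otimes>\<^bsub>BXA\<^esub> q' j))"
    by (elim exE)
  then have h: "\<And>j. j \<in> {..<n'} \<Longrightarrow> vf_hom K A \<Omega> BB.T BB.TE BB.TJ BB.T BB.TE BB.TJ (h j)" by blast
  have hp: "h j (bp u v) = bp (u \<otimes>\<^bsub>BXA\<^esub> p' j) (v \<otimes>\<^bsub>BXA\<^esub> q' j)"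
    if "j < n'" "u \<in> carrier BXA" "v \<in> carrier BXA" for j u v
    using H that by (simp add: carrier_LB bpure_eq)
  have bpc: "bp u v \<in> carrier BB.T" if "u \<in> carrier BXA" "v \<in> carrier BXA" for u v
    using that by (simp add: bpure_eq BB.pto_closed carrier_LB)
  \<comment> \<open>Both sides are homomorphisms in b; at b = 1 the right side collapses to the
    given representation of \<Delta>(c).\<close>
  have "\<Delta> (b \<otimes>\<^bsub>BXA\<^esub> c) = (\<Oplus>\<^bsub>BB.T\<^esub>j\<in>{..<n'}. h j (\<Delta> b))"
  proof (rule BX_free_module_unique[OF BB.vf_module_tensor vf_hom_compose[OF right_mult_hom[OF c] \<Delta>]
        vf_hom_compose[OF \<Delta> vf_hom_sum[OF BB.vf_module_tensor BB.vf_module_tensor h]] _ b])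
    have "(\<Oplus>\<^bsub>BB.T\<^esub>j\<in>{..<n'}. h j (\<Delta> \<one>\<^bsub>BXA\<^esub>)) = (\<Oplus>\<^bsub>BB.T\<^esub>j\<in>{..<n'}. bp (p' j) (q' j))"
      by (rule BB.T.M.finsum_cong') (auto simp: \<Delta>1 hp cl bpc)
    also have "\<dots> = \<Delta> c" using s' by (simp add: sweedler_def bsum_def bsquare_eq)
    finally show "\<Delta> (\<one>\<^bsub>BXA\<^esub> \<otimes>\<^bsub>BXA\<^esub> c) = (\<Oplus>\<^bsub>BB.T\<^esub>j\<in>{..<n'}. h j (\<Delta> \<one>\<^bsub>BXA\<^esub>))" using c by simp
  qed
  also have "\<dots> = (\<Oplus>\<^bsub>BB.T\<^esub>j\<in>{..<n'}. \<Oplus>\<^bsub>BB.T\<^esub>i\<in>{..<n}. bp (p i \<otimes>\<^bsub>BXA\<^esub> p' j) (q i \<otimes>\<^bsub>BXA\<^esub> q' j))"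
  proof (rule BB.T.M.finsum_cong')
    fix j assume j: "j \<in> {..<n'}"
    have "h j (\<Delta> b) = (\<Oplus>\<^bsub>BB.T\<^esub>i\<in>{..<n}. h j (bp (p i) (q i)))"
      by (rule lin_bsum[OF vf_hom_linear[OF h[OF j]] BB.mT s])
    also have "\<dots> = (\<Oplus>\<^bsub>BB.T\<^esub>i\<in>{..<n}. bp (p i \<otimes>\<^bsub>BXA\<^esub> p' j) (q i \<otimes>\<^bsub>BXA\<^esub> q' j))"
      using j by (intro BB.T.M.finsum_cong') (auto simp: hp cl bpc)
    finally show "h j (\<Delta> b) = (\<Oplus>\<^bsub>BB.T\<^esub>i\<in>{..<n}. bp (p i \<otimes>\<^bsub>BXA\<^esub> p' j) (q i \<otimes>\<^bsub>BXA\<^esub> q' j))" .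
  qed (auto intro!: BB.T.M.finsum_closed simp: bpc cl)
  also have "\<dots> = (\<Oplus>\<^bsub>BB.T\<^esub>i\<in>{..<n}. \<Oplus>\<^bsub>BB.T\<^esub>j\<in>{..<n'}. bp (p i \<otimes>\<^bsub>BXA\<^esub> p' j) (q i \<otimes>\<^bsub>BXA\<^esub> q' j))"
    by (rule BB.T.M.finsum_swap) (auto simp: bpc cl)
  finally show "\<Delta> (b \<otimes>\<^bsub>BXA\<^esub> c) =
      (\<Oplus>\<^bsub>Q\<^esub>i\<in>{..<n}. \<Oplus>\<^bsub>Q\<^esub>j\<in>{..<n'}. bp (p i \<otimes>\<^bsub>BXA\<^esub> p' j) (q i \<otimes>\<^bsub>BXA\<^esub> q' j))"
    by (simp add: bsquare_eq)
qed

text \<open>The map b to \<epsilon>(b c) is a homomorphism with value \<epsilon>(c) at 1, so it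
  depends on c through \<epsilon>(c) only. Replacing c by the source or the target of \<epsilon>(c),
  which have the same counit, gives the two rules.\<close>

lemma counit_mult_rule:
  assumes b: "b \<in> carrier BXA" and c: "c \<in> carrier BXA"
  shows "\<epsilon> (b \<otimes>\<^bsub>BXA\<^esub> c) = \<epsilon> (b \<otimes>\<^bsub>BXA\<^esub> sB (\<epsilon> c))" "\<epsilon> (b \<otimes>\<^bsub>BXA\<^esub> c) = \<epsilon> (b \<otimes>\<^bsub>BXA\<^esub> tB (\<epsilon> c))"
proof -
  have eq: "\<epsilon> (b \<otimes>\<^bsub>BXA\<^esub> c) = \<epsilon> (b \<otimes>\<^bsub>BXA\<^esub> c')" if c': "c' \<in> carrier BXA" "\<epsilon> c = \<epsilon> c'" for c'
    by (rule BX_free_module_unique[OF vf_module_regular vf_hom_compose[OF right_mult_hom[OF c] \<epsilon>]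
        vf_hom_compose[OF right_mult_hom[OF c'(1)] \<epsilon>] _ b]) (simp add: c c')
  show "\<epsilon> (b \<otimes>\<^bsub>BXA\<^esub> c) = \<epsilon> (b \<otimes>\<^bsub>BXA\<^esub> sB (\<epsilon> c))" "\<epsilon> (b \<otimes>\<^bsub>BXA\<^esub> c) = \<epsilon> (b \<otimes>\<^bsub>BXA\<^esub> tB (\<epsilon> c))"
    by (rule eq; simp add: BX_closed counit_closed source_target_values c)+
qed

text \<open>Applying \<epsilon> to the first factor and letting the result act on the second is a
  homomorphism h by \<open>vf_hom_left_unit\<close>. Composed with \<Delta> it is an endomorphism of
  \<open>|B\<close> fixing 1, hence the identity.\<close>

lemma counit_left_rule:
  assumes b: "b \<in> carrier BXA" and s: "sweedler K A BXA \<eta> (\<Delta> b) n p q"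
  shows "(\<Oplus>\<^bsub>BXA\<^esub>i\<in>{..<n}. sB (\<epsilon> (p i)) \<otimes>\<^bsub>BXA\<^esub> q i) = b"
proof -
  obtain h where h: "vf_hom K A \<Omega> BB.T BB.TE BB.TJ LB EB JB h"
    and hp: "\<And>u v. \<lbrakk>u \<in> carrier LB; v \<in> carrier LB\<rbrakk> \<Longrightarrow> h (pure_tensor_over K A LB LB u v) = \<epsilon> u \<triangleright>\<^bsub>LB\<^esub> v"
    using BB.vf_hom_left_unit[OF \<epsilon>] by blast
  have cl: "i < n \<Longrightarrow> p i \<in> carrier BXA" "i < n \<Longrightarrow> q i \<in> carrier BXA" for i
    using s by (auto simp: sweedler_def)
  have "h (\<Delta> b) = b"
    by (rule BX_free_module_unique[OF vf_module_LB vf_hom_compose[OF \<Delta> h] vf_hom_id _ b])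
      (simp add: \<Delta>1 bpure_eq hp carrier_LB \<epsilon>1 LB.N.one_lact)
  moreover have "h (\<Delta> b) = (\<Oplus>\<^bsub>LB\<^esub>i\<in>{..<n}. h (bp (p i) (q i)))"
    by (rule lin_bsum[OF vf_hom_linear[OF h] LB.N.M.module_axioms s])
  moreover have "\<dots> = (\<Oplus>\<^bsub>LB\<^esub>i\<in>{..<n}. sB (\<epsilon> (p i)) \<otimes>\<^bsub>BXA\<^esub> q i)"
    by (rule LB.N.M.finsum_cong')
      (auto simp: bpure_eq hp cl carrier_LB, auto simp: left_bimodule_simps cl BX_closed counit_closed)
  moreover have "\<dots> = (\<Oplus>\<^bsub>BXA\<^esub>i\<in>{..<n}. sB (\<epsilon> (p i)) \<otimes>\<^bsub>BXA\<^esub> q i)"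
    by (rule finsum_cong_record) (simp_all add: left_bimodule_simps)
  ultimately show ?thesis by simp
qed

lemma counit_right_rule:
  assumes b: "b \<in> carrier BXA" and s: "sweedler K A BXA \<eta> (\<Delta> b) n p q"
  shows "(\<Oplus>\<^bsub>BXA\<^esub>i\<in>{..<n}. tB (\<epsilon> (q i)) \<otimes>\<^bsub>BXA\<^esub> p i) = b"
proof -
  obtain h where h: "vf_hom K A \<Omega> BB.T BB.TE BB.TJ LB EB JB h"
    and hp: "\<And>u v. \<lbrakk>u \<in> carrier LB; v \<in> carrier LB\<rbrakk> \<Longrightarrow> h (pure_tensor_over K A LB LB u v) = u \<triangleleft>\<^bsub>LB\<^esub> \<epsilon> v"
    using BB.vf_hom_right_unit[OF \<epsilon>] by blast
  have cl: "i < n \<Longrightarrow> p i \<in> carrier BXA" "i < n \<Longrightarrow> q i \<in> carrier BXA" for i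
    using s by (auto simp: sweedler_def)
  have "h (\<Delta> b) = b"
    by (rule BX_free_module_unique[OF vf_module_LB vf_hom_compose[OF \<Delta> h] vf_hom_id _ b])
      (simp add: \<Delta>1 bpure_eq hp carrier_LB \<epsilon>1 LB.N.ract_one)
  moreover have "h (\<Delta> b) = (\<Oplus>\<^bsub>LB\<^esub>i\<in>{..<n}. h (bp (p i) (q i)))"
    by (rule lin_bsum[OF vf_hom_linear[OF h] LB.N.M.module_axioms s])
  moreover have "\<dots> = (\<Oplus>\<^bsub>LB\<^esub>i\<in>{..<n}. tB (\<epsilon> (q i)) \<otimes>\<^bsub>BXA\<^esub> p i)"
    by (rule LB.N.M.finsum_cong')
      (auto simp: bpure_eq hp cl carrier_LB, auto simp: left_bimodule_simps cl BX_closed counit_closed)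
  moreover have "\<dots> = (\<Oplus>\<^bsub>BXA\<^esub>i\<in>{..<n}. tB (\<epsilon> (q i)) \<otimes>\<^bsub>BXA\<^esub> p i)"
    by (rule finsum_cong_record) (simp_all add: left_bimodule_simps)
  ultimately show ?thesis by simp
qed

text \<open>Here f is \<Delta> on the first factor, g is \<Delta> on the second and h is the
  associator. The composites of \<Delta> with h after f and with g are homomorphisms that both send
  1 to the triple tensor of 1, so they agree; evaluating them on the given representations yields
  the two sums.\<close>

lemma coassociative_rule:
  assumes b: "b \<in> carrier BXA" and s: "sweedler K A BXA \<eta> (\<Delta> b) n p q"
    and s': "\<And>i. i < n \<Longrightarrow> sweedler K A BXA \<eta> (\<Delta> (p i)) (m i) (u i) (v i)"
  shows "(\<Oplus>\<^bsub>tensor_over K A LB Q\<^esub>i\<in>{..<n}. \<Oplus>\<^bsub>tensor_over K A LB Q\<^esub>j\<in>{..<m i}.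
      pure_tensor_over K A LB Q (u i j) (bp (v i j) (q i))) =
    (\<Oplus>\<^bsub>tensor_over K A LB Q\<^esub>i\<in>{..<n}. pure_tensor_over K A LB Q (p i) (\<Delta> (q i)))"
proof -
  interpret L3: vf_pair K A \<Omega> d r \<theta> \<xi> BB.T BB.TE BB.TJ LB EB JB
    by (rule vf_pairI[OF BB.vf_module_tensor vf_module_LB])
  interpret R3: vf_pair K A \<Omega> d r \<theta> \<xi> LB EB JB BB.T BB.TE BB.TJ
    by (rule vf_pairI[OF vf_module_LB BB.vf_module_tensor])
  let ?bb = "pure_tensor_over K A LB LB" and ?l = "pure_tensor_over K A BB.T LB" and ?r = "pure_tensor_over K A LB BB.T"
  have cl: "i < n \<Longrightarrow> p i \<in> carrier LB" "i < n \<Longrightarrow> q i \<in> carrier LB"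
    "\<lbrakk>i < n; j < m i\<rbrakk> \<Longrightarrow> u i j \<in> carrier LB" "\<lbrakk>i < n; j < m i\<rbrakk> \<Longrightarrow> v i j \<in> carrier LB" for i j
    using s s' by (auto simp: sweedler_def carrier_LB)
  obtain f where f: "vf_hom K A \<Omega> BB.T BB.TE BB.TJ L3.T L3.TE L3.TJ f"
    and fp: "\<And>u v. \<lbrakk>u \<in> carrier LB; v \<in> carrier LB\<rbrakk> \<Longrightarrow> f (?bb u v) = ?l (\<Delta> u) v"
    using vf_hom_tensor[OF vf_module_LB vf_module_LB BB.vf_module_tensor vf_module_LB \<Delta> vf_hom_id] by blast
  obtain g where g: "vf_hom K A \<Omega> BB.T BB.TE BB.TJ R3.T R3.TE R3.TJ g"
    and gp: "\<And>u v. \<lbrakk>u \<in> carrier LB; v \<in> carrier LB\<rbrakk> \<Longrightarrow> g (?bb u v) = ?r u (\<Delta> v)"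
    using vf_hom_tensor[OF vf_module_LB vf_module_LB vf_module_LB BB.vf_module_tensor vf_hom_id \<Delta>] by blast
  obtain h where h: "vf_hom K A \<Omega> L3.T L3.TE L3.TJ R3.T R3.TE R3.TJ h"
    and hp: "\<And>u v w. \<lbrakk>u \<in> carrier LB; v \<in> carrier LB; w \<in> carrier LB\<rbrakk> \<Longrightarrow> h (?l (?bb u v) w) = ?r u (?bb v w)"
    using vf_hom_associator[OF vf_module_LB vf_module_LB vf_module_LB] by blast
  have one: "\<one>\<^bsub>BXA\<^esub> \<in> carrier LB" by (simp add: carrier_LB)
  note \<Delta>c = vf_hom_closed[OF \<Delta>]
  have "h (f (\<Delta> b)) = g (\<Delta> b)"
    by (rule BX_free_module_unique[OF R3.vf_module_tensor vf_hom_compose[OF \<Delta> vf_hom_compose[OF f h]]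
          vf_hom_compose[OF \<Delta> g] _ b]) (simp add: \<Delta>1 bpure_eq fp gp hp one)
  moreover have "h (f (\<Delta> b)) = (\<Oplus>\<^bsub>R3.T\<^esub>i\<in>{..<n}. h (f (bp (p i) (q i))))"
    by (rule lin_bsum[OF vf_hom_linear[OF vf_hom_compose[OF f h]] R3.mT s])
  moreover have "\<dots> = (\<Oplus>\<^bsub>R3.T\<^esub>i\<in>{..<n}. \<Oplus>\<^bsub>R3.T\<^esub>j\<in>{..<m i}. ?r (u i j) (?bb (v i j) (q i)))"
  proof (rule R3.T.M.finsum_cong')
    fix i assume "i \<in> {..<n}"
    then have i: "i < n" by simp
    have lin: "(\<lambda>t. h (?l t (q i))) \<in> linear_maps K BB.T R3.T"
      by (rule lin_compose[OF bilin_left[OF L3.pto_bilinear cl(2)[OF i]] vf_hom_linear[OF h]])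
    have "h (f (bp (p i) (q i))) = h (?l (\<Delta> (p i)) (q i))" using i by (simp add: bpure_eq fp cl)
    also have "\<dots> = (\<Oplus>\<^bsub>R3.T\<^esub>j\<in>{..<m i}. h (?l (bp (u i j) (v i j)) (q i)))"
      by (rule lin_bsum[OF lin R3.mT s'[OF i]])
    also have "\<dots> = (\<Oplus>\<^bsub>R3.T\<^esub>j\<in>{..<m i}. ?r (u i j) (?bb (v i j) (q i)))"
      using i by (intro R3.T.M.finsum_cong') (auto simp: bpure_eq hp cl R3.pto_closed BB.pto_closed)
    finally show "h (f (bp (p i) (q i))) = (\<Oplus>\<^bsub>R3.T\<^esub>j\<in>{..<m i}. ?r (u i j) (?bb (v i j) (q i)))" .
  qed (auto intro!: R3.T.M.finsum_closed simp: cl R3.pto_closed BB.pto_closed)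
  moreover have "g (\<Delta> b) = (\<Oplus>\<^bsub>R3.T\<^esub>i\<in>{..<n}. g (bp (p i) (q i)))"
    by (rule lin_bsum[OF vf_hom_linear[OF g] R3.mT s])
  moreover have "\<dots> = (\<Oplus>\<^bsub>R3.T\<^esub>i\<in>{..<n}. ?r (p i) (\<Delta> (q i)))"
    by (rule R3.T.M.finsum_cong') (auto simp: bpure_eq gp cl R3.pto_closed \<Delta>c)
  ultimately show ?thesis by (simp add: bsquare_eq bpure_eq)
qed

text \<open>The case of the product rule in which the right factor comes from the enveloping
  algebra, so that its coproduct has the one-term representation given by
  \<open>comult_env_value\<close>.\<close>

lemma comult_right_base_rule:
  assumes b: "b \<in> carrier BXA" and a: "a \<in> carrier A" and a': "a' \<in> carrier A"
    and s: "sweedler K A BXA \<eta> (\<Delta> b) n p q"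
  shows "\<Delta> (b \<otimes>\<^bsub>BXA\<^esub> sB a \<otimes>\<^bsub>BXA\<^esub> tB a') = bsum K A BXA \<eta> n (\<lambda>i. p i \<otimes>\<^bsub>BXA\<^esub> sB a) (\<lambda>i. q i \<otimes>\<^bsub>BXA\<^esub> tB a')"
proof -
  have cl: "i < n \<Longrightarrow> p i \<in> carrier BXA" "i < n \<Longrightarrow> q i \<in> carrier BXA" for i
    using s by (auto simp: sweedler_def)
  have c: "bp c c' \<in> carrier BB.T" if "c \<in> carrier BXA" "c' \<in> carrier BXA" for c c'
    using that by (simp add: bpure_eq BB.pto_closed carrier_LB)
  have "sweedler K A BXA \<eta> (\<Delta> (\<eta> (env_elem K A a a'))) (Suc 0) (\<lambda>_. sB a) (\<lambda>_. tB a')"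
    using a a' by (simp add: sweedler_def bsum_def bsquare_eq comult_env_value BX_closed lessThan_Suc c)
  with s have "\<Delta> (b \<otimes>\<^bsub>BXA\<^esub> \<eta> (env_elem K A a a')) =
      (\<Oplus>\<^bsub>Q\<^esub>i\<in>{..<n}. \<Oplus>\<^bsub>Q\<^esub>j\<in>{..<Suc 0}. bp (p i \<otimes>\<^bsub>BXA\<^esub> sB a) (q i \<otimes>\<^bsub>BXA\<^esub> tB a'))"
    using comult_mult_rule b BX_env_closed[OF a a'] unfolding comult_product_rule_def by blast
  also have "\<dots> = bsum K A BXA \<eta> n (\<lambda>i. p i \<otimes>\<^bsub>BXA\<^esub> sB a) (\<lambda>i. q i \<otimes>\<^bsub>BXA\<^esub> tB a')"
    unfolding bsum_def bsquare_eq using a a'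
    by (intro BB.T.M.finsum_cong') (auto simp: lessThan_Suc c cl BX_closed)
  finally show ?thesis using a a' b by (simp add: B.A.m_assoc BX_closed BX_source_target)
qed

lemma left_bialgebroid_rules: "left_bialgebroid K A BXA \<eta> \<Delta> \<epsilon>"
proof (intro left_bialgebroid.intro left_bialgebroid_axioms.intro Ae_ring.intro Ae_ring_axioms.intro
    k_algebra_axioms k_algebra_BX BX_env_hom)
  show "\<Delta> \<in> bimodule_maps K A LB Q"
    using \<Delta> by (simp add: vf_hom_def bsquare_eq)
  show "\<epsilon> \<in> bimodule_maps K A LB (regular_bimodule A)"
    using \<epsilon> by (simp add: vf_hom_def)
  \<comment> \<open>The target of a has counit a, so the product rule turns it into the source of
    a.\<close>
  show "\<epsilon> (b \<otimes>\<^bsub>BXA\<^esub> sB a) = \<epsilon> (b \<otimes>\<^bsub>BXA\<^esub> tB a)" if "b \<in> carrier BXA" "a \<in> carrier A" for b a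
    using counit_mult_rule(1)[of b "tB a"] that by (simp add: BX_closed source_target_values)
qed (rule coassociative_rule counit_left_rule counit_right_rule comult_right_base_rule comult_mult_rule \<Delta>1 \<epsilon>1
  counit_mult_rule; assumption)+

text \<open>A generator is that generator acting on 1, so its coproduct is the corresponding
  operator applied to \<open>1 \<otimes> 1\<close>. The prescribed formulas hold for every dual
  basis whereas the operators use the fixed one; \<open>coev_independent\<close> closes the
  gap.\<close>

lemma coproduct_counit_values:
  assumes "\<Delta> \<in> extensional (carrier BXA)" "\<epsilon> \<in> extensional (carrier BXA)"
  shows "BX_coproduct_counit K A \<Omega> d \<Delta> \<epsilon>"
proof
  show "\<Delta> \<in> linear_maps K BXA Q" "\<epsilon> \<in> linear_maps K BXA A"
    using vf_hom_linear[OF \<Delta>] vf_hom_linear[OF \<epsilon>]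
    by (simp_all add: bsquare_eq linear_maps_LB linear_maps_regular)
  have one: "\<one>\<^bsub>BXA\<^esub> \<in> carrier LB" by (simp add: carrier_LB)
  fix x assume x: "x \<in> carrier X"
  show "\<Delta> (eB x \<omega>) = bsum K A BXA \<eta> n (\<lambda>i. eB x (\<omega>\<^sub>i i)) (\<lambda>i. eB (x\<^sub>i i) \<omega>)"
    if \<omega>: "\<omega> \<in> carrier \<Omega>" and c: "coev_family \<Omega> A n \<omega>\<^sub>i x\<^sub>i" for \<omega> n \<omega>\<^sub>i x\<^sub>i
  proof -
    have cl: "i < n \<Longrightarrow> \<omega>\<^sub>i i \<in> carrier \<Omega>" "i < n \<Longrightarrow> x\<^sub>i i \<in> carrier X" for i
      using c by (simp_all add: coev_family_def)
    have "\<Delta> (eB x \<omega>) = BB.TE x \<omega> (bp \<one>\<^bsub>BXA\<^esub> \<one>\<^bsub>BXA\<^esub>)"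
      using vf_hom_E[OF \<Delta> x \<omega> one] x \<omega> by (simp add: BX_closed \<Delta>1)
    also have "\<dots> = (\<Oplus>\<^bsub>BB.T\<^esub>i\<in>{..<n}. pure_tensor_over K A LB LB (EB x (\<omega>\<^sub>i i) \<one>\<^bsub>BXA\<^esub>) (EB (x\<^sub>i i) \<omega> \<one>\<^bsub>BXA\<^esub>))"
      unfolding bpure_eq BB.TE_pure[OF x \<omega> one one]
      by (rule coev_independent[OF BB.mT BB.EE_balanced[OF x \<omega> one one] c, symmetric])
    also have "\<dots> = bsum K A BXA \<eta> n (\<lambda>i. eB x (\<omega>\<^sub>i i)) (\<lambda>i. eB (x\<^sub>i i) \<omega>)"
      unfolding bsum_def bsquare_eq bpure_eq using x \<omega>
      by (intro BB.T.M.finsum_cong') (auto simp: BX_closed cl carrier_LB intro!: BB.pto_closed)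
    finally show ?thesis .
  qed
  show "\<Delta> (jB x) = bp (jB x) \<one>\<^bsub>BXA\<^esub> \<oplus>\<^bsub>Q\<^esub> bsum K A BXA \<eta> n (\<lambda>i. eB x (\<omega>\<^sub>i i)) (\<lambda>i. jB (x\<^sub>i i))"
    if c: "coev_family \<Omega> A n \<omega>\<^sub>i x\<^sub>i" for n \<omega>\<^sub>i x\<^sub>i
  proof -
    have cl: "i < n \<Longrightarrow> \<omega>\<^sub>i i \<in> carrier \<Omega>" "i < n \<Longrightarrow> x\<^sub>i i \<in> carrier X" for i
      using c by (simp_all add: coev_family_def)
    have "(\<Oplus>\<^bsub>BB.T\<^esub>i\<in>{..<r}. pure_tensor_over K A LB LB (EB x (\<theta> i) \<one>\<^bsub>BXA\<^esub>) (JB (\<xi> i) \<one>\<^bsub>BXA\<^esub>)) =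
        (\<Oplus>\<^bsub>BB.T\<^esub>i\<in>{..<n}. pure_tensor_over K A LB LB (EB x (\<omega>\<^sub>i i) \<one>\<^bsub>BXA\<^esub>) (JB (x\<^sub>i i) \<one>\<^bsub>BXA\<^esub>))"
      by (rule coev_independent[OF BB.mT BB.EJ_balanced[OF x one one] c, symmetric])
    also have "\<dots> = bsum K A BXA \<eta> n (\<lambda>i. eB x (\<omega>\<^sub>i i)) (\<lambda>i. jB (x\<^sub>i i))"
      unfolding bsum_def bsquare_eq bpure_eq using x
      by (intro BB.T.M.finsum_cong') (auto simp: BX_closed cl carrier_LB intro!: BB.pto_closed)
    finally have "BB.TJ x (bp \<one>\<^bsub>BXA\<^esub> \<one>\<^bsub>BXA\<^esub>) = bp (jB x) \<one>\<^bsub>BXA\<^esub> \<oplus>\<^bsub>Q\<^esub> bsum K A BXA \<eta> n (\<lambda>i. eB x (\<omega>\<^sub>i i)) (\<lambda>i. jB (x\<^sub>i i))"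
      using x by (simp add: bpure_eq bsquare_eq BB.TJ_pure[OF x one one] BX_closed)
    then show ?thesis using vf_hom_J[OF \<Delta> x one] x by (simp add: BX_closed \<Delta>1)
  qed
  show "\<epsilon> (eB x \<omega>) = x \<omega>" if "\<omega> \<in> carrier \<Omega>" for \<omega>
    using vf_hom_E[OF \<epsilon> x that one] x that by (simp add: BX_closed \<epsilon>1 one_lact)
  \<comment> \<open>By the Leibniz rule d(1 1) = d 1 + d 1. This is what makes \<epsilon> vanish on
    vector fields.\<close>
  have d1: "d \<one>\<^bsub>A\<^esub> = \<zero>\<^bsub>\<Omega>\<^esub>"
    using leibniz[of "\<one>\<^bsub>A\<^esub>" "\<one>\<^bsub>A\<^esub>"] d_closed[of "\<one>\<^bsub>A\<^esub>"] by (simp add: ract_one one_lact)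
  show "\<epsilon> (jB x) = \<zero>\<^bsub>A\<^esub>"
    using vf_hom_J[OF \<epsilon> x one] x lin_zero[OF dual_linear[OF x] M.module_axioms A.module_axioms]
    by (simp add: BX_closed \<epsilon>1 d1)
qed (rule assms comult_env_value counit_env_value comult_mult_rule counit_mult_rule(1); assumption)+

end

text \<open>Both parts run \<open>BX_left_induct\<close> on the set where the competitors agree. The
  product rule for \<Delta> reduces a product to its two factors directly; the one for \<epsilon> is
  asymmetric and needs agreement on more than the generators themselves.\<close>

lemma coproduct_counit_unique:
  assumes 1: "BX_coproduct_counit K A \<Omega> d \<Delta> \<epsilon>" and 2: "BX_coproduct_counit K A \<Omega> d \<Delta>' \<epsilon>'"
  shows "\<Delta>' = \<Delta>" "\<epsilon>' = \<epsilon>"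
proof -
  interpret c: BX_coproduct_counit K A \<Omega> d \<Delta> \<epsilon> by (rule 1)
  interpret c': BX_coproduct_counit K A \<Omega> d \<Delta>' \<epsilon>' by (rule 2)
  note one_env = BX_source_target(5)[symmetric, unfolded source_def]
  have \<Delta>env: "\<Delta>' (\<eta> (env_elem K A a b)) = \<Delta> (\<eta> (env_elem K A a b))" if "a \<in> carrier A" "b \<in> carrier A" for a b
    using that by (simp add: c.comult_env c'.comult_env)
  have "carrier BXA \<subseteq> {b \<in> carrier BXA. \<Delta>' b = \<Delta> b}" (is "_ \<subseteq> ?H")
  proof (rule BX_left_induct)
    have mult: "g \<otimes>\<^bsub>BXA\<^esub> b \<in> ?H" if g: "g \<in> ?H" and b: "b \<in> ?H" for g b
    proof -
      have gb: "g \<in> carrier BXA" "b \<in> carrier BXA" "\<Delta>' g = \<Delta> g" "\<Delta>' b = \<Delta> b" using g b by auto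
      have rep: "\<exists>n p q. sweedler K A BXA \<eta> (\<Delta> b) n p q" if "b \<in> carrier BXA" for b
        using lin_closed[OF c.comult_linear that] by (intro sweedler_exists) (simp add: bsquare_eq)
      obtain n p q where s: "sweedler K A BXA \<eta> (\<Delta> g) n p q" using rep[OF gb(1)] by (elim exE)
      obtain n' p' q' where s': "sweedler K A BXA \<eta> (\<Delta> b) n' p' q'" using rep[OF gb(2)] by (elim exE)
      \<comment> \<open>The two coproducts agree on g and on b, so the same representations serve
        both and the rule returns the same sum.\<close>
      note rule = comult_product_rule_def[THEN iffD1, rule_format, OF _ gb(1,2) conjI]
      have "\<Delta>' (g \<otimes>\<^bsub>BXA\<^esub> b) = \<Delta> (g \<otimes>\<^bsub>BXA\<^esub> b)"
        using rule[OF c.comult_product s s'] rule[OF c'.comult_product s[folded gb(3)] s'[folded gb(4)]] by simp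
      then show ?thesis using g b by simp
    qed
    show "\<eta> (env_elem K A u v) \<otimes>\<^bsub>BXA\<^esub> b \<in> ?H" if "u \<in> carrier A" "v \<in> carrier A" "b \<in> ?H" for u v b
      using that by (intro mult) (simp_all add: BX_env_closed \<Delta>env)
    show "eB x \<omega> \<otimes>\<^bsub>BXA\<^esub> b \<in> ?H" if "x \<in> carrier X" "\<omega> \<in> carrier \<Omega>" "b \<in> ?H" for x \<omega> b
      using that by (intro mult) (simp_all add: BX_closed c.comult_endo[OF _ _ coev] c'.comult_endo[OF _ _ coev])
    show "jB x \<otimes>\<^bsub>BXA\<^esub> b \<in> ?H" if "x \<in> carrier X" "b \<in> ?H" for x b
      using that by (intro mult) (simp_all add: BX_closed c.comult_field[OF _ coev] c'.comult_field[OF _ coev])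
    show "\<one>\<^bsub>BXA\<^esub> \<in> ?H" by (simp add: one_env \<Delta>env) (simp add: one_env[symmetric])
  qed (auto simp: lin_add[OF c.comult_linear] lin_add[OF c'.comult_linear]
      lin_smult[OF c.comult_linear] lin_smult[OF c'.comult_linear])
  then show "\<Delta>' = \<Delta>"
    by (intro extensionalityI[OF c'.comult_extensional c.comult_extensional]) auto
  have "carrier BXA \<subseteq> {b \<in> carrier BXA. \<epsilon>' b = \<epsilon> b}" (is "_ \<subseteq> ?H")
  proof (rule BX_left_induct)
    have \<epsilon>env: "\<epsilon>' (\<eta> (env_elem K A a b)) = \<epsilon> (\<eta> (env_elem K A a b))" if "a \<in> carrier A" "b \<in> carrier A" for a b
      using that by (simp add: c.counit_env c'.counit_env)
    \<comment> \<open>The rule replaces b by the source of \<epsilon>(b). For a generator g,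
      agreement is therefore required on all products of g with a source element; the relations of
      \<open>BX\<close> rewrite these in terms of generators and source elements.\<close>
    have mult: "g \<otimes>\<^bsub>BXA\<^esub> b \<in> ?H"
      if g: "g \<in> carrier BXA" "\<And>a. a \<in> carrier A \<Longrightarrow> \<epsilon>' (g \<otimes>\<^bsub>BXA\<^esub> sB a) = \<epsilon> (g \<otimes>\<^bsub>BXA\<^esub> sB a)" and b: "b \<in> ?H" for g b
      using c.counit_product[of g b] c'.counit_product[of g b] g b lin_closed[OF c.counit_linear, of b] by simp
    have \<epsilon>s: "\<epsilon>' (sB a) = \<epsilon> (sB a)" if "a \<in> carrier A" for a
      using that by (simp add: source_def \<epsilon>env)
    show "\<eta> (env_elem K A u v) \<otimes>\<^bsub>BXA\<^esub> b \<in> ?H" if "u \<in> carrier A" "v \<in> carrier A" "b \<in> ?H" for u v b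
      using that by (intro mult) (simp_all add: BX_env_closed source_def BX_env_mult \<epsilon>env)
    show "eB x \<omega> \<otimes>\<^bsub>BXA\<^esub> b \<in> ?H" if "x \<in> carrier X" "\<omega> \<in> carrier \<Omega>" "b \<in> ?H" for x \<omega> b
      using that by (intro mult)
        (simp_all add: BX_closed BX_endo_relations c.counit_endo c'.counit_endo X.ract_closed)
    show "jB x \<otimes>\<^bsub>BXA\<^esub> b \<in> ?H" if "x \<in> carrier X" "b \<in> ?H" for x b
      using that by (intro mult)
        (simp_all add: BX_closed BX_field_relations c.counit_field c'.counit_field X.ract_closed \<epsilon>s dual_closed d_closed
          lin_add[OF c.counit_linear] lin_add[OF c'.counit_linear])
    show "\<one>\<^bsub>BXA\<^esub> \<in> ?H" by (simp add: one_env \<epsilon>env) (simp add: one_env[symmetric])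
  qed (auto simp: lin_add[OF c.counit_linear] lin_add[OF c'.counit_linear]
      lin_smult[OF c.counit_linear] lin_smult[OF c'.counit_linear])
  then show "\<epsilon>' = \<epsilon>"
    by (intro extensionalityI[OF c'.counit_extensional c.counit_extensional]) auto
qed

end

theorem lemma3p4:
  fixes K :: "'k ring" and A :: "('k, 'a) module" and \<Omega> :: "('k, 'a, 'w) bimodule"
    and d :: "'a \<Rightarrow> 'w"
  assumes "differential_calculus K A \<Omega> d"
    and "fg_projective_right A \<Omega>"
  shows "\<exists>\<Delta> \<epsilon>. BX_coproduct_counit K A \<Omega> d \<Delta> \<epsilon> \<and>
    (\<forall>\<Delta>' \<epsilon>'. BX_coproduct_counit K A \<Omega> d \<Delta>' \<epsilon>' \<longrightarrow> \<Delta>' = \<Delta> \<and> \<epsilon>' = \<epsilon>) \<and>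
    left_bialgebroid K A (BX K A \<Omega> d) (BX_env K A \<Omega> d) \<Delta> \<epsilon>"
proof -
  interpret D: differential_calculus K A \<Omega> d by fact
  obtain r \<theta> \<xi> where coev: "coev_family \<Omega> A r \<theta> \<xi>"
    using D.coev_family_exists[OF assms(2)] by blast
  interpret F: framed_calculus K A \<Omega> d r \<theta> \<xi>
    by (intro framed_calculus.intro framed_calculus_axioms.intro assms(1) coev)
  interpret B: k_algebra K D.BXA by (rule D.k_algebra_BX)
  have one: "F.bp \<one>\<^bsub>D.BXA\<^esub> \<one>\<^bsub>D.BXA\<^esub> \<in> carrier F.BB.T"
    by (simp add: F.bpure_eq F.BB.pto_closed F.carrier_LB)
  obtain \<Delta>0 where \<Delta>0: "F.LB_hom F.BB.T F.BB.TE F.BB.TJ \<Delta>0"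
    "\<Delta>0 \<one>\<^bsub>D.BXA\<^esub> = F.bp \<one>\<^bsub>D.BXA\<^esub> \<one>\<^bsub>D.BXA\<^esub>"
    using D.BX_free_module[OF F.BB.vf_module_tensor one] by blast
  obtain \<epsilon>0 where \<epsilon>0: "F.LB_hom (regular_bimodule A) D.EA D.JA \<epsilon>0" "\<epsilon>0 \<one>\<^bsub>D.BXA\<^esub> = \<one>\<^bsub>A\<^esub>"
    using D.BX_free_module[OF D.vf_module_regular, of "\<one>\<^bsub>A\<^esub>"] by auto
  \<comment> \<open>Uniqueness is claimed among extensional maps, so the homomorphisms given by
    freeness are cut down to the carrier.\<close>
  define \<Delta> where "\<Delta> = restrict \<Delta>0 (carrier D.LB)"
  define \<epsilon> where "\<epsilon> = restrict \<epsilon>0 (carrier D.LB)"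
  have 1: "\<Delta> \<one>\<^bsub>D.BXA\<^esub> = F.bp \<one>\<^bsub>D.BXA\<^esub> \<one>\<^bsub>D.BXA\<^esub>" "\<epsilon> \<one>\<^bsub>D.BXA\<^esub> = \<one>\<^bsub>A\<^esub>"
    using \<Delta>0(2) \<epsilon>0(2) by (simp_all add: \<Delta>_def \<epsilon>_def F.carrier_LB)
  have ext: "\<Delta> \<in> extensional (carrier D.BXA)" "\<epsilon> \<in> extensional (carrier D.BXA)"
    by (simp_all add: \<Delta>_def \<epsilon>_def F.carrier_LB)
  note data = vf_hom_restrict[OF D.vf_module_LB \<Delta>0(1), folded \<Delta>_def] 1(1)
    vf_hom_restrict[OF D.vf_module_LB \<epsilon>0(1), folded \<epsilon>_def] 1(2)
  have "BX_coproduct_counit K A \<Omega> d \<Delta> \<epsilon>"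
    by (rule F.coproduct_counit_values[OF data ext])
  moreover have "left_bialgebroid K A D.BXA D.\<eta> \<Delta> \<epsilon>"
    by (rule F.left_bialgebroid_rules[OF data])
  ultimately show ?thesis using F.coproduct_counit_unique by blast
qed

end
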